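(* Let $\Omega=(\mathbb R\times(-1,1))\setminus\overline{\mathcal O}$, where $\mathcal O$ is a non-empty open bounded strictly convex set with $C^{1,1}$ boundary and $\overline{\mathcal O}\subset\mathbb R\times(-1,1)$. Then for any $\delta>0$ there are positive constants $E_0$ and $C$ such that \[ \big\|(1+|x|)^{-\frac{3+\delta}{2}}(-\Delta-E-i\varepsilon)^{-1}(1+|x|)^{-\frac{3+\delta}{2}}\big\|_{L^2(\Omega)\to L^2(\Omega)}\le C E^{1/2} \] for all $E\ge E_0$ and $\varepsilon\in(0,1]$.
   Context: Coordinates on $\mathbb R^2$ are $(x,y)$. $\Delta$ is the Dirichlet Laplacian on $\Omega$ (the Friedrichs extension from $C_c^\infty(\Omega)$); the spectrum of $-\Delta$ is contained in $[0,\infty)$, and $(-\Delta-z)^{-1}:L^2(\Omega)\to L^2(\Omega)$ is its resolvent. Powers of $1+|x|$ act as multiplication operators. *)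

theory Defs
  imports "HOL-Analysis.Analysis"
begin

text \<open>
  Elements of \<open>L\<^sup>2(M)\<close> are represented by functions, without forming a quotient modulo null
  sets; graphs of operators below are closed under changing representatives in \<open>L2 M\<close>.
\<close>

definition L2 :: "'a measure \<Rightarrow> ('a \<Rightarrow> complex) set" where
  "L2 M = {f \<in> borel_measurable M. integrable M (\<lambda>x. (cmod (f x))\<^sup>2)}"

definition L2_inner :: "'a measure \<Rightarrow> ('a \<Rightarrow> complex) \<Rightarrow> ('a \<Rightarrow> complex) \<Rightarrow> complex" where
  "L2_inner M f g = (LINT x|M. f x * cnj (g x))"

definition L2_norm :: "'a measure \<Rightarrow> ('a \<Rightarrow> complex) \<Rightarrow> real" where
  "L2_norm M f = sqrt (LINT x|M. (cmod (f x))\<^sup>2)"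

text \<open>
  The Bochner integral is \<open>0\<close> on non-integrable functions, so values outside \<open>L\<^sup>2\<close> are
  sent to \<open>\<infinity>\<close> explicitly.
\<close>

definition L2_opnorm :: "'a measure \<Rightarrow> (('a \<Rightarrow> complex) \<Rightarrow> ('a \<Rightarrow> complex)) \<Rightarrow> ereal" where
  "L2_opnorm M T =
     (SUP f\<in>{f \<in> L2 M. L2_norm M f \<le> 1}. if T f \<in> L2 M then ereal (L2_norm M (T f)) else \<infinity>)"

primrec Ck :: "nat \<Rightarrow> ('a::euclidean_space \<Rightarrow> 'b::real_normed_vector) \<Rightarrow> bool" where
  "Ck 0 f \<longleftrightarrow> continuous_on UNIV f"
| "Ck (Suc k) f \<longleftrightarrow>
     f differentiable_on UNIV \<and> (\<forall>v. Ck k (\<lambda>x. frechet_derivative f (at x) v))"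

definition Cc_infinity :: "'a::euclidean_space set \<Rightarrow> ('a \<Rightarrow> complex) set" where
  "Cc_infinity \<Omega> =
     {\<phi>. (\<forall>k. Ck k \<phi>) \<and> compact (closure {x. \<phi> x \<noteq> 0}) \<and> closure {x. \<phi> x \<noteq> 0} \<subseteq> \<Omega>}"

definition laplacian :: "('a::euclidean_space \<Rightarrow> complex) \<Rightarrow> 'a \<Rightarrow> complex" where
  "laplacian f x =
     (\<Sum>b\<in>Basis. frechet_derivative (\<lambda>y. frechet_derivative f (at y) b) (at x) b)"

text \<open>
  Let \<open>S\<close> be a nonnegative symmetric operator with domain \<open>D\<close> and quadratic form
  \<open>q(\<phi>,\<psi>) = \<langle>S \<phi>, \<psi>\<rangle>\<close>.  The element \<open>u\<close> lies in the domain of the closure of \<open>q\<close> iff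
  \<open>form_converges M S D \<phi> u\<close> for some sequence \<open>\<phi>\<close>.
\<close>

definition form_converges ::
    "'a measure \<Rightarrow> (('a \<Rightarrow> complex) \<Rightarrow> ('a \<Rightarrow> complex)) \<Rightarrow> ('a \<Rightarrow> complex) set
      \<Rightarrow> (nat \<Rightarrow> 'a \<Rightarrow> complex) \<Rightarrow> ('a \<Rightarrow> complex) \<Rightarrow> bool" where
  "form_converges M S D \<phi> u \<longleftrightarrow>
     range \<phi> \<subseteq> D \<and> u \<in> L2 M \<and>
     (\<lambda>n. L2_norm M (\<lambda>x. \<phi> n x - u x)) \<longlonglongrightarrow> 0 \<and>
     (\<forall>e>0. \<exists>N. \<forall>m\<ge>N. \<forall>n\<ge>N.
        Re (L2_inner M (S (\<lambda>x. \<phi> m x - \<phi> n x)) (\<lambda>x. \<phi> m x - \<phi> n x)) < e)"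

text \<open>
  Unbounded operators are represented by their graphs.  The Friedrichs extension is the
  operator associated with the closure of \<open>q\<close>, whose value at \<open>(u,v)\<close> is
  \<open>lim q(\<phi>\<^sub>n,\<psi>\<^sub>n)\<close> for any sequences with \<open>\<phi>\<^sub>n \<rightarrow> u\<close> and \<open>\<psi>\<^sub>n \<rightarrow> v\<close> in the above sense.
\<close>

definition friedrichs_extension ::
    "'a measure \<Rightarrow> (('a \<Rightarrow> complex) \<Rightarrow> ('a \<Rightarrow> complex)) \<Rightarrow> ('a \<Rightarrow> complex) set
      \<Rightarrow> (('a \<Rightarrow> complex) \<times> ('a \<Rightarrow> complex)) set" where
  "friedrichs_extension M S D =
     {(u, f). f \<in> L2 M \<and>
        (\<exists>\<phi>. form_converges M S D \<phi> u \<and>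
          (\<forall>\<psi> v. form_converges M S D \<psi> v \<longrightarrow>
             (\<lambda>n. L2_inner M (S (\<phi> n)) (\<psi> n)) \<longlonglongrightarrow> L2_inner M f v))}"

definition neg_dirichlet_laplacian ::
    "'a::euclidean_space set \<Rightarrow> (('a \<Rightarrow> complex) \<times> ('a \<Rightarrow> complex)) set" where
  "neg_dirichlet_laplacian \<Omega> =
     friedrichs_extension (lebesgue_on \<Omega>) (\<lambda>\<phi> x. - laplacian \<phi> x) (Cc_infinity \<Omega>)"

text \<open>
  With \<open>A\<close> a graph, \<open>(u, f + z u) \<in> A\<close> says that \<open>u\<close> is in the domain and \<open>(A - z) u = f\<close>.
\<close>

definition resolvent_set ::
    "'a measure \<Rightarrow> (('a \<Rightarrow> complex) \<times> ('a \<Rightarrow> complex)) set \<Rightarrow> complex set" where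
  "resolvent_set M A =
     {z. (\<forall>f\<in>L2 M. \<exists>u\<in>L2 M. (u, \<lambda>x. f x + z * u x) \<in> A) \<and>
         (\<exists>K. \<forall>f\<in>L2 M. \<forall>u\<in>L2 M. (u, \<lambda>x. f x + z * u x) \<in> A \<longrightarrow> L2_norm M u \<le> K * L2_norm M f)}"

text \<open>
  For \<open>z\<close> in the resolvent set (and \<open>A\<close> linear) the chosen \<open>u\<close> is unique up to null sets.
\<close>

definition resolvent ::
    "'a measure \<Rightarrow> (('a \<Rightarrow> complex) \<times> ('a \<Rightarrow> complex)) set \<Rightarrow> complex
      \<Rightarrow> ('a \<Rightarrow> complex) \<Rightarrow> ('a \<Rightarrow> complex)" where
  "resolvent M A z f = (SOME u. u \<in> L2 M \<and> (u, \<lambda>x. f x + z * u x) \<in> A)"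

text \<open>
  The closure is essential: for an open set, testing only pairs of points of \<open>S\<close> itself would
  amount to plain convexity.
\<close>

definition strictly_convex :: "'a::real_normed_vector set \<Rightarrow> bool" where
  "strictly_convex S \<longleftrightarrow>
     (\<forall>x\<in>closure S. \<forall>y\<in>closure S. x \<noteq> y \<longrightarrow> open_segment x y \<subseteq> interior S)"

text \<open>
  Near each boundary point, in suitable orthonormal coordinates centred there, the set is the
  region above the graph of a function with Lipschitz derivative.
\<close>

definition C11_boundary :: "(real \<times> real) set \<Rightarrow> bool" where
  "C11_boundary S \<longleftrightarrow>
     (\<forall>p\<in>frontier S. \<exists>r>0. \<exists>T \<gamma> \<gamma>' L.
        orthogonal_transformation T \<and>
        (\<forall>t. (\<gamma> has_real_derivative \<gamma>' t) (at t)) \<and> L-lipschitz_on UNIV \<gamma>' \<and>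
        S \<inter> ball p r = {q \<in> ball p r. snd (T (q - p)) > \<gamma> (fst (T (q - p)))})"

definition waveguide :: "(real \<times> real) set \<Rightarrow> (real \<times> real) set" where
  "waveguide Ob = (UNIV \<times> {-1<..<1}) - closure Ob"

definition weight_mult ::
    "real \<Rightarrow> (real \<times> real \<Rightarrow> complex) \<Rightarrow> (real \<times> real \<Rightarrow> complex)" where
  "weight_mult s f = (\<lambda>(x, y). of_real ((1 + \<bar>x\<bar>) powr s) * f (x, y))"

end

theory Submission
  imports Defs
begin

text \<open>
  Let \<open>X\<close> be a bounded vector field, with bounded and Lipschitz derivative, such that
  \<open>p \<mapsto> p - t X p\<close> maps the complement of \<open>\<Omega>\<close> into itself for small \<open>t \<ge> 0\<close>. Composition with
  this map preserves test functions, and comparing the energies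
  \<open>\<integral>|\<nabla>\<phi>|\<^sup>2 - E|\<phi>|\<^sup>2\<close> of a test function and of its image yields the Rellich--Morawetz
  inequality without boundary traces, hence without boundary regularity: the boundary term has
  a sign and never appears. Everything is done along sequences of test functions, so
  that no weak derivatives are needed either.

  The field is \<open>X = (W, \<tau> Y)\<close>. Near the obstacle \<open>W\<close> is \<open>x - x\<^sub>T\<close> above and \<open>x - x\<^sub>B\<close> below it, with
  \<open>x\<^sub>T\<close>, \<open>x\<^sub>B\<close> the abscissae of the highest and of the lowest point of the obstacle; the switch
  between the two is hidden inside the obstacle, along the chord from its leftmost to its
  rightmost point. Convexity makes this field outgoing. Far away \<open>W\<close> is increasing and bounded,
  with \<open>W'\<close> of size \<open>|x|\<close> to the power \<open>- 1 - \<delta>\<close>. Between the two regimes the zero order term has no sign;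
  there \<open>Y = \<chi>(x) (y \<mp> 1)\<close>, which vanishes on the wall facing the obstacle, contributes
  \<open>\<tau> \<chi> E |u|\<^sup>2\<close>, and this dominates for large \<open>E\<close>. The transition regions have to lie between the
  extremal abscissae of the obstacle and \<open>x\<^sub>T\<close>, \<open>x\<^sub>B\<close>; these are distinct because the boundary has
  tangents. Finally \<open>\<epsilon> \<parallel>u\<parallel>\<^sup>2 \<le> |\<langle>f, u\<rangle>|\<close> and \<open>\<parallel>\<nabla>u\<parallel>\<^sup>2 \<le> E \<parallel>u\<parallel>\<^sup>2 + |\<langle>f, u\<rangle>|\<close> bound the term with \<open>\<epsilon>\<close>, at the
  cost of the factor \<open>\<surd>E\<close>.
\<close>

section \<open>The space of square integrable functions\<close>

text \<open>Testing the equation with W' u cancels the longitudinal part of the divergence term in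
  the Rellich identity. What remains of that part is 2 W' |u_x|^2, with no positive multiple of
  |u|^2. A zero order term is obtained by adding the integral of the x-derivative of G |u|^2, which
  is zero. Far away, with G = W''/2, the form in (|u_x|, |u|) has the coefficients A W', 2 |W''| and
  W'''/2. For W' = \<delta> |x - mid|^(-1-\<delta>) it is positive with A = 2 - 1/(2+\<delta>), and
  W''' decays like |x|^(-3-\<delta>), the square of the weight. The amount W'/(2+\<delta>) |u_x|^2
  left over because A < 2 pays for the terms that Y brings in.

  The derivative u_y is controlled only where \<chi> is positive. This is enough because the
  right-hand side is paired only with u and with X . grad u, and X is longitudinal elsewhere. Hence
  the coercivity estimate carries |X . grad u|^2 and not |grad u|^2.\<close>

lemma L2_measurable [measurable_dest]: "f \<in> L2 M \<Longrightarrow> f \<in> borel_measurable M"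
  by (simp add: L2_def)

lemma borel_measurable_cnj_comp [measurable (raw)]:
  "f \<in> borel_measurable M \<Longrightarrow> (\<lambda>x. cnj (f x)) \<in> borel_measurable M"
  by (rule borel_measurable_continuous_on) (auto intro: continuous_intros)

lemma L2_integrable: "f \<in> L2 M \<Longrightarrow> integrable M (\<lambda>x. (cmod (f x))\<^sup>2)"
  by (simp add: L2_def)

lemma norm_mult_le_squares: "cmod a * cmod b \<le> (cmod a)\<^sup>2 + (cmod b)\<^sup>2"
proof -
  have "2 * (cmod a * cmod b) \<le> (cmod a)\<^sup>2 + (cmod b)\<^sup>2"
    using sum_squares_bound[of "cmod a" "cmod b"] by simp
  moreover have "0 \<le> cmod a * cmod b" by simp
  ultimately show ?thesis by linarith
qed

lemma norm_add_squared_le: "(norm (a + b))\<^sup>2 \<le> 2 * (norm a)\<^sup>2 + 2 * (norm b)\<^sup>2"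
  for a b :: "'a::real_normed_vector"
proof -
  have "(norm (a + b))\<^sup>2 \<le> (norm a + norm b)\<^sup>2"
    by (intro power_mono norm_triangle_ineq) simp
  also have "\<dots> \<le> 2 * (norm a)\<^sup>2 + 2 * (norm b)\<^sup>2"
    using sum_squares_bound[of "norm a" "norm b"] by (simp add: power2_sum)
  finally show ?thesis .
qed

lemma L2_zero: "(\<lambda>x. 0) \<in> L2 M"
  by (simp add: L2_def)

lemma L2_add: assumes "f \<in> L2 M" "g \<in> L2 M" shows "(\<lambda>x. f x + g x) \<in> L2 M"
proof -
  have "integrable M (\<lambda>x. (cmod (f x + g x))\<^sup>2)"
  proof (rule Bochner_Integration.integrable_bound)
    show "integrable M (\<lambda>x. 2 * (cmod (f x))\<^sup>2 + 2 * (cmod (g x))\<^sup>2)"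
      using assms by (simp add: L2_def)
    show "AE x in M. norm ((cmod (f x + g x))\<^sup>2) \<le> norm (2 * (cmod (f x))\<^sup>2 + 2 * (cmod (g x))\<^sup>2)"
      using norm_add_squared_le by (intro AE_I2) auto
  qed (use assms in measurable)
  moreover have "(\<lambda>x. f x + g x) \<in> borel_measurable M" using assms by measurable
  ultimately show ?thesis by (simp add: L2_def)
qed

lemma L2_scale: assumes "f \<in> L2 M" shows "(\<lambda>x. c * f x) \<in> L2 M"
proof -
  have "(\<lambda>x. c * f x) \<in> borel_measurable M" using assms by measurable
  with assms show ?thesis by (simp add: L2_def norm_mult power_mult_distrib)
qed

lemma L2_minus: "f \<in> L2 M \<Longrightarrow> (\<lambda>x. - f x) \<in> L2 M"
  using L2_scale[of f M "-1"] by simp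

lemma L2_diff: "f \<in> L2 M \<Longrightarrow> g \<in> L2 M \<Longrightarrow> (\<lambda>x. f x - g x) \<in> L2 M"
  using L2_add[OF _ L2_minus] by simp

lemma L2_bounded_mult:
  assumes f: "f \<in> L2 M" and m: "m \<in> borel_measurable M" and b: "\<And>x. x \<in> space M \<Longrightarrow> cmod (m x) \<le> B"
  shows "(\<lambda>x. m x * f x) \<in> L2 M"
proof -
  have "integrable M (\<lambda>x. (cmod (m x * f x))\<^sup>2)"
  proof (rule Bochner_Integration.integrable_bound)
    show "integrable M (\<lambda>x. B\<^sup>2 * (cmod (f x))\<^sup>2)"
      using f by (simp add: L2_def)
    show "AE x in M. norm ((cmod (m x * f x))\<^sup>2) \<le> norm (B\<^sup>2 * (cmod (f x))\<^sup>2)"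
      by (intro AE_I2)
         (auto simp: norm_mult power_mult_distrib intro!: mult_right_mono power_mono b)
  qed (use f m in measurable)
  moreover have "(\<lambda>x. m x * f x) \<in> borel_measurable M" using f m by measurable
  ultimately show ?thesis by (simp add: L2_def)
qed

lemma L2_mult_integrable:
  assumes "f \<in> L2 M" "g \<in> L2 M" shows "integrable M (\<lambda>x. f x * cnj (g x))"
proof (rule Bochner_Integration.integrable_bound)
  show "integrable M (\<lambda>x. (cmod (f x))\<^sup>2 + (cmod (g x))\<^sup>2)"
    using assms by (simp add: L2_def)
  show "AE x in M. norm (f x * cnj (g x)) \<le> norm ((cmod (f x))\<^sup>2 + (cmod (g x))\<^sup>2)"
    using norm_mult_le_squares by (intro AE_I2) (auto simp: norm_mult)
qed (use assms in measurable)

lemma L2_inner_add_left: "f \<in> L2 M \<Longrightarrow> g \<in> L2 M \<Longrightarrow> h \<in> L2 M \<Longrightarrow>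
   L2_inner M (\<lambda>x. f x + g x) h = L2_inner M f h + L2_inner M g h"
  unfolding L2_inner_def by (simp add: distrib_right L2_mult_integrable)

lemma L2_inner_scale_left: "L2_inner M (\<lambda>x. c * f x) h = c * L2_inner M f h"
  unfolding L2_inner_def by (simp add: mult.assoc)

lemma L2_inner_cnj: "cnj (L2_inner M f g) = L2_inner M g f"
  unfolding L2_inner_def by (simp flip: Bochner_Integration.integral_cnj add: mult.commute)

lemma L2_inner_scale_right: "L2_inner M f (\<lambda>x. c * h x) = cnj c * L2_inner M f h"
  by (subst (1 2) L2_inner_cnj[symmetric]) (simp add: L2_inner_scale_left)

lemma L2_inner_add_right: "f \<in> L2 M \<Longrightarrow> g \<in> L2 M \<Longrightarrow> h \<in> L2 M \<Longrightarrow>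
   L2_inner M h (\<lambda>x. f x + g x) = L2_inner M h f + L2_inner M h g"
  by (subst (1 2 3) L2_inner_cnj[symmetric]) (simp add: L2_inner_add_left)

lemma L2_inner_diff_left: "f \<in> L2 M \<Longrightarrow> g \<in> L2 M \<Longrightarrow> h \<in> L2 M \<Longrightarrow>
   L2_inner M (\<lambda>x. f x - g x) h = L2_inner M f h - L2_inner M g h"
  unfolding L2_inner_def by (simp add: left_diff_distrib L2_mult_integrable)

lemma L2_inner_diff_right: "f \<in> L2 M \<Longrightarrow> g \<in> L2 M \<Longrightarrow> h \<in> L2 M \<Longrightarrow>
   L2_inner M h (\<lambda>x. f x - g x) = L2_inner M h f - L2_inner M h g"
  by (subst (1 2 3) L2_inner_cnj[symmetric]) (simp add: L2_inner_diff_left)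

lemmas L2_inner_simps = L2_inner_add_left L2_inner_add_right L2_inner_diff_left L2_inner_diff_right
  L2_inner_scale_left L2_inner_scale_right

lemma L2_norm_nonneg: "0 \<le> L2_norm M f"
  by (simp add: L2_norm_def)

lemma L2_norm_squared: "(L2_norm M f)\<^sup>2 = (LINT x|M. (cmod (f x))\<^sup>2)"
  by (simp add: L2_norm_def)

lemma L2_inner_self: "L2_inner M f f = of_real ((L2_norm M f)\<^sup>2)"
proof -
  have "L2_inner M f f = (LINT x|M. complex_of_real ((cmod (f x))\<^sup>2))"
    unfolding L2_inner_def by (intro Bochner_Integration.integral_cong) (auto simp: complex_norm_square[symmetric])
  then show ?thesis by (simp only: L2_norm_squared integral_complex_of_real)
qed

lemma L2_norm_scale: "L2_norm M (\<lambda>x. c * f x) = cmod c * L2_norm M f"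
  by (simp add: L2_norm_def norm_mult power_mult_distrib real_sqrt_mult)

lemma L2_norm_minus_commute: "L2_norm M (\<lambda>x. f x - g x) = L2_norm M (\<lambda>x. g x - f x)"
  by (simp add: L2_norm_def norm_minus_commute)

text \<open>The squared norm of f - t c g, with c the inner product, is nonnegative for every real
  t. Functions are not taken modulo null sets, so norm zero does not make g the zero function and
  gets its own case.\<close>

lemma L2_Cauchy_Schwarz:
  assumes "f \<in> L2 M" "g \<in> L2 M"
  shows "cmod (L2_inner M f g) \<le> L2_norm M f * L2_norm M g"
proof -
  define c where "c = L2_inner M f g"
  define a where "a = (L2_norm M f)\<^sup>2"
  define b where "b = (L2_norm M g)\<^sup>2"
  have key: "2 * t * (cmod c)\<^sup>2 \<le> a + t\<^sup>2 * (cmod c)\<^sup>2 * b" for t :: real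
  proof -
    define h where "h = (\<lambda>x. f x - (of_real t * c) * g x)"
    have h: "(\<lambda>x. (of_real t * c) * g x) \<in> L2 M" by (intro L2_scale assms)
    have "complex_of_real ((L2_norm M h)\<^sup>2) = L2_inner M h h"
      by (simp add: L2_inner_self)
    also have "\<dots> = of_real a - of_real t * cnj c * c - of_real t * c * cnj c + of_real t * c * cnj (of_real t * c) * of_real b"
      unfolding h_def using assms h
      by (simp add: L2_inner_simps L2_diff)
         (simp add: L2_inner_self a_def b_def L2_inner_cnj[of M f g, symmetric] c_def[symmetric] algebra_simps)
    also have "\<dots> = complex_of_real (a - 2 * t * (cmod c)\<^sup>2 + t\<^sup>2 * (cmod c)\<^sup>2 * b)"
    proof -
      have "of_real a - of_real t * cnj c * c - of_real t * c * cnj c + of_real t * c * cnj (of_real t * c) * of_real b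
         = of_real a - 2 * of_real t * (c * cnj c) + (of_real t)\<^sup>2 * (c * cnj c) * complex_of_real b"
        by (simp add: power2_eq_square algebra_simps)
      then show ?thesis by (simp flip: complex_norm_square)
    qed
    finally have "(L2_norm M h)\<^sup>2 = a - 2 * t * (cmod c)\<^sup>2 + t\<^sup>2 * (cmod c)\<^sup>2 * b"
      by (simp only: of_real_eq_iff)
    then show ?thesis using zero_le_power2[of "L2_norm M h"] by linarith
  qed
  have "(cmod c)\<^sup>2 \<le> a * b"
  proof (cases "b = 0")
    case True
    have "(cmod c)\<^sup>2 = 0"
    proof (rule ccontr)
      assume "(cmod c)\<^sup>2 \<noteq> 0"
      \<comment> \<open>With b = 0 the inequality \<open>key\<close> is linear in t, so a large t
        refutes it.\<close>
      then have "2 * (a + 1) \<le> a" using key[of "(a + 1) / (cmod c)\<^sup>2"] True by simp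
      moreover have "a \<ge> 0" by (simp add: a_def)
      ultimately show False by argo
    qed
    then show ?thesis using True by simp
  next
    case False
    then have b: "b > 0" using zero_le_power2[of "L2_norm M g"] by (auto simp: b_def)
    have "2 * (cmod c)\<^sup>2 / b \<le> a + (cmod c)\<^sup>2 / b"
      using key[of "1 / b"] b by (simp add: power2_eq_square)
    then have "(cmod c)\<^sup>2 / b \<le> a" by (simp add: field_simps)
    then show ?thesis using b by (simp add: field_simps)
  qed
  then have "(cmod c)\<^sup>2 \<le> (L2_norm M f * L2_norm M g)\<^sup>2"
    by (simp add: a_def b_def power_mult_distrib)
  then show ?thesis unfolding c_def
    by (rule power2_le_imp_le) (simp add: L2_norm_nonneg)
qed

lemma L2_norm_triangle:
  assumes "f \<in> L2 M" "g \<in> L2 M"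
  shows "L2_norm M (\<lambda>x. f x + g x) \<le> L2_norm M f + L2_norm M g"
proof (rule power2_le_imp_le)
  have "complex_of_real ((L2_norm M (\<lambda>x. f x + g x))\<^sup>2)
      = of_real ((L2_norm M f)\<^sup>2) + of_real ((L2_norm M g)\<^sup>2) + L2_inner M f g + cnj (L2_inner M f g)"
    using assms by (simp only: L2_inner_self[symmetric] L2_inner_simps L2_add L2_inner_cnj) simp
  also have "\<dots> = of_real ((L2_norm M f)\<^sup>2 + (L2_norm M g)\<^sup>2 + 2 * Re (L2_inner M f g))"
    by (simp add: complex_add_cnj)
  finally have "(L2_norm M (\<lambda>x. f x + g x))\<^sup>2 = (L2_norm M f)\<^sup>2 + (L2_norm M g)\<^sup>2 + 2 * Re (L2_inner M f g)"
    by (simp only: of_real_eq_iff)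
  also have "\<dots> \<le> (L2_norm M f)\<^sup>2 + (L2_norm M g)\<^sup>2 + 2 * (L2_norm M f * L2_norm M g)"
    using L2_Cauchy_Schwarz[OF assms] complex_Re_le_cmod[of "L2_inner M f g"] by linarith
  finally show "(L2_norm M (\<lambda>x. f x + g x))\<^sup>2 \<le> (L2_norm M f + L2_norm M g)\<^sup>2"
    by (simp add: power2_sum)
qed (simp add: L2_norm_nonneg)

lemma L2_norm_triangle_diff:
  assumes "f \<in> L2 M" "g \<in> L2 M"
  shows "L2_norm M f \<le> L2_norm M (\<lambda>x. f x - g x) + L2_norm M g"
  using L2_norm_triangle[OF L2_diff[OF assms] assms(2)] by simp

lemma L2_norm_triangle_diff2:
  assumes "f \<in> L2 M" "g \<in> L2 M" "h \<in> L2 M"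
  shows "L2_norm M (\<lambda>x. f x - h x) \<le> L2_norm M (\<lambda>x. f x - g x) + L2_norm M (\<lambda>x. g x - h x)"
  using L2_norm_triangle[OF L2_diff[OF assms(1,2)] L2_diff[OF assms(2,3)]] by simp

text \<open>Riesz-Fischer: a subsequence with geometrically small gaps converges almost everywhere,
  and Fatou's lemma carries the Cauchy estimate over to the limit.\<close>

lemma L2_complete:
  assumes f: "\<And>n. f n \<in> L2 M"
    and Cauchy: "\<And>e. e > 0 \<Longrightarrow> \<exists>N. \<forall>m\<ge>N. \<forall>n\<ge>N. L2_norm M (\<lambda>x. f m x - f n x) < e"
  shows "\<exists>g\<in>L2 M. (\<lambda>n. L2_norm M (\<lambda>x. f n x - g x)) \<longlonglongrightarrow> 0"
proof -
  have [measurable]: "f n \<in> borel_measurable M" for n using f by measurable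
  have "\<forall>k. \<exists>N. \<forall>m\<ge>N. \<forall>n\<ge>N. L2_norm M (\<lambda>x. f m x - f n x) < (1/4)^k"
    using Cauchy by simp
  then obtain N where N: "\<And>k m n. m \<ge> N k \<Longrightarrow> n \<ge> N k \<Longrightarrow> L2_norm M (\<lambda>x. f m x - f n x) < (1/4)^k"
    by metis
  \<comment> \<open>The sum makes \<open>r\<close> monotone and at least \<open>N k\<close>; the
    summand k makes it unbounded.\<close>
  define r where "r k = (\<Sum>i\<le>k. N i) + k" for k
  have rN: "r k \<ge> N k" for k
    unfolding r_def by (rule trans_le_add1) (auto intro: member_le_sum)
  have rmono: "r k \<le> r (Suc k)" for k by (simp add: r_def)
  have rk: "r k \<ge> k" for k by (simp add: r_def)
  have rN': "r (Suc k) \<ge> N k" for k using rN[of k] rmono[of k] by linarith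
  define d where "d k x = cmod (f (r (Suc k)) x - f (r k) x)" for k x
  have [measurable]: "d k \<in> borel_measurable M" for k unfolding d_def by measurable
  have nn: "(\<integral>\<^sup>+x. ennreal ((cmod (h x))\<^sup>2) \<partial>M) = ennreal ((L2_norm M h)\<^sup>2)" if "h \<in> L2 M" for h
    using that by (subst nn_integral_eq_integral) (auto simp: L2_def L2_norm_squared)
  \<comment> \<open>The squared gap is at most 16^(-k). Spending only a factor 4^k leaves a summable
    series, and its finiteness at almost every x forces d k x to be O(2^(-k)).\<close>
  have d2: "(\<integral>\<^sup>+x. ennreal (4^k * (d k x)\<^sup>2) \<partial>M) \<le> ennreal ((1/4)^k)" for k
  proof -
    have "(\<integral>\<^sup>+x. ennreal (4^k * (d k x)\<^sup>2) \<partial>M) = ennreal (4^k) * (\<integral>\<^sup>+x. ennreal ((d k x)\<^sup>2) \<partial>M)"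
      by (subst nn_integral_cmult[symmetric]) (auto simp: ennreal_mult)
    also have "(\<integral>\<^sup>+x. ennreal ((d k x)\<^sup>2) \<partial>M) = ennreal ((L2_norm M (\<lambda>x. f (r (Suc k)) x - f (r k) x))\<^sup>2)"
      unfolding d_def by (rule nn) (intro L2_diff f)
    also have "ennreal (4^k) * \<dots> \<le> ennreal (4^k) * ennreal (((1/4)^k)\<^sup>2)"
      using N[OF rN' rN, of k] by (intro mult_left_mono ennreal_leI power_mono) (auto simp: L2_norm_nonneg less_imp_le)
    also have "\<dots> = ennreal ((1/4)^k)"
      by (simp add: ennreal_mult[symmetric] power2_eq_square power_one_over field_simps)
    finally show ?thesis .
  qed
  have "(\<integral>\<^sup>+x. (\<Sum>k. ennreal (4^k * (d k x)\<^sup>2)) \<partial>M) = (\<Sum>k. \<integral>\<^sup>+x. ennreal (4^k * (d k x)\<^sup>2) \<partial>M)"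
    by (rule nn_integral_suminf) measurable
  also have "\<dots> \<le> (\<Sum>k. ennreal ((1/4)^k))"
    using d2 by (intro suminf_le) auto
  also have "\<dots> = ennreal (\<Sum>k. (1/4)^k)"
    by (rule suminf_ennreal2) (auto intro: summable_geometric)
  finally have fin: "(\<integral>\<^sup>+x. (\<Sum>k. ennreal (4^k * (d k x)\<^sup>2)) \<partial>M) \<noteq> \<infinity>"
    by (auto simp: top_unique)
  have AE: "AE x in M. (\<Sum>k. ennreal (4^k * (d k x)\<^sup>2)) \<noteq> \<infinity>"
    by (rule nn_integral_PInf_AE[OF _ fin]) measurable
  define g where "g x = lim (\<lambda>k. f (r k) x)" for x
  have [measurable]: "g \<in> borel_measurable M" unfolding g_def by measurable
  have conv: "AE x in M. (\<lambda>k. f (r k) x) \<longlonglongrightarrow> g x"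
    using AE
  proof eventually_elim
    case (elim x)
    define c where "c = (\<Sum>k. ennreal (4^k * (d k x)\<^sup>2))"
    have "c \<noteq> \<infinity>" using elim by (simp add: c_def)
    then obtain C where C: "c = ennreal C" "C \<ge> 0" by (cases c) auto
    have "4^k * (d k x)\<^sup>2 \<le> C" for k
    proof -
      have "ennreal (4^k * (d k x)\<^sup>2) = (\<Sum>i\<in>{k}. ennreal (4^i * (d i x)\<^sup>2))" by simp
      also have "\<dots> \<le> c" unfolding c_def by (intro sum_le_suminf) auto
      finally show ?thesis using C by (simp add: ennreal_le_iff)
    qed
    then have "(2^k * d k x)\<^sup>2 \<le> (sqrt C)\<^sup>2" for k
      using C by (simp add: power_mult_distrib power_mult[symmetric] mult.commute[of k])
         (simp add: power_mult)
    then have "2^k * d k x \<le> sqrt C" for k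
      by (rule power2_le_imp_le) (use C in simp)
    then have dk: "d k x \<le> sqrt C * (1/2)^k" for k
      by (simp add: power_one_over field_simps)
    have "summable (\<lambda>k. f (r (Suc k)) x - f (r k) x)"
    proof (rule summable_comparison_test)
      show "\<exists>N. \<forall>n\<ge>N. norm (f (r (Suc n)) x - f (r n) x) \<le> sqrt C * (1/2)^n"
        using dk by (auto simp: d_def)
      show "summable (\<lambda>n. sqrt C * (1/2)^n)" by (intro summable_mult summable_geometric) simp
    qed
    then have "(\<lambda>n. \<Sum>k<n. f (r (Suc k)) x - f (r k) x) \<longlonglongrightarrow> (\<Sum>k. f (r (Suc k)) x - f (r k) x)"
      by (rule summable_LIMSEQ)
    then have "(\<lambda>n. f (r n) x - f (r 0) x) \<longlonglongrightarrow> (\<Sum>k. f (r (Suc k)) x - f (r k) x)"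
      by (subst (asm) sum_lessThan_telescope)
    then have "(\<lambda>n. (f (r n) x - f (r 0) x) + f (r 0) x) \<longlonglongrightarrow> (\<Sum>k. f (r (Suc k)) x - f (r k) x) + f (r 0) x"
      by (intro tendsto_intros)
    then have "convergent (\<lambda>n. f (r n) x)" by (auto simp: convergent_def)
    then show ?case unfolding g_def by (simp add: convergent_LIMSEQ_iff)
  qed
  \<comment> \<open>Fatou's lemma along the subsequence; square integrability of the difference
    comes out of the same estimate.\<close>
  have est: "(\<lambda>x. f n x - g x) \<in> L2 M \<and> L2_norm M (\<lambda>x. f n x - g x) \<le> e"
    if e: "e > 0" and n: "\<And>m. m \<ge> n \<Longrightarrow> L2_norm M (\<lambda>x. f n x - f m x) < e" for n e
  proof -
    have "(\<integral>\<^sup>+x. ennreal ((cmod (f n x - g x))\<^sup>2) \<partial>M)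
       = (\<integral>\<^sup>+x. liminf (\<lambda>k. ennreal ((cmod (f n x - f (r k) x))\<^sup>2)) \<partial>M)"
    proof (rule nn_integral_cong_AE)
      show "AE x in M. ennreal ((cmod (f n x - g x))\<^sup>2) = liminf (\<lambda>k. ennreal ((cmod (f n x - f (r k) x))\<^sup>2))"
        using conv
      proof eventually_elim
        case (elim x)
        have "(\<lambda>k. ennreal ((cmod (f n x - f (r k) x))\<^sup>2)) \<longlonglongrightarrow> ennreal ((cmod (f n x - g x))\<^sup>2)"
          by (intro tendsto_intros elim)
        from lim_imp_Liminf[OF _ this] show ?case by simp
      qed
    qed
    also have "\<dots> \<le> liminf (\<lambda>k. \<integral>\<^sup>+x. ennreal ((cmod (f n x - f (r k) x))\<^sup>2) \<partial>M)"
      by (rule nn_integral_liminf) measurable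
    also have "\<dots> \<le> ennreal (e\<^sup>2)"
    proof (rule Liminf_le)
      show "\<forall>\<^sub>F k in sequentially. (\<integral>\<^sup>+x. ennreal ((cmod (f n x - f (r k) x))\<^sup>2) \<partial>M) \<le> ennreal (e\<^sup>2)"
        using eventually_ge_at_top[of n]
      proof eventually_elim
        case (elim k)
        have "r k \<ge> n" using rk[of k] elim by linarith
        then show ?case
          using n[of "r k"] by (subst nn) (auto intro!: L2_diff f ennreal_leI power_mono simp: L2_norm_nonneg less_imp_le)
      qed
    qed simp
    finally have le: "(\<integral>\<^sup>+x. ennreal ((cmod (f n x - g x))\<^sup>2) \<partial>M) \<le> ennreal (e\<^sup>2)" .
    have int: "integrable M (\<lambda>x. (cmod (f n x - g x))\<^sup>2)"
      by (rule integrableI_bounded) (use le in \<open>auto simp: less_top[symmetric] top_unique\<close>)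
    then have L: "(\<lambda>x. f n x - g x) \<in> L2 M" by (simp add: L2_def)
    have "(L2_norm M (\<lambda>x. f n x - g x))\<^sup>2 \<le> e\<^sup>2"
      using le unfolding nn[OF L] by (simp add: ennreal_le_iff)
    then show ?thesis using L e by (auto intro: power2_le_imp_le)
  qed
  have est': "\<exists>N. \<forall>n\<ge>N. (\<lambda>x. f n x - g x) \<in> L2 M \<and> L2_norm M (\<lambda>x. f n x - g x) \<le> e" if "e > 0" for e
    using est[OF that] Cauchy[OF that] by (meson order.trans)
  obtain n where n: "(\<lambda>x. f n x - g x) \<in> L2 M" using est'[of 1] by auto
  have g: "g \<in> L2 M" using L2_diff[OF f[of n] n] by simp
  have "(\<lambda>n. L2_norm M (\<lambda>x. f n x - g x)) \<longlonglongrightarrow> 0"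
  proof (rule LIMSEQ_I)
    fix e :: real assume "e > 0"
    then obtain N where "\<forall>n\<ge>N. L2_norm M (\<lambda>x. f n x - g x) \<le> e/2" using est'[of "e/2"] by auto
    then show "\<exists>N. \<forall>n\<ge>N. norm (L2_norm M (\<lambda>x. f n x - g x) - 0) < e"
      using \<open>e > 0\<close> by (intro exI[of _ N]) (fastforce simp: L2_norm_nonneg)
  qed
  then show ?thesis using g by blast
qed

section \<open>Resolvents of Friedrichs extensions\<close>

locale nonneg_symmetric =
  fixes M :: "'a measure" and S :: "('a \<Rightarrow> complex) \<Rightarrow> ('a \<Rightarrow> complex)" and D :: "('a \<Rightarrow> complex) set"
  assumes D_L2: "\<phi> \<in> D \<Longrightarrow> \<phi> \<in> L2 M"
    and S_L2: "\<phi> \<in> D \<Longrightarrow> S \<phi> \<in> L2 M"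
    and D_zero: "(\<lambda>x. 0) \<in> D"
    and D_add: "\<phi> \<in> D \<Longrightarrow> \<psi> \<in> D \<Longrightarrow> (\<lambda>x. \<phi> x + \<psi> x) \<in> D"
    and D_scale: "\<phi> \<in> D \<Longrightarrow> (\<lambda>x. c * \<phi> x) \<in> D"
    and S_add: "\<phi> \<in> D \<Longrightarrow> \<psi> \<in> D \<Longrightarrow> S (\<lambda>x. \<phi> x + \<psi> x) = (\<lambda>x. S \<phi> x + S \<psi> x)"
    and S_scale: "\<phi> \<in> D \<Longrightarrow> S (\<lambda>x. c * \<phi> x) = (\<lambda>x. c * S \<phi> x)"
    and S_sym: "\<phi> \<in> D \<Longrightarrow> \<psi> \<in> D \<Longrightarrow> L2_inner M (S \<phi>) \<psi> = cnj (L2_inner M (S \<psi>) \<phi>)"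
    and S_nonneg: "\<phi> \<in> D \<Longrightarrow> 0 \<le> Re (L2_inner M (S \<phi>) \<phi>)"
begin

abbreviation A where "A \<equiv> friedrichs_extension M S D"

definition b where "b \<phi> \<psi> = L2_inner M (S \<phi>) \<psi>"

text \<open>The square of the form norm. Adding the mass makes its Cauchy sequences converge in L^2,
  so the two conditions of \<open>form_converges\<close> become one.\<close>

definition a where "a \<phi> = Re (b \<phi> \<phi>) + (L2_norm M \<phi>)\<^sup>2"

lemma D_diff: "\<phi> \<in> D \<Longrightarrow> \<psi> \<in> D \<Longrightarrow> (\<lambda>x. \<phi> x - \<psi> x) \<in> D"
  using D_add[OF _ D_scale[of \<psi> "-1"]] by simp

lemma S_diff: "\<phi> \<in> D \<Longrightarrow> \<psi> \<in> D \<Longrightarrow> S (\<lambda>x. \<phi> x - \<psi> x) = (\<lambda>x. S \<phi> x - S \<psi> x)"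
  using S_add[OF _ D_scale[of \<psi> "-1"]] S_scale[of \<psi> "-1"] by simp

lemma b_add_left: "\<lbrakk>\<phi> \<in> D; \<psi> \<in> D; \<eta> \<in> D\<rbrakk> \<Longrightarrow> b (\<lambda>x. \<phi> x + \<psi> x) \<eta> = b \<phi> \<eta> + b \<psi> \<eta>"
  by (simp add: b_def S_add L2_inner_add_left S_L2 D_L2)

lemma b_add_right: "\<lbrakk>\<phi> \<in> D; \<psi> \<in> D; \<eta> \<in> D\<rbrakk> \<Longrightarrow> b \<eta> (\<lambda>x. \<phi> x + \<psi> x) = b \<eta> \<phi> + b \<eta> \<psi>"
  by (simp add: b_def L2_inner_add_right S_L2 D_L2)

lemma b_scale_left: "\<phi> \<in> D \<Longrightarrow> b (\<lambda>x. c * \<phi> x) \<eta> = c * b \<phi> \<eta>"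
  by (simp add: b_def S_scale L2_inner_scale_left)

lemma b_scale_right: "b \<eta> (\<lambda>x. c * \<phi> x) = cnj c * b \<eta> \<phi>"
  by (simp add: b_def L2_inner_scale_right)

lemma b_sym: "\<phi> \<in> D \<Longrightarrow> \<psi> \<in> D \<Longrightarrow> b \<psi> \<phi> = cnj (b \<phi> \<psi>)"
  unfolding b_def using S_sym by blast

lemma b_self_real: "\<phi> \<in> D \<Longrightarrow> b \<phi> \<phi> = of_real (Re (b \<phi> \<phi>))"
  using b_sym[of \<phi> \<phi>] by (simp add: complex_eq_iff)

lemma b_nonneg: "\<phi> \<in> D \<Longrightarrow> 0 \<le> Re (b \<phi> \<phi>)"
  using S_nonneg by (simp add: b_def)

lemma b_expand:
  assumes "\<phi> \<in> D" "\<psi> \<in> D"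
  shows "Re (b (\<lambda>x. \<phi> x + \<psi> x) (\<lambda>x. \<phi> x + \<psi> x)) = Re (b \<phi> \<phi>) + 2 * Re (b \<phi> \<psi>) + Re (b \<psi> \<psi>)"
  using assms b_sym[OF assms] by (simp add: b_add_left b_add_right D_add)

lemma norm_expand:
  assumes "\<phi> \<in> L2 M" "\<psi> \<in> L2 M"
  shows "(L2_norm M (\<lambda>x. \<phi> x + \<psi> x))\<^sup>2 = (L2_norm M \<phi>)\<^sup>2 + 2 * Re (L2_inner M \<phi> \<psi>) + (L2_norm M \<psi>)\<^sup>2"
proof -
  have "complex_of_real ((L2_norm M (\<lambda>x. \<phi> x + \<psi> x))\<^sup>2) = L2_inner M (\<lambda>x. \<phi> x + \<psi> x) (\<lambda>x. \<phi> x + \<psi> x)"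
    by (simp only: L2_inner_self)
  also have "\<dots> = L2_inner M \<phi> \<phi> + L2_inner M \<psi> \<psi> + L2_inner M \<phi> \<psi> + cnj (L2_inner M \<phi> \<psi>)"
    using assms by (simp only: L2_inner_simps L2_add L2_inner_cnj) simp
  finally have "Re (complex_of_real ((L2_norm M (\<lambda>x. \<phi> x + \<psi> x))\<^sup>2))
     = Re (L2_inner M \<phi> \<phi> + L2_inner M \<psi> \<psi> + L2_inner M \<phi> \<psi> + cnj (L2_inner M \<phi> \<psi>))" by simp
  then show ?thesis unfolding L2_inner_self by simp
qed

lemma a_nonneg: "\<phi> \<in> D \<Longrightarrow> 0 \<le> a \<phi>"
  using b_nonneg by (simp add: a_def)

lemma a_bounds: "\<phi> \<in> D \<Longrightarrow> Re (b \<phi> \<phi>) \<le> a \<phi>" "\<phi> \<in> D \<Longrightarrow> (L2_norm M \<phi>)\<^sup>2 \<le> a \<phi>"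
  using b_nonneg[of \<phi>] by (simp_all add: a_def)

lemma a_expand:
  assumes "\<phi> \<in> D" "\<psi> \<in> D"
  shows "a (\<lambda>x. \<phi> x + \<psi> x) = a \<phi> + 2 * Re (b \<phi> \<psi> + L2_inner M \<phi> \<psi>) + a \<psi>"
  using assms by (simp add: a_def b_expand norm_expand D_L2)

lemma a_scale: "\<phi> \<in> D \<Longrightarrow> a (\<lambda>x. c * \<phi> x) = (cmod c)\<^sup>2 * a \<phi>"
proof -
  assume "\<phi> \<in> D"
  then have "b (\<lambda>x. c * \<phi> x) (\<lambda>x. c * \<phi> x) = c * cnj c * b \<phi> \<phi>"
    by (simp add: b_scale_left b_scale_right)
  also have "c * cnj c = of_real ((cmod c)\<^sup>2)" by (metis complex_norm_square)
  finally show ?thesis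
    by (simp add: a_def L2_norm_scale power_mult_distrib algebra_simps)
qed

lemma a_parallelogram:
  assumes "\<phi> \<in> D" "\<psi> \<in> D"
  shows "a (\<lambda>x. \<phi> x + \<psi> x) + a (\<lambda>x. \<phi> x - \<psi> x) = 2 * a \<phi> + 2 * a \<psi>"
proof -
  have m: "(\<lambda>x. (-1) * \<psi> x) \<in> D" by (rule D_scale) fact
  have "a (\<lambda>x. \<phi> x + (-1) * \<psi> x) = a \<phi> + 2 * Re (b \<phi> (\<lambda>x. (-1) * \<psi> x) + L2_inner M \<phi> (\<lambda>x. (-1) * \<psi> x)) + a (\<lambda>x. (-1) * \<psi> x)"
    by (rule a_expand[OF assms(1) m])
  then have "a (\<lambda>x. \<phi> x + (-1) * \<psi> x) = a \<phi> - 2 * Re (b \<phi> \<psi> + L2_inner M \<phi> \<psi>) + a \<psi>"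
    unfolding a_scale[OF assms(2)] b_scale_right L2_inner_scale_right by simp
  then show ?thesis using a_expand[OF assms] by simp
qed

section \<open>Sequences that are Cauchy in the form norm\<close>

definition form_Cauchy :: "(nat \<Rightarrow> 'a \<Rightarrow> complex) \<Rightarrow> bool" where
  "form_Cauchy \<phi> \<longleftrightarrow> (\<forall>n. \<phi> n \<in> D) \<and> (\<forall>e>0. \<exists>N. \<forall>m\<ge>N. \<forall>n\<ge>N. a (\<lambda>x. \<phi> m x - \<phi> n x) < e)"

lemma form_Cauchy_D: "form_Cauchy \<phi> \<Longrightarrow> \<phi> n \<in> D"
  by (simp add: form_Cauchy_def)

lemma form_Cauchy_converges:
  assumes "form_Cauchy \<phi>"
  shows "\<exists>u\<in>L2 M. form_converges M S D \<phi> u"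
proof -
  have D: "\<phi> n \<in> D" for n using assms by (simp add: form_Cauchy_def)
  have C: "\<exists>N. \<forall>m\<ge>N. \<forall>n\<ge>N. a (\<lambda>x. \<phi> m x - \<phi> n x) < e" if "e > 0" for e
    using assms that by (simp add: form_Cauchy_def)
  have "\<exists>N. \<forall>m\<ge>N. \<forall>n\<ge>N. L2_norm M (\<lambda>x. \<phi> m x - \<phi> n x) < e" if "e > 0" for e
  proof -
    obtain N where N: "\<forall>m\<ge>N. \<forall>n\<ge>N. a (\<lambda>x. \<phi> m x - \<phi> n x) < e\<^sup>2"
      using C[of "e\<^sup>2"] \<open>e > 0\<close> by auto
    have "L2_norm M (\<lambda>x. \<phi> m x - \<phi> n x) < e" if "m \<ge> N" "n \<ge> N" for m n
    proof (rule power2_less_imp_less)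
      show "(L2_norm M (\<lambda>x. \<phi> m x - \<phi> n x))\<^sup>2 < e\<^sup>2"
        using N that a_bounds(2)[OF D_diff[OF D D], of m n] by (meson order_le_less_trans)
    qed (use \<open>e > 0\<close> in simp)
    then show ?thesis by blast
  qed
  with L2_complete[of \<phi>, OF D_L2[OF D]] obtain u where u: "u \<in> L2 M" "(\<lambda>n. L2_norm M (\<lambda>x. \<phi> n x - u x)) \<longlonglongrightarrow> 0"
    by auto
  have "\<exists>N. \<forall>m\<ge>N. \<forall>n\<ge>N. Re (L2_inner M (S (\<lambda>x. \<phi> m x - \<phi> n x)) (\<lambda>x. \<phi> m x - \<phi> n x)) < e" if e: "e > 0" for e
  proof -
    obtain N where "\<forall>m\<ge>N. \<forall>n\<ge>N. a (\<lambda>x. \<phi> m x - \<phi> n x) < e" using C[OF e] by blast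
    then show ?thesis
      using a_bounds(1)[OF D_diff[OF D D]] unfolding b_def by (meson order_le_less_trans)
  qed
  then have "form_converges M S D \<phi> u" using u D by (auto simp: form_converges_def)
  then show ?thesis using u by blast
qed

lemma form_converges_Cauchy:
  assumes "form_converges M S D \<phi> u"
  shows "form_Cauchy \<phi>"
  unfolding form_Cauchy_def
proof (intro conjI allI impI)
  show D: "\<phi> n \<in> D" for n using assms by (auto simp: form_converges_def)
  have u: "u \<in> L2 M" and lim: "(\<lambda>n. L2_norm M (\<lambda>x. \<phi> n x - u x)) \<longlonglongrightarrow> 0"
    using assms by (auto simp: form_converges_def)
  fix e :: real assume e: "e > 0"
  obtain N1 where N1: "\<forall>m\<ge>N1. \<forall>n\<ge>N1. Re (b (\<lambda>x. \<phi> m x - \<phi> n x) (\<lambda>x. \<phi> m x - \<phi> n x)) < e/2"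
    using assms e unfolding form_converges_def b_def by (meson half_gt_zero)
  obtain N2 where N2: "\<forall>n\<ge>N2. L2_norm M (\<lambda>x. \<phi> n x - u x) < sqrt (e/2) / 2"
    using LIMSEQ_D[OF lim, of "sqrt (e/2) / 2"] e by (auto simp: L2_norm_nonneg)
  have "a (\<lambda>x. \<phi> m x - \<phi> n x) < e" if "m \<ge> max N1 N2" "n \<ge> max N1 N2" for m n
  proof -
    have "L2_norm M (\<lambda>x. \<phi> m x - \<phi> n x) \<le> L2_norm M (\<lambda>x. \<phi> m x - u x) + L2_norm M (\<lambda>x. u x - \<phi> n x)"
      by (intro L2_norm_triangle_diff2 D_L2 D u)
    also have "\<dots> < sqrt (e/2)"
    proof -
      have "L2_norm M (\<lambda>x. \<phi> m x - u x) < sqrt (e/2) / 2" "L2_norm M (\<lambda>x. u x - \<phi> n x) < sqrt (e/2) / 2"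
        using N2 that by (auto simp: L2_norm_minus_commute[of M u])
      then show ?thesis by linarith
    qed
    finally have "(L2_norm M (\<lambda>x. \<phi> m x - \<phi> n x))\<^sup>2 < (sqrt (e/2))\<^sup>2"
      by (intro power_strict_mono) (auto simp: L2_norm_nonneg)
    then have "(L2_norm M (\<lambda>x. \<phi> m x - \<phi> n x))\<^sup>2 < e/2" using e by simp
    moreover have "Re (b (\<lambda>x. \<phi> m x - \<phi> n x) (\<lambda>x. \<phi> m x - \<phi> n x)) < e/2" using N1 that by simp
    ultimately show ?thesis by (simp add: a_def)
  qed
  then show "\<exists>N. \<forall>m\<ge>N. \<forall>n\<ge>N. a (\<lambda>x. \<phi> m x - \<phi> n x) < e" by blast
qed

lemma form_Cauchy_add:
  assumes "form_Cauchy \<phi>" "form_Cauchy \<psi>" shows "form_Cauchy (\<lambda>n x. \<phi> n x + \<psi> n x)"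
  unfolding form_Cauchy_def
proof (intro conjI allI impI)
  note D = form_Cauchy_D[OF assms(1)] form_Cauchy_D[OF assms(2)]
  show "(\<lambda>x. \<phi> n x + \<psi> n x) \<in> D" for n by (intro D_add D)
  fix e :: real assume e: "e > 0"
  obtain N1 where N1: "\<And>m n. m\<ge>N1 \<Longrightarrow> n\<ge>N1 \<Longrightarrow> a (\<lambda>x. \<phi> m x - \<phi> n x) < e/4"
    using assms(1) e unfolding form_Cauchy_def by (metis zero_less_divide_iff zero_less_numeral)
  obtain N2 where N2: "\<And>m n. m\<ge>N2 \<Longrightarrow> n\<ge>N2 \<Longrightarrow> a (\<lambda>x. \<psi> m x - \<psi> n x) < e/4"
    using assms(2) e unfolding form_Cauchy_def by (metis zero_less_divide_iff zero_less_numeral)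
  have "a (\<lambda>x. \<phi> m x + \<psi> m x - (\<phi> n x + \<psi> n x)) < e" if "m \<ge> max N1 N2" "n \<ge> max N1 N2" for m n
  proof -
    have eq: "(\<lambda>x. \<phi> m x + \<psi> m x - (\<phi> n x + \<psi> n x)) = (\<lambda>x. (\<phi> m x - \<phi> n x) + (\<psi> m x - \<psi> n x))"
      by (auto simp: algebra_simps)
    have "a (\<lambda>x. (\<phi> m x - \<phi> n x) + (\<psi> m x - \<psi> n x)) \<le> 2 * a (\<lambda>x. \<phi> m x - \<phi> n x) + 2 * a (\<lambda>x. \<psi> m x - \<psi> n x)"
      using a_parallelogram[OF D_diff[OF D(1) D(1), of m n] D_diff[OF D(2) D(2), of m n]]
        a_nonneg[OF D_diff[OF D_diff[OF D(1) D(1), of m n] D_diff[OF D(2) D(2), of m n]]] by linarith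
    then show ?thesis unfolding eq using N1[of m n] N2[of m n] that by auto
  qed
  then show "\<exists>N. \<forall>m\<ge>N. \<forall>n\<ge>N. a (\<lambda>x. \<phi> m x + \<psi> m x - (\<phi> n x + \<psi> n x)) < e" by blast
qed

lemma form_Cauchy_scale:
  assumes "form_Cauchy \<phi>" shows "form_Cauchy (\<lambda>n x. c * \<phi> n x)"
  unfolding form_Cauchy_def
proof (intro conjI allI impI)
  note D = form_Cauchy_D[OF assms(1)]
  show "(\<lambda>x. c * \<phi> n x) \<in> D" for n by (intro D_scale D)
  fix e :: real assume e: "e > 0"
  define k where "k = (cmod c)\<^sup>2 + 1"
  have k: "k > 0" by (simp add: k_def add_nonneg_pos)
  obtain N where N: "\<And>m n. m\<ge>N \<Longrightarrow> n\<ge>N \<Longrightarrow> a (\<lambda>x. \<phi> m x - \<phi> n x) < e/k"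
    using assms(1) e k unfolding form_Cauchy_def by (metis zero_less_divide_iff)
  have "a (\<lambda>x. c * \<phi> m x - c * \<phi> n x) < e" if "m \<ge> N" "n \<ge> N" for m n
  proof -
    have "a (\<lambda>x. c * \<phi> m x - c * \<phi> n x) = (cmod c)\<^sup>2 * a (\<lambda>x. \<phi> m x - \<phi> n x)"
      using a_scale[OF D_diff[OF D D], of c m n] by (simp add: right_diff_distrib)
    also have "\<dots> \<le> k * a (\<lambda>x. \<phi> m x - \<phi> n x)"
      by (intro mult_right_mono a_nonneg D_diff D) (simp add: k_def)
    also have "\<dots> < e" using N[OF that] k by (simp add: field_simps)
    finally show ?thesis .
  qed
  then show "\<exists>N. \<forall>m\<ge>N. \<forall>n\<ge>N. a (\<lambda>x. c * \<phi> m x - c * \<phi> n x) < e" by blast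
qed

lemma form_Cauchy_bounded:
  assumes "form_Cauchy \<phi>" shows "\<exists>B. \<forall>n. a (\<phi> n) \<le> B"
proof -
  note D = form_Cauchy_D[OF assms]
  obtain N where N: "\<And>m n. m\<ge>N \<Longrightarrow> n\<ge>N \<Longrightarrow> a (\<lambda>x. \<phi> m x - \<phi> n x) < 1"
    using assms unfolding form_Cauchy_def by (metis zero_less_one)
  have "a (\<phi> n) \<le> 2 * a (\<phi> N) + 2 + (\<Sum>i<N. a (\<phi> i))" for n
  proof (cases "n < N")
    case True
    then have "a (\<phi> n) \<le> (\<Sum>i<N. a (\<phi> i))" by (intro member_le_sum) (auto intro: a_nonneg D)
    then show ?thesis using a_nonneg[OF D[of N]] by linarith
  next
    case False
    have "a (\<lambda>x. (\<phi> n x - \<phi> N x) + \<phi> N x) \<le> 2 * a (\<lambda>x. \<phi> n x - \<phi> N x) + 2 * a (\<phi> N)"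
      using a_parallelogram[OF D_diff[OF D[of n] D[of N]] D[of N]] a_nonneg[OF D_diff[OF D_diff[OF D[of n] D[of N]] D[of N]]]
      by linarith
    moreover have "(\<Sum>i<N. a (\<phi> i)) \<ge> 0" by (intro sum_nonneg a_nonneg D)
    ultimately show ?thesis using N[of n N] False by auto
  qed
  then show ?thesis by blast
qed

lemma form_Cauchy_L2_bounded:
  assumes "form_Cauchy \<phi>" shows "\<exists>B\<ge>0. \<forall>n. L2_norm M (\<phi> n) \<le> B"
proof -
  obtain B where B: "\<And>n. a (\<phi> n) \<le> B" using form_Cauchy_bounded[OF assms] by auto
  have "L2_norm M (\<phi> n) \<le> sqrt B" for n
    using a_bounds(2)[OF form_Cauchy_D[OF assms], of n] B[of n]
    by (intro real_le_rsqrt) linarith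
  moreover have "sqrt B \<ge> 0" using order_trans[OF L2_norm_nonneg calculation] .
  ultimately show ?thesis by blast
qed

section \<open>The graph of the Friedrichs extension in terms of representing sequences\<close>

lemma inner_tendsto_right:
  assumes "g \<in> L2 M" "\<And>n. \<psi> n \<in> L2 M" "v \<in> L2 M" "(\<lambda>n. L2_norm M (\<lambda>x. \<psi> n x - v x)) \<longlonglongrightarrow> 0"
  shows "(\<lambda>n. L2_inner M g (\<psi> n)) \<longlonglongrightarrow> L2_inner M g v"
proof (rule Lim_null[THEN iffD2], rule Lim_null_comparison)
  show "(\<lambda>n. L2_norm M g * L2_norm M (\<lambda>x. \<psi> n x - v x)) \<longlonglongrightarrow> 0"
    using tendsto_mult_left[OF assms(4), of "L2_norm M g"] by simp
  show "\<forall>\<^sub>F n in sequentially. norm (L2_inner M g (\<psi> n) - L2_inner M g v) \<le> L2_norm M g * L2_norm M (\<lambda>x. \<psi> n x - v x)"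
    using L2_Cauchy_Schwarz[OF assms(1) L2_diff[OF assms(2,3)]] assms by (simp add: L2_inner_diff_right)
qed

text \<open>Unlike in \<open>friedrichs_extension\<close>, the test sequences need not come with a limit.\<close>
definition represents where
  "represents \<phi> u g \<longleftrightarrow> form_converges M S D \<phi> u \<and> g \<in> L2 M \<and>
     (\<forall>\<psi>. form_Cauchy \<psi> \<longrightarrow> (\<lambda>n. b (\<phi> n) (\<psi> n) - L2_inner M g (\<psi> n)) \<longlonglongrightarrow> 0)"

lemma represents_imp_mem: assumes "represents \<phi> u g" shows "(u, g) \<in> A"
proof -
  have "(\<lambda>n. L2_inner M (S (\<phi> n)) (\<psi> n)) \<longlonglongrightarrow> L2_inner M g v" if v: "form_converges M S D \<psi> v" for \<psi> v
  proof -
    have 1: "(\<lambda>n. b (\<phi> n) (\<psi> n) - L2_inner M g (\<psi> n)) \<longlonglongrightarrow> 0"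
      using assms form_converges_Cauchy[OF v] by (simp add: represents_def)
    have 2: "(\<lambda>n. L2_inner M g (\<psi> n)) \<longlonglongrightarrow> L2_inner M g v"
      using assms v form_Cauchy_D[OF form_converges_Cauchy[OF v]]
      by (intro inner_tendsto_right) (auto simp: represents_def form_converges_def D_L2)
    from tendsto_add[OF 1 2] show ?thesis by (simp add: b_def)
  qed
  then show ?thesis using assms unfolding friedrichs_extension_def represents_def by blast
qed

text \<open>Every form-Cauchy sequence has a limit v in L^2, and pairing with g passes to that
  limit; so testing without naming v loses nothing.\<close>

lemma mem_imp_represents: assumes "(u, g) \<in> A" shows "\<exists>\<phi>. represents \<phi> u g"
proof -
  obtain \<phi> where \<phi>: "g \<in> L2 M" "form_converges M S D \<phi> u"
    "\<And>\<psi> v. form_converges M S D \<psi> v \<Longrightarrow> (\<lambda>n. b (\<phi> n) (\<psi> n)) \<longlonglongrightarrow> L2_inner M g v"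
    using assms unfolding friedrichs_extension_def b_def by auto
  have "(\<lambda>n. b (\<phi> n) (\<psi> n) - L2_inner M g (\<psi> n)) \<longlonglongrightarrow> 0" if "form_Cauchy \<psi>" for \<psi>
  proof -
    obtain v where v: "v \<in> L2 M" "form_converges M S D \<psi> v" using form_Cauchy_converges[OF \<open>form_Cauchy \<psi>\<close>] by auto
    have 2: "(\<lambda>n. L2_inner M g (\<psi> n)) \<longlonglongrightarrow> L2_inner M g v"
      using \<phi> v form_Cauchy_D[OF that] by (intro inner_tendsto_right) (auto simp: form_converges_def D_L2)
    from tendsto_diff[OF \<phi>(3)[OF v(2)] 2] show ?thesis by simp
  qed
  then show ?thesis using \<phi> unfolding represents_def by blast
qed

lemma represents_lin:
  assumes "represents \<phi> u g" "represents \<psi> v h"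
  shows "represents (\<lambda>n x. \<phi> n x + c * \<psi> n x) (\<lambda>x. u x + c * v x) (\<lambda>x. g x + c * h x)"
proof -
  note C = form_converges_Cauchy[of \<phi> u] form_converges_Cauchy[of \<psi> v]
  have f: "form_converges M S D \<phi> u" "form_converges M S D \<psi> v" using assms by (auto simp: represents_def)
  have L: "u \<in> L2 M" "v \<in> L2 M" "g \<in> L2 M" "h \<in> L2 M" using assms by (auto simp: represents_def form_converges_def)
  have D: "\<phi> n \<in> D" "\<psi> n \<in> D" for n using C f form_Cauchy_D by auto
  have FC: "form_Cauchy (\<lambda>n x. \<phi> n x + c * \<psi> n x)"
    using form_Cauchy_add[OF C(1)[OF f(1)] form_Cauchy_scale[OF C(2)[OF f(2)]]] .
  have lim: "(\<lambda>n. L2_norm M (\<lambda>x. \<phi> n x + c * \<psi> n x - (u x + c * v x))) \<longlonglongrightarrow> 0"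
  proof (rule tendsto_sandwich[OF _ _ tendsto_const])
    show "\<forall>\<^sub>F n in sequentially. 0 \<le> L2_norm M (\<lambda>x. \<phi> n x + c * \<psi> n x - (u x + c * v x))"
      by (simp add: L2_norm_nonneg)
    show "(\<lambda>n. L2_norm M (\<lambda>x. \<phi> n x - u x) + cmod c * L2_norm M (\<lambda>x. \<psi> n x - v x)) \<longlonglongrightarrow> 0"
      using f by (auto simp: form_converges_def intro!: tendsto_eq_intros)
    have "L2_norm M (\<lambda>x. \<phi> n x + c * \<psi> n x - (u x + c * v x)) \<le> L2_norm M (\<lambda>x. \<phi> n x - u x) + cmod c * L2_norm M (\<lambda>x. \<psi> n x - v x)" for n
    proof -
      have "L2_norm M (\<lambda>x. \<phi> n x - u x + c * (\<psi> n x - v x)) \<le> L2_norm M (\<lambda>x. \<phi> n x - u x) + cmod c * L2_norm M (\<lambda>x. \<psi> n x - v x)"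
        unfolding L2_norm_scale[symmetric] by (intro L2_norm_triangle L2_diff L2_scale D_L2 D L)
      moreover have "(\<lambda>x. \<phi> n x - u x + c * (\<psi> n x - v x)) = (\<lambda>x. \<phi> n x + c * \<psi> n x - (u x + c * v x))"
        by (auto simp: algebra_simps)
      ultimately show ?thesis by simp
    qed
    then show "\<forall>\<^sub>F n in sequentially. L2_norm M (\<lambda>x. \<phi> n x + c * \<psi> n x - (u x + c * v x))
        \<le> L2_norm M (\<lambda>x. \<phi> n x - u x) + cmod c * L2_norm M (\<lambda>x. \<psi> n x - v x)" by simp
  qed
  have "form_converges M S D (\<lambda>n x. \<phi> n x + c * \<psi> n x) (\<lambda>x. u x + c * v x)"
    unfolding form_converges_def
  proof (intro conjI lim)
    show "range (\<lambda>n x. \<phi> n x + c * \<psi> n x) \<subseteq> D" using form_Cauchy_D[OF FC] by auto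
    show "(\<lambda>x. u x + c * v x) \<in> L2 M" by (intro L2_add L2_scale L)
    show "\<forall>e>0. \<exists>N. \<forall>m\<ge>N. \<forall>n\<ge>N. Re (L2_inner M (S (\<lambda>x. \<phi> m x + c * \<psi> m x - (\<phi> n x + c * \<psi> n x)))
         (\<lambda>x. \<phi> m x + c * \<psi> m x - (\<phi> n x + c * \<psi> n x))) < e"
    proof (intro allI impI)
      fix e :: real assume "e > 0"
      then obtain N where "\<forall>m\<ge>N. \<forall>n\<ge>N. a (\<lambda>x. \<phi> m x + c * \<psi> m x - (\<phi> n x + c * \<psi> n x)) < e"
        using FC by (auto simp: form_Cauchy_def)
      then show "\<exists>N. \<forall>m\<ge>N. \<forall>n\<ge>N. Re (L2_inner M (S (\<lambda>x. \<phi> m x + c * \<psi> m x - (\<phi> n x + c * \<psi> n x)))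
         (\<lambda>x. \<phi> m x + c * \<psi> m x - (\<phi> n x + c * \<psi> n x))) < e"
        using a_bounds(1)[OF D_diff[OF form_Cauchy_D[OF FC] form_Cauchy_D[OF FC]]] unfolding b_def
        by (meson order_le_less_trans)
    qed
  qed
  moreover have "(\<lambda>n. b (\<lambda>x. \<phi> n x + c * \<psi> n x) (\<eta> n) - L2_inner M (\<lambda>x. g x + c * h x) (\<eta> n)) \<longlonglongrightarrow> 0"
    if \<eta>: "form_Cauchy \<eta>" for \<eta>
  proof -
    have "(\<lambda>n. (b (\<phi> n) (\<eta> n) - L2_inner M g (\<eta> n)) + c * (b (\<psi> n) (\<eta> n) - L2_inner M h (\<eta> n))) \<longlonglongrightarrow> 0 + c * 0"
      using assms \<eta> by (intro tendsto_intros) (auto simp: represents_def)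
    then show ?thesis
      using D form_Cauchy_D[OF \<eta>] L
      by (simp add: b_add_left b_scale_left D_scale L2_inner_add_left L2_inner_scale_left L2_scale D_L2 algebra_simps)
  qed
  ultimately show ?thesis using L unfolding represents_def by (auto intro!: L2_add L2_scale)
qed

lemma A_lin: "(u, g) \<in> A \<Longrightarrow> (v, h) \<in> A \<Longrightarrow> (\<lambda>x. u x + c * v x, \<lambda>x. g x + c * h x) \<in> A"
proof -
  assume "(u, g) \<in> A" "(v, h) \<in> A"
  then obtain \<phi> \<psi> where "represents \<phi> u g" "represents \<psi> v h" using mem_imp_represents by blast
  from represents_imp_mem[OF represents_lin[OF this]] show ?thesis .
qed

lemma A_L2: "(u, g) \<in> A \<Longrightarrow> u \<in> L2 M" "(u, g) \<in> A \<Longrightarrow> g \<in> L2 M"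
  by (auto simp: friedrichs_extension_def form_converges_def)

text \<open>Testing a representing sequence against itself exhibits <g, u> as a limit of the real
  nonnegative numbers b (\<phi> n) (\<phi> n).\<close>

lemma A_inner: assumes "(u, g) \<in> A"
  shows "0 \<le> Re (L2_inner M g u)" "Im (L2_inner M g u) = 0"
proof -
  obtain \<phi> where \<phi>: "represents \<phi> u g" using mem_imp_represents[OF assms] by auto
  then have c: "form_converges M S D \<phi> u" by (simp add: represents_def)
  note C = form_converges_Cauchy[OF c]
  have 1: "(\<lambda>n. b (\<phi> n) (\<phi> n) - L2_inner M g (\<phi> n)) \<longlonglongrightarrow> 0" using \<phi> C by (simp add: represents_def)
  have 2: "(\<lambda>n. L2_inner M g (\<phi> n)) \<longlonglongrightarrow> L2_inner M g u"
    using c A_L2[OF assms] form_Cauchy_D[OF C] by (intro inner_tendsto_right) (auto simp: form_converges_def D_L2)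
  have 3: "(\<lambda>n. b (\<phi> n) (\<phi> n)) \<longlonglongrightarrow> L2_inner M g u" using tendsto_add[OF 1 2] by simp
  show "0 \<le> Re (L2_inner M g u)"
    using b_nonneg[OF form_Cauchy_D[OF C]] by (intro tendsto_lowerbound[OF tendsto_Re[OF 3]]) auto
  have "Im (b (\<phi> n) (\<phi> n)) = 0" for n using b_self_real[OF form_Cauchy_D[OF C, of n]] by (metis Im_complex_of_real)
  then show "Im (L2_inner M g u) = 0" using tendsto_Im[OF 3] LIMSEQ_unique[OF tendsto_const[of 0]] by simp
qed

text \<open>Membership sees g only through inner products, which ignore null functions. It is wanted
  because an equation obtained as a limit holds only up to a null function.\<close>

lemma A_cong_right:
  assumes "(u, g) \<in> A" "g' \<in> L2 M" "L2_norm M (\<lambda>x. g x - g' x) = 0"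
  shows "(u, g') \<in> A"
proof -
  have "L2_inner M g \<psi> = L2_inner M g' \<psi>" if "\<psi> \<in> L2 M" for \<psi>
    using L2_Cauchy_Schwarz[OF L2_diff[OF A_L2(2)[OF assms(1)] assms(2)] that] assms that A_L2(2)[OF assms(1)]
    by (simp add: L2_inner_diff_left)
  then have "L2_inner M g v = L2_inner M g' v" if "form_converges M S D \<psi> v" for \<psi> v
    using that by (simp add: form_converges_def)
  then show ?thesis using assms unfolding friedrichs_extension_def by force
qed

text \<open>
  A minimising sequence of \<open>a \<phi> - 2 Re \<langle>f, \<phi>\<rangle>\<close> is form-Cauchy by the parallelogram law, and
  the Euler--Lagrange equation holds along it up to an error that is uniform in the test function.
\<close>
lemma exists_represents:
  assumes f: "f \<in> L2 M"
  shows "\<exists>\<phi> u. represents \<phi> u (\<lambda>x. f x - u x)"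
proof -
  define J where "J \<phi> = a \<phi> - 2 * Re (L2_inner M f \<phi>)" for \<phi>
  define m where "m = Inf (J ` D)"
  have lower: "J \<phi> \<ge> - (L2_norm M f)\<^sup>2" if "\<phi> \<in> D" for \<phi>
  proof -
    have "Re (L2_inner M f \<phi>) \<le> L2_norm M f * L2_norm M \<phi>"
      using L2_Cauchy_Schwarz[OF f D_L2[OF that]] complex_Re_le_cmod order_trans by blast
    moreover have "2 * (L2_norm M f * L2_norm M \<phi>) \<le> (L2_norm M f)\<^sup>2 + (L2_norm M \<phi>)\<^sup>2"
      using sum_squares_bound[of "L2_norm M f" "L2_norm M \<phi>"] by (simp add: mult.assoc)
    ultimately show ?thesis using a_bounds(2)[OF that] unfolding J_def by linarith
  qed
  have bdd: "bdd_below (J ` D)" using lower by (intro bdd_belowI[of _ "- (L2_norm M f)\<^sup>2"]) auto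
  have mle: "m \<le> J \<phi>" if "\<phi> \<in> D" for \<phi>
    unfolding m_def using bdd that by (intro cInf_lower) auto
  have "\<exists>\<phi>\<in>D. J \<phi> < m + inverse (real (Suc n))" for n
    using cInf_lessD[of "J ` D" "m + inverse (real (Suc n))"] D_zero unfolding m_def by auto
  then obtain \<phi> where D: "\<And>n. \<phi> n \<in> D" and near: "\<And>n. J (\<phi> n) < m + inverse (real (Suc n))"
    by metis
  have diff: "a (\<lambda>x. \<phi> i x - \<phi> j x) \<le> 2 * inverse (real (Suc i)) + 2 * inverse (real (Suc j))" for i j
  proof -
    \<comment> \<open>J of the midpoint of two near-minimisers is at least m, a lower bound for the
      norm of their sum; the parallelogram law turns it into an upper bound for their
      difference.\<close>
    have DD: "(\<lambda>x. \<phi> i x + \<phi> j x) \<in> D" by (intro D_add D)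
    have "J (\<lambda>x. (1/2) * (\<phi> i x + \<phi> j x)) = a (\<lambda>x. \<phi> i x + \<phi> j x) / 4 - (Re (L2_inner M f (\<phi> i)) + Re (L2_inner M f (\<phi> j)))"
      unfolding J_def a_scale[OF DD] L2_inner_scale_right L2_inner_add_right[OF D_L2[OF D] D_L2[OF D] f]
      by (simp add: power2_eq_square add_divide_distrib)
    then have "a (\<lambda>x. \<phi> i x + \<phi> j x) / 4 - (Re (L2_inner M f (\<phi> i)) + Re (L2_inner M f (\<phi> j))) \<ge> m"
      using mle[OF D_scale[OF DD, of "1/2"]] by simp
    then show ?thesis using a_parallelogram[OF D D, of i j] near[of i] near[of j]
      unfolding J_def by linarith
  qed
  have FC: "form_Cauchy \<phi>" unfolding form_Cauchy_def
  proof (intro conjI allI impI D)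
    fix e :: real assume "e > 0"
    then obtain N where N: "inverse (real (Suc N)) < e/4" using reals_Archimedean[of "e/4"] by auto
    have "a (\<lambda>x. \<phi> i x - \<phi> j x) < e" if "i \<ge> N" "j \<ge> N" for i j
    proof -
      have "inverse (real (Suc i)) \<le> inverse (real (Suc N))" "inverse (real (Suc j)) \<le> inverse (real (Suc N))"
        using that by (auto intro!: le_imp_inverse_le)
      then show ?thesis using diff[of i j] N by linarith
    qed
    then show "\<exists>N. \<forall>m\<ge>N. \<forall>n\<ge>N. a (\<lambda>x. \<phi> m x - \<phi> n x) < e" by blast
  qed
  obtain u where u: "u \<in> L2 M" "form_converges M S D \<phi> u" using form_Cauchy_converges[OF FC] by auto
  define c where "c n \<eta> = b (\<phi> n) \<eta> + L2_inner M (\<phi> n) \<eta> - L2_inner M f \<eta>" for n \<eta>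
  have EL: "(cmod (c n \<eta>))\<^sup>2 \<le> B * inverse (real (Suc n))" if \<eta>: "\<eta> \<in> D" and B: "a \<eta> \<le> B" "B \<ge> 1" for n \<eta> B
  proof -
    \<comment> \<open>This minimises the quadratic upper bound of J along \<eta>. The divisor is B
      \<ge> 1 and not a \<eta>, which may vanish.\<close>
    define w where "w = - (of_real (1/B) * c n \<eta>)"
    have wD: "(\<lambda>x. w * \<eta> x) \<in> D" by (intro D_scale \<eta>)
    have "J (\<lambda>x. \<phi> n x + w * \<eta> x) = J (\<phi> n) + 2 * Re (cnj w * c n \<eta>) + (cmod w)\<^sup>2 * a \<eta>"
      unfolding J_def a_expand[OF D wD] a_scale[OF \<eta>] b_scale_right L2_inner_add_right[OF D_L2[OF D] D_L2[OF wD] f]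
        L2_inner_scale_right c_def by (simp add: algebra_simps)
    moreover have "cnj w * c n \<eta> = - of_real ((cmod (c n \<eta>))\<^sup>2 / B)"
      unfolding w_def using complex_norm_square[of "c n \<eta>"] by (simp add: mult.commute)
    then have "Re (cnj w * c n \<eta>) = - ((cmod (c n \<eta>))\<^sup>2 / B)"
      by (metis Re_complex_of_real of_real_minus)
    moreover have "(cmod w)\<^sup>2 = (cmod (c n \<eta>))\<^sup>2 / B\<^sup>2"
      using B unfolding w_def by (simp add: norm_mult norm_divide power_divide)
    moreover have "(cmod (c n \<eta>))\<^sup>2 / B\<^sup>2 * a \<eta> \<le> (cmod (c n \<eta>))\<^sup>2 / B"
    proof -
      have "(cmod (c n \<eta>))\<^sup>2 / B\<^sup>2 * a \<eta> \<le> (cmod (c n \<eta>))\<^sup>2 / B\<^sup>2 * B" using B by (intro mult_left_mono) auto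
      then show ?thesis using B by (simp add: power2_eq_square)
    qed
    ultimately have "J (\<lambda>x. \<phi> n x + w * \<eta> x) \<le> J (\<phi> n) + 2 * (- ((cmod (c n \<eta>))\<^sup>2 / B)) + (cmod (c n \<eta>))\<^sup>2 / B"
      by (simp only:)
    then have "(cmod (c n \<eta>))\<^sup>2 / B \<le> inverse (real (Suc n))"
      using mle[OF D_add[OF D wD], of n] near[of n] by linarith
    then show ?thesis using B by (simp add: field_simps)
  qed
  have "(\<lambda>n. b (\<phi> n) (\<psi> n) - L2_inner M (\<lambda>x. f x - u x) (\<psi> n)) \<longlonglongrightarrow> 0" if \<psi>: "form_Cauchy \<psi>" for \<psi>
  proof -
    note P = form_Cauchy_D[OF \<psi>]
    obtain B0 where B0: "\<And>n. a (\<psi> n) \<le> B0" using form_Cauchy_bounded[OF \<psi>] by auto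
    define B where "B = max B0 1"
    have "(\<lambda>n. c n (\<psi> n)) \<longlonglongrightarrow> 0"
    proof (rule Lim_null_comparison)
      show "\<forall>\<^sub>F n in sequentially. norm (c n (\<psi> n)) \<le> sqrt (B * inverse (real (Suc n)))"
        using EL[OF P, of _ B] B0 by (intro always_eventually allI real_le_rsqrt) (auto simp: B_def le_max_iff_disj)
      have "(\<lambda>n. sqrt (B * inverse (real (Suc n)))) \<longlonglongrightarrow> sqrt (B * 0)"
        by (intro tendsto_intros LIMSEQ_inverse_real_of_nat)
      then show "(\<lambda>n. sqrt (B * inverse (real (Suc n)))) \<longlonglongrightarrow> 0" by simp
    qed
    moreover obtain C where C: "\<And>n. L2_norm M (\<psi> n) \<le> C" using form_Cauchy_L2_bounded[OF \<psi>] by auto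
    have "(\<lambda>n. L2_inner M (\<lambda>x. \<phi> n x - u x) (\<psi> n)) \<longlonglongrightarrow> 0"
    proof (rule Lim_null_comparison)
      have "norm (L2_inner M (\<lambda>x. \<phi> n x - u x) (\<psi> n)) \<le> L2_norm M (\<lambda>x. \<phi> n x - u x) * C" for n
        using L2_Cauchy_Schwarz[OF L2_diff[OF D_L2[OF D] u(1)] D_L2[OF P], of n n] C[of n]
        by (meson L2_norm_nonneg mult_left_mono order_trans)
      then show "\<forall>\<^sub>F n in sequentially. norm (L2_inner M (\<lambda>x. \<phi> n x - u x) (\<psi> n)) \<le> L2_norm M (\<lambda>x. \<phi> n x - u x) * C" by simp
      show "(\<lambda>n. L2_norm M (\<lambda>x. \<phi> n x - u x) * C) \<longlonglongrightarrow> 0"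
        using u(2) by (auto simp: form_converges_def intro!: tendsto_eq_intros)
    qed
    ultimately have "(\<lambda>n. c n (\<psi> n)) \<longlonglongrightarrow> 0" "(\<lambda>n. L2_inner M (\<lambda>x. \<phi> n x - u x) (\<psi> n)) \<longlonglongrightarrow> 0" by auto
    then have "(\<lambda>n. c n (\<psi> n) - L2_inner M (\<lambda>x. \<phi> n x - u x) (\<psi> n)) \<longlonglongrightarrow> 0 - 0"
      by (rule tendsto_diff)
    then show ?thesis using P D u f by (simp add: c_def L2_inner_diff_left D_L2 algebra_simps)
  qed
  then show ?thesis using u f unfolding represents_def by (blast intro: L2_diff)
qed

section \<open>From the inverse of A + 1 to the resolvent in the upper half plane\<close>

lemma exists_inverse: "f \<in> L2 M \<Longrightarrow> \<exists>u. (u, \<lambda>x. f x - u x) \<in> A"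
  using exists_represents represents_imp_mem by metis

text \<open>For e = (A + 1)^(-1) d, nonnegativity of A gives |e|^2 \<le> <d, e>; with Cauchy-Schwarz
  this puts the numerical range of the inverse into [0,1].\<close>

lemma inverse_bounds:
  assumes "(e, \<lambda>x. d x - e x) \<in> A" "d \<in> L2 M"
  obtains r where "L2_inner M e d = of_real r" "0 \<le> r" "r \<le> (L2_norm M d)\<^sup>2" "L2_norm M e \<le> L2_norm M d"
proof -
  note e = A_L2(1)[OF assms(1)]
  define r where "r = Re (L2_inner M e d)"
  have 1: "L2_inner M (\<lambda>x. d x - e x) e = L2_inner M d e - of_real ((L2_norm M e)\<^sup>2)"
    using assms e by (simp only: L2_inner_diff_left L2_inner_self)
  have im: "Im (L2_inner M d e) = 0" using A_inner(2)[OF assms(1)] unfolding 1 by simp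
  have re: "Re (L2_inner M d e) \<ge> (L2_norm M e)\<^sup>2" using A_inner(1)[OF assms(1)] unfolding 1 by simp
  have c: "L2_inner M e d = cnj (L2_inner M d e)" by (simp add: L2_inner_cnj)
  have r: "L2_inner M e d = of_real r" unfolding r_def c using im by (simp add: complex_eq_iff)
  have rr: "r \<ge> (L2_norm M e)\<^sup>2" using re unfolding r_def c by simp
  have "r \<le> L2_norm M e * L2_norm M d"
    using L2_Cauchy_Schwarz[OF e assms(2)] complex_Re_le_cmod[of "L2_inner M e d"] unfolding r_def by linarith
  then have "L2_norm M e * L2_norm M e \<le> L2_norm M e * L2_norm M d" using rr by (simp add: power2_eq_square)
  then have le: "L2_norm M e \<le> L2_norm M d"
    using L2_norm_nonneg[of M e] L2_norm_nonneg[of M d] by (cases "L2_norm M e = 0") (auto simp: mult_le_cancel_left)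
  have "r \<le> (L2_norm M d)\<^sup>2"
    using \<open>r \<le> L2_norm M e * L2_norm M d\<close> mult_right_mono[OF le L2_norm_nonneg[of M d]] by (simp add: power2_eq_square)
  moreover have "0 \<le> r" using rr zero_le_power2[of "L2_norm M e"] by linarith
  ultimately show ?thesis using that[OF r] le by blast
qed

text \<open>
  For \<open>r \<in> [0,1]\<close> (the numerical range of the inverse of \<open>A + 1\<close>) the values of
  \<open>\<omega> (1 - (z+1) r)\<close> lie on the segment from \<open>\<omega>\<close> to \<open>- \<omega> z\<close>; the multiplier \<open>\<omega>\<close> rotates
  this segment into the half plane where the real part is at least \<open>1\<close>.
\<close>
lemma contraction_factor:
  assumes z: "Im z > 0"
  obtains w :: complex and q :: real where "0 \<le> q" "q < 1" "w \<noteq> 0"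
    "\<And>e d. (e, \<lambda>x. d x - e x) \<in> A \<Longrightarrow> d \<in> L2 M \<Longrightarrow>
        L2_norm M (\<lambda>x. d x - w * (d x - (z + 1) * e x)) \<le> q * L2_norm M d"
proof -
  \<comment> \<open>The real part 1 settles r = 0. The imaginary part makes Re (- \<omega> z) equal
    to |Re z| + 1 - Re z, at least 1, which settles r = 1.\<close>
  define \<omega> where "\<omega> = Complex 1 ((\<bar>Re z\<bar> + 1) / Im z)"
  define L where "L = 1 + cmod (z + 1)"
  \<comment> \<open>\<open>L\<close> bounds the norm of 1 - (z + 1) R, where R is the inverse of A +
    1. This step length turns 1 - 2 k + k^2 |\<omega>|^2 L^2 into 1 - k.\<close>
  define k where "k = 1 / ((cmod \<omega>)\<^sup>2 * L\<^sup>2)"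
  have w1: "1 \<le> cmod \<omega>" using complex_Re_le_cmod[of \<omega>] by (simp add: \<omega>_def)
  have L1: "1 \<le> L" by (simp add: L_def)
  have "1 \<le> (cmod \<omega>)\<^sup>2 * L\<^sup>2" using w1 L1 by (intro mult_ge1_I) (auto simp: one_le_power)
  then have k: "0 < k" "k \<le> 1" "k * ((cmod \<omega>)\<^sup>2 * L\<^sup>2) = 1" by (auto simp: k_def)
  have rot: "Re (\<omega> * (1 - (z + 1) * of_real r)) \<ge> 1" if "0 \<le> r" "r \<le> 1" for r :: real
  proof -
    have "Re (\<omega> * (1 - (z + 1) * of_real r)) = (1 - r) + r * (- Re z + (\<bar>Re z\<bar> + 1))"
      using z by (simp add: \<omega>_def field_simps)
    moreover have "r * (- Re z + (\<bar>Re z\<bar> + 1)) \<ge> r * 1" using that by (intro mult_left_mono) auto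
    ultimately show ?thesis by linarith
  qed
  show ?thesis
  proof (rule that[of "sqrt (1 - k)" "of_real k * \<omega>"])
    show "0 \<le> sqrt (1 - k)" "sqrt (1 - k) < 1" using k by auto
    show "of_real k * \<omega> \<noteq> 0" using k w1 by auto
    fix e d assume ed: "(e, \<lambda>x. d x - e x) \<in> A" and d: "d \<in> L2 M"
    note e = A_L2(1)[OF ed]
    obtain r where r: "L2_inner M e d = of_real r" "0 \<le> r" "r \<le> (L2_norm M d)\<^sup>2" "L2_norm M e \<le> L2_norm M d"
      using inverse_bounds[OF ed d] .
    define T where "T x = d x - (z + 1) * e x" for x
    have T: "T \<in> L2 M" unfolding T_def by (intro L2_diff L2_scale d e)
    have "L2_norm M T \<le> L2_norm M d + cmod (z + 1) * L2_norm M e"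
      using L2_norm_triangle[OF d L2_scale[OF e, of "- (z + 1)"]] unfolding L2_norm_scale T_def
      by (simp add: norm_minus_commute[of _ z] algebra_simps norm_minus_cancel)
    also have "\<dots> \<le> L2_norm M d + cmod (z + 1) * L2_norm M d" by (intro add_left_mono mult_left_mono r) simp
    finally have Tn: "L2_norm M T \<le> L * L2_norm M d" by (simp add: L_def algebra_simps)
    have Td: "L2_inner M d T = of_real ((L2_norm M d)\<^sup>2) - cnj (z + 1) * of_real r"
      unfolding T_def using d e r L2_inner_cnj[of M e d]
      by (simp add: L2_inner_diff_right L2_scale L2_inner_scale_right L2_inner_self)
    have re: "Re (cnj \<omega> * L2_inner M d T) \<ge> (L2_norm M d)\<^sup>2"
    proof (cases "L2_norm M d = 0")
      case True
      then show ?thesis using r Td by simp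
    next
      case False
      define s where "s = r / (L2_norm M d)\<^sup>2"
      have s: "0 \<le> s" "s \<le> 1" "r = s * (L2_norm M d)\<^sup>2" using r False by (auto simp: s_def divide_le_eq_1)
      have "cnj \<omega> * L2_inner M d T = cnj (\<omega> * (1 - (z + 1) * of_real s)) * of_real ((L2_norm M d)\<^sup>2)"
        unfolding Td s(3) by (simp add: algebra_simps)
      then have "Re (cnj \<omega> * L2_inner M d T) = Re (\<omega> * (1 - (z + 1) * of_real s)) * (L2_norm M d)\<^sup>2"
        by (simp only: Re_complex_of_real Im_complex_of_real times_complex.sel cnj.sel)
      then show ?thesis using mult_right_mono[OF rot[OF s(1,2)], of "(L2_norm M d)\<^sup>2"] by simp
    qed
    have "(L2_norm M (\<lambda>x. d x + (- of_real k * \<omega>) * T x))\<^sup>2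
        = (L2_norm M d)\<^sup>2 + 2 * Re (L2_inner M d (\<lambda>x. (- of_real k * \<omega>) * T x)) + (L2_norm M (\<lambda>x. (- of_real k * \<omega>) * T x))\<^sup>2"
      by (intro norm_expand d L2_scale T)
    also have "\<dots> = (L2_norm M d)\<^sup>2 - 2 * k * Re (cnj \<omega> * L2_inner M d T) + k\<^sup>2 * (cmod \<omega>)\<^sup>2 * (L2_norm M T)\<^sup>2"
      unfolding L2_inner_scale_right L2_norm_scale using k
      by (simp add: norm_mult power_mult_distrib algebra_simps)
    also have "\<dots> \<le> (L2_norm M d)\<^sup>2 - 2 * k * (L2_norm M d)\<^sup>2 + k\<^sup>2 * (cmod \<omega>)\<^sup>2 * (L * L2_norm M d)\<^sup>2"
      using re k Tn by (intro add_mono diff_mono mult_left_mono power_mono) (auto simp: L2_norm_nonneg)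
    also have "\<dots> = (1 - 2 * k + k * (k * ((cmod \<omega>)\<^sup>2 * L\<^sup>2))) * (L2_norm M d)\<^sup>2"
      by (simp add: power2_eq_square algebra_simps)
    also have "\<dots> = (sqrt (1 - k) * L2_norm M d)\<^sup>2"
      unfolding k(3) using k by (simp add: power_mult_distrib)
    finally have "L2_norm M (\<lambda>x. d x + (- of_real k * \<omega>) * T x) \<le> sqrt (1 - k) * L2_norm M d"
      by (rule power2_le_imp_le) (use k in \<open>auto simp: L2_norm_nonneg\<close>)
    then show "L2_norm M (\<lambda>x. d x - of_real k * \<omega> * (d x - (z + 1) * e x)) \<le> sqrt (1 - k) * L2_norm M d"
      by (simp add: T_def)
  qed
qed

lemma geometric_L2_Cauchy:
  assumes u: "\<And>n. u n \<in> L2 M" and q: "0 \<le> q" "q < 1"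
    and step: "\<And>n. L2_norm M (\<lambda>x. u (Suc n) x - u n x) \<le> C * q ^ n"
  shows "\<exists>v\<in>L2 M. (\<lambda>n. L2_norm M (\<lambda>x. u n x - v x)) \<longlonglongrightarrow> 0"
proof (rule L2_complete[OF u])
  fix e :: real assume e: "e > 0"
  have C: "C \<ge> 0" using step[of 0] L2_norm_nonneg[of M "\<lambda>x. u (Suc 0) x - u 0 x"] by simp
  \<comment> \<open>Stated with the exact partial sum of the geometric series so that the induction
    closes.\<close>
  have tail: "L2_norm M (\<lambda>x. u (n + k) x - u n x) \<le> C * (q ^ n - q ^ (n + k)) / (1 - q)" for n k
  proof (induction k)
    case 0 then show ?case by (simp add: L2_norm_def)
  next
    case (Suc k)
    have "L2_norm M (\<lambda>x. u (n + Suc k) x - u n x) \<le> L2_norm M (\<lambda>x. u (Suc (n + k)) x - u (n + k) x) + L2_norm M (\<lambda>x. u (n + k) x - u n x)"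
      using L2_norm_triangle_diff2[OF u[of "Suc (n + k)"] u[of "n + k"] u[of n]] by simp
    also have "\<dots> \<le> C * q ^ (n + k) + C * (q ^ n - q ^ (n + k)) / (1 - q)" by (intro add_mono step Suc.IH)
    also have "\<dots> = C * (q ^ n - q ^ (n + Suc k)) / (1 - q)" using q by (simp add: field_simps)
    finally show ?case .
  qed
  have "(\<lambda>n. C * q ^ n / (1 - q)) \<longlonglongrightarrow> C * 0 / (1 - q)"
    using q by (intro tendsto_intros LIMSEQ_power_zero) auto
  then obtain N where "\<forall>n\<ge>N. norm (C * q ^ n / (1 - q) - 0) < e"
    using LIMSEQ_D[of _ 0 e] e by fastforce
  then have N: "C * q ^ n / (1 - q) < e" if "n \<ge> N" for n
    using that abs_ge_self[of "C * q ^ n / (1 - q)"] by (metis diff_zero order_le_less_trans real_norm_def)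
  have ord: "L2_norm M (\<lambda>x. u m x - u n x) < e" if "N \<le> n" "n \<le> m" for m n
  proof -
    have "L2_norm M (\<lambda>x. u m x - u n x) \<le> C * (q ^ n - q ^ m) / (1 - q)"
      using tail[of n "m - n"] that by simp
    also have "\<dots> \<le> C * q ^ n / (1 - q)" using C q by (intro divide_right_mono mult_left_mono) auto
    also have "\<dots> < e" using N that by simp
    finally show ?thesis .
  qed
  show "\<exists>N. \<forall>m\<ge>N. \<forall>n\<ge>N. L2_norm M (\<lambda>x. u m x - u n x) < e"
  proof (intro exI[of _ N] allI impI)
    fix m n assume "N \<le> m" "N \<le> n"
    then show "L2_norm M (\<lambda>x. u m x - u n x) < e"
      using ord[of n m] ord[of m n] L2_norm_minus_commute[of M "u m" "u n"] by (cases "n \<le> m") auto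
  qed
qed

text \<open>With R the inverse of A + 1, the equation (A - z) u = f becomes u - (z + 1) R u = R f.
  It is solved by a damped iteration, and \<open>contraction_factor\<close> is the contraction
  estimate for one step of it.\<close>

lemma resolvent_exists:
  assumes z: "Im z > 0" and f: "f \<in> L2 M"
  shows "\<exists>u\<in>L2 M. (u, \<lambda>x. f x + z * u x) \<in> A"
proof -
  obtain w q where q: "0 \<le> q" "q < 1" and w: "w \<noteq> 0" and contr:
    "\<And>e d. (e, \<lambda>x. d x - e x) \<in> A \<Longrightarrow> d \<in> L2 M \<Longrightarrow>
        L2_norm M (\<lambda>x. d x - w * (d x - (z + 1) * e x)) \<le> q * L2_norm M d"
    by (rule contraction_factor[OF z], rule that)
  \<comment> \<open>\<open>R\<close> picks one solution for each g and is linear only up to null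
    functions; differences are therefore handled through the graph, in \<open>Rdiff\<close>.\<close>
  define R where "R g = (SOME h. (h, \<lambda>x. g x - h x) \<in> A)" for g
  have R: "(R g, \<lambda>x. g x - R g x) \<in> A" if "g \<in> L2 M" for g
    unfolding R_def by (rule someI_ex[OF exists_inverse[OF that]])
  have RL: "R g \<in> L2 M" if "g \<in> L2 M" for g using A_L2(1)[OF R[OF that]] .
  have Rdiff: "(\<lambda>x. R g x - R h x, \<lambda>x. (g x - h x) - (R g x - R h x)) \<in> A" if "g \<in> L2 M" "h \<in> L2 M" for g h
    proof -
    have "(\<lambda>x. R g x + (-1) * R h x, \<lambda>x. (g x - R g x) + (-1) * (h x - R h x)) \<in> A"
      by (rule A_lin[OF R[OF that(1)] R[OF that(2)]])
    moreover have "(\<lambda>x. (g x - R g x) + (-1) * (h x - R h x)) = (\<lambda>x. (g x - h x) - (R g x - R h x))"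
      by auto
    ultimately show ?thesis by simp
  qed
  define k where "k = R f"
  have k: "k \<in> L2 M" unfolding k_def by (rule RL[OF f])
  define Tm where "Tm g = (\<lambda>x. g x - w * (g x - (z + 1) * R g x - k x))" for g
  define u where "u n = (Tm ^^ n) (\<lambda>x. 0)" for n
  have uS: "u (Suc n) = (\<lambda>x. u n x - w * (u n x - (z + 1) * R (u n) x - k x))" for n
    unfolding u_def by (simp add: Tm_def)
  have uL: "u n \<in> L2 M" for n
  proof (induction n)
    case 0 show ?case by (simp add: u_def L2_zero)
  next
    case (Suc n) then show ?case unfolding uS by (intro L2_diff L2_scale RL k)
  qed
  have step: "L2_norm M (\<lambda>x. u (Suc n) x - u n x) \<le> L2_norm M (\<lambda>x. u 1 x - u 0 x) * q ^ n" for n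
  proof (induction n)
    case 0 then show ?case by simp
  next
    case (Suc n)
    have "L2_norm M (\<lambda>x. u (Suc (Suc n)) x - u (Suc n) x)
       = L2_norm M (\<lambda>x. (u (Suc n) x - u n x) - w * ((u (Suc n) x - u n x) - (z + 1) * (R (u (Suc n)) x - R (u n) x)))"
    proof -
      have "U2 - U1 = (U1 - U0) - w * ((U1 - U0) - (z + 1) * (R1 - R0))"
        if "U1 = U0 - w * (U0 - (z + 1) * R0 - K)" "U2 = U1 - w * (U1 - (z + 1) * R1 - K)"
        for U0 U1 U2 R0 R1 K :: complex
        using that by algebra
      from this[OF fun_cong[OF uS[of n]] fun_cong[OF uS[of "Suc n"]]] show ?thesis
        by (intro arg_cong[where f = "L2_norm M"] ext)
    qed
    also have "\<dots> \<le> q * L2_norm M (\<lambda>x. u (Suc n) x - u n x)"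
      by (rule contr[OF Rdiff[OF uL uL] L2_diff[OF uL uL]])
    also have "\<dots> \<le> q * (L2_norm M (\<lambda>x. u 1 x - u 0 x) * q ^ n)" by (intro mult_left_mono Suc.IH q)
    finally show ?case by (simp add: algebra_simps)
  qed
  obtain v where v: "v \<in> L2 M" and lim: "(\<lambda>n. L2_norm M (\<lambda>x. u n x - v x)) \<longlonglongrightarrow> 0"
    using geometric_L2_Cauchy[OF uL q step] by auto
  define h where "h = R v"
  have h: "h \<in> L2 M" unfolding h_def by (rule RL[OF v])
  \<comment> \<open>As a combination of values of \<open>R\<close>, v' comes with a known value of
    A; it remains to see that it differs from the limit v by a null function.\<close>
  define v' where "v' = (\<lambda>x. k x + (z + 1) * h x)"
  have v': "v' \<in> L2 M" unfolding v'_def by (intro L2_add L2_scale k h)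
  have zero: "L2_norm M (\<lambda>x. v x - v' x) = 0"
  proof -
    have RR: "L2_norm M (\<lambda>x. R (u n) x - h x) \<le> L2_norm M (\<lambda>x. u n x - v x)" for n
      using inverse_bounds[OF Rdiff[OF uL v] L2_diff[OF uL v]] unfolding h_def by metis
    have bound: "cmod w * L2_norm M (\<lambda>x. v x - v' x) \<le>
       L2_norm M (\<lambda>x. u (Suc n) x - u n x) + cmod w * (1 + cmod (z + 1)) * L2_norm M (\<lambda>x. u n x - v x)" for n
    proof -
      have 1: "(\<lambda>x. w * (v x - v' x)) = (\<lambda>x. ((-1) * (u (Suc n) x - u n x)) + (w * ((v x - u n x) + (z + 1) * (R (u n) x - h x))))"
        unfolding uS v'_def by (auto simp: algebra_simps)
      have "cmod w * L2_norm M (\<lambda>x. v x - v' x) = L2_norm M (\<lambda>x. w * (v x - v' x))" by (simp only: L2_norm_scale)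
      also have "\<dots> \<le> L2_norm M (\<lambda>x. (-1) * (u (Suc n) x - u n x)) + L2_norm M (\<lambda>x. w * ((v x - u n x) + (z + 1) * (R (u n) x - h x)))"
        unfolding 1 by (intro L2_norm_triangle L2_scale L2_add L2_diff uL v RL h)
      also have "L2_norm M (\<lambda>x. (-1) * (u (Suc n) x - u n x)) = L2_norm M (\<lambda>x. u (Suc n) x - u n x)"
        by (simp only: L2_norm_scale) simp
      also have "L2_norm M (\<lambda>x. w * ((v x - u n x) + (z + 1) * (R (u n) x - h x)))
         \<le> cmod w * (L2_norm M (\<lambda>x. v x - u n x) + L2_norm M (\<lambda>x. (z + 1) * (R (u n) x - h x)))"
        unfolding L2_norm_scale[of M w] by (intro mult_left_mono L2_norm_triangle L2_scale L2_diff uL v RL h) simp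
      also have "\<dots> \<le> cmod w * (L2_norm M (\<lambda>x. u n x - v x) + cmod (z + 1) * L2_norm M (\<lambda>x. u n x - v x))"
        unfolding L2_norm_scale[of M "z + 1"] L2_norm_minus_commute[of M v]
        by (intro mult_left_mono add_left_mono RR) auto
      finally show ?thesis by (simp add: algebra_simps)
    qed
    have "(\<lambda>n. L2_norm M (\<lambda>x. u 1 x - u 0 x) * q ^ n + cmod w * (1 + cmod (z + 1)) * L2_norm M (\<lambda>x. u n x - v x))
       \<longlonglongrightarrow> L2_norm M (\<lambda>x. u 1 x - u 0 x) * 0 + cmod w * (1 + cmod (z + 1)) * 0"
      using q by (intro tendsto_intros lim LIMSEQ_power_zero) auto
    then have "cmod w * L2_norm M (\<lambda>x. v x - v' x) \<le> L2_norm M (\<lambda>x. u 1 x - u 0 x) * 0 + cmod w * (1 + cmod (z + 1)) * 0"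
    proof (rule LIMSEQ_le_const, intro exI[of _ 0] allI impI)
      fix n
      show "cmod w * L2_norm M (\<lambda>x. v x - v' x) \<le> L2_norm M (\<lambda>x. u 1 x - u 0 x) * q ^ n
          + cmod w * (1 + cmod (z + 1)) * L2_norm M (\<lambda>x. u n x - v x)"
        using bound[of n] step[of n] by linarith
    qed
    then show ?thesis using w L2_norm_nonneg[of M "\<lambda>x. v x - v' x"] by (simp add: mult_le_0_iff)
  qed
  have mem: "(v', \<lambda>x. (f x - k x) + (z + 1) * (v x - h x)) \<in> A"
    using A_lin[OF R[OF f] R[OF v], of "z + 1"] unfolding v'_def k_def h_def .
  have "(\<lambda>x. (f x - k x) + (z + 1) * (v x - h x) - (f x + z * v' x)) = (\<lambda>x. (z + 1) * (v x - v' x))"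
    unfolding v'_def by (auto simp: algebra_simps)
  then have "L2_norm M (\<lambda>x. (f x - k x) + (z + 1) * (v x - h x) - (f x + z * v' x)) = 0"
    using zero by (simp only: L2_norm_scale)
  then have "(v', \<lambda>x. f x + z * v' x) \<in> A"
    by (intro A_cong_right[OF mem]) (intro L2_add L2_scale f v')
  then show ?thesis using v' by blast
qed

text \<open>The imaginary part of the equation tested with u, where <A u, u> is real.\<close>

lemma resolvent_energy:
  assumes "f \<in> L2 M" "(u, \<lambda>x. f x + z * u x) \<in> A"
  shows "Im z * (L2_norm M u)\<^sup>2 = - Im (L2_inner M f u)"
proof -
  note u = A_L2(1)[OF assms(2)]
  have "L2_inner M (\<lambda>x. f x + z * u x) u = L2_inner M f u + z * of_real ((L2_norm M u)\<^sup>2)"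
    using assms u by (simp only: L2_inner_add_left L2_scale L2_inner_scale_left L2_inner_self)
  then show ?thesis using A_inner(2)[OF assms(2)] by simp
qed

theorem upper_half_plane_resolvent:
  assumes z: "Im z > 0" shows "z \<in> resolvent_set M A"
proof -
  have "L2_norm M u \<le> inverse (Im z) * L2_norm M f"
    if "f \<in> L2 M" "u \<in> L2 M" "(u, \<lambda>x. f x + z * u x) \<in> A" for f u
  proof -
    have "Im z * (L2_norm M u)\<^sup>2 \<le> L2_norm M f * L2_norm M u"
      using resolvent_energy[OF that(1,3)] L2_Cauchy_Schwarz[OF that(1,2)] abs_Im_le_cmod[of "L2_inner M f u"]
      by linarith
    then have "(Im z * L2_norm M u) * L2_norm M u \<le> L2_norm M f * L2_norm M u" by (simp add: power2_eq_square)
    then have "Im z * L2_norm M u \<le> L2_norm M f \<or> L2_norm M u = 0"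
      using L2_norm_nonneg[of M u] by (auto simp: mult_le_cancel_right)
    then show ?thesis
    proof
      assume "L2_norm M u = 0" then show ?thesis using z L2_norm_nonneg[of M f] by simp
    qed (use z in \<open>simp add: field_simps\<close>)
  qed
  then show ?thesis using resolvent_exists[OF z] unfolding resolvent_set_def by blast
qed

end

section \<open>Smooth functions\<close>

text \<open>A local version of \<open>Ck\<close>: powers are smooth only on half-lines, and the
  profile is later glued over an open cover.\<close>

primrec Ck_on :: "nat \<Rightarrow> 'a::euclidean_space set \<Rightarrow> ('a \<Rightarrow> 'b::real_normed_vector) \<Rightarrow> bool" where
  "Ck_on 0 U f \<longleftrightarrow> continuous_on U f"
| "Ck_on (Suc k) U f \<longleftrightarrow>
     (\<forall>x\<in>U. f differentiable (at x)) \<and> (\<forall>v. Ck_on k U (\<lambda>x. frechet_derivative f (at x) v))"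

lemma Ck_iff_Ck_on: "Ck k f \<longleftrightarrow> Ck_on k UNIV f"
  by (induction k arbitrary: f) (simp_all add: differentiable_on_def)

lemma Ck_on_cong:
  assumes "open U" "\<And>x. x \<in> U \<Longrightarrow> f x = g x" "Ck_on k U f"
  shows "Ck_on k U g"
  using assms(2,3)
proof (induction k arbitrary: f g)
  case 0
  then show ?case using continuous_on_cong[of U U f g] by simp
next
  case (Suc k)
  have d: "(g has_derivative frechet_derivative f (at x)) (at x)" if "x \<in> U" for x
    using Suc.prems that assms(1)
    by (intro has_derivative_transform_within_open[of f _ x UNIV U g])
       (auto simp: frechet_derivative_works[symmetric])
  have "Ck_on k U (\<lambda>x. frechet_derivative g (at x) v)" for v
  proof (rule Suc.IH)
    show "frechet_derivative f (at x) v = frechet_derivative g (at x) v" if "x \<in> U" for x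
      using frechet_derivative_at[OF d[OF that]] by simp
  qed (use Suc.prems(2) in simp)
  then show ?case using d by (auto intro: differentiableI)
qed

lemma Ck_on_SucI:
  assumes "open U" "\<And>x. x \<in> U \<Longrightarrow> (f has_derivative f' x) (at x)" "\<And>v. Ck_on k U (\<lambda>x. f' x v)"
  shows "Ck_on (Suc k) U f"
proof -
  have "Ck_on k U (\<lambda>x. frechet_derivative f (at x) v)" for v
  proof (rule Ck_on_cong[OF assms(1) _ assms(3)[of v]])
    show "f' x v = frechet_derivative f (at x) v" if "x \<in> U" for x
      using frechet_derivative_at[OF assms(2)[OF that]] by simp
  qed
  then show ?thesis using assms(2) by (auto intro: differentiableI)
qed

lemma Ck_on_deriv:
  "Ck_on (Suc k) U f \<Longrightarrow> x \<in> U \<Longrightarrow> (f has_derivative frechet_derivative f (at x)) (at x)"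
  by (auto simp: frechet_derivative_works[symmetric])

lemma Ck_on_continuous: "Ck_on k U f \<Longrightarrow> continuous_on U f"
  by (cases k)
     (auto intro!: continuous_at_imp_continuous_on differentiable_imp_continuous_within)

lemma Ck_on_SucD: "Ck_on (Suc k) U f \<Longrightarrow> Ck_on k U f"
proof (induction k arbitrary: f)
  case 0
  then show ?case using Ck_on_continuous by (metis Ck_on.simps(1))
next
  case (Suc k)
  then show ?case by (subst Ck_on.simps) (metis Ck_on.simps(2))
qed

lemma Ck_on_const [intro, simp]: "Ck_on k U (\<lambda>x. c)"
  by (induction k arbitrary: c) (auto simp: frechet_derivative_const)

lemma Ck_on_linear:
  assumes "bounded_linear f" shows "Ck_on k U f"
proof (cases k)
  case 0
  then show ?thesis using assms by (simp add: linear_continuous_on)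
next
  case (Suc j)
  have "frechet_derivative f (at x) = f" for x
    using frechet_derivative_at[OF bounded_linear_imp_has_derivative[OF assms]] by metis
  then show ?thesis using assms Suc by (auto intro: bounded_linear_imp_differentiable)
qed

lemma Ck_on_add:
  assumes "open U" "Ck_on k U f" "Ck_on k U g" shows "Ck_on k U (\<lambda>x. f x + g x)"
  using assms(2,3)
proof (induction k arbitrary: f g)
  case 0 then show ?case by (auto intro: continuous_intros)
next
  case (Suc k)
  show ?case
  proof (rule Ck_on_SucI[OF assms(1)])
    show "((\<lambda>x. f x + g x) has_derivative (\<lambda>v. frechet_derivative f (at x) v + frechet_derivative g (at x) v)) (at x)" if "x \<in> U" for x
      using Suc.prems that by (intro has_derivative_add Ck_on_deriv)
    show "Ck_on k U (\<lambda>x. frechet_derivative f (at x) v + frechet_derivative g (at x) v)" for v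
      using Suc.prems by (intro Suc.IH) auto
  qed
qed

lemma Ck_on_sum:
  assumes "open U" "\<And>i. i \<in> I \<Longrightarrow> Ck_on k U (f i)" shows "Ck_on k U (\<lambda>x. \<Sum>i\<in>I. f i x)"
  using assms(2) by (induction I rule: infinite_finite_induct) (auto intro!: Ck_on_add[OF assms(1)])

lemma (in bounded_bilinear) Ck_on_bilinear:
  assumes "open U" "Ck_on k U f" "Ck_on k U g" shows "Ck_on k U (\<lambda>x. prod (f x) (g x))"
  using assms(2,3)
proof (induction k arbitrary: f g)
  case 0 then show ?case by (auto intro: continuous_on)
next
  case (Suc k)
  show ?case
  proof (rule Ck_on_SucI[OF assms(1)])
    show "((\<lambda>x. prod (f x) (g x)) has_derivative (\<lambda>v. prod (f x) (frechet_derivative g (at x) v) + prod (frechet_derivative f (at x) v) (g x))) (at x)" if "x \<in> U" for x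
      using Suc.prems that by (intro FDERIV Ck_on_deriv)
    show "Ck_on k U (\<lambda>x. prod (f x) (frechet_derivative g (at x) v) + prod (frechet_derivative f (at x) v) (g x))" for v
      using Suc.prems Ck_on_SucD[OF Suc.prems(1)] Ck_on_SucD[OF Suc.prems(2)]
      by (intro Ck_on_add[OF assms(1)] Suc.IH) auto
  qed
qed

lemmas Ck_on_mult = bounded_bilinear.Ck_on_bilinear[OF bounded_bilinear_mult]
lemmas Ck_on_scaleR = bounded_bilinear.Ck_on_bilinear[OF bounded_bilinear_scaleR]

lemma Ck_on_comp_linear:
  assumes "open U" "bounded_linear L" "Ck_on k U f" shows "Ck_on k U (\<lambda>x. L (f x))"
  using assms(3)
proof (induction k arbitrary: f)
  case 0 then show ?case using assms(2) by (simp add: bounded_linear.continuous_on)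
next
  case (Suc k)
  show ?case
  proof (rule Ck_on_SucI[OF assms(1)])
    show "((\<lambda>x. L (f x)) has_derivative (\<lambda>v. L (frechet_derivative f (at x) v))) (at x)" if "x \<in> U" for x
      using that by (rule bounded_linear.has_derivative[OF assms(2) Ck_on_deriv[OF Suc.prems]])
    show "Ck_on k U (\<lambda>x. L (frechet_derivative f (at x) v))" for v
      using Suc.prems by (intro Suc.IH) auto
  qed
qed

lemma Ck_on_minus: "open U \<Longrightarrow> Ck_on k U f \<Longrightarrow> Ck_on k U (\<lambda>x. - f x)"
  by (rule Ck_on_comp_linear[OF _ bounded_linear_minus[OF bounded_linear_ident]])

lemma Ck_on_diff: "open U \<Longrightarrow> Ck_on k U f \<Longrightarrow> Ck_on k U g \<Longrightarrow> Ck_on k U (\<lambda>x. f x - g x)"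
  using Ck_on_add[OF _ _ Ck_on_minus] by fastforce

text \<open>The derivative f'(g x)(g' x v) does not have the form "fixed function of g x", so the
  induction hypothesis does not apply to it. Expanding over the basis leaves the functions f'(g x) b
  with b fixed, to which it does.\<close>

lemma Ck_on_compose:
  fixes f :: "'b::euclidean_space \<Rightarrow> 'c::real_normed_vector" and g :: "'a::euclidean_space \<Rightarrow> 'b"
  assumes "open U" "open V" "Ck_on k V f" "Ck_on k U g" "g ` U \<subseteq> V"
  shows "Ck_on k U (\<lambda>x. f (g x))"
  using assms(3,4)
proof (induction k arbitrary: f)
  case 0 then show ?case using continuous_on_compose2[of V f U g] assms(5) by simp
next
  case (Suc k)
  define f' where "f' x b = frechet_derivative f (at x) b" for x b
  define g' where "g' x b = frechet_derivative g (at x) b" for x b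
  show ?case
  proof (rule Ck_on_SucI[OF assms(1)])
    fix x assume x: "x \<in> U"
    have df: "(f has_derivative f' (g x)) (at (g x))"
      using Suc.prems(1) x assms(5) unfolding f'_def[abs_def] by (intro Ck_on_deriv) auto
    have dg: "(g has_derivative g' x) (at x)"
      using Suc.prems(2) x unfolding g'_def[abs_def] by (intro Ck_on_deriv) auto
    have lin: "linear (f' (g x))" using df has_derivative_linear by blast
    have eq: "f' (g x) w = (\<Sum>b\<in>Basis. (w \<bullet> b) *\<^sub>R f' (g x) b)" for w
    proof -
      have "f' (g x) w = f' (g x) (\<Sum>b\<in>Basis. (w \<bullet> b) *\<^sub>R b)" by (simp add: euclidean_representation)
      also have "\<dots> = (\<Sum>b\<in>Basis. (w \<bullet> b) *\<^sub>R f' (g x) b)"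
        by (simp add: linear_sum[OF lin] linear_scale[OF lin])
      finally show ?thesis .
    qed
    have "((\<lambda>x. f (g x)) has_derivative (\<lambda>v. f' (g x) (g' x v))) (at x)"
      using has_derivative_compose[OF dg df] .
    then show "((\<lambda>x. f (g x)) has_derivative (\<lambda>v. \<Sum>b\<in>Basis. (g' x v \<bullet> b) *\<^sub>R f' (g x) b)) (at x)"
      by (rule has_derivative_eq_rhs) (rule ext, rule eq)
  next
    fix v
    have "Ck_on k U (\<lambda>x. f' (g x) b)" for b
      using Suc.prems Ck_on_SucD[OF Suc.prems(2)] unfolding f'_def by (intro Suc.IH) auto
    moreover have "Ck_on k U (\<lambda>x. g' x v \<bullet> b)" for b
      using Suc.prems(2) unfolding g'_def
      by (intro Ck_on_comp_linear[OF assms(1) bounded_linear_inner_left]) auto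
    ultimately show "Ck_on k U (\<lambda>x. \<Sum>b\<in>Basis. (g' x v \<bullet> b) *\<^sub>R f' (g x) b)"
      by (intro Ck_on_sum Ck_on_scaleR assms(1))
  qed
qed

lemma Ck_on_Un:
  assumes "open U" "open V" "Ck_on k U f" "Ck_on k V f" shows "Ck_on k (U \<union> V) f"
  using assms(3,4)
proof (induction k arbitrary: f)
  case 0
  then show ?case using continuous_on_open_Un[OF assms(1,2), of f] by simp
next
  case (Suc k)
  then show ?case by (simp, blast)
qed

lemma Ck_on_subset: "Ck_on k V f \<Longrightarrow> U \<subseteq> V \<Longrightarrow> Ck_on k U f"
  by (induction k arbitrary: f) (auto intro: continuous_on_subset)

lemma Ck_on_SucI_real:
  fixes f :: "real \<Rightarrow> real"
  assumes "open U" "\<And>x. x \<in> U \<Longrightarrow> (f has_real_derivative f' x) (at x)" "Ck_on k U f'"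
  shows "Ck_on (Suc k) U f"
proof (rule Ck_on_SucI[OF assms(1)])
  show "(f has_derivative (\<lambda>v. f' x * v)) (at x)" if "x \<in> U" for x
    using assms(2)[OF that] by (simp add: has_field_derivative_def)
  show "Ck_on k U (\<lambda>x. f' x * v)" for v by (intro Ck_on_mult assms Ck_on_const)
qed

section \<open>Infinitely differentiable functions on open sets\<close>

definition smooth_on :: "'a::euclidean_space set \<Rightarrow> ('a \<Rightarrow> 'b::real_normed_vector) \<Rightarrow> bool" where
  "smooth_on U f \<longleftrightarrow> open U \<and> (\<forall>k. Ck_on k U f)"

abbreviation smooth :: "('a::euclidean_space \<Rightarrow> 'b::real_normed_vector) \<Rightarrow> bool" where
  "smooth \<equiv> smooth_on UNIV"

lemma smooth_iff_Ck: "smooth f \<longleftrightarrow> (\<forall>k. Ck k f)"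
  by (simp add: smooth_on_def Ck_iff_Ck_on)

lemma smooth_on_const: "open U \<Longrightarrow> smooth_on U (\<lambda>x. c)"
  by (simp add: smooth_on_def)

lemma smooth_on_linear: "open U \<Longrightarrow> bounded_linear f \<Longrightarrow> smooth_on U f"
  by (simp add: smooth_on_def Ck_on_linear)

lemma smooth_on_add: "smooth_on U f \<Longrightarrow> smooth_on U g \<Longrightarrow> smooth_on U (\<lambda>x. f x + g x)"
  by (simp add: smooth_on_def Ck_on_add)

lemma smooth_on_diff: "smooth_on U f \<Longrightarrow> smooth_on U g \<Longrightarrow> smooth_on U (\<lambda>x. f x - g x)"
  by (simp add: smooth_on_def Ck_on_diff)

lemma smooth_on_minus: "smooth_on U f \<Longrightarrow> smooth_on U (\<lambda>x. - f x)"
  by (simp add: smooth_on_def Ck_on_minus)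

lemma smooth_on_mult: "smooth_on U f \<Longrightarrow> smooth_on U g \<Longrightarrow> smooth_on U (\<lambda>x. f x * g x)"
  for f g :: "'a::euclidean_space \<Rightarrow> 'b::real_normed_algebra"
  by (simp add: smooth_on_def Ck_on_mult)

lemma smooth_on_scaleR: "smooth_on U f \<Longrightarrow> smooth_on U g \<Longrightarrow> smooth_on U (\<lambda>x. f x *\<^sub>R g x)"
  by (simp add: smooth_on_def Ck_on_scaleR)

lemma smooth_on_comp_linear: "bounded_linear L \<Longrightarrow> smooth_on U f \<Longrightarrow> smooth_on U (\<lambda>x. L (f x))"
  by (simp add: smooth_on_def Ck_on_comp_linear)

lemma smooth_on_of_real: "smooth_on U f \<Longrightarrow> smooth_on U (\<lambda>x. complex_of_real (f x))"
  by (rule smooth_on_comp_linear[OF bounded_linear_of_real])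

lemma smooth_on_compose:
  "smooth_on V f \<Longrightarrow> smooth_on U g \<Longrightarrow> g ` U \<subseteq> V \<Longrightarrow> smooth_on U (\<lambda>x. f (g x))"
  for f :: "'b::euclidean_space \<Rightarrow> 'c::real_normed_vector" and g :: "'a::euclidean_space \<Rightarrow> 'b"
  by (auto simp: smooth_on_def intro: Ck_on_compose)

lemma smooth_on_Un: "smooth_on U f \<Longrightarrow> smooth_on V f \<Longrightarrow> smooth_on (U \<union> V) f"
  by (auto simp: smooth_on_def intro: Ck_on_Un)

lemma smooth_on_cong: "smooth_on U f \<Longrightarrow> (\<And>x. x \<in> U \<Longrightarrow> f x = g x) \<Longrightarrow> smooth_on U g"
  using Ck_on_cong unfolding smooth_on_def by metis

lemma smooth_on_subset: "smooth_on V f \<Longrightarrow> open U \<Longrightarrow> U \<subseteq> V \<Longrightarrow> smooth_on U f"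
  using Ck_on_subset unfolding smooth_on_def by metis

lemma smooth_on_frechet: "smooth_on U f \<Longrightarrow> smooth_on U (\<lambda>x. frechet_derivative f (at x) v)"
  unfolding smooth_on_def by (metis Ck_on.simps(2))

lemma smooth_has_derivative: "smooth f \<Longrightarrow> (f has_derivative frechet_derivative f (at x)) (at x)"
  unfolding smooth_on_def by (meson Ck_on_deriv UNIV_I)

lemma smooth_continuous: "smooth_on U f \<Longrightarrow> continuous_on U f"
  unfolding smooth_on_def by (meson Ck_on_continuous)

lemma smooth_on_real_deriv:
  fixes f :: "real \<Rightarrow> real"
  assumes "smooth_on U f" "\<And>x. x \<in> U \<Longrightarrow> (f has_real_derivative f' x) (at x)"
  shows "smooth_on U f'"
proof (rule smooth_on_cong[OF smooth_on_frechet[OF assms(1), of 1]])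
  fix x assume "x \<in> U"
  then have "(f has_derivative (\<lambda>v. f' x * v)) (at x)"
    using assms(2) by (simp add: has_field_derivative_def)
  then show "frechet_derivative f (at x) 1 = f' x"
    using fun_cong[OF frechet_derivative_at, of f "(*) (f' x)" x 1] by simp
qed

lemma smooth_has_real_derivative:
  fixes f :: "real \<Rightarrow> real"
  assumes "smooth f" shows "(f has_real_derivative deriv f x) (at x)"
proof -
  have "f differentiable (at x)" using smooth_has_derivative[OF assms] by (rule differentiableI)
  then show ?thesis
    by (metis DERIV_deriv_iff_real_differentiable)
qed

lemma smooth_deriv: "smooth f \<Longrightarrow> smooth (deriv f)" for f :: "real \<Rightarrow> real"
  by (rule smooth_on_real_deriv) (auto intro: smooth_has_real_derivative)

text \<open>If the derivatives of all members are combinations of members, all members gain one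
  derivative at a time, simultaneously. Applied to the powers of x and to the functions
  \<open>flat\<close>.\<close>

lemma smooth_on_familyI:
  fixes F :: "'i \<Rightarrow> real \<Rightarrow> real"
  assumes "open U" "\<And>i x. x \<in> U \<Longrightarrow> (F i has_real_derivative (c i * F (s i) x + d i * F (r i) x)) (at x)"
  shows "smooth_on U (F i)"
  unfolding smooth_on_def
proof (intro conjI allI assms(1))
  show "Ck_on k U (F i)" for k
  proof (induction k arbitrary: i)
    case 0
    show ?case using assms(2)[THEN DERIV_isCont] by (auto intro!: continuous_at_imp_continuous_on)
  next
    case (Suc k)
    show ?case
      by (rule Ck_on_SucI_real[OF assms(1) assms(2)]) (auto intro!: Ck_on_add Ck_on_mult Suc.IH assms(1))
  qed
qed

lemma smooth_on_powr: "smooth_on {0<..} (\<lambda>x::real. x powr a)"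
proof -
  have "smooth_on {0<..} ((\<lambda>a x::real. x powr a) a)"
  proof (rule smooth_on_familyI[where c = "\<lambda>a. a" and s = "\<lambda>a. a - 1" and d = "\<lambda>_. 0" and r = "\<lambda>a. a"])
    show "((\<lambda>x::real. x powr a) has_real_derivative a * x powr (a - 1) + 0 * x powr a) (at x)" if "x \<in> {0<..}" for a x
      using has_real_derivative_powr[of x a] that by simp
  qed simp
  then show ?thesis .
qed

lemma smooth_on_inverse:
  fixes f :: "'a::euclidean_space \<Rightarrow> real"
  assumes "smooth_on U f" "\<And>x. x \<in> U \<Longrightarrow> f x > 0"
  shows "smooth_on U (\<lambda>x. inverse (f x))"
proof -
  have "smooth_on U (\<lambda>x. f x powr (-1))"
    using assms by (intro smooth_on_compose[OF smooth_on_powr]) auto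
  then show ?thesis by (rule smooth_on_cong) (simp add: assms powr_minus less_imp_le)
qed

text \<open>The derivatives of \<open>exp (- 1 / x)\<close> are combinations of the functions below.\<close>
definition flat :: "nat \<Rightarrow> real \<Rightarrow> real" where
  "flat m x = (if x > 0 then (1 / x) ^ m * exp (- (1 / x)) else 0)"

text \<open>This is the difference quotient of \<open>flat m\<close> at 0; exp (- 1 / x) beats every
  power of 1 / x.\<close>

lemma flat_over_tendsto: "((\<lambda>x. flat m x / x) \<longlongrightarrow> 0) (at 0)"
proof -
  have "((\<lambda>y::real. y ^ Suc m / exp y) \<longlongrightarrow> 0) at_top" by (rule tendsto_power_div_exp_0)
  then have "((\<lambda>x::real. inverse x ^ Suc m / exp (inverse x)) \<longlongrightarrow> 0) (at_right 0)"
    by (rule filterlim_compose[OF _ filterlim_inverse_at_top_right])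
  then have R: "((\<lambda>x. flat m x / x) \<longlongrightarrow> 0) (at_right 0)"
  proof (rule Lim_transform_eventually)
    show "\<forall>\<^sub>F x in at_right 0. inverse x ^ Suc m / exp (inverse x) = flat m x / x"
      unfolding eventually_at_right_field
      by (intro exI[of _ 1]) (auto simp: flat_def exp_minus field_simps)
  qed
  have L: "((\<lambda>x. flat m x / x) \<longlongrightarrow> 0) (at_left 0)"
  proof (rule Lim_transform_eventually[OF tendsto_const])
    show "\<forall>\<^sub>F x in at_left 0. 0 = flat m x / x"
      unfolding eventually_at_left_field by (intro exI[of _ "-1"]) (auto simp: flat_def)
  qed
  show ?thesis using L R by (simp add: filterlim_split_at)
qed

lemma flat_deriv: "(flat m has_real_derivative - real m * flat (Suc m) x + 1 * flat (Suc (Suc m)) x) (at x)"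
proof -
  consider "x > 0" | "x < 0" | "x = 0" by linarith
  then show ?thesis
  proof cases
    case 1
    have i: "((\<lambda>x. 1 / x) has_real_derivative - ((1 / x) * (1 / x))) (at x)"
      using 1 by (auto intro!: derivative_eq_intros simp: field_simps)
    have "((\<lambda>x. (1 / x) ^ m * exp (- (1 / x))) has_real_derivative
        real m * (- ((1 / x) * (1 / x)) * (1 / x) ^ (m - Suc 0)) * exp (- (1 / x))
        + exp (- (1 / x)) * (- (- ((1 / x) * (1 / x)))) * (1 / x) ^ m) (at x)"
      by (intro DERIV_mult DERIV_power DERIV_fun_exp DERIV_minus i)
    also have "real m * (- ((1 / x) * (1 / x)) * (1 / x) ^ (m - Suc 0)) * exp (- (1 / x))
        + exp (- (1 / x)) * (- (- ((1 / x) * (1 / x)))) * (1 / x) ^ m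
        = - real m * flat (Suc m) x + 1 * flat (Suc (Suc m)) x"
      using 1 by (cases m) (simp_all add: flat_def diff_divide_distrib add_divide_distrib algebra_simps)
    finally have "((\<lambda>x. (1 / x) ^ m * exp (- (1 / x))) has_real_derivative - real m * flat (Suc m) x + 1 * flat (Suc (Suc m)) x) (at x)" .
    then show ?thesis
      by (rule has_field_derivative_transform_within_open[of _ _ _ "{0<..}"]) (use 1 in \<open>auto simp: flat_def\<close>)
  next
    case 2
    have "((\<lambda>x. 0) has_real_derivative - real m * flat (Suc m) x + 1 * flat (Suc (Suc m)) x) (at x)"
      using 2 by (simp add: flat_def)
    then show ?thesis
      by (rule has_field_derivative_transform_within_open[of _ _ _ "{..<0}"]) (use 2 in \<open>auto simp: flat_def\<close>)
  next
    case 3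
    have "(\<lambda>h. (flat m (0 + h) - flat m 0) / h) \<midarrow>0\<rightarrow> 0"
      using flat_over_tendsto[of m] by (simp add: flat_def)
    then show ?thesis using 3 by (simp add: DERIV_def flat_def)
  qed
qed

lemma smooth_flat: "smooth (flat m)"
  using smooth_on_familyI[where F = flat and U = UNIV and c = "\<lambda>m. - real m" and s = Suc and d = "\<lambda>_. 1" and r = "\<lambda>m. Suc (Suc m)"]
    flat_deriv by (simp add: fun_eq_iff)

text \<open>A smooth monotone transition from 0 on x \<le> 0 to 1 on x \<ge> 1; all cut-offs below
  are built from it.\<close>

definition step :: "real \<Rightarrow> real" where
  "step x = flat 0 x / (flat 0 x + flat 0 (1 - x))"

lemma flat_nonneg: "0 \<le> flat m x" by (simp add: flat_def)

lemma step_denom: "0 < flat 0 x + flat 0 (1 - x)"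
  by (cases "x > 0") (auto simp: flat_def intro: add_pos_nonneg)

lemma smooth_on_ident: "open U \<Longrightarrow> smooth_on U (\<lambda>x. x)"
  by (rule smooth_on_linear) (auto intro: bounded_linear_ident)

lemma smooth_step: "smooth step"
proof -
  have 1: "smooth (\<lambda>x. flat 0 (1 - x))"
    by (rule smooth_on_compose[OF smooth_flat]) (auto intro!: smooth_on_diff smooth_on_const smooth_on_ident)
  have "smooth (\<lambda>x. flat 0 x * inverse (flat 0 x + flat 0 (1 - x)))"
    by (intro smooth_on_mult smooth_on_inverse smooth_on_add smooth_flat 1 step_denom)
  then show ?thesis by (simp add: step_def[abs_def] divide_inverse)
qed

lemma step_bounds: "0 \<le> step x" "step x \<le> 1"
  using step_denom[of x] flat_nonneg[of 0 x] flat_nonneg[of 0 "1 - x"] by (auto simp: step_def)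

lemma step_0: "x \<le> 0 \<Longrightarrow> step x = 0"
  by (simp add: step_def flat_def)

lemma step_1: "x \<ge> 1 \<Longrightarrow> step x = 1"
  by (simp add: step_def flat_def)

lemma flat0_mono: "x \<le> y \<Longrightarrow> flat 0 x \<le> flat 0 y"
  by (auto simp: flat_def intro!: divide_left_mono)

lemma step_mono: "x \<le> y \<Longrightarrow> step x \<le> step y"
proof -
  assume "x \<le> y"
  then have 1: "flat 0 x \<le> flat 0 y" "flat 0 (1 - y) \<le> flat 0 (1 - x)" by (auto intro!: flat0_mono)
  have "flat 0 x * (flat 0 y + flat 0 (1 - y)) \<le> flat 0 y * (flat 0 x + flat 0 (1 - x))"
    using mult_mono[OF 1 flat_nonneg flat_nonneg] by (simp add: algebra_simps)
  then show ?thesis using step_denom[of x] step_denom[of y] by (simp add: step_def field_simps)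
qed

section \<open>Test functions\<close>

text \<open>Lets any compact set that carries \<phi> stand in for the closed support.\<close>

lemma Cc_infinity_iff:
  "\<phi> \<in> Cc_infinity \<Omega> \<longleftrightarrow> smooth \<phi> \<and> (\<exists>K. compact K \<and> K \<subseteq> \<Omega> \<and> (\<forall>x. x \<notin> K \<longrightarrow> \<phi> x = 0))"
proof
  assume "\<phi> \<in> Cc_infinity \<Omega>"
  then show "smooth \<phi> \<and> (\<exists>K. compact K \<and> K \<subseteq> \<Omega> \<and> (\<forall>x. x \<notin> K \<longrightarrow> \<phi> x = 0))"
    using closure_subset[of "{x. \<phi> x \<noteq> 0}"] unfolding Cc_infinity_def smooth_iff_Ck
    by (intro conjI exI[of _ "closure {x. \<phi> x \<noteq> 0}"]) blast+
next
  assume "smooth \<phi> \<and> (\<exists>K. compact K \<and> K \<subseteq> \<Omega> \<and> (\<forall>x. x \<notin> K \<longrightarrow> \<phi> x = 0))"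
  then obtain K where K: "smooth \<phi>" "compact K" "K \<subseteq> \<Omega>" "\<forall>x. x \<notin> K \<longrightarrow> \<phi> x = 0" by auto
  then have "closure {x. \<phi> x \<noteq> 0} \<subseteq> K" by (intro closure_minimal compact_imp_closed) auto
  then show "\<phi> \<in> Cc_infinity \<Omega>"
    using K bounded_subset[OF compact_imp_bounded[OF K(2)], of "{x. \<phi> x \<noteq> 0}"]
    unfolding Cc_infinity_def smooth_iff_Ck by (auto simp: compact_closure)
qed

lemma Cc_smooth: "\<phi> \<in> Cc_infinity \<Omega> \<Longrightarrow> smooth \<phi>"
  by (simp add: Cc_infinity_iff)

lemma Cc_outside: "\<phi> \<in> Cc_infinity \<Omega> \<Longrightarrow> x \<notin> \<Omega> \<Longrightarrow> \<phi> x = 0"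
  by (auto simp: Cc_infinity_iff)

lemma Cc_mono: "\<phi> \<in> Cc_infinity \<Omega> \<Longrightarrow> \<Omega> \<subseteq> \<Omega>' \<Longrightarrow> \<phi> \<in> Cc_infinity \<Omega>'"
  unfolding Cc_infinity_iff by (meson order_trans)

lemma Cc_zero: "(\<lambda>x. 0) \<in> Cc_infinity \<Omega>"
  unfolding Cc_infinity_iff by (auto intro!: smooth_on_const exI[of _ "{}"])

lemma Cc_add: "\<phi> \<in> Cc_infinity \<Omega> \<Longrightarrow> \<psi> \<in> Cc_infinity \<Omega> \<Longrightarrow> (\<lambda>x. \<phi> x + \<psi> x) \<in> Cc_infinity \<Omega>"
proof -
  assume a: "\<phi> \<in> Cc_infinity \<Omega>" "\<psi> \<in> Cc_infinity \<Omega>"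
  then obtain K L where "compact K" "K \<subseteq> \<Omega>" "\<forall>x. x \<notin> K \<longrightarrow> \<phi> x = 0" "compact L" "L \<subseteq> \<Omega>" "\<forall>x. x \<notin> L \<longrightarrow> \<psi> x = 0"
    unfolding Cc_infinity_iff by blast
  then show ?thesis using a[THEN Cc_smooth] unfolding Cc_infinity_iff
    by (intro conjI smooth_on_add exI[of _ "K \<union> L"]) auto
qed

lemma Cc_mult: "smooth m \<Longrightarrow> \<phi> \<in> Cc_infinity \<Omega> \<Longrightarrow> (\<lambda>x. m x * \<phi> x) \<in> Cc_infinity \<Omega>"
  unfolding Cc_infinity_iff by (auto intro!: smooth_on_mult)

lemma Cc_scale: "\<phi> \<in> Cc_infinity \<Omega> \<Longrightarrow> (\<lambda>x. c * \<phi> x) \<in> Cc_infinity \<Omega>"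
  by (intro Cc_mult smooth_on_const) auto

lemma Cc_minus: "\<phi> \<in> Cc_infinity \<Omega> \<Longrightarrow> (\<lambda>x. - \<phi> x) \<in> Cc_infinity \<Omega>"
  using Cc_scale[of \<phi> \<Omega> "-1"] by simp

lemma Cc_diff: "\<phi> \<in> Cc_infinity \<Omega> \<Longrightarrow> \<psi> \<in> Cc_infinity \<Omega> \<Longrightarrow> (\<lambda>x. \<phi> x - \<psi> x) \<in> Cc_infinity \<Omega>"
  using Cc_add[OF _ Cc_minus] by fastforce

lemma Cc_cnj: "\<phi> \<in> Cc_infinity \<Omega> \<Longrightarrow> (\<lambda>x. cnj (\<phi> x)) \<in> Cc_infinity \<Omega>"
  unfolding Cc_infinity_iff by (auto intro!: smooth_on_comp_linear[OF bounded_linear_cnj])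

lemma Cc_frechet: "\<phi> \<in> Cc_infinity \<Omega> \<Longrightarrow> (\<lambda>x. frechet_derivative \<phi> (at x) v) \<in> Cc_infinity \<Omega>"
proof -
  assume a: "\<phi> \<in> Cc_infinity \<Omega>"
  then obtain K where K: "compact K" "K \<subseteq> \<Omega>" "\<forall>x. x \<notin> K \<longrightarrow> \<phi> x = 0"
    unfolding Cc_infinity_iff by blast
  have "frechet_derivative \<phi> (at x) v = 0" if "x \<notin> K" for x
  proof -
    have "(\<phi> has_derivative (\<lambda>_. 0)) (at x)"
      by (rule has_derivative_transform_within_open[of "\<lambda>_. 0" _ _ _ "- K"])
         (use K that in \<open>auto intro: compact_imp_closed\<close>)
    then show ?thesis using frechet_derivative_at by metis
  qed
  then show ?thesis using a[THEN Cc_smooth] K unfolding Cc_infinity_iff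
    by (intro conjI smooth_on_frechet exI[of _ K]) auto
qed

text \<open>The preimage of the support is bounded because \<Psi> moves points by at most B, and it
  lies in \<Omega> because the complement is mapped into itself.\<close>

lemma Cc_compose:
  fixes \<phi> :: "'a::euclidean_space \<Rightarrow> complex"
  assumes \<phi>: "\<phi> \<in> Cc_infinity \<Omega>" and \<Psi>: "smooth \<Psi>" and near: "\<And>x. norm (\<Psi> x - x) \<le> B"
    and out: "\<And>x. x \<notin> \<Omega> \<Longrightarrow> \<Psi> x \<notin> \<Omega>"
  shows "(\<lambda>x. \<phi> (\<Psi> x)) \<in> Cc_infinity \<Omega>"
proof -
  obtain K where K: "compact K" "K \<subseteq> \<Omega>" "\<forall>x. x \<notin> K \<longrightarrow> \<phi> x = 0"
    using \<phi> unfolding Cc_infinity_iff by blast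
  obtain R where R: "\<And>x. x \<in> K \<Longrightarrow> norm x \<le> R" using compact_imp_bounded[OF K(1)] bounded_iff by metis
  have "closed (\<Psi> -` K)"
    using continuous_closed_vimage[of K \<Psi>] compact_imp_closed[OF K(1)] smooth_continuous[OF \<Psi>]
    by (simp add: continuous_on_eq_continuous_at)
  moreover have "bounded (\<Psi> -` K)"
    unfolding bounded_iff
  proof (intro exI[of _ "R + B"] ballI)
    fix x assume "x \<in> \<Psi> -` K"
    then show "norm x \<le> R + B" using R[of "\<Psi> x"] near[of x] norm_triangle_sub[of x "\<Psi> x"]
      by (simp add: norm_minus_commute)
  qed
  ultimately have "compact (\<Psi> -` K)" by (simp add: compact_eq_bounded_closed)
  then show ?thesis
    using K out smooth_on_compose[OF Cc_smooth[OF \<phi>] \<Psi>] unfolding Cc_infinity_iff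
    by (intro conjI exI[of _ "\<Psi> -` K"]) auto
qed

section \<open>Integrals of continuous functions with compact support\<close>

definition cont_compact :: "('a::euclidean_space \<Rightarrow> 'b::real_normed_vector) \<Rightarrow> bool" where
  "cont_compact f \<longleftrightarrow> continuous_on UNIV f \<and> (\<exists>K. compact K \<and> (\<forall>x. x \<notin> K \<longrightarrow> f x = 0))"

lemma cont_compact_integrable:
  fixes f :: "'a::euclidean_space \<Rightarrow> 'b::{banach, second_countable_topology}"
  assumes "cont_compact f" shows "integrable lborel f"
proof -
  obtain K where K: "compact K" "\<forall>x. x \<notin> K \<longrightarrow> f x = 0" using assms by (auto simp: cont_compact_def)
  have "integrable lborel (\<lambda>x. indicator K x *\<^sub>R f x)"
    using K assms by (intro borel_integrable_compact) (auto simp: cont_compact_def intro: continuous_on_subset)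
  moreover have "(\<lambda>x. indicator K x *\<^sub>R f x) = f" using K by (auto simp: indicator_def fun_eq_iff)
  ultimately show ?thesis by simp
qed

lemma cont_compact_measurable: "cont_compact f \<Longrightarrow> f \<in> borel_measurable borel"
  by (simp add: cont_compact_def borel_measurable_continuous_onI)

lemma Cc_cont_compact: "\<phi> \<in> Cc_infinity \<Omega> \<Longrightarrow> cont_compact \<phi>"
  unfolding Cc_infinity_iff cont_compact_def using smooth_continuous by blast

lemma cont_compact_add: "cont_compact f \<Longrightarrow> cont_compact g \<Longrightarrow> cont_compact (\<lambda>x. f x + g x)"
  unfolding cont_compact_def
proof safe
  fix K L assume "compact K" "\<forall>x. x \<notin> K \<longrightarrow> f x = 0" "compact L" "\<forall>x. x \<notin> L \<longrightarrow> g x = 0"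
  then show "\<exists>K. compact K \<and> (\<forall>x. x \<notin> K \<longrightarrow> f x + g x = 0)" by (intro exI[of _ "K \<union> L"]) auto
qed (auto intro: continuous_intros)

lemma cont_compact_mult: "cont_compact f \<Longrightarrow> continuous_on UNIV g \<Longrightarrow> cont_compact (\<lambda>x. g x * f x)"
  for f g :: "'a::euclidean_space \<Rightarrow> 'b::real_normed_algebra"
  unfolding cont_compact_def by (auto intro!: continuous_intros)

lemma cont_compact_mult2: "cont_compact f \<Longrightarrow> continuous_on UNIV g \<Longrightarrow> cont_compact (\<lambda>x. f x * g x)"
  for f g :: "'a::euclidean_space \<Rightarrow> 'b::real_normed_algebra"
  unfolding cont_compact_def by (auto intro!: continuous_intros)

lemma cont_compact_comp:
  assumes "cont_compact f" "continuous_on UNIV h" "h 0 = 0" shows "cont_compact (\<lambda>x. h (f x))"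
  using assms continuous_on_compose2[of UNIV h UNIV f] unfolding cont_compact_def by auto

lemma cont_compact_norm2: "cont_compact f \<Longrightarrow> cont_compact (\<lambda>x. (norm (f x))\<^sup>2)"
  by (rule cont_compact_comp) (auto intro!: continuous_intros)

lemma cont_compact_Re_cnj: "cont_compact f \<Longrightarrow> cont_compact g \<Longrightarrow> cont_compact (\<lambda>x. Re (f x * cnj (g x)))"
proof -
  assume a: "cont_compact f" "cont_compact g"
  then have "cont_compact (\<lambda>x. f x * cnj (g x))"
    by (intro cont_compact_mult2) (auto simp: cont_compact_def intro!: continuous_intros)
  then show ?thesis by (rule cont_compact_comp) (auto intro!: continuous_intros)
qed

lemma cont_compact_bounded: assumes "cont_compact f" shows "\<exists>B>0. \<forall>x. norm (f x) \<le> B"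
proof -
  obtain K where K: "compact K" "\<forall>x. x \<notin> K \<longrightarrow> f x = 0" "continuous_on UNIV f" using assms by (auto simp: cont_compact_def)
  then have "compact (f ` K)" by (meson compact_continuous_image continuous_on_subset subset_UNIV)
  then obtain B where B: "B > 0" "\<And>y. y \<in> f ` K \<Longrightarrow> norm y \<le> B" using compact_imp_bounded bounded_pos by metis
  then have "norm (f x) \<le> B" for x using K by (cases "x \<in> K") auto
  then show ?thesis using B by blast
qed

lemma lborel_integral_translation:
  fixes f :: "'a::euclidean_space \<Rightarrow> 'b::{banach, second_countable_topology}"
  assumes "f \<in> borel_measurable borel"
  shows "(LINT x|lborel. f (c + x)) = (LINT x|lborel. f x)"
proof -
  have "(LINT x|lborel. f x) = (LINT x|distr lborel borel ((+) c). f x)" by (simp add: lborel_distr_plus)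
  also have "\<dots> = (LINT x|lborel. f (c + x))" using assms by (intro integral_distr) auto
  finally show ?thesis ..
qed

text \<open>Translation invariance of the integral, differentiated.\<close>
lemma integral_frechet_derivative_zero:
  fixes \<phi> :: "'a::euclidean_space \<Rightarrow> complex"
  assumes \<phi>: "\<phi> \<in> Cc_infinity \<Omega>"
  shows "(LINT x|lborel. frechet_derivative \<phi> (at x) v) = 0"
proof -
  define d where "d x = frechet_derivative \<phi> (at x) v" for x
  define t where "t n = inverse (real (Suc n))" for n
  have t: "0 < t n" "t n \<le> 1" for n by (auto simp: t_def field_simps)
  have "cont_compact d" unfolding d_def[abs_def] by (intro Cc_cont_compact[OF Cc_frechet[OF \<phi>]])
  then obtain B where B: "B > 0" "\<And>x. norm (d x) \<le> B" using cont_compact_bounded by metis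
  obtain K where K: "compact K" "\<forall>x. x \<notin> K \<longrightarrow> \<phi> x = 0" using \<phi> unfolding Cc_infinity_iff by blast
  \<comment> \<open>The support swept backwards along v for times in [0,1]. Outside it all the
    quotients \<open>q n\<close> vanish, which yields the dominating function.\<close>
  define K' where "K' = (\<lambda>(s, x). x - s *\<^sub>R v) ` ({0..1} \<times> K)"
  have K': "compact K'" unfolding K'_def
    by (intro compact_continuous_image compact_Times K) (auto simp: split_def intro!: continuous_intros)
  have der: "((\<lambda>s. \<phi> (x + s *\<^sub>R v)) has_vector_derivative d (x + s *\<^sub>R v)) (at s)" for x s
  proof -
    have "((\<lambda>s. x + s *\<^sub>R v) has_derivative (\<lambda>h. h *\<^sub>R v)) (at s)" by (auto intro!: derivative_eq_intros)
    from has_derivative_compose[OF this smooth_has_derivative[OF Cc_smooth[OF \<phi>]]]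
    show ?thesis unfolding has_vector_derivative_def d_def
      using linear_scale[OF has_derivative_linear[OF smooth_has_derivative[OF Cc_smooth[OF \<phi>]]]] by simp
  qed
  define q where "q n x = (\<phi> (t n *\<^sub>R v + x) - \<phi> x) /\<^sub>R t n" for n x
  have [measurable]: "\<phi> \<in> borel_measurable borel" by (rule cont_compact_measurable[OF Cc_cont_compact[OF \<phi>]])
  have int: "integrable lborel \<phi>" by (rule cont_compact_integrable[OF Cc_cont_compact[OF \<phi>]])
  have int2: "integrable lborel (\<lambda>x. \<phi> (c + x))" for c
    using int integrable_distr_eq[of "(+) c" lborel borel \<phi>] by (simp add: lborel_distr_plus)
  have zero: "(LINT x|lborel. q n x) = 0" for n
    unfolding q_def using int int2 lborel_integral_translation[of \<phi> "t n *\<^sub>R v"] by simp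
  have bound: "norm (q n x) \<le> indicator K' x *\<^sub>R B" for n x
  proof (cases "x \<in> K'")
    case True
    have "norm (\<phi> (x + t n *\<^sub>R v) - \<phi> (x + 0 *\<^sub>R v)) \<le> B * norm (t n - 0)"
    proof (rule differentiable_bound[of "{0..t n}" _ "\<lambda>s h. h *\<^sub>R d (x + s *\<^sub>R v)"])
      show "((\<lambda>s. \<phi> (x + s *\<^sub>R v)) has_derivative (\<lambda>h. h *\<^sub>R d (x + s *\<^sub>R v))) (at s within {0..t n})" for s
        using der[of x s] has_derivative_at_withinI unfolding has_vector_derivative_def by blast
      show "onorm (\<lambda>h. h *\<^sub>R d (x + s *\<^sub>R v)) \<le> B" for s
        by (rule onorm_bound) (use B in \<open>auto intro!: mult_left_mono less_imp_le[OF B(1)] simp: mult.commute[of B]\<close>)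
    qed (use t[of n] in auto)
    then have "cmod (\<phi> (t n *\<^sub>R v + x) - \<phi> x) / t n \<le> B" using t[of n] by (simp add: divide_le_eq add.commute)
    then show ?thesis using True t[of n] unfolding q_def norm_scaleR by (simp add: divide_inverse mult.commute)
  next
    case False
    have "x + s *\<^sub>R v \<notin> K" if "0 \<le> s" "s \<le> 1" for s
    proof
      assume "x + s *\<^sub>R v \<in> K"
      then have "(\<lambda>(s, x). x - s *\<^sub>R v) (s, x + s *\<^sub>R v) \<in> K'" unfolding K'_def using that by (intro imageI) auto
      then show False using False by simp
    qed
    from this[of 0] this[of "t n"] show ?thesis using K t[of n] False by (simp add: q_def add.commute less_imp_le)
  qed
  have "(\<lambda>n. LINT x|lborel. q n x) \<longlonglongrightarrow> (LINT x|lborel. d x)"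
  proof (rule integral_dominated_convergence[where w = "\<lambda>x. indicator K' x *\<^sub>R B"])
    show "integrable lborel (\<lambda>x. indicator K' x *\<^sub>R B)"
      using K' by (intro borel_integrable_compact) auto
    show "d \<in> borel_measurable lborel" using \<open>cont_compact d\<close> cont_compact_measurable by simp
    show "AE x in lborel. (\<lambda>n. q n x) \<longlonglongrightarrow> d x"
    proof (intro AE_I2)
      fix x
      have "((\<lambda>h. (\<phi> (x + h *\<^sub>R v) - \<phi> (x + 0 *\<^sub>R v)) /\<^sub>R h) \<longlongrightarrow> d (x + 0 *\<^sub>R v)) (at 0)"
      proof (rule Lim_null[THEN iffD2], rule tendsto_norm_zero_cancel, rule Lim_transform_eventually)
        show "((\<lambda>h. norm (\<phi> (x + h *\<^sub>R v) - \<phi> (x + 0 *\<^sub>R v) - h *\<^sub>R d (x + 0 *\<^sub>R v)) / norm h) \<longlongrightarrow> 0) (at 0)"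
          using der[of x 0] by (simp add: has_vector_derivative_def has_derivative_at)
        have "norm (\<phi> (x + h *\<^sub>R v) - \<phi> (x + 0 *\<^sub>R v) - h *\<^sub>R d (x + 0 *\<^sub>R v)) / norm h
            = norm ((\<phi> (x + h *\<^sub>R v) - \<phi> (x + 0 *\<^sub>R v)) /\<^sub>R h - d (x + 0 *\<^sub>R v))" if "h \<noteq> 0" for h
        proof -
          have "(\<phi> (x + h *\<^sub>R v) - \<phi> (x + 0 *\<^sub>R v)) /\<^sub>R h - d (x + 0 *\<^sub>R v)
             = (\<phi> (x + h *\<^sub>R v) - \<phi> (x + 0 *\<^sub>R v) - h *\<^sub>R d (x + 0 *\<^sub>R v)) /\<^sub>R h"
            using that by (simp add: scaleR_diff_right)
          then show ?thesis by (simp only: norm_scaleR) (simp add: divide_inverse mult.commute)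
        qed
        then show "\<forall>\<^sub>F h in at 0. norm (\<phi> (x + h *\<^sub>R v) - \<phi> (x + 0 *\<^sub>R v) - h *\<^sub>R d (x + 0 *\<^sub>R v)) / norm h
            = norm ((\<phi> (x + h *\<^sub>R v) - \<phi> (x + 0 *\<^sub>R v)) /\<^sub>R h - d (x + 0 *\<^sub>R v))"
          by (auto simp: eventually_at_filter)
      qed
      moreover have "filterlim t (at 0) sequentially"
        unfolding filterlim_at using LIMSEQ_inverse_real_of_nat t by (auto simp: t_def[abs_def] simp del: of_nat_Suc)
      ultimately have "(\<lambda>n. (\<phi> (x + t n *\<^sub>R v) - \<phi> (x + 0 *\<^sub>R v)) /\<^sub>R t n) \<longlonglongrightarrow> d (x + 0 *\<^sub>R v)"
        by (rule filterlim_compose)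
      then show "(\<lambda>n. q n x) \<longlonglongrightarrow> d x" by (simp add: q_def add.commute)
    qed
  qed (use bound in \<open>auto simp: q_def\<close>)
  then show ?thesis using zero LIMSEQ_unique[OF _ tendsto_const[of 0]] unfolding d_def by simp
qed

section \<open>Partial derivatives in the plane and Green's formula\<close>

definition D1 :: "(real \<times> real \<Rightarrow> complex) \<Rightarrow> real \<times> real \<Rightarrow> complex" where
  "D1 f p = frechet_derivative f (at p) (1, 0)"

definition D2 :: "(real \<times> real \<Rightarrow> complex) \<Rightarrow> real \<times> real \<Rightarrow> complex" where
  "D2 f p = frechet_derivative f (at p) (0, 1)"

lemma frechet_eq_partials:
  assumes "smooth f"
  shows "frechet_derivative f (at p) v = fst v *\<^sub>R D1 f p + snd v *\<^sub>R D2 f p"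
proof -
  have lin: "linear (frechet_derivative f (at p))"
    using has_derivative_linear[OF smooth_has_derivative[OF assms]] .
  have "frechet_derivative f (at p) v = frechet_derivative f (at p) (fst v *\<^sub>R (1, 0) + snd v *\<^sub>R (0, 1))" by simp
  then show ?thesis unfolding D1_def D2_def by (simp only: linear_add[OF lin] linear_scale[OF lin])
qed

lemma smooth_partials: "smooth f \<Longrightarrow> (f has_derivative (\<lambda>v. fst v *\<^sub>R D1 f p + snd v *\<^sub>R D2 f p)) (at p)"
  using smooth_has_derivative[of f p] by (simp add: frechet_eq_partials[symmetric])

lemma partials_eqI:
  assumes "(f has_derivative (\<lambda>v. fst v *\<^sub>R a + snd v *\<^sub>R b)) (at p)"
  shows "D1 f p = a" "D2 f p = b"
  using fun_cong[OF frechet_derivative_at[OF assms], of "(1, 0)"] fun_cong[OF frechet_derivative_at[OF assms], of "(0, 1)"]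
  by (simp_all add: D1_def D2_def)

lemma Cc_D1: "\<phi> \<in> Cc_infinity \<Omega> \<Longrightarrow> D1 \<phi> \<in> Cc_infinity \<Omega>"
  unfolding D1_def[abs_def] by (rule Cc_frechet)

lemma Cc_D2: "\<phi> \<in> Cc_infinity \<Omega> \<Longrightarrow> D2 \<phi> \<in> Cc_infinity \<Omega>"
  unfolding D2_def[abs_def] by (rule Cc_frechet)

lemma smooth_D1: "smooth f \<Longrightarrow> smooth (D1 f)"
  unfolding D1_def[abs_def] by (rule smooth_on_frechet)

lemma smooth_D2: "smooth f \<Longrightarrow> smooth (D2 f)"
  unfolding D2_def[abs_def] by (rule smooth_on_frechet)

lemma D_add: assumes "smooth f" "smooth g"
  shows "D1 (\<lambda>x. f x + g x) p = D1 f p + D1 g p" "D2 (\<lambda>x. f x + g x) p = D2 f p + D2 g p"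
proof -
  have "((\<lambda>x. f x + g x) has_derivative (\<lambda>v. fst v *\<^sub>R (D1 f p + D1 g p) + snd v *\<^sub>R (D2 f p + D2 g p))) (at p)"
    using has_derivative_add[OF smooth_partials[OF assms(1)] smooth_partials[OF assms(2)], of p] by (simp add: algebra_simps)
  from partials_eqI[OF this] show "D1 (\<lambda>x. f x + g x) p = D1 f p + D1 g p" "D2 (\<lambda>x. f x + g x) p = D2 f p + D2 g p" .
qed

lemma D_mult: assumes "smooth f" "smooth g"
  shows "D1 (\<lambda>x. f x * g x) p = f p * D1 g p + D1 f p * g p" "D2 (\<lambda>x. f x * g x) p = f p * D2 g p + D2 f p * g p"
proof -
  have "((\<lambda>x. f x * g x) has_derivative (\<lambda>v. fst v *\<^sub>R (f p * D1 g p + D1 f p * g p) + snd v *\<^sub>R (f p * D2 g p + D2 f p * g p))) (at p)"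
    using has_derivative_mult[OF smooth_partials[OF assms(1)] smooth_partials[OF assms(2)], of p] by (simp add: algebra_simps scaleR_conv_of_real)
  from partials_eqI[OF this] show "D1 (\<lambda>x. f x * g x) p = f p * D1 g p + D1 f p * g p" "D2 (\<lambda>x. f x * g x) p = f p * D2 g p + D2 f p * g p" .
qed

lemma D_const: "D1 (\<lambda>x. c) p = 0" "D2 (\<lambda>x. c) p = 0"
  by (simp_all add: D1_def D2_def frechet_derivative_const)

lemma D_scale: assumes "smooth f"
  shows "D1 (\<lambda>x. c * f x) p = c * D1 f p" "D2 (\<lambda>x. c * f x) p = c * D2 f p"
  using D_mult[OF smooth_on_const[of UNIV c] assms] by (simp_all add: D_const)

lemma D_diff: assumes "smooth f" "smooth g"
  shows "D1 (\<lambda>x. f x - g x) p = D1 f p - D1 g p" "D2 (\<lambda>x. f x - g x) p = D2 f p - D2 g p"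
  using D_add[OF assms(1) smooth_on_minus[OF assms(2)]] D_scale[OF assms(2), of "-1"] by simp_all

lemma D_cnj: assumes "smooth f"
  shows "D1 (\<lambda>x. cnj (f x)) p = cnj (D1 f p)" "D2 (\<lambda>x. cnj (f x)) p = cnj (D2 f p)"
proof -
  have "((\<lambda>x. cnj (f x)) has_derivative (\<lambda>v. fst v *\<^sub>R cnj (D1 f p) + snd v *\<^sub>R cnj (D2 f p))) (at p)"
    using bounded_linear.has_derivative[OF bounded_linear_cnj smooth_partials[OF assms], of p] by simp
  from partials_eqI[OF this] show "D1 (\<lambda>x. cnj (f x)) p = cnj (D1 f p)" "D2 (\<lambda>x. cnj (f x)) p = cnj (D2 f p)" .
qed

lemma integral_D1_zero: "\<phi> \<in> Cc_infinity \<Omega> \<Longrightarrow> (LINT p|lborel. D1 \<phi> p) = 0"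
  unfolding D1_def by (rule integral_frechet_derivative_zero)

lemma integral_D2_zero: "\<phi> \<in> Cc_infinity \<Omega> \<Longrightarrow> (LINT p|lborel. D2 \<phi> p) = 0"
  unfolding D2_def by (rule integral_frechet_derivative_zero)

lemma laplacian_eq: "laplacian f p = D1 (D1 f) p + D2 (D2 f) p"
proof -
  have "(Basis :: (real \<times> real) set) = {(1, 0), (0, 1)}" by (auto simp: Basis_prod_def)
  then have "laplacian f p = (\<Sum>b\<in>{(1, 0), (0, 1)}. frechet_derivative (\<lambda>y. frechet_derivative f (at y) b) (at p) b)"
    unfolding laplacian_def by (simp only:)
  then show ?thesis unfolding D1_def[abs_def] D2_def[abs_def] by simp
qed

lemma Cc_laplacian: "\<phi> \<in> Cc_infinity \<Omega> \<Longrightarrow> laplacian \<phi> \<in> Cc_infinity \<Omega>" for \<phi> :: "real \<times> real \<Rightarrow> complex"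
proof -
  assume "\<phi> \<in> Cc_infinity \<Omega>"
  then have "(\<lambda>p. D1 (D1 \<phi>) p + D2 (D2 \<phi>) p) \<in> Cc_infinity \<Omega>" by (intro Cc_add Cc_D1 Cc_D2)
  then show ?thesis by (simp add: laplacian_eq[abs_def])
qed

text \<open>The x-derivative of D1 \<phi> cnj \<psi> and the y-derivative of D2 \<phi> cnj \<psi>
  integrate to zero.\<close>

lemma Green:
  assumes \<phi>: "\<phi> \<in> Cc_infinity \<Omega>" and \<psi>: "\<psi> \<in> Cc_infinity \<Omega>"
  shows "(LINT p|lborel. - laplacian \<phi> p * cnj (\<psi> p)) = (LINT p|lborel. D1 \<phi> p * cnj (D1 \<psi> p) + D2 \<phi> p * cnj (D2 \<psi> p))"
proof -
  have s: "smooth \<phi>" "smooth \<psi>" "smooth (D1 \<phi>)" "smooth (D2 \<phi>)" "smooth (\<lambda>x. cnj (\<psi> x))"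
    using \<phi> \<psi> Cc_smooth smooth_D1 smooth_D2 Cc_cnj by blast+
  have ii: "integrable lborel (\<lambda>x. f x * cnj (g x))" if "f \<in> Cc_infinity \<Omega>" "g \<in> Cc_infinity \<Omega>" for f g :: "real \<times> real \<Rightarrow> complex"
    using that by (intro cont_compact_integrable Cc_cont_compact[of _ \<Omega>] Cc_mult Cc_cnj Cc_smooth)
  have 1: "(LINT p|lborel. D1 \<phi> p * cnj (D1 \<psi> p) + D1 (D1 \<phi>) p * cnj (\<psi> p)) = 0"
    using integral_D1_zero[OF Cc_mult[OF s(3) Cc_cnj[OF \<psi>]]] by (simp add: D_mult[OF s(3,5)] D_cnj s)
  have 2: "(LINT p|lborel. D2 \<phi> p * cnj (D2 \<psi> p) + D2 (D2 \<phi>) p * cnj (\<psi> p)) = 0"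
    using integral_D2_zero[OF Cc_mult[OF s(4) Cc_cnj[OF \<psi>]]] by (simp add: D_mult[OF s(4,5)] D_cnj s)
  note iii = ii[OF Cc_D1[OF \<phi>] Cc_D1[OF \<psi>]] ii[OF Cc_D2[OF \<phi>] Cc_D2[OF \<psi>]] ii[OF Cc_D1[OF Cc_D1[OF \<phi>]] \<psi>] ii[OF Cc_D2[OF Cc_D2[OF \<phi>]] \<psi>]
  have "(LINT p|lborel. - laplacian \<phi> p * cnj (\<psi> p)) = - (LINT p|lborel. D1 (D1 \<phi>) p * cnj (\<psi> p)) - (LINT p|lborel. D2 (D2 \<phi>) p * cnj (\<psi> p))"
    using iii by (simp add: laplacian_eq left_diff_distrib)
  then show ?thesis using 1 2 iii by (simp add: add_eq_0_iff)
qed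

section \<open>Change of variables in the plane\<close>

text \<open>The change of variables theorem speaks of real^n and Jacobian matrices; this measure
  preserving linear bijection carries planar integrals there and back.\<close>

definition pair_of :: "real^2 \<Rightarrow> real \<times> real" where "pair_of v = (v $ 1, v $ 2)"
definition vec_of :: "real \<times> real \<Rightarrow> real^2" where "vec_of p = vector [fst p, snd p]"

lemma pair_of_vec_of [simp]: "pair_of (vec_of p) = p"
  by (simp add: pair_of_def vec_of_def)

lemma vec_of_pair_of [simp]: "vec_of (pair_of v) = v"
  by (simp add: pair_of_def vec_of_def vec_eq_iff forall_2)

lemma linear_pair_of: "bounded_linear pair_of"
  unfolding pair_of_def[abs_def] by (intro bounded_linear_Pair bounded_linear_vec_nth)

lemma linear_vec_of: "bounded_linear vec_of"
proof -
  have "linear vec_of" by (rule linearI) (auto simp: vec_of_def vec_eq_iff forall_2)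
  then show ?thesis by (simp add: linear_conv_bounded_linear)
qed

lemma lborel_pair_of: "distr lborel borel pair_of = (lborel :: (real \<times> real) measure)"
proof (rule lborel_eqI[symmetric])
  have m: "pair_of \<in> borel_measurable borel"
    by (intro borel_measurable_continuous_onI linear_continuous_on linear_pair_of)
  show "sets (distr lborel borel pair_of) = sets borel" by simp
  fix l u :: "real \<times> real" assume le: "\<And>b. b \<in> Basis \<Longrightarrow> l \<bullet> b \<le> u \<bullet> b"
  have B: "(Basis :: (real \<times> real) set) = {(1, 0), (0, 1)}" by (auto simp: Basis_prod_def)
  have le': "fst l \<le> fst u" "snd l \<le> snd u" using le[of "(1,0)"] le[of "(0,1)"] by (auto simp: B inner_prod_def)
  have "pair_of -` box l u = box (vec_of l) (vec_of u)"
    by (auto simp: box_def B pair_of_def vec_of_def Basis_vec_def inner_axis inner_prod_def UNIV_2 forall_2)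
  then have "emeasure (distr lborel borel pair_of) (box l u) = emeasure lborel (box (vec_of l) (vec_of u))"
    using m by (subst emeasure_distr) auto
  also have "\<dots> = ennreal (\<Prod>b\<in>Basis. (vec_of u - vec_of l) \<bullet> b)"
    using le' by (intro emeasure_lborel_box) (auto simp: Basis_vec_def inner_axis vec_of_def UNIV_2)
  also have "(\<Prod>b\<in>Basis. (vec_of u - vec_of l) \<bullet> b) = (fst u - fst l) * (snd u - snd l)"
  proof -
    have B2: "(Basis :: (real^2) set) = {axis 1 1, axis 2 1}" by (auto simp: Basis_vec_def UNIV_2)
    have "axis 1 (1::real) \<noteq> (axis 2 1 :: real^2)" by (simp add: axis_eq_axis)
    then show ?thesis unfolding B2 by (simp add: inner_axis vec_of_def)
  qed
  also have "(fst u - fst l) * (snd u - snd l) = (\<Prod>b\<in>Basis. (u - l) \<bullet> b)"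
  proof -
    have "(\<Prod>b\<in>Basis. (u - l) \<bullet> b) = (\<Prod>b\<in>{(1, 0), (0, 1)}. (u - l) \<bullet> b)" by (simp only: B)
    then show ?thesis by (simp add: inner_prod_def)
  qed
  finally show "emeasure (distr lborel borel pair_of) (box l u) = ennreal (\<Prod>b\<in>Basis. (u - l) \<bullet> b)" .
qed

lemma integral_pair_of:
  fixes f :: "real \<times> real \<Rightarrow> real"
  assumes "f \<in> borel_measurable borel"
  shows "(LINT p|lborel. f p) = (LINT v|lborel. f (pair_of v))"
proof -
  have m: "pair_of \<in> borel_measurable borel"
    by (intro borel_measurable_continuous_onI linear_continuous_on linear_pair_of)
  show ?thesis using assms m by (subst lborel_pair_of[symmetric], subst integral_distr) auto
qed

lemma integral_substitution_plane:
  fixes f :: "real \<times> real \<Rightarrow> real" and \<Psi> :: "real \<times> real \<Rightarrow> real \<times> real"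
  assumes f: "cont_compact f"
    and der: "\<And>p. (\<Psi> has_derivative (\<lambda>v. (fst v * a p + snd v * b p, fst v * c p + snd v * d p))) (at p)"
    and bij: "bij \<Psi>"
    and pos: "\<And>p. a p * d p - b p * c p > 0"
    and cc: "cont_compact (\<lambda>p. (a p * d p - b p * c p) * f (\<Psi> p))"
  shows "(LINT p|lborel. (a p * d p - b p * c p) * f (\<Psi> p)) = (LINT p|lborel. f p)"
proof -
  define J where "J p = a p * d p - b p * c p" for p
  define g where "g v = vec_of (\<Psi> (pair_of v))" for v
  define g' where "g' v w = vec_of ((\<lambda>u. (fst u * a (pair_of v) + snd u * b (pair_of v), fst u * c (pair_of v) + snd u * d (pair_of v))) (pair_of w))" for v w
  \<comment> \<open>The theorem integrates vector valued functions, hence the one-dimensional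
    vectors.\<close>
  define F where "F v = (vec (f (pair_of v)) :: real^1)" for v
  have dg: "(g has_derivative g' v) (at v within UNIV)" for v
  proof -
    have "((\<lambda>v. \<Psi> (pair_of v)) has_derivative (\<lambda>w. (\<lambda>u. (fst u * a (pair_of v) + snd u * b (pair_of v), fst u * c (pair_of v) + snd u * d (pair_of v))) (pair_of w))) (at v)"
      by (rule has_derivative_compose[OF bounded_linear_imp_has_derivative[OF linear_pair_of] der])
    from bounded_linear.has_derivative[OF linear_vec_of this] show ?thesis
      by (simp add: g_def[abs_def] g'_def[abs_def])
  qed
  have det: "det (matrix (g' v)) = J (pair_of v)" for v
    by (simp add: det_2 matrix_def g'_def vec_of_def pair_of_def axis_def J_def)
  have inj: "inj g" and surj: "range g = UNIV"
  proof -
    have v: "bij vec_of" "bij pair_of" by (auto intro!: bij_betw_byWitness[of _ pair_of] bij_betw_byWitness[of _ vec_of])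
    have "bij (vec_of \<circ> \<Psi> \<circ> pair_of)" by (intro bij_comp v bij)
    then have "bij g" by (simp add: g_def[abs_def] comp_def)
    then show "inj g" "range g = UNIV" by (auto simp: bij_def)
  qed
  have Lint: "integrable lborel (\<lambda>v. h (pair_of v))" "(LINT v|lborel. h (pair_of v)) = (LINT p|lborel. h p)"
    "(\<lambda>v. h (pair_of v)) absolutely_integrable_on UNIV" "integral UNIV (\<lambda>v. h (pair_of v)) = (LINT p|lborel. h p)"
    if "cont_compact h" for h :: "real \<times> real \<Rightarrow> real"
  proof -
    have m: "pair_of \<in> borel_measurable borel"
      by (intro borel_measurable_continuous_onI linear_continuous_on linear_pair_of)
    have hm: "h \<in> borel_measurable borel" using cont_compact_measurable[OF that] .
    show 1: "integrable lborel (\<lambda>v. h (pair_of v))"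
      using cont_compact_integrable[OF that] integrable_distr_eq[of pair_of lborel borel h] m hm
      by (simp add: lborel_pair_of)
    show 2: "(LINT v|lborel. h (pair_of v)) = (LINT p|lborel. h p)" using integral_pair_of[OF hm] by simp
    have 3: "integrable lborel (\<lambda>v. \<bar>h (pair_of v)\<bar>)" using 1 by simp
    show "(\<lambda>v. h (pair_of v)) absolutely_integrable_on UNIV"
      using 1 3 integrable_completion by (auto simp: set_integrable_def integrable_completion)
    show "integral UNIV (\<lambda>v. h (pair_of v)) = (LINT p|lborel. h p)" using integral_lborel[OF 1] 2 by simp
  qed
  have FF: "F absolutely_integrable_on (g ` UNIV)" "integral (g ` UNIV) F = vec (LINT p|lborel. f p)"
    using Lint(3,4)[OF f] unfolding surj F_def[abs_def]
    by (simp_all add: absolutely_integrable_on_1_iff integral_on_1_eq)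
  have "(\<lambda>v. \<bar>det (matrix (g' v))\<bar> *\<^sub>R F (g v)) absolutely_integrable_on UNIV \<and>
      integral UNIV (\<lambda>v. \<bar>det (matrix (g' v))\<bar> *\<^sub>R F (g v)) = vec (LINT p|lborel. f p)"
    using has_absolute_integral_change_of_variables[OF _ dg inj, of F "vec (LINT p|lborel. f p)"] FF by simp
  moreover have "(\<lambda>v. \<bar>det (matrix (g' v))\<bar> *\<^sub>R F (g v)) = (\<lambda>v. vec (J (pair_of v) * f (\<Psi> (pair_of v))))"
    using pos unfolding det F_def g_def J_def by (auto simp: fun_eq_iff vec_eq_iff abs_of_pos)
  ultimately have "integral UNIV (\<lambda>v. vec (J (pair_of v) * f (\<Psi> (pair_of v))) :: real^1) = vec (LINT p|lborel. f p)" by simp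
  then have "integral UNIV (\<lambda>v. J (pair_of v) * f (\<Psi> (pair_of v))) = (LINT p|lborel. f p)"
    by (simp add: integral_on_1_eq vec_eq_iff)
  then show ?thesis using Lint(4)[OF cc] by (simp add: J_def)
qed

section \<open>Inner variations\<close>

lemma cont_compact_compose_near:
  fixes f :: "'a::euclidean_space \<Rightarrow> 'b::real_normed_vector"
  assumes f: "cont_compact f" and \<Psi>: "continuous_on UNIV \<Psi>" and near: "\<And>x. norm (\<Psi> x - x) \<le> B"
  shows "cont_compact (\<lambda>x. f (\<Psi> x))"
proof -
  obtain K where K: "compact K" "\<forall>x. x \<notin> K \<longrightarrow> f x = 0" and c: "continuous_on UNIV f"
    using f unfolding cont_compact_def by blast
  obtain R where R: "\<And>x. x \<in> K \<Longrightarrow> norm x \<le> R" using compact_imp_bounded[OF K(1)] bounded_iff by metis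
  have "f (\<Psi> x) = 0" if "x \<notin> cball 0 (R + B)" for x
  proof -
    have "norm x \<le> norm (\<Psi> x) + B"
      using near[of x] norm_triangle_sub[of x "\<Psi> x"] by (simp add: norm_minus_commute)
    then have "\<Psi> x \<notin> K" using R[of "\<Psi> x"] that by auto
    then show ?thesis using K by simp
  qed
  moreover have "continuous_on UNIV (\<lambda>x. f (\<Psi> x))"
    using continuous_on_compose2[OF c \<Psi>] by simp
  ultimately show ?thesis unfolding cont_compact_def by (auto intro!: exI[of _ "cball 0 (R + B)"])
qed

lemma norm_real_pair_le: "norm ((x, y) :: real \<times> real) \<le> \<bar>x\<bar> + \<bar>y\<bar>"
  using norm_Pair_le[of x y] by simp

lemma lipschitz_of_partials:
  fixes f a b :: "real \<times> real \<Rightarrow> real"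
  assumes "\<And>p. (f has_derivative (\<lambda>v. fst v * a p + snd v * b p)) (at p)" "\<And>p. \<bar>a p\<bar> \<le> B" "\<And>p. \<bar>b p\<bar> \<le> B"
  shows "\<bar>f p - f q\<bar> \<le> 2 * B * norm (p - q)"
proof -
  have B: "0 \<le> B" using assms(2)[of 0] by linarith
  have "norm (f p - f q) \<le> 2 * B * norm (p - q)"
  proof (rule differentiable_bound[of UNIV])
    show "onorm (\<lambda>v. fst v * a p + snd v * b p) \<le> 2 * B" for p
    proof (rule onorm_bound)
      fix v :: "real \<times> real"
      have "\<bar>fst v * a p + snd v * b p\<bar> \<le> \<bar>fst v\<bar> * \<bar>a p\<bar> + \<bar>snd v\<bar> * \<bar>b p\<bar>"
        by (metis abs_mult abs_triangle_ineq)
      also have "\<dots> \<le> norm v * B + norm v * B"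
        using assms norm_fst_le[of "fst v" "snd v"] norm_snd_le[of "snd v" "fst v"] B by (intro add_mono mult_mono) auto
      finally show "norm (fst v * a p + snd v * b p) \<le> 2 * B * norm v" by (simp add: algebra_simps)
    qed (use B in auto)
  qed (use assms in auto)
  then show ?thesis by simp
qed

text \<open>\<open>Xij\<close> is the derivative of \<open>Xi\<close> in the j-th variable. The
  Lipschitz bounds on these derivatives make the error of the first variation quadratic in t. One
  constant serves all bounds, since only its existence matters in the end.\<close>

locale planar_field =
  fixes X1 X2 X11 X12 X21 X22 :: "real \<times> real \<Rightarrow> real" and L :: real
  assumes smooth_X: "smooth X1" "smooth X2"
    and dX1: "(X1 has_derivative (\<lambda>v. fst v * X11 p + snd v * X12 p)) (at p)"
    and dX2: "(X2 has_derivative (\<lambda>v. fst v * X21 p + snd v * X22 p)) (at p)"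
    and L1: "1 \<le> L"
    and bX: "\<bar>X1 p\<bar> \<le> L" "\<bar>X2 p\<bar> \<le> L"
    and bdX: "\<bar>X11 p\<bar> \<le> L" "\<bar>X12 p\<bar> \<le> L" "\<bar>X21 p\<bar> \<le> L" "\<bar>X22 p\<bar> \<le> L"
    and lipX: "\<bar>X11 p - X11 q\<bar> \<le> L * norm (p - q)" "\<bar>X12 p - X12 q\<bar> \<le> L * norm (p - q)"
      "\<bar>X21 p - X21 q\<bar> \<le> L * norm (p - q)" "\<bar>X22 p - X22 q\<bar> \<le> L * norm (p - q)"
begin

definition shift :: "real \<Rightarrow> real \<times> real \<Rightarrow> real \<times> real" where
  "shift t p = (fst p - t * X1 p, snd p - t * X2 p)"

definition Jac :: "real \<Rightarrow> real \<times> real \<Rightarrow> real" where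
  "Jac t p = (1 - t * X11 p) * (1 - t * X22 p) - (- t * X12 p) * (- t * X21 p)"

definition XD :: "(real \<times> real \<Rightarrow> complex) \<Rightarrow> real \<times> real \<Rightarrow> complex" where
  "XD \<phi> p = of_real (X1 p) * D1 \<phi> p + of_real (X2 p) * D2 \<phi> p"

lemma cont_dX: "continuous_on UNIV X11" "continuous_on UNIV X12" "continuous_on UNIV X21" "continuous_on UNIV X22"
proof -
  have "continuous_on UNIV f" if "\<And>p q. \<bar>f p - f q\<bar> \<le> L * norm (p - q)" for f :: "real \<times> real \<Rightarrow> real"
    using that L1 by (intro lipschitz_on_continuous_on[of L]) (auto simp: lipschitz_on_def dist_real_def dist_norm)
  then show "continuous_on UNIV X11" "continuous_on UNIV X12" "continuous_on UNIV X21" "continuous_on UNIV X22"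
    using lipX by auto
qed

lemma cont_X: "continuous_on UNIV X1" "continuous_on UNIV X2"
  using smooth_X smooth_continuous by auto

lemma lip_X: "\<bar>X1 p - X1 q\<bar> \<le> 2 * L * norm (p - q)" "\<bar>X2 p - X2 q\<bar> \<le> 2 * L * norm (p - q)"
  using lipschitz_of_partials[OF dX1 bdX(1,2)] lipschitz_of_partials[OF dX2 bdX(3,4)] by auto

lemma lip_pair: "norm ((X1 p - X1 q, X2 p - X2 q)) \<le> 4 * L * norm (p - q)"
  using lip_X[of p q] norm_real_pair_le[of "X1 p - X1 q" "X2 p - X2 q"] by simp

lemma shift_near: "0 \<le> t \<Longrightarrow> norm (shift t p - p) \<le> t * (2 * L)"
proof -
  assume t: "0 \<le> t"
  have "norm (shift t p - p) = norm (- t *\<^sub>R (X1 p, X2 p))" by (simp add: shift_def prod_eq_iff minus_prod_def)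
  also have "\<dots> = t * norm (X1 p, X2 p)" using t by (simp only: norm_scaleR) simp
  also have "\<dots> \<le> t * (2 * L)"
    using norm_real_pair_le[of "X1 p" "X2 p"] bX[of p] t by (intro mult_left_mono) auto
  finally show ?thesis .
qed

lemma smooth_shift: "smooth (shift t)"
proof -
  have 1: "smooth (\<lambda>p. f p *\<^sub>R v)" if "smooth f" for f :: "real \<times> real \<Rightarrow> real" and v :: "real \<times> real"
    by (intro smooth_on_scaleR that smooth_on_const) auto
  have "smooth (\<lambda>p. p - ((t * X1 p) *\<^sub>R (1, 0) + (t * X2 p) *\<^sub>R (0, 1)))"
    by (intro smooth_on_diff smooth_on_add 1 smooth_on_mult smooth_on_const smooth_X smooth_on_linear bounded_linear_ident) auto
  then show ?thesis by (simp add: shift_def[abs_def] minus_prod_def)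
qed

lemma shift_derivative:
  "(shift t has_derivative (\<lambda>v. (fst v * (1 - t * X11 p) + snd v * (- t * X12 p), fst v * (- t * X21 p) + snd v * (1 - t * X22 p)))) (at p)"
  unfolding shift_def[abs_def]
  by (auto intro!: derivative_eq_intros dX1 dX2 simp: fun_eq_iff algebra_simps)

lemma cont_shift: "continuous_on UNIV (shift t)"
  using smooth_continuous[OF smooth_shift] .

lemma cont_Jac: "continuous_on UNIV (Jac t)"
  unfolding Jac_def[abs_def] by (intro continuous_intros cont_dX)

text \<open>The field has Lipschitz constant at most 4 L, so up to this time t X contracts by 1/2
  and the Jacobian stays above 1/2.\<close>

definition t0 where "t0 = 1 / (8 * L)"

lemma small_t:
  assumes "0 \<le> t" "t \<le> t0"
  shows "t * L \<le> 1 / 8" "t \<le> 1" "\<bar>t * X11 p\<bar> \<le> t * L" "\<bar>t * X12 p\<bar> \<le> t * L" "\<bar>t * X21 p\<bar> \<le> t * L" "\<bar>t * X22 p\<bar> \<le> t * L"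
proof -
  show 1: "t * L \<le> 1 / 8" using assms L1 by (simp add: t0_def field_simps)
  have "t * 1 \<le> t * L" using assms L1 by (intro mult_left_mono) auto
  then show "t \<le> 1" using 1 by simp
  show "\<bar>t * X11 p\<bar> \<le> t * L" "\<bar>t * X12 p\<bar> \<le> t * L" "\<bar>t * X21 p\<bar> \<le> t * L" "\<bar>t * X22 p\<bar> \<le> t * L"
    using assms bdX[of p] by (auto simp: abs_mult intro!: mult_left_mono)
qed

lemma Jac_bounds:
  assumes "0 \<le> t" "t \<le> t0"
  shows "\<bar>Jac t p - 1\<bar> \<le> 4 * L\<^sup>2 * t" "1 / 2 \<le> Jac t p" "\<bar>Jac t p - 1\<bar> \<le> 3 * (t * L)"
proof -
  note s = small_t[OF assms]
  have 2: "\<bar>(t * X11 p) * (t * X22 p)\<bar> \<le> (t * L) * (t * L)" "\<bar>(t * X12 p) * (t * X21 p)\<bar> \<le> (t * L) * (t * L)"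
    unfolding abs_mult using s(3-6)[of p] assms L1 by (auto intro!: mult_mono simp: abs_mult)
  have e: "Jac t p - 1 = - (t * X11 p) - (t * X22 p) + (t * X11 p) * (t * X22 p) - (t * X12 p) * (t * X21 p)"
    by (simp add: Jac_def algebra_simps)
  have 3: "\<bar>Jac t p - 1\<bar> \<le> 2 * (t * L) + 2 * ((t * L) * (t * L))"
    unfolding e using 2 s(3)[of p] s(6)[of p] by linarith
  have "(t * L) * (t * L) \<le> (t * L) * (1 / 8)" using s(1) assms L1 by (intro mult_left_mono) auto
  then show 4: "\<bar>Jac t p - 1\<bar> \<le> 3 * (t * L)" using 3 by linarith
  then show "1 / 2 \<le> Jac t p" using s(1) by linarith
  have "t * L * 1 \<le> t * L * L" using assms L1 by (intro mult_left_mono) auto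
  then show "\<bar>Jac t p - 1\<bar> \<le> 4 * L\<^sup>2 * t" 
  proof -
    have "0 \<le> t * L * L" using assms L1 by simp
    then have "3 * (t * L) \<le> 4 * (t * L * L)" using \<open>t * L * 1 \<le> t * L * L\<close> by linarith
    then have "\<bar>Jac t p - 1\<bar> \<le> 4 * (t * L * L)" using 4 by linarith
    then show ?thesis by (simp add: power2_eq_square algebra_simps)
  qed
qed

text \<open>Surjectivity is the fixed point equation p = q + t X p.\<close>

lemma bij_shift:
  assumes "0 \<le> t" "t \<le> t0" shows "bij (shift t)"
proof -
  have tL: "t * (4 * L) \<le> 1 / 2" using small_t(1)[OF assms] by linarith
  have est: "norm (t *\<^sub>R (X1 p - X1 q, X2 p - X2 q)) \<le> 1 / 2 * norm (p - q)" for p q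
  proof -
    have "norm (t *\<^sub>R (X1 p - X1 q, X2 p - X2 q)) \<le> t * (4 * L * norm (p - q))"
      using lip_pair[of p q] assms(1) by (simp only: norm_scaleR abs_of_nonneg[OF assms(1)]) (intro mult_left_mono)
    also have "\<dots> \<le> 1 / 2 * norm (p - q)" using mult_right_mono[OF tL, of "norm (p - q)"] by (simp add: mult.assoc)
    finally show ?thesis .
  qed
  have "inj (shift t)"
  proof (rule injI)
    fix p q assume "shift t p = shift t q"
    then have "p - q = t *\<^sub>R (X1 p - X1 q, X2 p - X2 q)"
      by (auto simp: shift_def prod_eq_iff algebra_simps)
    then have "norm (p - q) \<le> 1 / 2 * norm (p - q)" using est[of p q] by simp
    then show "p = q" by simp
  qed
  moreover have "surj (shift t)"
  unfolding surj_def
  proof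
    fix q
    have "\<exists>!p. (\<lambda>p. q + t *\<^sub>R (X1 p, X2 p)) p = p"
    proof (rule banach_fix_type[of "1/2"])
      show "\<forall>x y. dist (q + t *\<^sub>R (X1 x, X2 x)) (q + t *\<^sub>R (X1 y, X2 y)) \<le> 1 / 2 * dist x y"
        using est by (simp add: dist_norm scaleR_diff_right[symmetric] del: scaleR_Pair)
    qed auto
    then obtain p where "q + t *\<^sub>R (X1 p, X2 p) = p" by blast
    then have "shift t p = q" by (auto simp: shift_def prod_eq_iff)
    then show "\<exists>p. q = shift t p" by blast
  qed
  ultimately show ?thesis by (simp add: bij_def)
qed

lemma integral_shift:
  fixes f :: "real \<times> real \<Rightarrow> real"
  assumes f: "cont_compact f" and t: "0 \<le> t" "t \<le> t0"
  shows "cont_compact (\<lambda>p. Jac t p * f (shift t p))" "(LINT p|lborel. Jac t p * f (shift t p)) = (LINT p|lborel. f p)"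
proof -
  show c: "cont_compact (\<lambda>p. Jac t p * f (shift t p))"
    by (intro cont_compact_mult cont_compact_compose_near[OF f cont_shift shift_near[OF t(1)]] cont_Jac)
  have "0 < Jac t p" for p using Jac_bounds(2)[OF t, of p] by linarith
  then show "(LINT p|lborel. Jac t p * f (shift t p)) = (LINT p|lborel. f p)"
    using integral_substitution_plane[OF f shift_derivative[of t] bij_shift[OF t]] c unfolding Jac_def by simp
qed

text \<open>The integral comparisons below start from pointwise inequalities of this form, which
  bound a value at p by values at its image; so the inverse map never appears.\<close>

lemma integral_le_shift:
  assumes "cont_compact G" "cont_compact H" "0 \<le> t" "t \<le> t0"
    and le: "\<And>p. H p \<le> Jac t p * G (shift t p)"
  shows "(LINT p|lborel. H p) \<le> (LINT p|lborel. G p)"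
  unfolding integral_shift(2)[OF assms(1,3,4), symmetric]
  by (intro integral_mono cont_compact_integrable assms integral_shift(1) le)

lemma partials_shift:
  assumes "smooth \<phi>"
  shows "D1 (\<lambda>p. \<phi> (shift t p)) p = (1 - t * X11 p) *\<^sub>R D1 \<phi> (shift t p) + (- t * X21 p) *\<^sub>R D2 \<phi> (shift t p)"
    "D2 (\<lambda>p. \<phi> (shift t p)) p = (- t * X12 p) *\<^sub>R D1 \<phi> (shift t p) + (1 - t * X22 p) *\<^sub>R D2 \<phi> (shift t p)"
proof -
  have "((\<lambda>p. \<phi> (shift t p)) has_derivative
     (\<lambda>v. fst v *\<^sub>R ((1 - t * X11 p) *\<^sub>R D1 \<phi> (shift t p) + (- t * X21 p) *\<^sub>R D2 \<phi> (shift t p))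
        + snd v *\<^sub>R ((- t * X12 p) *\<^sub>R D1 \<phi> (shift t p) + (1 - t * X22 p) *\<^sub>R D2 \<phi> (shift t p)))) (at p)"
    using has_derivative_compose[OF shift_derivative[of t p] smooth_partials[OF assms]]
    by (simp add: algebra_simps)
  from partials_eqI[OF this] show "D1 (\<lambda>p. \<phi> (shift t p)) p = (1 - t * X11 p) *\<^sub>R D1 \<phi> (shift t p) + (- t * X21 p) *\<^sub>R D2 \<phi> (shift t p)"
    "D2 (\<lambda>p. \<phi> (shift t p)) p = (- t * X12 p) *\<^sub>R D1 \<phi> (shift t p) + (1 - t * X22 p) *\<^sub>R D2 \<phi> (shift t p)" .
qed

lemma Cc_shift:
  assumes "\<phi> \<in> Cc_infinity \<Omega>" "0 \<le> t" "\<And>p. p \<notin> \<Omega> \<Longrightarrow> shift t p \<notin> \<Omega>"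
  shows "(\<lambda>p. \<phi> (shift t p)) \<in> Cc_infinity \<Omega>"
  by (rule Cc_compose[OF assms(1) smooth_shift shift_near[OF assms(2)] assms(3)])

end

lemma norm_real_combination:
  "(cmod (r *\<^sub>R a + s *\<^sub>R b))\<^sup>2 = r\<^sup>2 * (cmod a)\<^sup>2 + s\<^sup>2 * (cmod b)\<^sup>2 + 2 * r * s * Re (a * cnj b)"
proof -
  have "(cmod (r *\<^sub>R a + s *\<^sub>R b))\<^sup>2 = (Re (r *\<^sub>R a + s *\<^sub>R b))\<^sup>2 + (Im (r *\<^sub>R a + s *\<^sub>R b))\<^sup>2" by (rule cmod_power2)
  also have "\<dots> = r\<^sup>2 * ((Re a)\<^sup>2 + (Im a)\<^sup>2) + s\<^sup>2 * ((Re b)\<^sup>2 + (Im b)\<^sup>2) + 2 * r * s * Re (a * cnj b)"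
    by (simp add: power2_eq_square algebra_simps)
  finally show ?thesis by (simp add: cmod_power2)
qed

lemma abs_Re_mult_cnj_le: "2 * \<bar>Re (a * cnj b)\<bar> \<le> (cmod a)\<^sup>2 + (cmod b)\<^sup>2"
proof -
  have "\<bar>Re (a * cnj b)\<bar> \<le> cmod a * cmod b" using abs_Re_le_cmod[of "a * cnj b"] by (simp add: norm_mult)
  then show ?thesis using sum_squares_bound[of "cmod a" "cmod b"] by (simp add: mult.assoc)
qed

text \<open>
  The expansion to second order behind the first variation of the energy. Here
  \<open>\<alpha>, \<beta>, \<kappa>\<close> stand for \<open>|\<phi>\<^sub>1|\<^sup>2, |\<phi>\<^sub>2|\<^sup>2, |\<phi>|\<^sup>2\<close> and \<open>\<gamma>\<close> for \<open>Re \<phi>\<^sub>1 \<phi>\<^sub>2\<close> (conjugated) at the image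
  point, \<open>x\<close> and \<open>y\<close> for the derivative of the field at the point and its image.
\<close>
lemma variation_pointwise:
  fixes \<alpha> \<beta> \<gamma> \<kappa> E t L :: real
  assumes nn: "0 \<le> \<alpha>" "0 \<le> \<beta>" "0 \<le> \<kappa>" "2 * \<bar>\<gamma>\<bar> \<le> \<alpha> + \<beta>" and E: "0 \<le> E" and L: "1 \<le> L" and t: "0 \<le> t" "t \<le> 1"
    and x: "\<bar>x11\<bar> \<le> L" "\<bar>x12\<bar> \<le> L" "\<bar>x21\<bar> \<le> L" "\<bar>x22\<bar> \<le> L"
    and y: "\<bar>y11\<bar> \<le> L" "\<bar>y12\<bar> \<le> L" "\<bar>y21\<bar> \<le> L" "\<bar>y22\<bar> \<le> L"
    and xy: "\<bar>x11 - y11\<bar> \<le> 2 * L\<^sup>2 * t" "\<bar>x12 - y12\<bar> \<le> 2 * L\<^sup>2 * t" "\<bar>x21 - y21\<bar> \<le> 2 * L\<^sup>2 * t" "\<bar>x22 - y22\<bar> \<le> 2 * L\<^sup>2 * t"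
    and J: "J = (1 - t * x11) * (1 - t * x22) - (- t * x12) * (- t * x21)" "1 / 2 \<le> J" "\<bar>J - 1\<bar> \<le> 4 * L\<^sup>2 * t"
    and H: "H = (1 - t * x11)\<^sup>2 * \<alpha> + (- t * x21)\<^sup>2 * \<beta> + 2 * (1 - t * x11) * (- t * x21) * \<gamma>
       + ((- t * x12)\<^sup>2 * \<alpha> + (1 - t * x22)\<^sup>2 * \<beta> + 2 * (- t * x12) * (1 - t * x22) * \<gamma>) - E * \<kappa>"
    and q: "q = 2 * (y11 * \<alpha> + y22 * \<beta> + (y12 + y21) * \<gamma>) - (y11 + y22) * (\<alpha> + \<beta> - E * \<kappa>)"
  shows "H \<le> J * ((\<alpha> + \<beta> - E * \<kappa>) - t * q + L ^ 3 * (84 + 28 * E) * t\<^sup>2 * (\<alpha> + \<beta> + \<kappa>))"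
proof -
  define S where "S = \<alpha> + \<beta> + \<kappa>"
  define A where "A = \<alpha> + \<beta> - E * \<kappa>"
  define Q where "Q x11 x12 x21 x22 = x11 * \<alpha> + x22 * \<beta> + (x12 + x21) * \<gamma>" for x11 x12 x21 x22
  define d where "d = x11 * x22 - x12 * x21"
  define r where "r = (x11\<^sup>2 + x12\<^sup>2) * \<alpha> + (x21\<^sup>2 + x22\<^sup>2) * \<beta> + 2 * (x21 * x11 + x12 * x22) * \<gamma>"
  have S: "0 \<le> S" "\<alpha> + \<beta> \<le> S" using nn by (auto simp: S_def)
  have A: "\<bar>A\<bar> \<le> (1 + E) * S"
  proof -
    have "E * \<kappa> \<le> E * S" using E nn by (intro mult_left_mono) (auto simp: S_def)
    moreover have "0 \<le> E * \<kappa>" using E nn by simp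
    moreover have "E * S \<ge> 0" using E S by simp
    ultimately show ?thesis using S nn unfolding A_def abs_le_iff by (simp add: algebra_simps)
  qed
  have Qb: "\<bar>Q u11 u12 u21 u22\<bar> \<le> 2 * m * S" if "\<bar>u11\<bar> \<le> m" "\<bar>u12\<bar> \<le> m" "\<bar>u21\<bar> \<le> m" "\<bar>u22\<bar> \<le> m" for u11 u12 u21 u22 m
  proof -
    have m: "0 \<le> m" using that by linarith
    have "\<bar>u11 * \<alpha>\<bar> \<le> m * \<alpha>" "\<bar>u22 * \<beta>\<bar> \<le> m * \<beta>" using that nn by (auto simp: abs_mult intro!: mult_right_mono)
    moreover have "\<bar>(u12 + u21) * \<gamma>\<bar> \<le> (2 * m) * ((\<alpha> + \<beta>) / 2)"
      unfolding abs_mult using that nn m by (intro mult_mono) auto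
    ultimately have "\<bar>Q u11 u12 u21 u22\<bar> \<le> 2 * m * (\<alpha> + \<beta>)" unfolding Q_def abs_le_iff by (simp add: algebra_simps)
    also have "\<dots> \<le> 2 * m * S" using S m by (intro mult_left_mono) auto
    finally show ?thesis .
  qed
  have Qd: "\<bar>Q x11 x12 x21 x22 - Q y11 y12 y21 y22\<bar> \<le> 4 * L\<^sup>2 * t * S"
  proof -
    have "Q x11 x12 x21 x22 - Q y11 y12 y21 y22 = Q (x11 - y11) (x12 - y12) (x21 - y21) (x22 - y22)"
      by (simp add: Q_def algebra_simps)
    then show ?thesis using Qb[OF xy] by simp
  qed
  have L2: "L\<^sup>2 \<le> L ^ 3" "1 \<le> L\<^sup>2" "0 \<le> L\<^sup>2" "L \<le> L ^ 3" "0 \<le> L ^ 3"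
    using L by (auto intro: power_increasing simp: one_le_power) (use power_increasing[of 1 3 L] in simp)
  have prod2: "\<bar>u * v\<bar> \<le> L\<^sup>2" if "\<bar>u\<bar> \<le> L" "\<bar>v\<bar> \<le> L" for u v
    using mult_mono[OF that] L by (simp add: abs_mult power2_eq_square)
  have sq: "u\<^sup>2 \<le> L\<^sup>2" if "\<bar>u\<bar> \<le> L" for u using prod2[OF that that] by (simp add: power2_eq_square)
  have db: "\<bar>d\<bar> \<le> 2 * L\<^sup>2" unfolding d_def using prod2[OF x(1) x(4)] prod2[OF x(2) x(3)] by linarith
  have rb: "\<bar>r\<bar> \<le> 4 * L\<^sup>2 * S"
  proof -
    have "(x11\<^sup>2 + x12\<^sup>2) * \<alpha> \<le> 2 * L\<^sup>2 * \<alpha>" "(x21\<^sup>2 + x22\<^sup>2) * \<beta> \<le> 2 * L\<^sup>2 * \<beta>"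
      using sq[OF x(1)] sq[OF x(2)] sq[OF x(3)] sq[OF x(4)] nn by (auto intro!: mult_right_mono)
    moreover have "0 \<le> (x11\<^sup>2 + x12\<^sup>2) * \<alpha>" "0 \<le> (x21\<^sup>2 + x22\<^sup>2) * \<beta>" using nn by auto
    moreover have "\<bar>(x21 * x11 + x12 * x22) * (2 * \<gamma>)\<bar> \<le> (2 * L\<^sup>2) * (\<alpha> + \<beta>)"
      unfolding abs_mult using prod2[OF x(3) x(1)] prod2[OF x(2) x(4)] nn by (intro mult_mono) auto
    ultimately have "\<bar>r\<bar> \<le> 4 * L\<^sup>2 * (\<alpha> + \<beta>)" unfolding r_def abs_le_iff by (simp add: algebra_simps)
    also have "\<dots> \<le> 4 * L\<^sup>2 * S" using S by (intro mult_left_mono) auto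
    finally show ?thesis .
  qed
  have qb: "\<bar>q\<bar> \<le> L * (6 + 2 * E) * S"
  proof -
    have "q = 2 * Q y11 y12 y21 y22 - (y11 + y22) * A" by (simp add: q Q_def A_def)
    moreover have "\<bar>(y11 + y22) * A\<bar> \<le> (2 * L) * ((1 + E) * S)"
      unfolding abs_mult using y A L by (intro mult_mono) auto
    ultimately show ?thesis using Qb[OF y] unfolding abs_le_iff by (simp add: algebra_simps)
  qed
  have tr: "\<bar>((y11 + y22) - (x11 + x22)) * A\<bar> \<le> (4 * L\<^sup>2 * t) * ((1 + E) * S)"
    unfolding abs_mult using xy A t L2 by (intro mult_mono) auto
  have dA: "\<bar>d * A\<bar> \<le> (2 * L\<^sup>2) * ((1 + E) * S)"
    unfolding abs_mult using db A L2 by (intro mult_mono) auto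
  have qJ: "\<bar>q * (J - 1)\<bar> \<le> (L * (6 + 2 * E) * S) * (4 * L\<^sup>2 * t)"
    unfolding abs_mult using qb J(3) E L S by (intro mult_mono) auto
  \<comment> \<open>All else cancels. Each of the five terms is O(t^2) times S; for the first two
    this is because the derivatives of the field at a point and at its image differ by O(t).\<close>
  have id: "J * (A - t * q) - H = t * (((y11 + y22) - (x11 + x22)) * A) + t * (2 * (Q x11 x12 x21 x22 - Q y11 y12 y21 y22))
      + t\<^sup>2 * (d * A) - t * (q * (J - 1)) - t\<^sup>2 * r"
    unfolding H J(1) q A_def Q_def d_def r_def by (simp add: power2_eq_square algebra_simps)
  have m: "t * u \<ge> - (t * v)" if "\<bar>u\<bar> \<le> v" for u v
    using mult_left_mono[of "-v" u t] that t by (simp add: abs_le_iff)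
  have m2: "t\<^sup>2 * u \<ge> - (t\<^sup>2 * v)" "- (t\<^sup>2 * u) \<ge> - (t\<^sup>2 * v)" if "\<bar>u\<bar> \<le> v" for u v
    using mult_left_mono[of "-v" u "t\<^sup>2"] mult_left_mono[of u v "t\<^sup>2"] that by (simp_all add: abs_le_iff)
  have m3: "- (t * u) \<ge> - (t * v)" if "\<bar>u\<bar> \<le> v" for u v
    using mult_left_mono[of u v t] that t by (simp add: abs_le_iff)
  have "J * (A - t * q) - H \<ge> - (t * ((4 * L\<^sup>2 * t) * ((1 + E) * S))) - t * (2 * (4 * L\<^sup>2 * t * S))
      - t\<^sup>2 * ((2 * L\<^sup>2) * ((1 + E) * S)) - t * ((L * (6 + 2 * E) * S) * (4 * L\<^sup>2 * t)) - t\<^sup>2 * (4 * L\<^sup>2 * S)"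
  proof -
    have "\<bar>2 * (Q x11 x12 x21 x22 - Q y11 y12 y21 y22)\<bar> \<le> 2 * (4 * L\<^sup>2 * t * S)" using Qd by (simp add: abs_mult)
    from m[OF this] show ?thesis
      unfolding id using m[OF tr] m2(1)[OF dA] m3[OF qJ] m2(2)[OF rb] by linarith
  qed
  also have "- (t * ((4 * L\<^sup>2 * t) * ((1 + E) * S))) - t * (2 * (4 * L\<^sup>2 * t * S))
      - t\<^sup>2 * ((2 * L\<^sup>2) * ((1 + E) * S)) - t * ((L * (6 + 2 * E) * S) * (4 * L\<^sup>2 * t)) - t\<^sup>2 * (4 * L\<^sup>2 * S)
     = - (t\<^sup>2 * S * (L\<^sup>2 * (18 + 6 * E) + L ^ 3 * (24 + 8 * E)))"
    by (simp add: power2_eq_square power3_eq_cube algebra_simps)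
  finally have 1: "H \<le> J * (A - t * q) + t\<^sup>2 * S * (L\<^sup>2 * (18 + 6 * E) + L ^ 3 * (24 + 8 * E))" by linarith
  have "L\<^sup>2 * (18 + 6 * E) + L ^ 3 * (24 + 8 * E) \<le> L ^ 3 * (18 + 6 * E) + L ^ 3 * (24 + 8 * E)"
    using L2 E by (intro add_right_mono mult_right_mono) auto
  \<comment> \<open>The error constant 42 + 14 E is doubled so that the Jacobian factor, at least
    1/2, can absorb it.\<close>
  also have "\<dots> = 1 / 2 * (L ^ 3 * (84 + 28 * E))" by (simp add: algebra_simps)
  also have "\<dots> \<le> J * (L ^ 3 * (84 + 28 * E))" using J(2) E L2 by (intro mult_right_mono) auto
  finally have "t\<^sup>2 * S * (L\<^sup>2 * (18 + 6 * E) + L ^ 3 * (24 + 8 * E)) \<le> t\<^sup>2 * S * (J * (L ^ 3 * (84 + 28 * E)))"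
    using S by (intro mult_left_mono) auto
  with 1 have "H \<le> J * (A - t * q) + t\<^sup>2 * S * (J * (L ^ 3 * (84 + 28 * E)))" by linarith
  then show ?thesis by (simp add: A_def S_def algebra_simps)
qed

section \<open>Energy, mass and their change under \<open>shift\<close>\<close>

definition Dir :: "(real \<times> real \<Rightarrow> complex) \<Rightarrow> real" where
  "Dir \<phi> = (LINT p|lborel. (cmod (D1 \<phi> p))\<^sup>2 + (cmod (D2 \<phi> p))\<^sup>2)"

definition mass :: "(real \<times> real \<Rightarrow> complex) \<Rightarrow> real" where
  "mass \<phi> = (LINT p|lborel. (cmod (\<phi> p))\<^sup>2)"

lemma Cc_cc:
  assumes "\<phi> \<in> Cc_infinity \<Omega>"
  shows "cont_compact (\<lambda>p. (cmod (\<phi> p))\<^sup>2)" "cont_compact (\<lambda>p. (cmod (D1 \<phi> p))\<^sup>2)" "cont_compact (\<lambda>p. (cmod (D2 \<phi> p))\<^sup>2)"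
    "cont_compact (\<lambda>p. Re (D1 \<phi> p * cnj (D2 \<phi> p)))" "cont_compact (\<lambda>p. Re (D1 \<phi> p * cnj (\<phi> p)))"
  using assms by (intro cont_compact_norm2 cont_compact_Re_cnj Cc_cont_compact[of _ \<Omega>] Cc_D1 Cc_D2; assumption)+

lemma cont_compact_cmult: "cont_compact f \<Longrightarrow> cont_compact (\<lambda>x. c * f x)" for f :: "'a::euclidean_space \<Rightarrow> real"
  by (rule cont_compact_mult) auto

lemma cont_compact_uminus: "cont_compact f \<Longrightarrow> cont_compact (\<lambda>x. - f x)" for f :: "'a::euclidean_space \<Rightarrow> real"
  using cont_compact_cmult[of f "-1"] by simp

lemma cont_compact_diff: "cont_compact f \<Longrightarrow> cont_compact g \<Longrightarrow> cont_compact (\<lambda>x. f x - g x)"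
  for f g :: "'a::euclidean_space \<Rightarrow> real"
  using cont_compact_add[OF _ cont_compact_uminus] by fastforce

lemmas cc_intros = cont_compact_add cont_compact_diff cont_compact_mult cont_compact_cmult

lemma Dir_nonneg: "0 \<le> Dir \<phi>" unfolding Dir_def by (rule integral_nonneg_AE) simp
lemma mass_nonneg: "0 \<le> mass \<phi>" unfolding mass_def by (rule integral_nonneg_AE) simp

lemma norm_add_squared_le': "(cmod a + cmod b)\<^sup>2 \<le> 2 * ((cmod a)\<^sup>2 + (cmod b)\<^sup>2)"
  using sum_squares_bound[of "cmod a" "cmod b"] by (simp add: power2_sum)

context planar_field
begin

text \<open>The derivative of the field contracted with the energy-momentum tensor of |grad
  \<phi>|^2 - E |\<phi>|^2; minus its integral is the first variation of the energy.\<close>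

definition qdens :: "real \<Rightarrow> (real \<times> real \<Rightarrow> complex) \<Rightarrow> real \<times> real \<Rightarrow> real" where
  "qdens E \<phi> p = 2 * (X11 p * (cmod (D1 \<phi> p))\<^sup>2 + X22 p * (cmod (D2 \<phi> p))\<^sup>2 + (X12 p + X21 p) * Re (D1 \<phi> p * cnj (D2 \<phi> p)))
     - (X11 p + X22 p) * ((cmod (D1 \<phi> p))\<^sup>2 + (cmod (D2 \<phi> p))\<^sup>2 - E * (cmod (\<phi> p))\<^sup>2)"

lemma cc_qdens: "\<phi> \<in> Cc_infinity \<Omega> \<Longrightarrow> cont_compact (qdens E \<phi>)"
  unfolding qdens_def[abs_def]
  by (intro cc_intros Cc_cc continuous_intros cont_dX) 

lemma shift_dist:
  assumes "0 \<le> t" "\<And>p q. \<bar>f p - f q\<bar> \<le> L * norm (p - q)"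
  shows "\<bar>f p - f (shift t p)\<bar> \<le> 2 * L\<^sup>2 * t"
proof -
  have "\<bar>f p - f (shift t p)\<bar> \<le> L * norm (p - shift t p)" by (rule assms)
  also have "\<dots> \<le> L * (t * (2 * L))"
    using shift_near[OF assms(1), of p] L1 by (intro mult_left_mono) (auto simp: norm_minus_commute)
  finally show ?thesis by (simp add: power2_eq_square algebra_simps)
qed

text \<open>An upper bound is the useful direction: in \<open>rellich_finite\<close> it meets the
  exact expansion of the same energy as a quadratic form in \<phi> and the difference
  \<eta>.\<close>

lemma energy_variation:
  assumes \<phi>: "\<phi> \<in> Cc_infinity UNIV" and t: "0 \<le> t" "t \<le> t0" and E: "0 \<le> E"
  shows "Dir (\<lambda>p. \<phi> (shift t p)) - E * mass (\<lambda>p. \<phi> (shift t p))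
    \<le> Dir \<phi> - E * mass \<phi> - t * (LINT p|lborel. qdens E \<phi> p) + L ^ 3 * (84 + 28 * E) * t\<^sup>2 * (Dir \<phi> + mass \<phi>)"
proof -
  define \<psi> where "\<psi> p = \<phi> (shift t p)" for p
  have \<psi>: "\<psi> \<in> Cc_infinity UNIV" unfolding \<psi>_def[abs_def] by (rule Cc_shift[OF \<phi> t(1)]) simp
  note int = Cc_cc[OF \<phi>, THEN cont_compact_integrable] Cc_cc[OF \<psi>, THEN cont_compact_integrable]
    cc_qdens[OF \<phi>, THEN cont_compact_integrable]
  define G where "G p = ((cmod (D1 \<phi> p))\<^sup>2 + (cmod (D2 \<phi> p))\<^sup>2 - E * (cmod (\<phi> p))\<^sup>2) - t * qdens E \<phi> p
     + L ^ 3 * (84 + 28 * E) * t\<^sup>2 * ((cmod (D1 \<phi> p))\<^sup>2 + (cmod (D2 \<phi> p))\<^sup>2 + (cmod (\<phi> p))\<^sup>2)" for p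
  define H where "H p = (cmod (D1 \<psi> p))\<^sup>2 + (cmod (D2 \<psi> p))\<^sup>2 - E * (cmod (\<psi> p))\<^sup>2" for p
  have ccG: "cont_compact G" unfolding G_def[abs_def] by (intro cc_intros Cc_cc[OF \<phi>] cc_qdens[OF \<phi>])
  have ccH: "cont_compact H" unfolding H_def[abs_def] by (intro cc_intros Cc_cc[OF \<psi>])
  have "(LINT p|lborel. H p) \<le> (LINT p|lborel. G p)"
  proof (rule integral_le_shift[OF ccG ccH t])
    fix p
    define p' where "p' = shift t p"
    note d = partials_shift[OF Cc_smooth[OF \<phi>], of t p, folded \<psi>_def p'_def]
    have Heq: "H p = (1 - t * X11 p)\<^sup>2 * (cmod (D1 \<phi> p'))\<^sup>2 + (- t * X21 p)\<^sup>2 * (cmod (D2 \<phi> p'))\<^sup>2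
         + 2 * (1 - t * X11 p) * (- t * X21 p) * Re (D1 \<phi> p' * cnj (D2 \<phi> p'))
       + ((- t * X12 p)\<^sup>2 * (cmod (D1 \<phi> p'))\<^sup>2 + (1 - t * X22 p)\<^sup>2 * (cmod (D2 \<phi> p'))\<^sup>2
         + 2 * (- t * X12 p) * (1 - t * X22 p) * Re (D1 \<phi> p' * cnj (D2 \<phi> p'))) - E * (cmod (\<phi> p'))\<^sup>2"
      unfolding H_def d norm_real_combination by (simp add: \<psi>_def p'_def)
    show "H p \<le> Jac t p * G (shift t p)"
      unfolding G_def p'_def[symmetric]
      by (rule variation_pointwise[OF _ _ _ _ E L1 t(1) small_t(2)[OF t] bdX[of p] bdX[of p'] _ _ _ _ Jac_def Jac_bounds(2,1)[OF t] Heq])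
        (use abs_Re_mult_cnj_le shift_dist[OF t(1) lipX(1)] shift_dist[OF t(1) lipX(2)] shift_dist[OF t(1) lipX(3)]
           shift_dist[OF t(1) lipX(4)] in \<open>auto simp: p'_def qdens_def\<close>)
  qed
  moreover have "(LINT p|lborel. H p) = Dir \<psi> - E * mass \<psi>"
    unfolding H_def Dir_def mass_def using int by simp
  moreover have "(LINT p|lborel. G p) = Dir \<phi> - E * mass \<phi> - t * (LINT p|lborel. qdens E \<phi> p) + L ^ 3 * (84 + 28 * E) * t\<^sup>2 * (Dir \<phi> + mass \<phi>)"
    unfolding G_def Dir_def mass_def using int by (simp add: algebra_simps)
  ultimately show ?thesis unfolding \<psi>_def[abs_def] by simp
qed

text \<open>Boundedness of the composition in the form norm, uniformly in t. Crude constants do, as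
  its purpose is that form-Cauchy sequences stay form-Cauchy.\<close>

lemma shift_bounded:
  assumes \<phi>: "\<phi> \<in> Cc_infinity UNIV" and t: "0 \<le> t" "t \<le> t0"
  shows "mass (\<lambda>p. \<phi> (shift t p)) \<le> 2 * mass \<phi>" "Dir (\<lambda>p. \<phi> (shift t p)) \<le> 8 * Dir \<phi>"
proof -
  define \<psi> where "\<psi> p = \<phi> (shift t p)" for p
  have \<psi>: "\<psi> \<in> Cc_infinity UNIV" unfolding \<psi>_def[abs_def] by (rule Cc_shift[OF \<phi> t(1)]) simp
  have J: "u \<le> Jac t p * (2 * u)" if "0 \<le> u" for u p
    using mult_right_mono[OF Jac_bounds(2)[OF t, of p], of "2 * u"] that by simp
  have "(LINT p|lborel. (cmod (\<psi> p))\<^sup>2) \<le> (LINT p|lborel. 2 * (cmod (\<phi> p))\<^sup>2)"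
  proof (rule integral_le_shift[OF _ _ t])
    show "(cmod (\<psi> p))\<^sup>2 \<le> Jac t p * (2 * (cmod (\<phi> (shift t p)))\<^sup>2)" for p by (simp only: \<psi>_def) (rule J, simp)
  qed (intro cc_intros Cc_cc[OF \<phi>] Cc_cc[OF \<psi>])+
  then show "mass (\<lambda>p. \<phi> (shift t p)) \<le> 2 * mass \<phi>" by (simp add: mass_def \<psi>_def)
  have "(LINT p|lborel. (cmod (D1 \<psi> p))\<^sup>2 + (cmod (D2 \<psi> p))\<^sup>2) \<le> (LINT p|lborel. 8 * ((cmod (D1 \<phi> p))\<^sup>2 + (cmod (D2 \<phi> p))\<^sup>2))"
  proof (rule integral_le_shift[OF _ _ t])
    fix p
    define a where "a = cmod (D1 \<phi> (shift t p))"
    define b where "b = cmod (D2 \<phi> (shift t p))"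
    note d = partials_shift[OF Cc_smooth[OF \<phi>], of t p, folded \<psi>_def]
    note s = small_t(1)[OF t] small_t(3-6)[OF t, of p]
    have est: "(cmod (r *\<^sub>R z + u *\<^sub>R w))\<^sup>2 \<le> 2 * (r\<^sup>2 * (cmod z)\<^sup>2 + u\<^sup>2 * (cmod w)\<^sup>2)" for r u z w
      using norm_add_squared_le[of "r *\<^sub>R z" "u *\<^sub>R w"] by (simp add: power_mult_distrib)
    have sq: "u\<^sup>2 \<le> m\<^sup>2" if "\<bar>u\<bar> \<le> m" for u m :: real using that by (rule power2_le_iff_abs_le[THEN iffD2, rotated]) (use that in linarith)
    have c: "(1 - t * X11 p)\<^sup>2 \<le> (9/8)\<^sup>2" "(1 - t * X22 p)\<^sup>2 \<le> (9/8)\<^sup>2" "(- t * X12 p)\<^sup>2 \<le> (1/8)\<^sup>2" "(- t * X21 p)\<^sup>2 \<le> (1/8)\<^sup>2"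
      using s by (auto intro!: sq simp: abs_le_iff)
    have "(cmod (D1 \<psi> p))\<^sup>2 \<le> 2 * ((9/8)\<^sup>2 * a\<^sup>2 + (1/8)\<^sup>2 * b\<^sup>2)"
      unfolding d a_def b_def by (rule order_trans[OF est]) (intro mult_left_mono add_mono mult_right_mono c, auto)
    moreover have "(cmod (D2 \<psi> p))\<^sup>2 \<le> 2 * ((1/8)\<^sup>2 * a\<^sup>2 + (9/8)\<^sup>2 * b\<^sup>2)"
      unfolding d a_def b_def by (rule order_trans[OF est]) (intro mult_left_mono add_mono mult_right_mono c, auto)
    ultimately have e1: "(cmod (D1 \<psi> p))\<^sup>2 \<le> 2 * ((9/8)\<^sup>2 * a\<^sup>2 + (1/8)\<^sup>2 * b\<^sup>2)"
      "(cmod (D2 \<psi> p))\<^sup>2 \<le> 2 * ((1/8)\<^sup>2 * a\<^sup>2 + (9/8)\<^sup>2 * b\<^sup>2)" by auto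
    have "(cmod (D1 \<psi> p))\<^sup>2 + (cmod (D2 \<psi> p))\<^sup>2 \<le> 4 * (a\<^sup>2 + b\<^sup>2)"
    proof -
      have "u + v \<le> 4 * (x + y)" if "u \<le> 2 * ((9/8)\<^sup>2 * x + (1/8)\<^sup>2 * y)" "v \<le> 2 * ((1/8)\<^sup>2 * x + (9/8)\<^sup>2 * y)" "0 \<le> x" "0 \<le> y" for u v x y :: real
        using that by (simp add: power_divide)
      from this[OF e1] show ?thesis by simp
    qed
    also have "\<dots> \<le> Jac t p * (2 * (4 * (a\<^sup>2 + b\<^sup>2)))" by (rule J) simp
    finally show "(cmod (D1 \<psi> p))\<^sup>2 + (cmod (D2 \<psi> p))\<^sup>2 \<le> Jac t p * (8 * ((cmod (D1 \<phi> (shift t p)))\<^sup>2 + (cmod (D2 \<phi> (shift t p)))\<^sup>2))"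
      by (simp add: a_def b_def)
  qed (intro cc_intros Cc_cc[OF \<phi>] Cc_cc[OF \<psi>])+
  then have "Dir \<psi> \<le> 8 * Dir \<phi>" unfolding Dir_def by (simp only: integral_mult_right_zero)
  then show "Dir (\<lambda>p. \<phi> (shift t p)) \<le> 8 * Dir \<phi>" by (simp only: \<psi>_def[abs_def])
qed

text \<open>Minus the s-derivative of \<phi> (shift s p). The field is taken at p and the gradient
  at the image, so this is not \<open>XD \<phi>\<close> at the image; \<open>speed_estimate\<close>
  bounds the cost of the difference.\<close>

definition speed :: "(real \<times> real \<Rightarrow> complex) \<Rightarrow> real \<Rightarrow> real \<times> real \<Rightarrow> complex" where
  "speed \<phi> s p = of_real (X1 p) * D1 \<phi> (shift s p) + of_real (X2 p) * D2 \<phi> (shift s p)"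

text \<open>Passing from p to its image changes the field, the weight \<rho> and the Jacobian by
  O(s) each. The error is measured by the Dirichlet integral without weight, which is harmless
  because s will be small.\<close>

lemma speed_estimate:
  assumes \<phi>: "\<phi> \<in> Cc_infinity UNIV" and s: "0 \<le> s" "s \<le> t0"
    and \<rho>: "\<And>p. 0 \<le> \<rho> p" "\<And>p. \<rho> p \<le> 1" "\<And>p q. \<bar>\<rho> p - \<rho> q\<bar> \<le> L * norm (p - q)"
  shows "cont_compact (\<lambda>p. (\<rho> p * cmod (speed \<phi> s p))\<^sup>2)"
    "(LINT p|lborel. (\<rho> p * cmod (speed \<phi> s p))\<^sup>2) \<le> (LINT p|lborel. (\<rho> p * cmod (XD \<phi> p))\<^sup>2) + 64 * L ^ 4 * s * Dir \<phi>"
proof -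
  have c\<rho>: "continuous_on UNIV \<rho>"
    using \<rho>(3) L1 by (intro lipschitz_on_continuous_on[of L]) (auto simp: lipschitz_on_def dist_real_def dist_norm)
  have cX: "continuous_on UNIV (\<lambda>p. complex_of_real (X1 p))" "continuous_on UNIV (\<lambda>p. complex_of_real (X2 p))"
    by (intro continuous_intros cont_X)+
  have ccsq: "cont_compact (\<lambda>p. (\<rho> p * cmod (f p))\<^sup>2)" if "cont_compact f" for f :: "real \<times> real \<Rightarrow> complex"
    unfolding power_mult_distrib by (intro cont_compact_mult cont_compact_norm2 that continuous_intros c\<rho>)
  have "cont_compact (speed \<phi> s)" unfolding speed_def[abs_def]
    by (intro cont_compact_add cont_compact_mult cX cont_compact_compose_near[OF _ cont_shift shift_near[OF s(1)]]
      Cc_cont_compact[of _ UNIV] Cc_D1 Cc_D2 \<phi>)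
  then show cc: "cont_compact (\<lambda>p. (\<rho> p * cmod (speed \<phi> s p))\<^sup>2)" by (rule ccsq)
  have "cont_compact (XD \<phi>)" unfolding XD_def[abs_def]
    by (intro cont_compact_add cont_compact_mult cX Cc_cont_compact[of _ UNIV] Cc_D1 Cc_D2 \<phi>)
  then have ccX: "cont_compact (\<lambda>p. (\<rho> p * cmod (XD \<phi> p))\<^sup>2)" by (rule ccsq)
  have "(LINT p|lborel. (\<rho> p * cmod (speed \<phi> s p))\<^sup>2)
     \<le> (LINT p|lborel. (\<rho> p * cmod (XD \<phi> p))\<^sup>2 + 64 * L ^ 4 * s * ((cmod (D1 \<phi> p))\<^sup>2 + (cmod (D2 \<phi> p))\<^sup>2))"
  proof (rule integral_le_shift[OF _ cc s])
    show "cont_compact (\<lambda>p. (\<rho> p * cmod (XD \<phi> p))\<^sup>2 + 64 * L ^ 4 * s * ((cmod (D1 \<phi> p))\<^sup>2 + (cmod (D2 \<phi> p))\<^sup>2))"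
      by (intro cc_intros ccX Cc_cc[OF \<phi>])
    fix p
    define p' where "p' = shift s p"
    define a where "a = D1 \<phi> p'"
    define b where "b = D2 \<phi> p'"
    define N where "N = cmod a + cmod b"
    define v where "v = speed \<phi> s p"
    define v' where "v' = XD \<phi> p'"
    have N: "0 \<le> N" "N\<^sup>2 \<le> 2 * ((cmod a)\<^sup>2 + (cmod b)\<^sup>2)"
      using norm_add_squared_le'[of a b] by (auto simp: N_def)
    have lin: "cmod (of_real r * a + of_real u * b) \<le> m * N" if "\<bar>r\<bar> \<le> m" "\<bar>u\<bar> \<le> m" for r u m
    proof -
      have "cmod (of_real r * a + of_real u * b) \<le> \<bar>r\<bar> * cmod a + \<bar>u\<bar> * cmod b"
        by (rule order_trans[OF norm_triangle_ineq]) (simp add: norm_mult)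
      also have "\<dots> \<le> m * cmod a + m * cmod b" by (intro add_mono mult_right_mono that) auto
      finally show ?thesis by (simp add: N_def distrib_left)
    qed
    have v: "cmod v \<le> L * N" unfolding v_def speed_def p'_def[symmetric] a_def[symmetric] b_def[symmetric] by (intro lin bX)
    have v': "cmod v' \<le> L * N" unfolding v'_def XD_def a_def[symmetric] b_def[symmetric] by (intro lin bX)
    have near: "norm (p - p') \<le> 2 * L * s" using shift_near[OF s(1), of p] by (simp add: p'_def norm_minus_commute algebra_simps)
    have xx: "\<bar>X1 p - X1 p'\<bar> \<le> 4 * L\<^sup>2 * s" "\<bar>X2 p - X2 p'\<bar> \<le> 4 * L\<^sup>2 * s"
    proof -
      have "2 * L * norm (p - p') \<le> 2 * L * (2 * L * s)" using near L1 by (intro mult_left_mono) auto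
      also have "\<dots> = 4 * L\<^sup>2 * s" by (simp add: power2_eq_square)
      finally show "\<bar>X1 p - X1 p'\<bar> \<le> 4 * L\<^sup>2 * s" "\<bar>X2 p - X2 p'\<bar> \<le> 4 * L\<^sup>2 * s"
        using lip_X(1)[of p p'] lip_X(2)[of p p'] by linarith+
    qed
    have "v - v' = of_real (X1 p - X1 p') * a + of_real (X2 p - X2 p') * b"
      unfolding v_def speed_def v'_def XD_def p'_def[symmetric] a_def[symmetric] b_def[symmetric] by (simp add: algebra_simps)
    then have vv: "cmod (v - v') \<le> (4 * L\<^sup>2 * s) * N" using lin[OF xx] by simp
    have rr: "\<bar>\<rho> p - \<rho> p'\<bar> \<le> 2 * L\<^sup>2 * s" unfolding p'_def by (rule shift_dist[OF s(1) \<rho>(3)])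
    have "\<rho> p * cmod v - \<rho> p' * cmod v' = (\<rho> p - \<rho> p') * cmod v + \<rho> p' * (cmod v - cmod v')" by (simp add: algebra_simps)
    also have "\<dots> \<le> (2 * L\<^sup>2 * s) * (L * N) + 1 * (4 * L\<^sup>2 * s * N)"
    proof (intro add_mono)
      show "(\<rho> p - \<rho> p') * cmod v \<le> (2 * L\<^sup>2 * s) * (L * N)"
        using rr v L1 s by (intro mult_mono) auto
      have "\<rho> p' * (cmod v - cmod v') \<le> \<rho> p' * cmod (v - v')"
        using norm_triangle_ineq2[of v v'] \<rho>(1) by (intro mult_left_mono) auto
      also have "\<dots> \<le> 1 * (4 * L\<^sup>2 * s * N)" using vv \<rho> by (intro mult_mono) auto
      finally show "\<rho> p' * (cmod v - cmod v') \<le> 1 * (4 * L\<^sup>2 * s * N)" .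
    qed
    also have "\<dots> \<le> 6 * L ^ 3 * s * N"
    proof -
      have "L\<^sup>2 * (s * N) \<le> L ^ 3 * (s * N)" using L1 s N by (intro mult_right_mono power_increasing) auto
      then show ?thesis by (simp add: power2_eq_square power3_eq_cube algebra_simps)
    qed
    finally have d1: "\<rho> p * cmod v - \<rho> p' * cmod v' \<le> 6 * L ^ 3 * s * N" .
    have d2: "\<rho> p * cmod v + \<rho> p' * cmod v' \<le> 2 * (L * N)"
      using mult_mono[OF \<rho>(2) v, of p] mult_mono[OF \<rho>(2) v', of p'] by simp
    have d2': "0 \<le> \<rho> p * cmod v + \<rho> p' * cmod v'" using \<rho>(1) by simp
    have "(\<rho> p * cmod v)\<^sup>2 - (\<rho> p' * cmod v')\<^sup>2 = (\<rho> p * cmod v - \<rho> p' * cmod v') * (\<rho> p * cmod v + \<rho> p' * cmod v')"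
      by (simp add: power2_eq_square algebra_simps)
    also have "\<dots> \<le> (6 * L ^ 3 * s * N) * (2 * (L * N))"
      using d1 d2 d2' L1 s N by (intro order_trans[OF mult_right_mono[OF d1 d2']] mult_left_mono) auto
    finally have 1: "(\<rho> p * cmod v)\<^sup>2 - (\<rho> p' * cmod v')\<^sup>2 \<le> 12 * L ^ 4 * s * N\<^sup>2"
      by (simp add: power2_eq_square power3_eq_cube power4_eq_xxxx algebra_simps)
    have "(\<rho> p' * cmod v')\<^sup>2 \<le> (1 * (L * N))\<^sup>2" using v' \<rho> by (intro power_mono mult_mono) auto
    moreover have "(1 - Jac s p) * (\<rho> p' * cmod v')\<^sup>2 \<le> (4 * L\<^sup>2 * s) * (\<rho> p' * cmod v')\<^sup>2"
      using Jac_bounds(1)[OF s, of p] by (intro mult_right_mono) auto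
    moreover have "(4 * L\<^sup>2 * s) * (\<rho> p' * cmod v')\<^sup>2 \<le> (4 * L\<^sup>2 * s) * (1 * (L * N))\<^sup>2"
      using calculation(1) s by (intro mult_left_mono) auto
    ultimately have "(1 - Jac s p) * (\<rho> p' * cmod v')\<^sup>2 \<le> (4 * L\<^sup>2 * s) * (1 * (L * N))\<^sup>2" by linarith
    then have 2: "(\<rho> p' * cmod v')\<^sup>2 - Jac s p * (\<rho> p' * cmod v')\<^sup>2 \<le> 4 * L ^ 4 * s * N\<^sup>2"
      by (simp add: power2_eq_square power4_eq_xxxx algebra_simps)
    \<comment> \<open>12 from the field and the weight and 4 from the Jacobian; squaring
      \<open>N\<close> costs a factor 2 and the Jacobian on the right another, which gives
      64.\<close>
    have "16 * L ^ 4 * s * N\<^sup>2 \<le> 16 * L ^ 4 * s * (2 * ((cmod a)\<^sup>2 + (cmod b)\<^sup>2))"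
      using N s L1 by (intro mult_left_mono) auto
    also have "\<dots> = 1/2 * (64 * L ^ 4 * s * ((cmod a)\<^sup>2 + (cmod b)\<^sup>2))" by simp
    also have "\<dots> \<le> Jac s p * (64 * L ^ 4 * s * ((cmod a)\<^sup>2 + (cmod b)\<^sup>2))"
      using Jac_bounds(2)[OF s, of p] s L1 by (intro mult_right_mono) auto
    finally have 3: "16 * L ^ 4 * s * N\<^sup>2 \<le> Jac s p * (64 * L ^ 4 * s * ((cmod a)\<^sup>2 + (cmod b)\<^sup>2))" .
    show "(\<rho> p * cmod (speed \<phi> s p))\<^sup>2 \<le> Jac s p * ((\<rho> (shift s p) * cmod (XD \<phi> (shift s p)))\<^sup>2
        + 64 * L ^ 4 * s * ((cmod (D1 \<phi> (shift s p)))\<^sup>2 + (cmod (D2 \<phi> (shift s p)))\<^sup>2))"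
      using 1 2 3 unfolding v_def v'_def a_def b_def p'_def distrib_left[of "Jac s p"] by linarith
  qed
  also have "\<dots> = (LINT p|lborel. (\<rho> p * cmod (XD \<phi> p))\<^sup>2) + 64 * L ^ 4 * s * Dir \<phi>"
    unfolding Dir_def using ccX[THEN cont_compact_integrable] Cc_cc[OF \<phi>, THEN cont_compact_integrable] by simp
  finally show "(LINT p|lborel. (\<rho> p * cmod (speed \<phi> s p))\<^sup>2) \<le> (LINT p|lborel. (\<rho> p * cmod (XD \<phi> p))\<^sup>2) + 64 * L ^ 4 * s * Dir \<phi>" .
qed

lemma shift_path_derivative:
  assumes "smooth \<phi>" shows "((\<lambda>s. \<phi> (shift s p)) has_vector_derivative - speed \<phi> s p) (at s)"
proof -
  have "((\<lambda>s. shift s p) has_derivative (\<lambda>h. (- h * X1 p, - h * X2 p))) (at s)"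
    unfolding shift_def by (auto intro!: derivative_eq_intros simp: fun_eq_iff)
  from has_derivative_compose[OF this smooth_partials[OF assms]]
  show ?thesis unfolding has_vector_derivative_def speed_def
    by (rule has_derivative_eq_rhs) (auto simp: scaleR_conv_of_real algebra_simps)
qed

text \<open>The difference is an integral of \<open>speed\<close> over [0,t]; Cauchy-Schwarz in time
  and Tonelli give the two factors t. The weight stays inside because the right-hand side of the
  equation is \<rho> f and its \<rho> is moved onto this difference.\<close>

lemma shift_difference:
  assumes \<phi>: "\<phi> \<in> Cc_infinity UNIV" and t: "0 \<le> t" "t \<le> t0"
    and \<rho>: "\<And>p. 0 \<le> \<rho> p" "\<And>p. \<rho> p \<le> 1" "\<And>p q. \<bar>\<rho> p - \<rho> q\<bar> \<le> L * norm (p - q)"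
  shows "(LINT p|lborel. (\<rho> p * cmod (\<phi> (shift t p) - \<phi> p))\<^sup>2)
     \<le> t\<^sup>2 * ((LINT p|lborel. (\<rho> p * cmod (XD \<phi> p))\<^sup>2) + 64 * L ^ 4 * t * Dir \<phi>)"
proof -
  define K where "K = (LINT p|lborel. (\<rho> p * cmod (XD \<phi> p))\<^sup>2) + 64 * L ^ 4 * t * Dir \<phi>"
  have K0: "0 \<le> K" unfolding K_def using t L1 by (intro add_nonneg_nonneg mult_nonneg_nonneg Dir_nonneg integral_nonneg_AE) auto
  have c\<rho>: "continuous_on UNIV \<rho>"
    using \<rho>(3) L1 by (intro lipschitz_on_continuous_on[of L]) (auto simp: lipschitz_on_def dist_real_def dist_norm)
  have cD: "continuous_on UNIV (D1 \<phi>)" "continuous_on UNIV (D2 \<phi>)"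
    using Cc_D1[OF \<phi>] Cc_D2[OF \<phi>] Cc_smooth smooth_continuous by blast+
  define e where "e = (\<lambda>(p, s). cmod (speed \<phi> s p))"
  \<comment> \<open>The integrand in space and time is taken in \<open>ennreal\<close>, so that
    measurability alone permits exchanging the integrals.\<close>
  define f where "f = (\<lambda>(p, s). ennreal ((\<rho> p)\<^sup>2) * (ennreal (indicator {0..t} s * cmod (speed \<phi> s p)))\<^sup>2)"
  have ce: "continuous_on UNIV e"
    unfolding e_def speed_def shift_def split_def
    by (intro continuous_intros continuous_on_compose2[OF cD(1)] continuous_on_compose2[OF cD(2)]
         continuous_on_compose2[OF cont_X(1)] continuous_on_compose2[OF cont_X(2)]) auto
  have [measurable]: "e \<in> borel_measurable borel" "\<rho> \<in> borel_measurable borel"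
    using ce c\<rho> by (auto intro: borel_measurable_continuous_onI)
  have f_eq: "f = (\<lambda>x. ennreal ((\<rho> (fst x))\<^sup>2) * (ennreal (indicator {0..t} (snd x) * e x))\<^sup>2)"
    by (auto simp: f_def e_def)
  have fm: "f \<in> borel_measurable (lborel \<Otimes>\<^sub>M lborel)"
  proof -
    have [measurable]: "(\<lambda>x. \<rho> (fst x)) \<in> borel_measurable (borel :: ((real \<times> real) \<times> real) measure)"
      by (intro borel_measurable_continuous_onI continuous_on_compose2[OF c\<rho>]) (auto intro!: continuous_intros)
    have s: "snd \<in> borel_measurable (borel :: ((real \<times> real) \<times> real) measure)"
      by (intro borel_measurable_continuous_onI continuous_intros)
    have [measurable]: "(\<lambda>x. indicat_real {0..t} (snd x)) \<in> borel_measurable (borel :: ((real \<times> real) \<times> real) measure)"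
      by (rule measurable_compose[OF s]) simp
    show ?thesis unfolding lborel_prod f_eq measurable_lborel1 by measurable
  qed
  have em: "(\<lambda>s. ennreal (indicator {0..t} s * cmod (speed \<phi> s p))) \<in> borel_measurable lborel" for p
  proof -
    have "(\<lambda>s. e (p, s)) \<in> borel_measurable borel"
      by (intro borel_measurable_continuous_onI continuous_on_compose2[OF ce]) (auto intro!: continuous_intros)
    then have "(\<lambda>s. cmod (speed \<phi> s p)) \<in> borel_measurable borel" by (simp add: e_def)
    then show ?thesis by simp
  qed
  have point: "ennreal ((\<rho> p * cmod (\<phi> (shift t p) - \<phi> p))\<^sup>2) \<le> ennreal t * (\<integral>\<^sup>+s. f (p, s) \<partial>lborel)" for p
  proof -
    have "has_bochner_integral lborel (\<lambda>s. indicator {0..t} s *\<^sub>R (- speed \<phi> s p)) (\<phi> (shift t p) - \<phi> (shift 0 p))"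
    proof (rule has_bochner_integral_FTC_Icc[OF t(1)])
      show "((\<lambda>s. \<phi> (shift s p)) has_vector_derivative - speed \<phi> s p) (at s within {0..t})" for s
        using shift_path_derivative[OF Cc_smooth[OF \<phi>]] has_vector_derivative_at_within by blast
      have "continuous_on UNIV (\<lambda>s. speed \<phi> s p)"
        unfolding speed_def shift_def
        by (intro continuous_intros continuous_on_compose2[OF cD(1)] continuous_on_compose2[OF cD(2)]) auto
      then show "continuous_on {0..t} (\<lambda>s. - speed \<phi> s p)" by (auto intro: continuous_intros continuous_on_subset)
    qed
    then have "ennreal (cmod (\<phi> (shift t p) - \<phi> (shift 0 p))) \<le> (\<integral>\<^sup>+s. norm (indicator {0..t} s *\<^sub>R (- speed \<phi> s p)) \<partial>lborel)"
      by (rule has_bochner_integral_norm_bound)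
    also have "\<dots> = (\<integral>\<^sup>+s. ennreal (indicator {0..t} s * cmod (speed \<phi> s p)) * indicator {0..t} s \<partial>lborel)"
      by (intro nn_integral_cong) (auto simp: indicator_def)
    finally have 1: "ennreal (cmod (\<phi> (shift t p) - \<phi> p)) \<le> (\<integral>\<^sup>+s. ennreal (indicator {0..t} s * cmod (speed \<phi> s p)) * indicator {0..t} s \<partial>lborel)"
      by (simp add: shift_def)
    have "(ennreal (cmod (\<phi> (shift t p) - \<phi> p)))\<^sup>2 \<le> (\<integral>\<^sup>+s. ennreal (indicator {0..t} s * cmod (speed \<phi> s p)) * indicator {0..t} s \<partial>lborel)\<^sup>2"
      by (intro power_mono 1) simp
    also have "\<dots> \<le> (\<integral>\<^sup>+s. (ennreal (indicator {0..t} s * cmod (speed \<phi> s p)))\<^sup>2 \<partial>lborel) * (\<integral>\<^sup>+s. (indicator {0..t} s)\<^sup>2 \<partial>lborel)"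
      by (rule Cauchy_Schwarz_nn_integral) (use em in auto)
    also have "(\<integral>\<^sup>+s. (indicator {0..t} s)\<^sup>2 \<partial>lborel) = (\<integral>\<^sup>+s. indicator {0..t} s \<partial>lborel)"
      by (intro nn_integral_cong) (auto simp: indicator_def)
    also have "\<dots> = ennreal t" using t by simp
    finally have 2: "(ennreal (cmod (\<phi> (shift t p) - \<phi> p)))\<^sup>2 \<le> (\<integral>\<^sup>+s. (ennreal (indicator {0..t} s * cmod (speed \<phi> s p)))\<^sup>2 \<partial>lborel) * ennreal t" .
    have "ennreal ((\<rho> p * cmod (\<phi> (shift t p) - \<phi> p))\<^sup>2) = ennreal ((\<rho> p)\<^sup>2) * (ennreal (cmod (\<phi> (shift t p) - \<phi> p)))\<^sup>2"
      by (simp add: power_mult_distrib ennreal_mult ennreal_power)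
    also have "\<dots> \<le> ennreal ((\<rho> p)\<^sup>2) * ((\<integral>\<^sup>+s. (ennreal (indicator {0..t} s * cmod (speed \<phi> s p)))\<^sup>2 \<partial>lborel) * ennreal t)"
      by (intro mult_left_mono 2) simp
    also have "\<dots> = ennreal t * (\<integral>\<^sup>+s. f (p, s) \<partial>lborel)"
      using em[of p] by (simp add: f_def nn_integral_cmult mult_ac)
    finally show ?thesis .
  qed
  have "(\<integral>\<^sup>+p. ennreal ((\<rho> p * cmod (\<phi> (shift t p) - \<phi> p))\<^sup>2) \<partial>lborel) \<le> (\<integral>\<^sup>+p. ennreal t * (\<integral>\<^sup>+s. f (p, s) \<partial>lborel) \<partial>lborel)"
    by (intro nn_integral_mono point)
  also have "\<dots> = ennreal t * (\<integral>\<^sup>+p. (\<integral>\<^sup>+s. f (p, s) \<partial>lborel) \<partial>lborel)"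
    by (intro nn_integral_cmult lborel.borel_measurable_nn_integral_fst fm)
  also have "(\<integral>\<^sup>+p. (\<integral>\<^sup>+s. f (p, s) \<partial>lborel) \<partial>lborel) = (\<integral>\<^sup>+s. (\<integral>\<^sup>+p. f (p, s) \<partial>lborel) \<partial>lborel)"
    by (rule lborel_pair.Fubini[OF fm, symmetric])
  also have "\<dots> \<le> (\<integral>\<^sup>+s. ennreal K * indicator {0..t} s \<partial>lborel)"
  proof (intro nn_integral_mono)
    fix s :: real
    show "(\<integral>\<^sup>+p. f (p, s) \<partial>lborel) \<le> ennreal K * indicator {0..t} s"
    proof (cases "s \<in> {0..t}")
      case True
      then have s: "0 \<le> s" "s \<le> t0" "s \<le> t" using t by auto
      note est = speed_estimate[OF \<phi> s(1,2) \<rho>]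
      have "(\<integral>\<^sup>+p. f (p, s) \<partial>lborel) = (\<integral>\<^sup>+p. ennreal ((\<rho> p * cmod (speed \<phi> s p))\<^sup>2) \<partial>lborel)"
        using True by (intro nn_integral_cong) (simp add: f_def power_mult_distrib ennreal_mult ennreal_power)
      also have "\<dots> = ennreal (LINT p|lborel. (\<rho> p * cmod (speed \<phi> s p))\<^sup>2)"
        using cont_compact_integrable[OF est(1)] by (intro nn_integral_eq_integral) auto
      also have "\<dots> \<le> ennreal K"
      proof (intro ennreal_leI order_trans[OF est(2)])
        show "(LINT p|lborel. (\<rho> p * cmod (XD \<phi> p))\<^sup>2) + 64 * L ^ 4 * s * Dir \<phi> \<le> K"
          unfolding K_def using s L1 Dir_nonneg by (intro add_left_mono mult_right_mono mult_left_mono) auto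
      qed
      finally show ?thesis using True by simp
    next
      case False
      then show ?thesis by (simp add: f_def)
    qed
  qed
  also have "\<dots> = ennreal (K * t)" using t K0 by (simp add: nn_integral_cmult ennreal_mult)
  finally have le: "(\<integral>\<^sup>+p. ennreal ((\<rho> p * cmod (\<phi> (shift t p) - \<phi> p))\<^sup>2) \<partial>lborel) \<le> ennreal (t * (K * t))"
    using t K0 by (simp add: mult_left_mono ennreal_mult)
  have "(LINT p|lborel. (\<rho> p * cmod (\<phi> (shift t p) - \<phi> p))\<^sup>2) \<le> t * (K * t)"
    by (rule integral_real_bounded) (use le t K0 in auto)
  then show ?thesis by (simp add: K_def power2_eq_square algebra_simps)
qed

end

section \<open>The Dirichlet Laplacian of a planar domain\<close>

text \<open>Test functions live on the whole plane and vanish off \<Omega>; this moves their inner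
  products to \<open>lborel\<close>, where integration by parts and substitution were done.\<close>

lemma lebesgue_on_integral:
  fixes h :: "'a::euclidean_space \<Rightarrow> 'b::{banach, second_countable_topology}"
  assumes "\<Omega> \<in> sets lebesgue" "h \<in> borel_measurable borel" "\<And>p. p \<notin> \<Omega> \<Longrightarrow> h p = 0"
  shows "(LINT p|lebesgue_on \<Omega>. h p) = (LINT p|lborel. h p)"
proof -
  have "(LINT p|lebesgue_on \<Omega>. h p) = (LINT p|lebesgue. indicator \<Omega> p *\<^sub>R h p)"
    using assms(1) by (intro integral_restrict_space) simp
  also have "(\<lambda>p. indicator \<Omega> p *\<^sub>R h p) = h" using assms(3) by (auto simp: indicator_def)
  also have "(LINT p|lebesgue. h p) = (LINT p|lborel. h p)"
    using assms(2) by (intro integral_completion) simp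
  finally show ?thesis .
qed

lemma lebesgue_on_integrable:
  fixes h :: "'a::euclidean_space \<Rightarrow> 'b::{banach, second_countable_topology}"
  assumes "\<Omega> \<in> sets lebesgue" "integrable lborel h"
  shows "integrable (lebesgue_on \<Omega>) h"
proof -
  have "integrable lebesgue h" using assms(2) by (subst integrable_completion) auto
  then have "integrable lebesgue (\<lambda>p. indicator \<Omega> p *\<^sub>R h p)"
    using assms(1) by (intro integrable_mult_indicator)
  then show ?thesis using assms(1) by (subst integrable_restrict_space) auto
qed

lemma borel_imp_lebesgue_on: "h \<in> borel_measurable borel \<Longrightarrow> h \<in> borel_measurable (lebesgue_on \<Omega>)"
  by (intro measurable_restrict_space1 measurable_completion) simp

lemma Cc_L2:
  assumes "open \<Omega>" "\<phi> \<in> Cc_infinity \<Omega>" shows "\<phi> \<in> L2 (lebesgue_on \<Omega>)"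
proof -
  note c = Cc_cont_compact[OF assms(2)]
  have "\<Omega> \<in> sets lebesgue" using assms(1) by (simp add: borel_open)
  then show ?thesis unfolding L2_def
    using borel_imp_lebesgue_on[OF cont_compact_measurable[OF c]]
      lebesgue_on_integrable[OF _ cont_compact_integrable[OF cont_compact_norm2[OF c]]] by auto
qed

section \<open>The quadratic form of the Laplacian on an open set\<close>

locale planar_domain =
  fixes \<Omega> :: "(real \<times> real) set" assumes open_domain: "open \<Omega>"
begin

abbreviation M where "M \<equiv> lebesgue_on \<Omega>"

lemma domain_sets: "\<Omega> \<in> sets lebesgue"
  using open_domain by (simp add: borel_open)

lemma inner_eq:
  assumes "\<phi> \<in> Cc_infinity \<Omega>" "\<psi> \<in> Cc_infinity \<Omega>"
  shows "L2_inner M \<phi> \<psi> = (LINT p|lborel. \<phi> p * cnj (\<psi> p))"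
  unfolding L2_inner_def using assms Cc_outside
  by (intro lebesgue_on_integral domain_sets cont_compact_measurable[OF Cc_cont_compact[of _ \<Omega>]] Cc_mult Cc_cnj Cc_smooth) auto

lemma norm_eq:
  assumes "\<phi> \<in> Cc_infinity \<Omega>" shows "(L2_norm M \<phi>)\<^sup>2 = mass \<phi>"
  unfolding L2_norm_squared mass_def using assms Cc_outside
  by (intro lebesgue_on_integral domain_sets cont_compact_measurable cont_compact_norm2 Cc_cont_compact[of _ \<Omega>]) auto

lemma form_eq:
  assumes "\<phi> \<in> Cc_infinity \<Omega>" "\<psi> \<in> Cc_infinity \<Omega>"
  shows "L2_inner M (\<lambda>p. - laplacian \<phi> p) \<psi> = (LINT p|lborel. D1 \<phi> p * cnj (D1 \<psi> p) + D2 \<phi> p * cnj (D2 \<psi> p))"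
  unfolding inner_eq[OF Cc_minus[OF Cc_laplacian[OF assms(1)]] assms(2)] by (rule Green[OF assms])

lemma form_self:
  assumes "\<phi> \<in> Cc_infinity \<Omega>"
  shows "L2_inner M (\<lambda>p. - laplacian \<phi> p) \<phi> = of_real (Dir \<phi>)"
  unfolding form_eq[OF assms assms] Dir_def integral_complex_of_real[symmetric]
  by (intro Bochner_Integration.integral_cong refl) (simp only: of_real_add complex_norm_square)

sublocale nonneg_symmetric M "\<lambda>\<phi> p. - laplacian \<phi> p" "Cc_infinity \<Omega>"
proof
  fix \<phi> \<psi> :: "real \<times> real \<Rightarrow> complex" and c :: complex
  assume \<phi>: "\<phi> \<in> Cc_infinity \<Omega>"
  show "\<phi> \<in> L2 M" by (rule Cc_L2[OF open_domain \<phi>])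
  show "(\<lambda>p. - laplacian \<phi> p) \<in> L2 M" by (intro Cc_L2[OF open_domain] Cc_minus Cc_laplacian \<phi>)
  show "(\<lambda>x. c * \<phi> x) \<in> Cc_infinity \<Omega>" by (rule Cc_scale[OF \<phi>])
  note s = Cc_smooth[OF \<phi>]
  have "D1 (\<lambda>x. c * \<phi> x) = (\<lambda>x. c * D1 \<phi> x)" "D2 (\<lambda>x. c * \<phi> x) = (\<lambda>x. c * D2 \<phi> x)" by (auto simp: D_scale s)
  then show "(\<lambda>p. - laplacian (\<lambda>x. c * \<phi> x) p) = (\<lambda>x. c * - laplacian \<phi> x)"
    by (simp add: laplacian_eq D_scale smooth_D1[OF s] smooth_D2[OF s] algebra_simps)
  show "0 \<le> Re (L2_inner M (\<lambda>p. - laplacian \<phi> p) \<phi>)" using Dir_nonneg by (simp add: form_self[OF \<phi>])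
  assume \<psi>: "\<psi> \<in> Cc_infinity \<Omega>"
  note s' = Cc_smooth[OF \<psi>]
  show "(\<lambda>x. \<phi> x + \<psi> x) \<in> Cc_infinity \<Omega>" by (rule Cc_add[OF \<phi> \<psi>])
  have "D1 (\<lambda>x. \<phi> x + \<psi> x) = (\<lambda>x. D1 \<phi> x + D1 \<psi> x)" "D2 (\<lambda>x. \<phi> x + \<psi> x) = (\<lambda>x. D2 \<phi> x + D2 \<psi> x)" by (auto simp: D_add s s')
  then show "(\<lambda>p. - laplacian (\<lambda>x. \<phi> x + \<psi> x) p) = (\<lambda>x. - laplacian \<phi> x + - laplacian \<psi> x)"
    by (simp add: laplacian_eq D_add smooth_D1[OF s] smooth_D2[OF s] smooth_D1[OF s'] smooth_D2[OF s'] algebra_simps)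
  show "L2_inner M (\<lambda>p. - laplacian \<phi> p) \<psi> = cnj (L2_inner M (\<lambda>p. - laplacian \<psi> p) \<phi>)"
    unfolding form_eq[OF \<phi> \<psi>] form_eq[OF \<psi> \<phi>] by (simp flip: Bochner_Integration.integral_cnj add: mult.commute)
qed (rule Cc_zero)

lemma laplacian_graph: "A = neg_dirichlet_laplacian \<Omega>"
  by (simp add: neg_dirichlet_laplacian_def)

lemma b_eq: "\<phi> \<in> Cc_infinity \<Omega> \<Longrightarrow> \<psi> \<in> Cc_infinity \<Omega> \<Longrightarrow>
    b \<phi> \<psi> = (LINT p|lborel. D1 \<phi> p * cnj (D1 \<psi> p) + D2 \<phi> p * cnj (D2 \<psi> p))"
  unfolding b_def by (rule form_eq)

lemma b_self: "\<phi> \<in> Cc_infinity \<Omega> \<Longrightarrow> Re (b \<phi> \<phi>) = Dir \<phi>"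
  unfolding b_def by (simp add: form_self)

lemma a_eq: "\<phi> \<in> Cc_infinity \<Omega> \<Longrightarrow> a \<phi> = Dir \<phi> + mass \<phi>"
  unfolding a_def by (simp add: b_self norm_eq)

text \<open>Serves for composition with the shift and for multiplication by smooth functions;
  linearity enters only as \<open>diff\<close>.\<close>

lemma form_Cauchy_map:
  assumes C: "form_Cauchy \<phi>" and K: "0 < K"
    and T: "\<And>\<eta>. \<eta> \<in> Cc_infinity \<Omega> \<Longrightarrow> T \<eta> \<in> Cc_infinity \<Omega> \<and> a (T \<eta>) \<le> K * a \<eta>"
    and diff: "\<And>m n. (\<lambda>x. T (\<phi> m) x - T (\<phi> n) x) = T (\<lambda>x. \<phi> m x - \<phi> n x)"
  shows "form_Cauchy (\<lambda>n. T (\<phi> n))"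
  unfolding form_Cauchy_def
proof (intro conjI allI impI)
  note D = form_Cauchy_D[OF C]
  show "T (\<phi> n) \<in> Cc_infinity \<Omega>" for n using T D by blast
  fix e :: real assume "e > 0"
  then have "e / K > 0" using K by simp
  then obtain N where N: "\<And>m n. m \<ge> N \<Longrightarrow> n \<ge> N \<Longrightarrow> a (\<lambda>x. \<phi> m x - \<phi> n x) < e / K"
    using C unfolding form_Cauchy_def by blast
  have "a (\<lambda>x. T (\<phi> m) x - T (\<phi> n) x) < e" if "m \<ge> N" "n \<ge> N" for m n
  proof -
    have "a (\<lambda>x. T (\<phi> m) x - T (\<phi> n) x) \<le> K * a (\<lambda>x. \<phi> m x - \<phi> n x)"
      unfolding diff using T[OF D_diff[OF D D]] by blast
    also have "\<dots> < e" using N[OF that] K by (simp add: field_simps)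
    finally show ?thesis .
  qed
  then show "\<exists>N. \<forall>m\<ge>N. \<forall>n\<ge>N. a (\<lambda>x. T (\<phi> m) x - T (\<phi> n) x) < e" by blast
qed

text \<open>Allows u to be replaced by its approximation \<phi> n in the equation tested with \<eta>
  n.\<close>

lemma inner_diff_tendsto_zero:
  assumes "form_converges M (\<lambda>\<phi> p. - laplacian \<phi> p) (Cc_infinity \<Omega>) \<phi> u" and "form_Cauchy \<eta>"
  shows "(\<lambda>n. L2_inner M (\<lambda>x. u x - \<phi> n x) (\<eta> n)) \<longlonglongrightarrow> 0"
proof -
  obtain C where C: "\<And>n. L2_norm M (\<eta> n) \<le> C" using form_Cauchy_L2_bounded[OF assms(2)] by auto
  have L: "u \<in> L2 M" "\<phi> n \<in> L2 M" "\<eta> n \<in> L2 M" for n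
    using assms form_Cauchy_D[OF form_converges_Cauchy[OF assms(1)]] form_Cauchy_D[OF assms(2)] D_L2
    by (auto simp: form_converges_def)
  have lim: "(\<lambda>n. L2_norm M (\<lambda>x. \<phi> n x - u x) * C) \<longlonglongrightarrow> 0"
    using assms(1) by (auto simp: form_converges_def intro!: tendsto_eq_intros)
  have "norm (L2_inner M (\<lambda>x. u x - \<phi> n x) (\<eta> n)) \<le> L2_norm M (\<lambda>x. \<phi> n x - u x) * C" for n
    unfolding L2_norm_minus_commute[of M "\<phi> n" u]
    by (rule order_trans[OF L2_Cauchy_Schwarz[OF L2_diff[OF L(1,2)] L(3)]]) (intro mult_left_mono C L2_norm_nonneg)
  then show ?thesis by (intro Lim_null_comparison[OF _ lim]) simp
qed

text \<open>Each of the two partial derivatives of m \<eta> puts 2 B^2 on the mass of \<eta>, and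
  the mass of m \<eta> puts B^2: together 5 B^2.\<close>

lemma a_mult_bound:
  assumes m: "smooth m" "\<And>p. (m has_derivative (\<lambda>v. fst v * m1 p + snd v * m2 p)) (at p)"
    and b: "\<And>p. \<bar>m p\<bar> \<le> B" "\<And>p. \<bar>m1 p\<bar> \<le> B" "\<And>p. \<bar>m2 p\<bar> \<le> B" and \<eta>: "\<eta> \<in> Cc_infinity \<Omega>"
  shows "(\<lambda>p. of_real (m p) * \<eta> p) \<in> Cc_infinity \<Omega>"
    "D1 (\<lambda>p. of_real (m p) * \<eta> p) p = of_real (m p) * D1 \<eta> p + of_real (m1 p) * \<eta> p"
    "D2 (\<lambda>p. of_real (m p) * \<eta> p) p = of_real (m p) * D2 \<eta> p + of_real (m2 p) * \<eta> p"
    "a (\<lambda>p. of_real (m p) * \<eta> p) \<le> 5 * B\<^sup>2 * a \<eta>"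
proof -
  show mem: "(\<lambda>p. of_real (m p) * \<eta> p) \<in> Cc_infinity \<Omega>" by (intro Cc_mult smooth_on_of_real m \<eta>)
  have "((\<lambda>p. complex_of_real (m p)) has_derivative (\<lambda>v. fst v *\<^sub>R of_real (m1 p) + snd v *\<^sub>R of_real (m2 p))) (at p)" for p
    using bounded_linear.has_derivative[OF bounded_linear_of_real m(2)[of p]] by (simp add: scaleR_conv_of_real)
  note Dm = partials_eqI[OF this]
  show d1: "D1 (\<lambda>p. of_real (m p) * \<eta> p) p = of_real (m p) * D1 \<eta> p + of_real (m1 p) * \<eta> p"
    and d2: "D2 (\<lambda>p. of_real (m p) * \<eta> p) p = of_real (m p) * D2 \<eta> p + of_real (m2 p) * \<eta> p" for p
    by (simp_all add: D_mult[OF smooth_on_of_real[OF m(1)] Cc_smooth[OF \<eta>]] Dm)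
  note int = Cc_cc[OF \<eta>, THEN cont_compact_integrable] Cc_cc[OF mem, THEN cont_compact_integrable]
  have sq: "(cmod (of_real r * z + of_real s * w))\<^sup>2 \<le> 2 * B\<^sup>2 * (cmod z)\<^sup>2 + 2 * B\<^sup>2 * (cmod w)\<^sup>2"
    if "\<bar>r\<bar> \<le> B" "\<bar>s\<bar> \<le> B" for r s z w
  proof -
    have "r\<^sup>2 \<le> B\<^sup>2" "s\<^sup>2 \<le> B\<^sup>2" using that by (auto intro!: abs_le_square_iff[THEN iffD1])
    then have "r\<^sup>2 * (cmod z)\<^sup>2 \<le> B\<^sup>2 * (cmod z)\<^sup>2" "s\<^sup>2 * (cmod w)\<^sup>2 \<le> B\<^sup>2 * (cmod w)\<^sup>2" by (auto intro!: mult_right_mono)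
    then show ?thesis using norm_add_squared_le[of "of_real r * z" "of_real s * w"]
      by (simp add: norm_mult power_mult_distrib)
  qed
  have "a (\<lambda>p. of_real (m p) * \<eta> p) = (LINT p|lborel. ((cmod (D1 (\<lambda>p. of_real (m p) * \<eta> p) p))\<^sup>2 + (cmod (D2 (\<lambda>p. of_real (m p) * \<eta> p) p))\<^sup>2)
       + (cmod (of_real (m p) * \<eta> p))\<^sup>2)"
    unfolding a_eq[OF mem] Dir_def mass_def using int by simp
  also have "\<dots> \<le> (LINT p|lborel. 2 * B\<^sup>2 * (((cmod (D1 \<eta> p))\<^sup>2 + (cmod (D2 \<eta> p))\<^sup>2)) + 5 * B\<^sup>2 * (cmod (\<eta> p))\<^sup>2)"
  proof (rule integral_mono)
    fix p
    show "((cmod (D1 (\<lambda>p. of_real (m p) * \<eta> p) p))\<^sup>2 + (cmod (D2 (\<lambda>p. of_real (m p) * \<eta> p) p))\<^sup>2)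
       + (cmod (of_real (m p) * \<eta> p))\<^sup>2 \<le> 2 * B\<^sup>2 * (((cmod (D1 \<eta> p))\<^sup>2 + (cmod (D2 \<eta> p))\<^sup>2)) + 5 * B\<^sup>2 * (cmod (\<eta> p))\<^sup>2"
    proof -
      have "(m p)\<^sup>2 \<le> B\<^sup>2" using b(1)[of p] by (intro abs_le_square_iff[THEN iffD1]) auto
      then have "(cmod (of_real (m p) * \<eta> p))\<^sup>2 \<le> B\<^sup>2 * (cmod (\<eta> p))\<^sup>2"
        by (simp add: norm_mult power_mult_distrib mult_right_mono)
      then show ?thesis
        using sq[OF b(1)[of p] b(2)[of p], of "D1 \<eta> p" "\<eta> p"] sq[OF b(1)[of p] b(3)[of p], of "D2 \<eta> p" "\<eta> p"]
        unfolding d1 d2 by (simp add: algebra_simps)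
    qed
  qed (use int in auto)
  also have "\<dots> = 2 * B\<^sup>2 * Dir \<eta> + 5 * B\<^sup>2 * mass \<eta>" unfolding Dir_def mass_def using int by simp
  also have "\<dots> \<le> 5 * B\<^sup>2 * Dir \<eta> + 5 * B\<^sup>2 * mass \<eta>" using Dir_nonneg by (intro add_right_mono mult_right_mono) auto
  finally show "a (\<lambda>p. of_real (m p) * \<eta> p) \<le> 5 * B\<^sup>2 * a \<eta>" unfolding a_eq[OF \<eta>] by (simp add: algebra_simps)
qed

lemma form_Cauchy_mult:
  assumes m: "smooth m" "\<And>p. (m has_derivative (\<lambda>v. fst v * m1 p + snd v * m2 p)) (at p)"
    and b: "\<And>p. \<bar>m p\<bar> \<le> B" "\<And>p. \<bar>m1 p\<bar> \<le> B" "\<And>p. \<bar>m2 p\<bar> \<le> B" and C: "form_Cauchy \<phi>"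
  shows "form_Cauchy (\<lambda>n p. of_real (m p) * \<phi> n p)"
\<comment> \<open>The summand 1 keeps the constant positive when B = 0.\<close>
proof (rule form_Cauchy_map[OF C, where K = "5 * B\<^sup>2 + 1" and T = "\<lambda>\<eta> p. of_real (m p) * \<eta> p"])
  show "0 < 5 * B\<^sup>2 + 1" by (simp add: add_nonneg_pos)
  fix \<eta> assume \<eta>: "\<eta> \<in> Cc_infinity \<Omega>"
  show "(\<lambda>p. of_real (m p) * \<eta> p) \<in> Cc_infinity \<Omega> \<and> a (\<lambda>p. of_real (m p) * \<eta> p) \<le> (5 * B\<^sup>2 + 1) * a \<eta>"
    using a_mult_bound(1)[OF m b \<eta>] a_mult_bound(4)[OF m b \<eta>] a_nonneg[OF \<eta>] by (simp add: algebra_simps)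
qed (simp add: right_diff_distrib)

text \<open>Testing the resolvent equation with \<open>m u\<close>, along an approximating sequence.\<close>
lemma multiplier_limit:
  assumes r: "represents \<phi> u (\<lambda>x. F x + Complex E \<epsilon> * u x)" and F: "F \<in> L2 M"
    and m: "smooth m" "\<And>p. (m has_derivative (\<lambda>v. fst v * m1 p + snd v * m2 p)) (at p)"
    and b: "\<And>p. \<bar>m p\<bar> \<le> B" "\<And>p. \<bar>m1 p\<bar> \<le> B" "\<And>p. \<bar>m2 p\<bar> \<le> B"
    and mc: "continuous_on UNIV m1" "continuous_on UNIV m2"
  shows "(\<lambda>n. (LINT p|lborel. m p * ((cmod (D1 (\<phi> n) p))\<^sup>2 + (cmod (D2 (\<phi> n) p))\<^sup>2 - E * (cmod (\<phi> n p))\<^sup>2)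
      + m1 p * Re (D1 (\<phi> n) p * cnj (\<phi> n p)) + m2 p * Re (D2 (\<phi> n) p * cnj (\<phi> n p)))
      - Re (L2_inner M F (\<lambda>p. of_real (m p) * \<phi> n p))) \<longlonglongrightarrow> 0"
proof -
  have conv: "form_converges M (\<lambda>\<phi> p. - laplacian \<phi> p) (Cc_infinity \<Omega>) \<phi> u" using r by (simp add: represents_def)
  note C = form_converges_Cauchy[OF conv]
  note D = form_Cauchy_D[OF C]
  define \<eta> where "\<eta> n p = of_real (m p) * \<phi> n p" for n p
  have \<eta>C: "form_Cauchy \<eta>" unfolding \<eta>_def[abs_def] by (rule form_Cauchy_mult[OF m b C])
  note \<eta>D = form_Cauchy_D[OF \<eta>C]
  have uL: "u \<in> L2 M" using conv by (simp add: form_converges_def)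
  note pL = D_L2[OF D] and eL = D_L2[OF \<eta>D]
  have 1: "(\<lambda>n. b (\<phi> n) (\<eta> n) - L2_inner M (\<lambda>x. F x + Complex E \<epsilon> * u x) (\<eta> n)) \<longlonglongrightarrow> 0"
    using r \<eta>C by (simp add: represents_def)
  have 2: "(\<lambda>n. L2_inner M (\<lambda>x. u x - \<phi> n x) (\<eta> n)) \<longlonglongrightarrow> 0" by (rule inner_diff_tendsto_zero[OF conv \<eta>C])
  have "(\<lambda>n. (b (\<phi> n) (\<eta> n) - L2_inner M (\<lambda>x. F x + Complex E \<epsilon> * u x) (\<eta> n)) + Complex E \<epsilon> * L2_inner M (\<lambda>x. u x - \<phi> n x) (\<eta> n))
      \<longlonglongrightarrow> 0 + Complex E \<epsilon> * 0" by (intro tendsto_intros 1 2)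
  moreover have "(b (\<phi> n) (\<eta> n) - L2_inner M (\<lambda>x. F x + Complex E \<epsilon> * u x) (\<eta> n)) + Complex E \<epsilon> * L2_inner M (\<lambda>x. u x - \<phi> n x) (\<eta> n)
      = b (\<phi> n) (\<eta> n) - L2_inner M F (\<eta> n) - Complex E \<epsilon> * L2_inner M (\<phi> n) (\<eta> n)" for n
    unfolding L2_inner_add_left[OF F L2_scale[OF uL] eL] L2_inner_diff_left[OF uL pL eL] L2_inner_scale_left
    by (simp add: algebra_simps)
  ultimately have "(\<lambda>n. b (\<phi> n) (\<eta> n) - L2_inner M F (\<eta> n) - Complex E \<epsilon> * L2_inner M (\<phi> n) (\<eta> n)) \<longlonglongrightarrow> 0" by simp
  from tendsto_Re[OF this] have lim: "(\<lambda>n. Re (b (\<phi> n) (\<eta> n)) - Re (L2_inner M F (\<eta> n)) - Re (Complex E \<epsilon> * L2_inner M (\<phi> n) (\<eta> n))) \<longlonglongrightarrow> 0" by simp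
  have "Re (b (\<phi> n) (\<eta> n)) - Re (Complex E \<epsilon> * L2_inner M (\<phi> n) (\<eta> n))
     = (LINT p|lborel. m p * ((cmod (D1 (\<phi> n) p))\<^sup>2 + (cmod (D2 (\<phi> n) p))\<^sup>2 - E * (cmod (\<phi> n p))\<^sup>2)
      + m1 p * Re (D1 (\<phi> n) p * cnj (\<phi> n p)) + m2 p * Re (D2 (\<phi> n) p * cnj (\<phi> n p)))" for n
  proof -
    note s = Cc_cc[OF D[of n]]
    have s2: "cont_compact (\<lambda>p. Re (D2 (\<phi> n) p * cnj (\<phi> n p)))"
      by (intro cont_compact_Re_cnj Cc_cont_compact[of _ \<Omega>] Cc_D2 D)
    have cm2: "(cmod z)\<^sup>2 = Re z * Re z + Im z * Im z" for z unfolding cmod_power2 by (simp add: power2_eq_square)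
    have cm: "continuous_on UNIV m" using smooth_continuous[OF m(1)] .
    have i: "integrable lborel (\<lambda>p. m p * ((cmod (D1 (\<phi> n) p))\<^sup>2 + (cmod (D2 (\<phi> n) p))\<^sup>2)
        + m1 p * Re (D1 (\<phi> n) p * cnj (\<phi> n p)) + m2 p * Re (D2 (\<phi> n) p * cnj (\<phi> n p)))"
      "integrable lborel (\<lambda>p. E * (m p * (cmod (\<phi> n p))\<^sup>2))"
      by (intro cont_compact_integrable cc_intros s s2 cm mc)+
    have cc: "integrable lborel (\<lambda>p. D1 (\<phi> n) p * cnj (D1 (\<eta> n) p) + D2 (\<phi> n) p * cnj (D2 (\<eta> n) p))"
      by (intro cont_compact_integrable Cc_cont_compact[of _ \<Omega>] Cc_add Cc_mult Cc_cnj Cc_smooth[of _ \<Omega>] Cc_D1 Cc_D2 D \<eta>D)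
    have "Re (b (\<phi> n) (\<eta> n)) = (LINT p|lborel. Re (D1 (\<phi> n) p * cnj (D1 (\<eta> n) p) + D2 (\<phi> n) p * cnj (D2 (\<eta> n) p)))"
      unfolding b_eq[OF D \<eta>D] using cc by (rule integral_Re[symmetric])
    also have "\<dots> = (LINT p|lborel. m p * ((cmod (D1 (\<phi> n) p))\<^sup>2 + (cmod (D2 (\<phi> n) p))\<^sup>2)
        + m1 p * Re (D1 (\<phi> n) p * cnj (\<phi> n p)) + m2 p * Re (D2 (\<phi> n) p * cnj (\<phi> n p)))"
      by (intro Bochner_Integration.integral_cong refl)
         (simp add: \<eta>_def[abs_def] a_mult_bound(2,3)[OF m b D] cm2 algebra_simps)
    finally have R1: "Re (b (\<phi> n) (\<eta> n)) = \<dots>" .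
    \<comment> \<open>This pairing is real because m is real, so \<epsilon> drops out of the real
      part.\<close>
    have "L2_inner M (\<phi> n) (\<eta> n) = (LINT p|lborel. complex_of_real (m p * (cmod (\<phi> n p))\<^sup>2))"
      unfolding inner_eq[OF D \<eta>D] \<eta>_def of_real_mult complex_norm_square
      by (intro Bochner_Integration.integral_cong refl) simp
    also have "\<dots> = of_real (LINT p|lborel. m p * (cmod (\<phi> n p))\<^sup>2)" by (rule integral_complex_of_real)
    finally have R2: "Re (Complex E \<epsilon> * L2_inner M (\<phi> n) (\<eta> n)) = (LINT p|lborel. E * (m p * (cmod (\<phi> n p))\<^sup>2))" by simp
    show ?thesis unfolding R1 R2 Bochner_Integration.integral_diff[OF i, symmetric]
      by (intro Bochner_Integration.integral_cong refl) (simp add: algebra_simps)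
  qed
  then show ?thesis using lim by (simp add: \<eta>_def[abs_def] algebra_simps)
qed

end

section \<open>The Rellich inequality for outgoing fields\<close>

locale outgoing_field = planar_domain \<Omega> + planar_field X1 X2 X11 X12 X21 X22 L
  for \<Omega> X1 X2 X11 X12 X21 X22 L +
  fixes t1 :: real
  assumes t1: "0 < t1" "t1 \<le> t0"
    and out: "\<And>t p. 0 \<le> t \<Longrightarrow> t \<le> t1 \<Longrightarrow> p \<notin> \<Omega> \<Longrightarrow> shift t p \<notin> \<Omega>"
begin

lemma form_Cauchy_shift:
  assumes t: "0 \<le> t" "t \<le> t1" and C: "form_Cauchy \<phi>"
  shows "form_Cauchy (\<lambda>n p. \<phi> n (shift t p))"
proof (rule form_Cauchy_map[OF C, where K = 8 and T = "\<lambda>\<eta> p. \<eta> (shift t p)"])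
  fix \<eta> assume \<eta>: "\<eta> \<in> Cc_infinity \<Omega>"
  have "t \<le> t0" using t t1 by simp
  note t' = t(1) this
  have mem: "(\<lambda>p. \<eta> (shift t p)) \<in> Cc_infinity \<Omega>" by (rule Cc_shift[OF \<eta> t(1) out[OF t]])
  have "\<eta> \<in> Cc_infinity UNIV" by (rule Cc_mono[OF \<eta>]) simp
  from shift_bounded[OF this t'] have "a (\<lambda>p. \<eta> (shift t p)) \<le> 8 * a \<eta>"
    unfolding a_eq[OF mem] a_eq[OF \<eta>] using mass_nonneg[of \<eta>] by simp
  then show "(\<lambda>p. \<eta> (shift t p)) \<in> Cc_infinity \<Omega> \<and> a (\<lambda>p. \<eta> (shift t p)) \<le> 8 * a \<eta>" using mem by blast
qed auto

text \<open>The weight is moved from f to the test function, whose norm over \<Omega> is an integral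
  over the plane.\<close>

lemma weighted_inner_bound:
  assumes f: "f \<in> L2 M" and \<eta>: "\<eta> \<in> Cc_infinity \<Omega>"
    and \<rho>: "continuous_on UNIV \<rho>" "\<And>p. 0 \<le> \<rho> p" "\<And>p. \<rho> p \<le> 1"
  shows "cmod (L2_inner M (\<lambda>x. of_real (\<rho> x) * f x) \<eta>) \<le> L2_norm M f * sqrt (LINT p|lborel. (\<rho> p * cmod (\<eta> p))\<^sup>2)"
    "L2_norm M (\<lambda>x. of_real (\<rho> x) * \<eta> x) = sqrt (LINT p|lborel. (\<rho> p * cmod (\<eta> p))\<^sup>2)"
    "(\<lambda>x. of_real (\<rho> x) * \<eta> x) \<in> L2 M"
proof -
  have m: "(\<lambda>x. complex_of_real (\<rho> x)) \<in> borel_measurable M"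
    using \<rho>(1) by (intro borel_imp_lebesgue_on borel_measurable_continuous_onI continuous_intros)
  show L: "(\<lambda>x. of_real (\<rho> x) * \<eta> x) \<in> L2 M"
    by (rule L2_bounded_mult[OF D_L2[OF \<eta>] m, of 1]) (use \<rho> in auto)
  have c: "cont_compact (\<lambda>p. (\<rho> p * cmod (\<eta> p))\<^sup>2)"
    unfolding power_mult_distrib by (intro cont_compact_mult Cc_cc[OF \<eta>] continuous_intros \<rho>)
  have "(LINT x|M. (cmod (of_real (\<rho> x) * \<eta> x))\<^sup>2) = (LINT x|M. (\<rho> x * cmod (\<eta> x))\<^sup>2)"
    using \<rho> by (simp add: norm_mult)
  also have "\<dots> = (LINT x|lborel. (\<rho> x * cmod (\<eta> x))\<^sup>2)"
    by (rule lebesgue_on_integral[OF domain_sets cont_compact_measurable[OF c]]) (simp add: Cc_outside[OF \<eta>])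
  finally show n: "L2_norm M (\<lambda>x. of_real (\<rho> x) * \<eta> x) = sqrt (LINT p|lborel. (\<rho> p * cmod (\<eta> p))\<^sup>2)"
    by (simp add: L2_norm_def)
  have "L2_inner M (\<lambda>x. of_real (\<rho> x) * f x) \<eta> = L2_inner M f (\<lambda>x. of_real (\<rho> x) * \<eta> x)"
    unfolding L2_inner_def by (simp add: mult_ac)
  then show "cmod (L2_inner M (\<lambda>x. of_real (\<rho> x) * f x) \<eta>) \<le> L2_norm M f * sqrt (LINT p|lborel. (\<rho> p * cmod (\<eta> p))\<^sup>2)"
    using L2_Cauchy_Schwarz[OF f L] n by simp
qed

text \<open>Meant for the term with \<epsilon> u, for which no weight is available.\<close>

lemma XD_bound:
  assumes \<phi>: "\<phi> \<in> Cc_infinity \<Omega>"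
  shows "cont_compact (XD \<phi>)" "(LINT p|lborel. (1 * cmod (XD \<phi> p))\<^sup>2) \<le> 2 * L\<^sup>2 * Dir \<phi>"
proof -
  show c: "cont_compact (XD \<phi>)" unfolding XD_def[abs_def]
    by (intro cont_compact_add cont_compact_mult continuous_intros cont_X Cc_cont_compact[of _ \<Omega>] Cc_D1 Cc_D2 \<phi>)
  have "(LINT p|lborel. (1 * cmod (XD \<phi> p))\<^sup>2) \<le> (LINT p|lborel. 2 * L\<^sup>2 * ((cmod (D1 \<phi> p))\<^sup>2 + (cmod (D2 \<phi> p))\<^sup>2))"
  proof (rule integral_mono)
    fix p
    have "(X1 p)\<^sup>2 \<le> L\<^sup>2" "(X2 p)\<^sup>2 \<le> L\<^sup>2" using bX[of p] L1 by (auto intro!: abs_le_square_iff[THEN iffD1])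
    then have "(X1 p)\<^sup>2 * (cmod (D1 \<phi> p))\<^sup>2 \<le> L\<^sup>2 * (cmod (D1 \<phi> p))\<^sup>2" "(X2 p)\<^sup>2 * (cmod (D2 \<phi> p))\<^sup>2 \<le> L\<^sup>2 * (cmod (D2 \<phi> p))\<^sup>2"
      by (auto intro!: mult_right_mono)
    then show "(1 * cmod (XD \<phi> p))\<^sup>2 \<le> 2 * L\<^sup>2 * ((cmod (D1 \<phi> p))\<^sup>2 + (cmod (D2 \<phi> p))\<^sup>2)"
      using norm_add_squared_le[of "of_real (X1 p) * D1 \<phi> p" "of_real (X2 p) * D2 \<phi> p"]
      unfolding XD_def by (simp add: norm_mult power_mult_distrib algebra_simps)
  qed (use cont_compact_norm2[OF c, THEN cont_compact_integrable] Cc_cc[OF \<phi>, THEN cont_compact_integrable] in auto)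
  then show "(LINT p|lborel. (1 * cmod (XD \<phi> p))\<^sup>2) \<le> 2 * L\<^sup>2 * Dir \<phi>" by (simp add: Dir_def)
qed

text \<open>
  Comparing the energy of \<open>\<phi>\<close> and of \<open>\<phi> \<circ> shift t\<close>: the boundary term of the Rellich identity
  is the energy of their difference and is simply dropped, having the right sign.
\<close>
lemma rellich_finite:
  assumes \<phi>: "\<phi> \<in> Cc_infinity \<Omega>" and t: "0 \<le> t" "t \<le> t1" and E: "0 \<le> E"
  defines "\<eta> \<equiv> (\<lambda>p. \<phi> (shift t p) - \<phi> p)"
  shows "t * (LINT p|lborel. qdens E \<phi> p) \<le> - 2 * (Re (b \<phi> \<eta>) - E * Re (L2_inner M \<phi> \<eta>))
     + E * mass \<eta> + L ^ 3 * (84 + 28 * E) * t\<^sup>2 * a \<phi>"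
proof -
  have t': "t \<le> t0" using t t1 by simp
  have \<psi>: "(\<lambda>p. \<phi> (shift t p)) \<in> Cc_infinity \<Omega>" by (rule Cc_shift[OF \<phi> t(1) out[OF t]])
  have \<eta>: "\<eta> \<in> Cc_infinity \<Omega>" unfolding \<eta>_def by (rule Cc_diff[OF \<psi> \<phi>])
  have eq: "(\<lambda>p. \<phi> p + \<eta> p) = (\<lambda>p. \<phi> (shift t p))" by (simp add: \<eta>_def)
  have 1: "Dir (\<lambda>p. \<phi> (shift t p)) = Dir \<phi> + 2 * Re (b \<phi> \<eta>) + Dir \<eta>"
    using b_expand[OF \<phi> \<eta>] unfolding eq b_self[OF \<psi>] b_self[OF \<phi>] b_self[OF \<eta>] .
  have 2: "mass (\<lambda>p. \<phi> (shift t p)) = mass \<phi> + 2 * Re (L2_inner M \<phi> \<eta>) + mass \<eta>"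
    using norm_expand[OF D_L2[OF \<phi>] D_L2[OF \<eta>]] unfolding eq norm_eq[OF \<psi>] norm_eq[OF \<phi>] norm_eq[OF \<eta>] .
  have "\<phi> \<in> Cc_infinity UNIV" by (rule Cc_mono[OF \<phi>]) simp
  from energy_variation[OF this t(1) t' E] show ?thesis
    unfolding 1 2 a_eq[OF \<phi>] using Dir_nonneg[of \<eta>] by (simp add: algebra_simps)
qed

text \<open>The order of the limits matters. First t is fixed so small that the errors, divided by
  t, stay below e/2; this is uniform in n because the form norms are bounded. Then n is taken so
  large that the tested equation holds up to a small multiple of t.\<close>

lemma rellich_limit:
  assumes r: "represents \<phi> u (\<lambda>x. of_real (\<rho> x) * f x + Complex E \<epsilon> * u x)" and f: "f \<in> L2 M"
    and \<rho>: "\<And>p. 0 \<le> \<rho> p" "\<And>p. \<rho> p \<le> 1" "\<And>p q. \<bar>\<rho> p - \<rho> q\<bar> \<le> L * norm (p - q)"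
    and E: "0 \<le> E" and \<epsilon>: "0 \<le> \<epsilon>" and e: "0 < e"
  shows "\<forall>\<^sub>F n in sequentially. (LINT p|lborel. qdens E (\<phi> n) p)
     \<le> 2 * L2_norm M f * sqrt (LINT p|lborel. (\<rho> p * cmod (XD (\<phi> n) p))\<^sup>2)
       + 2 * (\<epsilon> * L2_norm M u) * sqrt (LINT p|lborel. (1 * cmod (XD (\<phi> n) p))\<^sup>2) + e"
proof -
  have conv: "form_converges M (\<lambda>\<phi> p. - laplacian \<phi> p) (Cc_infinity \<Omega>) \<phi> u" using r by (simp add: represents_def)
  note C = form_converges_Cauchy[OF conv]
  note D = form_Cauchy_D[OF C]
  have uL: "u \<in> L2 M" using conv by (simp add: form_converges_def)
  have c\<rho>: "continuous_on UNIV \<rho>"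
    using \<rho>(3) L1 by (intro lipschitz_on_continuous_on[of L]) (auto simp: lipschitz_on_def dist_real_def dist_norm)
  have FL: "(\<lambda>x. of_real (\<rho> x) * f x) \<in> L2 M"
    by (rule L2_bounded_mult[OF f _, of _ 1])
       (use \<rho> c\<rho> in \<open>auto intro!: borel_imp_lebesgue_on borel_measurable_continuous_onI continuous_intros\<close>)
  obtain B where B: "\<And>n. a (\<phi> n) \<le> B" using form_Cauchy_bounded[OF C] by auto
  have B0: "0 \<le> B" using B[of 0] a_nonneg[OF D[of 0]] by linarith
  define f0 where "f0 = L2_norm M f"
  define u0 where "u0 = \<epsilon> * L2_norm M u"
  have n0: "0 \<le> f0" "0 \<le> u0" using \<epsilon> by (auto simp: f0_def u0_def L2_norm_nonneg)
  define C1 where "C1 = 64 * L ^ 4"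
  define C2 where "C2 = 2 * L\<^sup>2 + C1"
  define Cv where "Cv = L ^ 3 * (84 + 28 * E)"
  have C0: "0 \<le> C1" "0 \<le> C2" "0 \<le> Cv" using L1 E by (auto simp: C1_def C2_def Cv_def)
  \<comment> \<open>The total error divided by t; the square root stems from the term 64 L^4 t Dir
    in \<open>shift_difference\<close>.\<close>
  define R where "R t = 2 * (f0 + u0) * sqrt (C1 * t * B) + (E * C2 + Cv) * B * t" for t
  have "(R \<longlongrightarrow> 2 * (f0 + u0) * sqrt (C1 * 0 * B) + (E * C2 + Cv) * B * 0) (at_right 0)"
    unfolding R_def[abs_def] by (intro tendsto_intros)
  then have "(R \<longlongrightarrow> 0) (at_right 0)" by simp
  then have "\<forall>\<^sub>F t in at_right 0. R t < e / 2" by (rule order_tendstoD) (use e in simp)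
  moreover have "\<forall>\<^sub>F t in at_right 0. t \<in> {0<..<t1}" by (rule eventually_at_rightI[OF _ t1(1)])
  ultimately have "\<forall>\<^sub>F t in at_right 0. R t < e / 2 \<and> t \<in> {0<..<t1}" by (rule eventually_conj)
  then obtain t where t: "R t < e / 2" "0 < t" "t < t1"
    using eventually_happens[of _ "at_right (0::real)"] by (auto simp: trivial_limit_at_right_real)
  then have t': "0 \<le> t" "t \<le> t1" "t \<le> t0" using t1 by auto
  have tl1: "t \<le> 1" using small_t(2)[OF t'(1,3)] .
  define \<eta> where "\<eta> n p = \<phi> n (shift t p) - \<phi> n p" for n p
  have \<eta>C: "form_Cauchy \<eta>"
    using form_Cauchy_add[OF form_Cauchy_shift[OF t'(1,2) C] form_Cauchy_scale[OF C, of "-1"]] by (simp add: \<eta>_def[abs_def])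
  note \<eta>D = form_Cauchy_D[OF \<eta>C]
  note pL = D_L2[OF D] and eL = D_L2[OF \<eta>D]
  \<comment> \<open>The real part of the defect of the equation tested with \<eta> n; the sign of
    the last term comes from Re (i \<epsilon> z) = - \<epsilon> Im z.\<close>
  define d where "d n = Re (b (\<phi> n) (\<eta> n)) - E * Re (L2_inner M (\<phi> n) (\<eta> n)) - Re (L2_inner M (\<lambda>x. of_real (\<rho> x) * f x) (\<eta> n))
      + \<epsilon> * Im (L2_inner M u (\<eta> n))" for n
  have "d \<longlonglongrightarrow> 0"
  proof -
    have 1: "(\<lambda>n. b (\<phi> n) (\<eta> n) - L2_inner M (\<lambda>x. of_real (\<rho> x) * f x + Complex E \<epsilon> * u x) (\<eta> n)) \<longlonglongrightarrow> 0"
      using r \<eta>C by (simp add: represents_def)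
    have 2: "(\<lambda>n. L2_inner M (\<lambda>x. u x - \<phi> n x) (\<eta> n)) \<longlonglongrightarrow> 0" by (rule inner_diff_tendsto_zero[OF conv \<eta>C])
    have "(\<lambda>n. Re (b (\<phi> n) (\<eta> n) - L2_inner M (\<lambda>x. of_real (\<rho> x) * f x + Complex E \<epsilon> * u x) (\<eta> n))
       + E * Re (L2_inner M (\<lambda>x. u x - \<phi> n x) (\<eta> n))) \<longlonglongrightarrow> Re 0 + E * Re 0"
      by (intro tendsto_intros 1 2)
    then show ?thesis
      unfolding L2_inner_add_left[OF FL L2_scale[OF uL] eL] L2_inner_diff_left[OF uL pL eL] L2_inner_scale_left
      by (simp add: d_def[abs_def] algebra_simps)
  qed
  then have "\<forall>\<^sub>F n in sequentially. - (t * e / 4) < d n"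
    by (rule order_tendstoD) (use t e in simp)
  then show ?thesis
  proof eventually_elim
    case (elim n)
    define N where "N = sqrt (LINT p|lborel. (\<rho> p * cmod (XD (\<phi> n) p))\<^sup>2)"
    define Y where "Y = sqrt (LINT p|lborel. (1 * cmod (XD (\<phi> n) p))\<^sup>2)"
    have \<phi>U: "\<phi> n \<in> Cc_infinity UNIV" by (rule Cc_mono[OF D]) simp
    have Dle: "Dir (\<phi> n) \<le> B" using B[of n] mass_nonneg[of "\<phi> n"] unfolding a_eq[OF D] by linarith
    have diff: "sqrt (LINT p|lborel. (\<sigma> p * cmod (\<eta> n p))\<^sup>2) \<le> t * (sqrt (LINT p|lborel. (\<sigma> p * cmod (XD (\<phi> n) p))\<^sup>2) + sqrt (C1 * t * B))"
      if "\<And>p. 0 \<le> \<sigma> p" "\<And>p. \<sigma> p \<le> 1" "\<And>p q. \<bar>\<sigma> p - \<sigma> q\<bar> \<le> L * norm (p - q)" for \<sigma>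
    proof -
      have i: "0 \<le> (LINT p|lborel. (\<sigma> p * cmod (XD (\<phi> n) p))\<^sup>2)" by (rule integral_nonneg_AE) simp
      have "(LINT p|lborel. (\<sigma> p * cmod (\<eta> n p))\<^sup>2) \<le> t\<^sup>2 * ((LINT p|lborel. (\<sigma> p * cmod (XD (\<phi> n) p))\<^sup>2) + 64 * L ^ 4 * t * Dir (\<phi> n))"
        unfolding \<eta>_def by (rule shift_difference[OF \<phi>U t'(1,3) that])
      also have "\<dots> \<le> t\<^sup>2 * ((LINT p|lborel. (\<sigma> p * cmod (XD (\<phi> n) p))\<^sup>2) + C1 * t * B)"
        using Dle C0 t' by (intro mult_left_mono add_left_mono) (auto simp: C1_def intro!: mult_left_mono)
      finally have "sqrt (LINT p|lborel. (\<sigma> p * cmod (\<eta> n p))\<^sup>2) \<le> sqrt (t\<^sup>2 * ((LINT p|lborel. (\<sigma> p * cmod (XD (\<phi> n) p))\<^sup>2) + C1 * t * B))"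
        by simp
      also have "\<dots> = t * sqrt ((LINT p|lborel. (\<sigma> p * cmod (XD (\<phi> n) p))\<^sup>2) + C1 * t * B)"
        using t' by (simp add: real_sqrt_mult)
      also have "\<dots> \<le> t * (sqrt (LINT p|lborel. (\<sigma> p * cmod (XD (\<phi> n) p))\<^sup>2) + sqrt (C1 * t * B))"
        using i C0 t' B0 by (intro mult_left_mono sqrt_add_le_add_sqrt) auto
      finally show ?thesis .
    qed
    have one: "\<bar>1 - 1\<bar> \<le> L * norm (p - q)" for p q :: "real \<times> real" using L1 by simp
    have ip1: "cmod (L2_inner M (\<lambda>x. of_real (\<rho> x) * f x) (\<eta> n)) \<le> f0 * (t * (N + sqrt (C1 * t * B)))"
      using weighted_inner_bound(1)[OF f \<eta>D[of n] c\<rho> \<rho>(1,2)] mult_left_mono[OF diff[OF \<rho>] n0(1)]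
      unfolding f0_def N_def by linarith
    have ip2: "\<epsilon> * cmod (L2_inner M u (\<eta> n)) \<le> u0 * (t * (Y + sqrt (C1 * t * B)))"
    proof -
      have "cmod (L2_inner M (\<lambda>x. of_real 1 * u x) (\<eta> n)) \<le> L2_norm M u * sqrt (LINT p|lborel. (1 * cmod (\<eta> n p))\<^sup>2)"
        by (rule weighted_inner_bound(1)[OF uL \<eta>D]) auto
      also have "\<dots> \<le> L2_norm M u * (t * (Y + sqrt (C1 * t * B)))"
        unfolding Y_def by (intro mult_left_mono diff[OF _ _ one] L2_norm_nonneg) auto
      finally have "\<epsilon> * cmod (L2_inner M u (\<eta> n)) \<le> \<epsilon> * (L2_norm M u * (t * (Y + sqrt (C1 * t * B))))"
        using \<epsilon> by (intro mult_left_mono) auto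
      then show ?thesis by (simp add: u0_def mult_ac)
    qed
    have m\<eta>: "mass (\<eta> n) \<le> t\<^sup>2 * (C2 * B)"
    proof -
      have "mass (\<eta> n) = (LINT p|lborel. (1 * cmod (\<eta> n p))\<^sup>2)" by (simp add: mass_def)
      also have "\<dots> \<le> t\<^sup>2 * ((LINT p|lborel. (1 * cmod (XD (\<phi> n) p))\<^sup>2) + 64 * L ^ 4 * t * Dir (\<phi> n))"
        unfolding \<eta>_def by (rule shift_difference[OF \<phi>U t'(1,3) _ _ one]) auto
      also have "\<dots> \<le> t\<^sup>2 * (2 * L\<^sup>2 * Dir (\<phi> n) + C1 * 1 * Dir (\<phi> n))"
        using XD_bound(2)[OF D[of n]] t' tl1 C0 Dir_nonneg[of "\<phi> n"] unfolding C1_def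
        by (intro mult_left_mono add_mono mult_right_mono mult_mono) auto
      also have "\<dots> = t\<^sup>2 * (C2 * Dir (\<phi> n))" by (simp add: C2_def algebra_simps)
      also have "\<dots> \<le> t\<^sup>2 * (C2 * B)" using Dle C0 by (intro mult_left_mono) auto
      finally show ?thesis .
    qed
    have "t * (LINT p|lborel. qdens E (\<phi> n) p) \<le> - 2 * (Re (b (\<phi> n) (\<eta> n)) - E * Re (L2_inner M (\<phi> n) (\<eta> n)))
        + E * mass (\<eta> n) + Cv * t\<^sup>2 * a (\<phi> n)"
      using rellich_finite[OF D t'(1,2) E, of n] unfolding \<eta>_def[abs_def] Cv_def .
    also have "\<dots> \<le> - 2 * (Re (b (\<phi> n) (\<eta> n)) - E * Re (L2_inner M (\<phi> n) (\<eta> n))) + E * (t\<^sup>2 * (C2 * B)) + Cv * t\<^sup>2 * B"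
      using mult_left_mono[OF m\<eta> E] mult_left_mono[OF B[of n], of "Cv * t\<^sup>2"] C0(3) by simp
    also have "\<dots> = - 2 * (d n + Re (L2_inner M (\<lambda>x. of_real (\<rho> x) * f x) (\<eta> n)) - \<epsilon> * Im (L2_inner M u (\<eta> n))) + t * ((E * C2 + Cv) * B * t)"
      by (simp add: d_def power2_eq_square algebra_simps)
    also have "\<dots> \<le> - 2 * d n + 2 * (f0 * (t * (N + sqrt (C1 * t * B)))) + 2 * (u0 * (t * (Y + sqrt (C1 * t * B)))) + t * ((E * C2 + Cv) * B * t)"
    proof -
      have gen: "- 2 * (d' + r - i) + z \<le> - 2 * d' + 2 * P + 2 * Q + z"
        if "i \<le> c'" "- r \<le> c" "c \<le> P" "c' \<le> Q" for d' r i z P Q c c' :: real using that by argo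
      have "\<epsilon> * Im (L2_inner M u (\<eta> n)) \<le> \<epsilon> * cmod (L2_inner M u (\<eta> n))"
        using \<epsilon> abs_Im_le_cmod[of "L2_inner M u (\<eta> n)"] by (intro mult_left_mono) auto
      moreover have "- Re (L2_inner M (\<lambda>x. of_real (\<rho> x) * f x) (\<eta> n)) \<le> cmod (L2_inner M (\<lambda>x. of_real (\<rho> x) * f x) (\<eta> n))"
        using abs_Re_le_cmod[of "L2_inner M (\<lambda>x. of_real (\<rho> x) * f x) (\<eta> n)"] by linarith
      ultimately show ?thesis using ip1 ip2 by (rule gen)
    qed
    also have "\<dots> = - 2 * d n + t * (2 * f0 * N + 2 * u0 * Y + R t)"
      by (simp add: R_def algebra_simps)
    also have "\<dots> \<le> t * (2 * f0 * N + 2 * u0 * Y + R t) + t * (e / 2)" using elim by simp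
    also have "\<dots> \<le> t * (2 * f0 * N + 2 * u0 * Y + e / 2) + t * (e / 2)" using t by simp
    also have "\<dots> = t * (2 * f0 * N + 2 * u0 * Y + e)" by (simp add: algebra_simps)
    finally have "(LINT p|lborel. qdens E (\<phi> n) p) \<le> 2 * f0 * N + 2 * u0 * Y + e" using t(2) by simp
    then show ?case by (simp only: f0_def u0_def N_def Y_def)
  qed
qed

end

section \<open>From pointwise coercivity to a resolvent bound\<close>

lemma L2_norm_bounded_mult:
  assumes f: "f \<in> L2 M" and m: "m \<in> borel_measurable M" and b: "\<And>x. x \<in> space M \<Longrightarrow> cmod (m x) \<le> B" and B: "0 \<le> B"
  shows "L2_norm M (\<lambda>x. m x * f x) \<le> B * L2_norm M f"
proof (rule power2_le_imp_le)
  have "(L2_norm M (\<lambda>x. m x * f x))\<^sup>2 \<le> (LINT x|M. B\<^sup>2 * (cmod (f x))\<^sup>2)"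
    unfolding L2_norm_squared
  proof (rule integral_mono)
    show "integrable M (\<lambda>x. (cmod (m x * f x))\<^sup>2)" by (rule L2_integrable[OF L2_bounded_mult[OF f m b]])
    show "integrable M (\<lambda>x. B\<^sup>2 * (cmod (f x))\<^sup>2)" using L2_integrable[OF f] by simp
    show "(cmod (m x * f x))\<^sup>2 \<le> B\<^sup>2 * (cmod (f x))\<^sup>2" if "x \<in> space M" for x
      using b[OF that] by (auto simp: norm_mult power_mult_distrib intro!: mult_right_mono power_mono)
  qed
  also have "\<dots> = (B * L2_norm M f)\<^sup>2" by (simp add: L2_norm_squared power_mult_distrib)
  finally show "(L2_norm M (\<lambda>x. m x * f x))\<^sup>2 \<le> (B * L2_norm M f)\<^sup>2" .
qed (use B L2_norm_nonneg[of M f] in simp)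

lemma L2_norm_tendsto:
  assumes "\<And>n. \<phi> n \<in> L2 M" "u \<in> L2 M" "(\<lambda>n. L2_norm M (\<lambda>x. \<phi> n x - u x)) \<longlonglongrightarrow> 0"
  shows "(\<lambda>n. L2_norm M (\<phi> n)) \<longlonglongrightarrow> L2_norm M u"
proof (rule Lim_null[THEN iffD2], rule Lim_null_comparison[OF _ assms(3)])
  have "norm (L2_norm M (\<phi> n) - L2_norm M u) \<le> L2_norm M (\<lambda>x. \<phi> n x - u x)" for n
    using L2_norm_triangle_diff[OF assms(1) assms(2), of n] L2_norm_triangle_diff[OF assms(2) assms(1), of n]
      L2_norm_minus_commute[of M u "\<phi> n"] by auto
  then show "\<forall>\<^sub>F n in sequentially. norm (L2_norm M (\<phi> n) - L2_norm M u) \<le> L2_norm M (\<lambda>x. \<phi> n x - u x)" by simp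
qed

text \<open>The integrand is the x-derivative of g |\<phi>|^2.\<close>

lemma null_Lagrangian:
  assumes \<phi>: "\<phi> \<in> Cc_infinity \<Omega>" and g: "smooth g" "\<And>p. (g has_derivative (\<lambda>v. fst v * g1 p + snd v * g2 p)) (at p)"
    and gc: "continuous_on UNIV g1"
  shows "(LINT p|lborel. g1 p * (cmod (\<phi> p))\<^sup>2 + 2 * g p * Re (D1 \<phi> p * cnj (\<phi> p))) = 0"
proof -
  note s = Cc_smooth[OF \<phi>]
  have s2: "smooth (\<lambda>p. \<phi> p * cnj (\<phi> p))" by (intro smooth_on_mult s smooth_on_comp_linear[OF bounded_linear_cnj])
  define h where "h p = complex_of_real (g p) * (\<phi> p * cnj (\<phi> p))" for p
  have h: "h \<in> Cc_infinity \<Omega>" unfolding h_def[abs_def]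
    by (intro Cc_mult smooth_on_of_real g Cc_cnj \<phi> s)
  have "((\<lambda>p. complex_of_real (g p)) has_derivative (\<lambda>v. fst v *\<^sub>R of_real (g1 p) + snd v *\<^sub>R of_real (g2 p))) (at p)" for p
    using bounded_linear.has_derivative[OF bounded_linear_of_real g(2)[of p]] by (simp add: scaleR_conv_of_real)
  note Dg = partials_eqI(1)[OF this]
  have "D1 h p = of_real (g1 p * (cmod (\<phi> p))\<^sup>2 + 2 * g p * Re (D1 \<phi> p * cnj (\<phi> p)))" for p
  proof -
    have "D1 h p = of_real (g p) * (\<phi> p * cnj (D1 \<phi> p) + D1 \<phi> p * cnj (\<phi> p)) + of_real (g1 p) * (\<phi> p * cnj (\<phi> p))"
      unfolding h_def[abs_def] D_mult(1)[OF smooth_on_of_real[OF g(1)] s2] Dg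
        D_mult(1)[OF s smooth_on_comp_linear[OF bounded_linear_cnj s]] D_cnj(1)[OF s] ..
    also have "\<phi> p * cnj (D1 \<phi> p) + D1 \<phi> p * cnj (\<phi> p) = of_real (2 * Re (D1 \<phi> p * cnj (\<phi> p)))"
      using complex_add_cnj[of "D1 \<phi> p * cnj (\<phi> p)"] by (simp add: mult.commute add.commute)
    also have "\<phi> p * cnj (\<phi> p) = of_real ((cmod (\<phi> p))\<^sup>2)" by (simp only: complex_norm_square)
    finally show ?thesis by simp
  qed
  then have "complex_of_real (LINT p|lborel. g1 p * (cmod (\<phi> p))\<^sup>2 + 2 * g p * Re (D1 \<phi> p * cnj (\<phi> p))) = 0"
    using integral_D1_zero[OF h] by (simp only: integral_complex_of_real)
  then show ?thesis by (simp only: of_real_eq_0_iff)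
qed

text \<open>Unless U is already below f / c, the term f^2 / c is at most f U and a factor U
  cancels.\<close>

lemma quadratic_bound:
  fixes U f K c :: real
  assumes "0 \<le> U" "0 \<le> f" "0 < c" "0 \<le> K" and le: "c * U\<^sup>2 \<le> f\<^sup>2 / c + K * f * U"
  shows "U \<le> (1 + K) / c * f"
proof (cases "U \<le> f / c")
  case True
  have "f / c \<le> (1 + K) / c * f" using assms by (simp add: field_simps)
  then show ?thesis using True by linarith
next
  case False
  then have U: "0 < U" "f \<le> c * U" using assms(2,3) by (auto simp: field_simps intro: le_less_trans[of 0 "f / c"])
  have "f * f \<le> f * (c * U)" using U assms by (intro mult_left_mono) auto
  then have "f\<^sup>2 / c \<le> f * U" using assms by (simp add: field_simps power2_eq_square)
  then have "c * U * U \<le> (1 + K) * f * U" using le by (simp add: power2_eq_square algebra_simps)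
  then have "c * U \<le> (1 + K) * f" using U by simp
  then show ?thesis using assms(3) by (simp add: field_simps)
qed

context outgoing_field
begin

text \<open>The right side of \<open>coercive\<close> adds up three integrands: of the Rellich
  inequality, of the equation tested with m u, and of the null Lagrangian of g. It is demanded for
  independent values w, a, b in place of u and its partial derivatives. The weighted X . grad u
  stands on the left because this is what the Rellich inequality pairs with f.\<close>

lemma coercive_resolvent_bound:
  fixes m m1 m2 g g1 g2 \<rho> :: "real \<times> real \<Rightarrow> real"
  assumes m: "smooth m" "\<And>p. (m has_derivative (\<lambda>v. fst v * m1 p + snd v * m2 p)) (at p)"
    and mb: "\<And>p. \<bar>m p\<bar> \<le> B" "\<And>p. \<bar>m1 p\<bar> \<le> B" "\<And>p. \<bar>m2 p\<bar> \<le> B"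
    and mc: "continuous_on UNIV m1" "continuous_on UNIV m2"
    and g: "smooth g" "\<And>p. (g has_derivative (\<lambda>v. fst v * g1 p + snd v * g2 p)) (at p)" "continuous_on UNIV g1"
    and \<rho>: "\<And>p. 0 \<le> \<rho> p" "\<And>p. \<rho> p \<le> 1" "\<And>p q. \<bar>\<rho> p - \<rho> q\<bar> \<le> L * norm (p - q)"
    and c: "0 < c"
    and coercive: "\<And>p a b w. p \<in> \<Omega> \<Longrightarrow>
       c * ((\<rho> p)\<^sup>2 * (cmod w)\<^sup>2 + (\<rho> p)\<^sup>2 * (cmod (of_real (X1 p) * a + of_real (X2 p) * b))\<^sup>2)
       \<le> 2 * (X11 p * (cmod a)\<^sup>2 + X22 p * (cmod b)\<^sup>2 + (X12 p + X21 p) * Re (a * cnj b))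
          - (X11 p + X22 p) * ((cmod a)\<^sup>2 + (cmod b)\<^sup>2 - E * (cmod w)\<^sup>2)
          + (m p * ((cmod a)\<^sup>2 + (cmod b)\<^sup>2 - E * (cmod w)\<^sup>2) + m1 p * Re (a * cnj w) + m2 p * Re (b * cnj w))
          + (g1 p * (cmod w)\<^sup>2 + 2 * g p * Re (a * cnj w))"
    and E: "1 \<le> E" and \<epsilon>: "0 < \<epsilon>" "\<epsilon> \<le> 1" and f: "f \<in> L2 M"
    and mem: "(u, \<lambda>x. of_real (\<rho> x) * f x + Complex E \<epsilon> * u x) \<in> A"
  shows "L2_norm M (\<lambda>x. of_real (\<rho> x) * u x) \<le> (1 + 4 * L + B) / c * sqrt E * L2_norm M f"
proof -
  obtain \<phi> where r: "represents \<phi> u (\<lambda>x. of_real (\<rho> x) * f x + Complex E \<epsilon> * u x)"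
    using mem_imp_represents[OF mem] by auto
  have conv: "form_converges M (\<lambda>\<phi> p. - laplacian \<phi> p) (Cc_infinity \<Omega>) \<phi> u" using r by (simp add: represents_def)
  note C = form_converges_Cauchy[OF conv]
  note D = form_Cauchy_D[OF C]
  have uL: "u \<in> L2 M" and lim: "(\<lambda>n. L2_norm M (\<lambda>x. \<phi> n x - u x)) \<longlonglongrightarrow> 0" using conv by (auto simp: form_converges_def)
  have c\<rho>: "continuous_on UNIV \<rho>"
    using \<rho>(3) L1 by (intro lipschitz_on_continuous_on[of L]) (auto simp: lipschitz_on_def dist_real_def dist_norm)
  have m\<rho>: "(\<lambda>x. complex_of_real (\<rho> x)) \<in> borel_measurable M"
    using c\<rho> by (intro borel_imp_lebesgue_on borel_measurable_continuous_onI continuous_intros)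
  define F where "F x = of_real (\<rho> x) * f x" for x
  have FL: "F \<in> L2 M" unfolding F_def[abs_def] by (rule L2_bounded_mult[OF f m\<rho>, of 1]) (use \<rho> in auto)
  have B0: "0 \<le> B" using mb(1)[of 0] by linarith
  define f0 where "f0 = L2_norm M f"
  define U where "U = L2_norm M (\<lambda>x. of_real (\<rho> x) * u x)"
  define u0 where "u0 = L2_norm M u"
  define T where "T = f0 * U"
  have n0: "0 \<le> f0" "0 \<le> U" "0 \<le> u0" "0 \<le> T" by (auto simp: f0_def U_def u0_def T_def L2_norm_nonneg)
  have \<rho>uL: "(\<lambda>x. of_real (\<rho> x) * u x) \<in> L2 M" by (rule L2_bounded_mult[OF uL m\<rho>, of 1]) (use \<rho> in auto)
  \<comment> \<open>The weight of \<rho> f is moved to u, so \<open>T\<close> involves only the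
    quantity \<open>U\<close> that is to be bounded.\<close>
  have energy: "\<epsilon> * u0\<^sup>2 \<le> T"
  proof -
    have mem': "(u, \<lambda>x. F x + Complex E \<epsilon> * u x) \<in> A" using mem by (simp add: F_def[abs_def])
    have "L2_inner M F u = L2_inner M f (\<lambda>x. of_real (\<rho> x) * u x)" unfolding L2_inner_def F_def by (simp add: mult_ac)
    then have "cmod (L2_inner M F u) \<le> T" using L2_Cauchy_Schwarz[OF f \<rho>uL] by (simp add: T_def f0_def U_def)
    then show ?thesis using resolvent_energy[OF FL mem'] abs_Im_le_cmod[of "L2_inner M F u"] by (simp add: u0_def)
  qed
  define P where "P n = sqrt (LINT p|lborel. (\<rho> p * cmod (\<phi> n p))\<^sup>2)" for n
  define N where "N n = sqrt (LINT p|lborel. (\<rho> p * cmod (XD (\<phi> n) p))\<^sup>2)" for n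
  define Y where "Y n = sqrt (LINT p|lborel. (1 * cmod (XD (\<phi> n) p))\<^sup>2)" for n
  have P_eq: "P n = L2_norm M (\<lambda>x. of_real (\<rho> x) * \<phi> n x)" for n
    unfolding P_def by (rule weighted_inner_bound(2)[OF f D c\<rho> \<rho>(1,2), symmetric])
  have P0: "0 \<le> P n" for n unfolding P_eq by (rule L2_norm_nonneg)
  have limP: "P \<longlonglongrightarrow> U"
    unfolding U_def P_eq[abs_def]
  proof (rule L2_norm_tendsto[OF weighted_inner_bound(3)[OF f D c\<rho> \<rho>(1,2)] \<rho>uL])
    show "(\<lambda>n. L2_norm M (\<lambda>x. of_real (\<rho> x) * \<phi> n x - of_real (\<rho> x) * u x)) \<longlonglongrightarrow> 0"
    proof (rule Lim_null_comparison[OF _ lim])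
      have "L2_norm M (\<lambda>x. of_real (\<rho> x) * \<phi> n x - of_real (\<rho> x) * u x) \<le> 1 * L2_norm M (\<lambda>x. \<phi> n x - u x)" for n
        unfolding right_diff_distrib[symmetric]
        by (rule L2_norm_bounded_mult[OF L2_diff[OF D_L2[OF D] uL] m\<rho>]) (use \<rho> in auto)
      then show "\<forall>\<^sub>F n in sequentially. norm (L2_norm M (\<lambda>x. of_real (\<rho> x) * \<phi> n x - of_real (\<rho> x) * u x)) \<le> L2_norm M (\<lambda>x. \<phi> n x - u x)"
        by (simp add: L2_norm_nonneg)
    qed
  qed
  have limu: "(\<lambda>n. mass (\<phi> n)) \<longlonglongrightarrow> u0\<^sup>2"
    unfolding norm_eq[OF D, symmetric] u0_def by (intro tendsto_power L2_norm_tendsto[OF D_L2[OF D] uL lim])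
  have r': "represents \<phi> u (\<lambda>x. F x + Complex E \<epsilon> * u x)" using r by (simp add: F_def[abs_def])
  have Fin: "cmod (L2_inner M F (\<phi> n)) \<le> f0 * P n" for n
    using weighted_inner_bound(1)[OF f D[of n] c\<rho> \<rho>(1,2)] by (simp add: F_def[abs_def] f0_def P_def)
  \<comment> \<open>The multiplier identity with m = 1.\<close>
  have limDir: "(\<lambda>n. Dir (\<phi> n) - E * mass (\<phi> n) - Re (L2_inner M F (\<phi> n))) \<longlonglongrightarrow> 0"
  proof -
    have "(\<lambda>n. (LINT p|lborel. 1 * ((cmod (D1 (\<phi> n) p))\<^sup>2 + (cmod (D2 (\<phi> n) p))\<^sup>2 - E * (cmod (\<phi> n p))\<^sup>2)
      + 0 * Re (D1 (\<phi> n) p * cnj (\<phi> n p)) + 0 * Re (D2 (\<phi> n) p * cnj (\<phi> n p)))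
      - Re (L2_inner M F (\<lambda>p. of_real 1 * \<phi> n p))) \<longlonglongrightarrow> 0"
      by (rule multiplier_limit[OF r' FL, where B = 1]) (auto intro!: smooth_on_const derivative_eq_intros)
    moreover have "(LINT p|lborel. 1 * ((cmod (D1 (\<phi> n) p))\<^sup>2 + (cmod (D2 (\<phi> n) p))\<^sup>2 - E * (cmod (\<phi> n p))\<^sup>2)
      + 0 * Re (D1 (\<phi> n) p * cnj (\<phi> n p)) + 0 * Re (D2 (\<phi> n) p * cnj (\<phi> n p))) = Dir (\<phi> n) - E * mass (\<phi> n)" for n
      unfolding Dir_def mass_def using Cc_cc[OF D[of n], THEN cont_compact_integrable] by simp
    ultimately show ?thesis by simp
  qed
  have Dir_ev: "\<forall>\<^sub>F n in sequentially. Dir (\<phi> n) < E * u0\<^sup>2 + T + e" if e: "0 < e" for e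
  proof -
    have "(\<lambda>n. (Dir (\<phi> n) - E * mass (\<phi> n) - Re (L2_inner M F (\<phi> n))) + E * mass (\<phi> n) + f0 * P n) \<longlonglongrightarrow> 0 + E * u0\<^sup>2 + f0 * U"
      by (intro tendsto_intros limDir limu limP)
    then have "\<forall>\<^sub>F n in sequentially. (Dir (\<phi> n) - E * mass (\<phi> n) - Re (L2_inner M F (\<phi> n))) + E * mass (\<phi> n) + f0 * P n < E * u0\<^sup>2 + T + e"
      by (rule order_tendstoD) (use e in \<open>simp add: T_def\<close>)
    then show ?thesis
    proof eventually_elim
      case (elim n)
      then show ?case using Fin[of n] complex_Re_le_cmod[of "L2_inner M F (\<phi> n)"] by linarith
    qed
  qed
  have main: "\<forall>\<^sub>F n in sequentially. c * (P n)\<^sup>2 \<le> f0\<^sup>2 / c + 2 * (sqrt 2 * L) * sqrt (2 * E * T\<^sup>2 + T * e) + f0 * B * P n + 2 * e"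
    if e: "0 < e" for e
  proof -
    have mult: "\<forall>\<^sub>F n in sequentially. (LINT p|lborel. m p * ((cmod (D1 (\<phi> n) p))\<^sup>2 + (cmod (D2 (\<phi> n) p))\<^sup>2 - E * (cmod (\<phi> n p))\<^sup>2)
      + m1 p * Re (D1 (\<phi> n) p * cnj (\<phi> n p)) + m2 p * Re (D2 (\<phi> n) p * cnj (\<phi> n p)))
      - Re (L2_inner M F (\<lambda>p. of_real (m p) * \<phi> n p)) < e"
      by (rule order_tendstoD(2)[OF multiplier_limit[OF r' FL m mb mc] e])
    have "0 \<le> \<epsilon>" "0 \<le> E" using \<epsilon> E by auto
    note rel = rellich_limit[OF r f \<rho> this(2,1) e, folded N_def Y_def f0_def u0_def]
    from mult rel Dir_ev[OF e] show ?thesis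
    proof eventually_elim
      case (elim n)
      note s = Cc_cc[OF D[of n]]
      have s2: "cont_compact (\<lambda>p. Re (D2 (\<phi> n) p * cnj (\<phi> n p)))"
        by (intro cont_compact_Re_cnj Cc_cont_compact[of _ \<Omega>] Cc_D2 D)
      have cm: "continuous_on UNIV m" "continuous_on UNIV g" using smooth_continuous m(1) g(1) by auto
      have i1: "integrable lborel (qdens E (\<phi> n))" by (rule cont_compact_integrable[OF cc_qdens[OF D]])
      have i2: "integrable lborel (\<lambda>p. m p * ((cmod (D1 (\<phi> n) p))\<^sup>2 + (cmod (D2 (\<phi> n) p))\<^sup>2 - E * (cmod (\<phi> n p))\<^sup>2)
          + m1 p * Re (D1 (\<phi> n) p * cnj (\<phi> n p)) + m2 p * Re (D2 (\<phi> n) p * cnj (\<phi> n p)))"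
        by (intro cont_compact_integrable cc_intros s s2 cm mc)
      have i3: "integrable lborel (\<lambda>p. g1 p * (cmod (\<phi> n p))\<^sup>2 + 2 * g p * Re (D1 (\<phi> n) p * cnj (\<phi> n p)))"
        by (intro cont_compact_integrable cc_intros s s2 cm g continuous_intros)
      have w: "cont_compact (\<lambda>p. (\<rho> p * cmod (h p))\<^sup>2)" if "cont_compact h" for h :: "real \<times> real \<Rightarrow> complex"
        unfolding power_mult_distrib by (intro cont_compact_mult cont_compact_norm2 that continuous_intros c\<rho>)
      have i4: "integrable lborel (\<lambda>p. (\<rho> p * cmod (\<phi> n p))\<^sup>2)" "integrable lborel (\<lambda>p. (\<rho> p * cmod (XD (\<phi> n) p))\<^sup>2)"
        by (intro cont_compact_integrable w Cc_cont_compact[OF D] XD_bound(1)[OF D])+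
      have sq: "(P n)\<^sup>2 = (LINT p|lborel. (\<rho> p * cmod (\<phi> n p))\<^sup>2)" "(N n)\<^sup>2 = (LINT p|lborel. (\<rho> p * cmod (XD (\<phi> n) p))\<^sup>2)"
        unfolding P_def N_def by (auto intro!: real_sqrt_pow2 integral_nonneg_AE)
      have "c * ((P n)\<^sup>2 + (N n)\<^sup>2) = (LINT p|lborel. c * ((\<rho> p * cmod (\<phi> n p))\<^sup>2 + (\<rho> p * cmod (XD (\<phi> n) p))\<^sup>2))"
        unfolding sq using i4 by simp
      also have "\<dots> \<le> (LINT p|lborel. (qdens E (\<phi> n) p + (m p * ((cmod (D1 (\<phi> n) p))\<^sup>2 + (cmod (D2 (\<phi> n) p))\<^sup>2 - E * (cmod (\<phi> n p))\<^sup>2)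
          + m1 p * Re (D1 (\<phi> n) p * cnj (\<phi> n p)) + m2 p * Re (D2 (\<phi> n) p * cnj (\<phi> n p))))
          + (g1 p * (cmod (\<phi> n p))\<^sup>2 + 2 * g p * Re (D1 (\<phi> n) p * cnj (\<phi> n p))))"
      proof (rule integral_mono)
        fix p
        show "c * ((\<rho> p * cmod (\<phi> n p))\<^sup>2 + (\<rho> p * cmod (XD (\<phi> n) p))\<^sup>2) \<le>
          (qdens E (\<phi> n) p + (m p * ((cmod (D1 (\<phi> n) p))\<^sup>2 + (cmod (D2 (\<phi> n) p))\<^sup>2 - E * (cmod (\<phi> n p))\<^sup>2)
          + m1 p * Re (D1 (\<phi> n) p * cnj (\<phi> n p)) + m2 p * Re (D2 (\<phi> n) p * cnj (\<phi> n p))))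
          + (g1 p * (cmod (\<phi> n p))\<^sup>2 + 2 * g p * Re (D1 (\<phi> n) p * cnj (\<phi> n p)))"
        proof (cases "p \<in> \<Omega>")
          case True
          then show ?thesis using coercive[OF True, of "\<phi> n p" "D1 (\<phi> n) p" "D2 (\<phi> n) p"]
            unfolding qdens_def XD_def power_mult_distrib by (simp only: add.assoc)
        next
          case False
          then show ?thesis using Cc_outside[OF D[of n] False] Cc_outside[OF Cc_D1[OF D[of n]] False] Cc_outside[OF Cc_D2[OF D[of n]] False]
            by (simp add: qdens_def XD_def)
        qed
      qed (use i1 i2 i3 i4 in auto)
      also have "\<dots> = (LINT p|lborel. qdens E (\<phi> n) p) + (LINT p|lborel. m p * ((cmod (D1 (\<phi> n) p))\<^sup>2 + (cmod (D2 (\<phi> n) p))\<^sup>2 - E * (cmod (\<phi> n p))\<^sup>2)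
          + m1 p * Re (D1 (\<phi> n) p * cnj (\<phi> n p)) + m2 p * Re (D2 (\<phi> n) p * cnj (\<phi> n p)))"
        using i1 i2 i3 null_Lagrangian[OF D[of n] g] by simp
      finally have 1: "c * ((P n)\<^sup>2 + (N n)\<^sup>2) \<le> (2 * f0 * N n + 2 * (\<epsilon> * u0) * Y n + e) + (Re (L2_inner M F (\<lambda>p. of_real (m p) * \<phi> n p)) + e)"
        using elim(1,2) by linarith
      have 2: "Re (L2_inner M F (\<lambda>p. of_real (m p) * \<phi> n p)) \<le> f0 * B * P n"
      proof -
        have mC: "(\<lambda>p. of_real (m p) * \<phi> n p) \<in> Cc_infinity \<Omega>" by (intro Cc_mult smooth_on_of_real m D)
        have "cmod (L2_inner M F (\<lambda>p. of_real (m p) * \<phi> n p)) \<le> f0 * sqrt (LINT p|lborel. (\<rho> p * cmod (of_real (m p) * \<phi> n p))\<^sup>2)"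
          using weighted_inner_bound(1)[OF f mC c\<rho> \<rho>(1,2)] by (simp add: F_def[abs_def] f0_def)
        also have "sqrt (LINT p|lborel. (\<rho> p * cmod (of_real (m p) * \<phi> n p))\<^sup>2) = L2_norm M (\<lambda>x. of_real (\<rho> x) * (of_real (m x) * \<phi> n x))"
          by (rule weighted_inner_bound(2)[OF f mC c\<rho> \<rho>(1,2), symmetric])
        also have "\<dots> = L2_norm M (\<lambda>x. of_real (m x) * (of_real (\<rho> x) * \<phi> n x))" by (simp add: mult_ac)
        also have "\<dots> \<le> B * P n" unfolding P_eq
          by (rule L2_norm_bounded_mult[OF weighted_inner_bound(3)[OF f D c\<rho> \<rho>(1,2)] _ _ B0])
             (use cm mb(1) in \<open>auto intro!: borel_imp_lebesgue_on borel_measurable_continuous_onI continuous_intros\<close>)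
        finally have "cmod (L2_inner M F (\<lambda>p. of_real (m p) * \<phi> n p)) \<le> f0 * (B * P n)" using n0 by (simp add: mult_left_mono)
        then show ?thesis using complex_Re_le_cmod[of "L2_inner M F (\<lambda>p. of_real (m p) * \<phi> n p)"] by (simp add: mult.assoc)
      qed
      \<comment> \<open>Since \<epsilon> u0^2 \<le> T and \<epsilon> \<le> 1, the product
        (\<epsilon> u0)^2 (E u0^2 + T) is at most 2 E T^2. Its root is linear in T and carries the
        factor sqrt E of the theorem.\<close>
      have 3: "\<epsilon> * u0 * Y n \<le> sqrt 2 * L * sqrt (2 * E * T\<^sup>2 + T * e)"
      proof -
        have "Y n \<le> sqrt (2 * L\<^sup>2 * Dir (\<phi> n))" unfolding Y_def using XD_bound(2)[OF D[of n]] by simp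
        also have "\<dots> = sqrt 2 * L * sqrt (Dir (\<phi> n))" using L1 by (simp add: real_sqrt_mult)
        also have "\<dots> \<le> sqrt 2 * L * sqrt (E * u0\<^sup>2 + T + e)" using elim(3) L1 by (intro mult_left_mono) auto
        finally have "\<epsilon> * u0 * Y n \<le> \<epsilon> * u0 * (sqrt 2 * L * sqrt (E * u0\<^sup>2 + T + e))"
          using \<epsilon> n0 by (intro mult_left_mono) auto
        also have "\<dots> = sqrt 2 * L * sqrt ((\<epsilon> * u0)\<^sup>2 * (E * u0\<^sup>2 + T + e))"
          using \<epsilon> n0 by (simp add: real_sqrt_mult)
        also have "\<dots> \<le> sqrt 2 * L * sqrt (2 * E * T\<^sup>2 + T * e)"
        proof -
          have v0: "0 \<le> \<epsilon> * u0\<^sup>2" using \<epsilon> by simp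
          have "\<epsilon> * (\<epsilon> * u0\<^sup>2) \<le> 1 * (\<epsilon> * u0\<^sup>2)" using \<epsilon> v0 by (intro mult_right_mono) auto
          then have s1: "(\<epsilon> * u0)\<^sup>2 \<le> T" using energy by (simp add: power2_eq_square mult_ac)
          have a1: "(\<epsilon> * u0)\<^sup>2 * (E * u0\<^sup>2) = E * (\<epsilon> * u0\<^sup>2)\<^sup>2" by (simp add: power2_eq_square)
          have a2: "E * (\<epsilon> * u0\<^sup>2)\<^sup>2 \<le> E * T\<^sup>2" using energy v0 E by (intro mult_left_mono power_mono) auto
          have a3: "(\<epsilon> * u0)\<^sup>2 * T \<le> T * T" using s1 n0 by (intro mult_right_mono) auto
          have a4: "(\<epsilon> * u0)\<^sup>2 * e \<le> T * e" using s1 e by (intro mult_right_mono) auto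
          have a5: "1 * T\<^sup>2 \<le> E * T\<^sup>2" using E by (intro mult_right_mono) auto
          have "(\<epsilon> * u0)\<^sup>2 * (E * u0\<^sup>2 + T + e) \<le> 2 * E * T\<^sup>2 + T * e"
            using a2 a3 a4 a5 unfolding distrib_left a1 by (simp add: power2_eq_square)
          then show ?thesis using L1 by (intro mult_left_mono) auto
        qed
        finally show ?thesis .
      qed
      \<comment> \<open>Young's inequality, with the constant that the weighted norm of X . grad u
        on the left can absorb.\<close>
      have 4: "2 * f0 * N n \<le> c * (N n)\<^sup>2 + f0\<^sup>2 / c"
      proof -
        have "0 \<le> (c * N n - f0)\<^sup>2" by simp
        then have "2 * f0 * (c * N n) \<le> c * (c * (N n)\<^sup>2) + f0\<^sup>2" by (simp add: power2_eq_square algebra_simps)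
        then show ?thesis using c by (simp add: field_simps)
      qed
      show ?case using 1 2 3 4 by (simp add: algebra_simps)
    qed
  qed
  \<comment> \<open>First n tends to infinity, afterwards e to 0.\<close>
  have "c * U\<^sup>2 \<le> f0\<^sup>2 / c + 2 * (sqrt 2 * L) * sqrt (2 * E * T\<^sup>2 + T * e) + f0 * B * U + 2 * e" if e: "0 < e" for e
    by (rule tendsto_le[OF _ _ _ main[OF e]]) (auto intro!: tendsto_intros limP)
  then have ev: "\<forall>\<^sub>F e in at_right 0. c * U\<^sup>2 \<le> f0\<^sup>2 / c + 2 * (sqrt 2 * L) * sqrt (2 * E * T\<^sup>2 + T * e) + f0 * B * U + 2 * e"
    by (auto intro!: eventually_at_rightI[of 0 1])
  have "c * U\<^sup>2 \<le> f0\<^sup>2 / c + 2 * (sqrt 2 * L) * sqrt (2 * E * T\<^sup>2 + T * 0) + f0 * B * U + 2 * 0"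
    by (rule tendsto_le[OF _ _ _ ev]) (simp add: trivial_limit_at_right_real, (intro tendsto_intros)+)
  also have "sqrt (2 * E * T\<^sup>2 + T * 0) = sqrt 2 * sqrt E * T" using n0 E by (simp add: real_sqrt_mult)
  also have "f0\<^sup>2 / c + 2 * (sqrt 2 * L) * (sqrt 2 * sqrt E * T) + f0 * B * U + 2 * 0 = f0\<^sup>2 / c + (4 * L * sqrt E + B) * f0 * U"
    by (simp add: T_def algebra_simps)
  finally have "U \<le> (1 + (4 * L * sqrt E + B)) / c * f0"
    using n0 c L1 B0 E by (intro quadratic_bound) auto
  also have "\<dots> \<le> ((1 + 4 * L + B) * sqrt E) / c * f0"
  proof -
    have "1 * (1 + B) \<le> sqrt E * (1 + B)" using E B0 by (intro mult_right_mono) auto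
    then show ?thesis using c n0 by (intro mult_right_mono divide_right_mono) (auto simp: algebra_simps)
  qed
  finally show ?thesis by (simp add: U_def f0_def)
qed

end

section \<open>Geometry of the obstacle\<close>

text \<open>Thus all functionals supporting \<open>S\<close> at \<open>p\<close> are proportional.\<close>
lemma C11_tangent:
  assumes op: "open S" and C: "C11_boundary S" and p: "p \<in> frontier S"
  obtains e :: "real \<times> real" where "e \<noteq> 0" "\<And>w. (\<And>q. q \<in> S \<Longrightarrow> w \<bullet> q \<le> w \<bullet> p) \<Longrightarrow> w \<bullet> e = 0"
proof -
  have "\<exists>r>0. \<exists>T \<gamma> \<gamma>' L. orthogonal_transformation T \<and>
        (\<forall>t. (\<gamma> has_real_derivative \<gamma>' t) (at t)) \<and> L-lipschitz_on UNIV \<gamma>' \<and>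
        S \<inter> ball p r = {q \<in> ball p r. snd (T (q - p)) > \<gamma> (fst (T (q - p)))}"
    using C p unfolding C11_boundary_def by (rule bspec)
  then obtain r T \<gamma> \<gamma>' where r: "r > 0" and T: "orthogonal_transformation T"
    and \<gamma>: "\<And>t. (\<gamma> has_real_derivative \<gamma>' t) (at t)"
    and S: "S \<inter> ball p r = {q \<in> ball p r. snd (T (q - p)) > \<gamma> (fst (T (q - p)))}"
    by auto
  have linT: "linear T" and bijT: "bij T" using T orthogonal_transformation_linear orthogonal_transformation_bij by auto
  have contT: "continuous_on UNIV T" using linT linear_continuous_on linear_conv_bounded_linear by blast
  have cont\<gamma>: "continuous_on UNIV \<gamma>" using \<gamma> DERIV_isCont continuous_at_imp_continuous_on by blast
  have pS: "p \<notin> S" using p op by (simp add: frontier_def interior_open)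
  have T0: "T 0 = 0" using linear_0[OF linT] .
  \<comment> \<open>One inequality because p is not in the open set S, the other because p is a
    limit of points of S.\<close>
  have "\<gamma> 0 = 0"
  proof (rule antisym)
    show "0 \<le> \<gamma> 0"
    proof (rule ccontr)
      assume "\<not> 0 \<le> \<gamma> 0"
      then have "p \<in> {q \<in> ball p r. snd (T (q - p)) > \<gamma> (fst (T (q - p)))}" using r T0 by simp
      then show False using S pS by blast
    qed
    show "\<gamma> 0 \<le> 0"
    proof (rule ccontr)
      assume neg: "\<not> \<gamma> 0 \<le> 0"
      define h where "h q = \<gamma> (fst (T (q - p))) - snd (T (q - p))" for q
      have "continuous_on UNIV h" unfolding h_def
        by (intro continuous_intros continuous_on_compose2[OF cont\<gamma>] continuous_on_compose2[OF contT]) auto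
      then have "open {q. 0 < h q}" by (intro open_Collect_less continuous_on_const)
      then have "open ({q. 0 < h q} \<inter> ball p r)" by auto
      moreover have "p \<in> {q. 0 < h q} \<inter> ball p r" using neg r T0 by (simp add: h_def)
      moreover have "p \<in> closure S" using p by (simp add: frontier_def)
      ultimately obtain q where "q \<in> S" "q \<in> {q. 0 < h q} \<inter> ball p r" using open_Int_closure_eq_empty by blast
      then have "q \<in> S \<inter> ball p r" "\<gamma> (fst (T (q - p))) > snd (T (q - p))" by (auto simp: h_def)
      then show False unfolding S by simp
    qed
  qed
  define T' where "T' = inv T"
  have TT': "T (T' v) = v" for v unfolding T'_def using bijT by (simp add: bij_is_surj surj_f_inv_f)
  have linT': "linear T'" unfolding T'_def
    using T orthogonal_transformation_inv orthogonal_transformation_linear by blast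
  have normT': "norm (T' v) = norm v" for v
    using T TT'[of v] orthogonal_transformation_norm by metis
  define e where "e = T' (1, \<gamma>' 0)"
  show ?thesis
  proof (rule that)
    show "e \<noteq> 0"
    proof
      assume "e = 0"
      then have "T e = 0" using T0 by simp
      then show False unfolding e_def TT' by (simp add: prod_eq_iff)
    qed
    fix w :: "real \<times> real" assume w: "\<And>q. q \<in> S \<Longrightarrow> w \<bullet> q \<le> w \<bullet> p"
    define n where "n = T' (0, 1)"
    \<comment> \<open>Points slightly above the tangent line at p, in either direction \<sigma>, lie
      in S by differentiability at 0, so w does not exceed its value at p there. Letting \<eta> tend
      to 0 gives both signs of w . e.\<close>
    have key: "\<sigma> * (w \<bullet> e) + \<eta> * (w \<bullet> n) \<le> 0" if \<eta>: "\<eta> > 0" and \<sigma>: "\<sigma> = 1 \<or> \<sigma> = -1" for \<sigma> \<eta> :: real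
    proof -
      have "((\<lambda>h. (\<gamma> (0 + h) - \<gamma> 0) / h) \<longlongrightarrow> \<gamma>' 0) (at 0)" using \<gamma>[of 0] unfolding DERIV_def .
      then have "\<forall>\<^sub>F h in at 0. dist ((\<gamma> (0 + h) - \<gamma> 0) / h) (\<gamma>' 0) < \<eta>" using \<eta> by (rule tendstoD)
      then obtain d where d: "d > 0" "\<And>h. h \<noteq> 0 \<Longrightarrow> \<bar>h\<bar> < d \<Longrightarrow> \<bar>\<gamma> h / h - \<gamma>' 0\<bar> < \<eta>"
        using \<open>\<gamma> 0 = 0\<close> by (auto simp: eventually_at dist_real_def)
      define v where "v = (\<sigma>, \<sigma> * \<gamma>' 0 + \<eta>)"
      have v0: "norm v > 0" using \<sigma> by (auto simp: v_def prod_eq_iff)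
      define s where "s = min (d / 2) (r / (2 * norm v))"
      have s: "0 < s" "s < d" "s * norm v < r"
      proof -
        show "0 < s" "s < d" using d r v0 by (auto simp: s_def)
        have "s * norm v \<le> r / (2 * norm v) * norm v" using v0 by (intro mult_right_mono) (auto simp: s_def)
        also have "\<dots> < r" using v0 r by simp
        finally show "s * norm v < r" .
      qed
      define q where "q = p + T' (s *\<^sub>R v)"
      have Tq: "T (q - p) = s *\<^sub>R v" by (simp add: q_def TT')
      have "\<bar>\<gamma> (s * \<sigma>) / (s * \<sigma>) - \<gamma>' 0\<bar> < \<eta>" using d(2)[of "s * \<sigma>"] s \<sigma> by auto
      then have "\<gamma> (s * \<sigma>) < s * (\<sigma> * \<gamma>' 0 + \<eta>)"
        using s \<sigma> by (auto simp: abs_less_iff field_simps)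
      then have "\<gamma> (fst (T (q - p))) < snd (T (q - p))" unfolding Tq by (simp add: v_def mult.commute)
      moreover have "q \<in> ball p r" using s by (simp add: q_def dist_norm normT' )
      ultimately have "q \<in> S" using S by blast
      then have "w \<bullet> T' (s *\<^sub>R v) \<le> 0" using w[of q] by (simp add: q_def inner_add_right)
      then have "s * (w \<bullet> T' v) \<le> 0" by (simp add: linear_scale[OF linT'])
      then have "w \<bullet> T' v \<le> 0" using s by (simp add: mult_le_0_iff)
      moreover have "T' v = \<sigma> *\<^sub>R e + \<eta> *\<^sub>R n"
      proof -
        have "v = \<sigma> *\<^sub>R (1, \<gamma>' 0) + \<eta> *\<^sub>R (0, 1)" by (simp add: v_def)
        then show ?thesis unfolding e_def n_def by (simp only: linear_add[OF linT'] linear_scale[OF linT'])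
      qed
      ultimately show ?thesis by (simp add: inner_add_right)
    qed
    have le: "\<sigma> * (w \<bullet> e) \<le> 0" if \<sigma>: "\<sigma> = 1 \<or> \<sigma> = -1" for \<sigma>
    proof -
      have "((\<lambda>\<eta>. \<sigma> * (w \<bullet> e) + \<eta> * (w \<bullet> n)) \<longlongrightarrow> \<sigma> * (w \<bullet> e) + 0 * (w \<bullet> n)) (at_right 0)"
        by (intro tendsto_intros)
      moreover have "\<forall>\<^sub>F \<eta> in at_right 0. \<sigma> * (w \<bullet> e) + \<eta> * (w \<bullet> n) \<le> 0"
        using key[OF _ \<sigma>] by (auto intro: eventually_at_rightI[of 0 1])
      ultimately show ?thesis using tendsto_upperbound[of _ _ "at_right (0::real)" 0] by (simp add: trivial_limit_at_right_real)
    qed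
    show "w \<bullet> e = 0" using le[of 1] le[of "-1"] by simp
  qed
qed

section \<open>The closed obstacle: convexity and extremal points\<close>

locale obstacle =
  fixes Ob :: "(real \<times> real) set"
  assumes nonempty: "Ob \<noteq> {}" and op: "open Ob" and bdd: "bounded Ob" and sc: "strictly_convex Ob"
    and C11: "C11_boundary Ob" and strip: "closure Ob \<subseteq> UNIV \<times> {-1<..<1}"
begin

abbreviation K where "K \<equiv> closure Ob"

lemma compact_K: "compact K" using bdd by (simp add: compact_closure)

lemma K_nonempty: "K \<noteq> {}" using nonempty by simp

lemma open_segment_Ob: "p \<in> K \<Longrightarrow> q \<in> K \<Longrightarrow> p \<noteq> q \<Longrightarrow> open_segment p q \<subseteq> Ob"
  using sc op unfolding strictly_convex_def by (simp add: interior_open)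

lemma Ob_K: "Ob \<subseteq> K" by (rule closure_subset)

lemma convex_K: "convex K"
proof (rule convexI)
  fix p q :: "real \<times> real" and u v :: real
  assume pq: "p \<in> K" "q \<in> K" and uv: "0 \<le> u" "0 \<le> v" "u + v = 1"
  have "u *\<^sub>R p + v *\<^sub>R q \<in> closed_segment p q"
    using uv by (auto simp: closed_segment_def intro!: exI[of _ v])
  moreover have "closed_segment p q \<subseteq> K"
    using pq open_segment_Ob[OF pq] Ob_K by (cases "p = q") (auto simp: closed_segment_eq_open)
  ultimately show "u *\<^sub>R p + v *\<^sub>R q \<in> K" by blast
qed

text \<open>A point of the open set is never a maximiser, because it can be moved along w; by strict
  convexity the midpoint of two maximisers would be such a point.\<close>

lemma maximiser:
  assumes p: "p \<in> K" and w: "w \<noteq> (0 :: real \<times> real)" and max: "\<And>q. q \<in> K \<Longrightarrow> w \<bullet> q \<le> w \<bullet> p"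
  shows "p \<in> frontier Ob" "\<And>q. q \<in> K \<Longrightarrow> w \<bullet> q = w \<bullet> p \<Longrightarrow> q = p"
proof -
  have inOb: False if q: "q \<in> Ob" "w \<bullet> q = w \<bullet> p" for q
  proof -
    obtain r where r: "r > 0" "ball q r \<subseteq> Ob" using op q open_contains_ball by blast
    define s where "s = r / (2 * norm w)"
    have s: "s > 0" using r w by (simp add: s_def)
    have "q + s *\<^sub>R w \<in> ball q r" using r w by (simp add: dist_norm s_def)
    then have "w \<bullet> (q + s *\<^sub>R w) \<le> w \<bullet> p" using r Ob_K by (intro max) auto
    then have "s * (w \<bullet> w) \<le> 0" using q by (simp add: inner_add_right)
    moreover have "w \<bullet> w > 0" using w by simp
    ultimately show False using s by (simp add: mult_le_0_iff)
  qed
  then show "p \<in> frontier Ob" using inOb[of p] p op by (auto simp: frontier_def interior_open)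
  fix q assume q: "q \<in> K" "w \<bullet> q = w \<bullet> p"
  show "q = p"
  proof (rule ccontr)
    assume ne: "q \<noteq> p"
    have "midpoint q p \<in> open_segment q p" using ne by simp
    then have "midpoint q p \<in> Ob" using open_segment_Ob[OF q(1) p ne] by blast
    moreover have "w \<bullet> midpoint q p = w \<bullet> p" using q(2) by (simp add: midpoint_def inner_add_right)
    ultimately show False using inOb by blast
  qed
qed

text \<open>Such a point would be a corner: two independent supporting functionals would both
  annihilate the nonzero tangent vector. Here the regularity of the boundary enters.\<close>

lemma no_double_maximiser:
  assumes p: "p \<in> K" and max: "\<And>q. q \<in> K \<Longrightarrow> \<sigma> * fst q \<le> \<sigma> * fst p" "\<And>q. q \<in> K \<Longrightarrow> \<tau> * snd q \<le> \<tau> * snd p"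
    and ne: "\<sigma> \<noteq> (0::real)" "\<tau> \<noteq> (0::real)"
  shows False
proof -
  have 1: "(\<sigma>, 0) \<bullet> q = \<sigma> * fst q" "(0, \<tau>) \<bullet> q = \<tau> * snd q" for q :: "real \<times> real" by (auto simp: inner_prod_def)
  have "p \<in> frontier Ob" using maximiser(1)[OF p, of "(\<sigma>, 0)"] max(1) ne by (simp add: 1 prod_eq_iff)
  then obtain e where e: "e \<noteq> 0" "\<And>w. (\<And>q. q \<in> Ob \<Longrightarrow> w \<bullet> q \<le> w \<bullet> p) \<Longrightarrow> w \<bullet> e = 0"
    using C11_tangent[OF op C11] by metis
  have "(\<sigma>, 0) \<bullet> e = 0" by (rule e(2)) (use max(1)[OF subsetD[OF Ob_K]] in \<open>simp add: 1\<close>)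
  moreover have "(0, \<tau>) \<bullet> e = 0" by (rule e(2)) (use max(2)[OF subsetD[OF Ob_K]] in \<open>simp add: 1\<close>)
  ultimately have "\<sigma> * fst e = 0" "\<tau> * snd e = 0" by (simp_all only: 1)
  then show False using e(1) ne by (simp add: prod_eq_iff)
qed

lemma extremal_points:
  obtains xT yT xB yB xl yl xr yr where
    "(xT, yT) \<in> K" "\<And>p. p \<in> K \<Longrightarrow> snd p \<le> yT" "\<And>p. p \<in> K \<Longrightarrow> snd p = yT \<Longrightarrow> fst p = xT"
    "(xB, yB) \<in> K" "\<And>p. p \<in> K \<Longrightarrow> yB \<le> snd p" "\<And>p. p \<in> K \<Longrightarrow> snd p = yB \<Longrightarrow> fst p = xB"
    "(xl, yl) \<in> K" "(xr, yr) \<in> K" "\<And>p. p \<in> K \<Longrightarrow> xl \<le> fst p" "\<And>p. p \<in> K \<Longrightarrow> fst p \<le> xr"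
    "xl < xT" "xT < xr" "xl < xB" "xB < xr"
proof -
  have c: "continuous_on K fst" "continuous_on K snd" by (auto intro!: continuous_intros)
  obtain T where T: "T \<in> K" "\<And>p. p \<in> K \<Longrightarrow> snd p \<le> snd T" using continuous_attains_sup[OF compact_K K_nonempty c(2)] by blast
  obtain B where B: "B \<in> K" "\<And>p. p \<in> K \<Longrightarrow> snd B \<le> snd p" using continuous_attains_inf[OF compact_K K_nonempty c(2)] by blast
  obtain R where R: "R \<in> K" "\<And>p. p \<in> K \<Longrightarrow> fst p \<le> fst R" using continuous_attains_sup[OF compact_K K_nonempty c(1)] by blast
  obtain L where L: "L \<in> K" "\<And>p. p \<in> K \<Longrightarrow> fst L \<le> fst p" using continuous_attains_inf[OF compact_K K_nonempty c(1)] by blast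
  have uT: "p = T" if "p \<in> K" "snd p = snd T" for p
    using maximiser(2)[OF T(1), of "(0, 1)" p] T(2) that by (simp add: inner_prod_def prod_eq_iff)
  have uB: "p = B" if "p \<in> K" "snd p = snd B" for p
    using maximiser(2)[OF B(1), of "(0, -1)" p] B(2) that by (simp add: inner_prod_def prod_eq_iff)
  have "fst L \<noteq> fst T"
  proof
    assume "fst L = fst T"
    then show False using no_double_maximiser[OF T(1), of "-1" 1] L(2) T(2) by simp
  qed
  moreover have "fst T \<noteq> fst R"
  proof
    assume "fst T = fst R"
    then show False using no_double_maximiser[OF T(1), of 1 1] R(2) T(2) by simp
  qed
  moreover have "fst L \<noteq> fst B"
  proof
    assume "fst L = fst B"
    then show False using no_double_maximiser[OF B(1), of "-1" "-1"] L(2) B(2) by simp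
  qed
  moreover have "fst B \<noteq> fst R"
  proof
    assume "fst B = fst R"
    then show False using no_double_maximiser[OF B(1), of 1 "-1"] R(2) B(2) by simp
  qed
  ultimately have lt: "fst L < fst T" "fst T < fst R" "fst L < fst B" "fst B < fst R"
    using L(2)[OF T(1)] R(2)[OF T(1)] L(2)[OF B(1)] R(2)[OF B(1)] by auto
  show ?thesis
  proof (rule that[of "fst T" "snd T" "fst B" "snd B" "fst L" "snd L" "fst R" "snd R"])
    show "fst p = fst T" if "p \<in> K" "snd p = snd T" for p using uT[OF that] by simp
    show "fst p = fst B" if "p \<in> K" "snd p = snd B" for p using uB[OF that] by simp
  qed (use T B L R lt in auto)
qed

lemma vertical_between:
  assumes "(x, y1) \<in> K" "(x, y2) \<in> K" "y1 \<le> y" "y \<le> y2" shows "(x, y) \<in> K"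
proof (cases "y1 = y2")
  case True then show ?thesis using assms by (simp add: order_antisym)
next
  case False
  define u where "u = (y - y1) / (y2 - y1)"
  have u: "0 \<le> u" "u \<le> 1" using assms False by (auto simp: u_def divide_le_eq_1)
  have "(1 - u) *\<^sub>R (x, y1) + u *\<^sub>R (x, y2) \<in> K" using convexD[OF convex_K assms(1,2), of "1 - u" u] u by simp
  moreover have "(1 - u) * y1 + u * y2 = y"
  proof -
    have "(1 - u) * y1 + u * y2 = y1 + u * (y2 - y1)" by (simp add: algebra_simps)
    then show ?thesis using False by (simp add: u_def)
  qed
  ultimately show ?thesis by (simp add: algebra_simps)
qed

text \<open>Moving from \<open>p\<close> into the triangle spanned by \<open>p\<close> and two points of \<open>K\<close> on one side of it.\<close>
lemma triangle_step:
  assumes p: "(x, y) \<in> K" and T: "(xT, yT) \<in> K" and B: "(xB, yB) \<in> K"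
    and s: "\<bar>s\<bar> \<le> \<bar>x - xT\<bar>" "\<bar>s\<bar> \<le> \<bar>x - xB\<bar>" "0 < (x - xT) * s" "0 < (x - xB) * s"
    and h: "\<bar>x - xT\<bar> \<le> D" "\<bar>x - xB\<bar> \<le> D" "c \<le> yT - y" "c \<le> y - yB" "0 \<le> c"
    and z: "\<bar>z\<bar> \<le> c / D * \<bar>s\<bar>"
  shows "(x - s, y - z) \<in> K"
proof -
  have D: "0 < D" using s h by (cases "x = xT") auto
  \<comment> \<open>Walk from p towards Q until the abscissa has changed by s: \<open>lam\<close> is
    the fraction of the way covered, and it is at least |s| / D because Q is at horizontal distance
    at most D.\<close>
  have on: "\<exists>lam. 0 \<le> lam \<and> lam \<le> 1 \<and> (x - s, y + lam * (yQ - y)) \<in> K \<and> \<bar>s\<bar> / D \<le> lam"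
    if Q: "(xQ, yQ) \<in> K" and q: "\<bar>s\<bar> \<le> \<bar>x - xQ\<bar>" "0 < (x - xQ) * s" "\<bar>x - xQ\<bar> \<le> D" for xQ yQ
  proof -
    define lam where "lam = s / (x - xQ)"
    have ne: "x - xQ \<noteq> 0" using q by auto
    have "0 < lam" using q(2) by (auto simp: lam_def zero_less_divide_iff zero_less_mult_iff)
    then have lam: "lam = \<bar>s\<bar> / \<bar>x - xQ\<bar>" by (simp add: lam_def flip: abs_divide)
    have l01: "0 \<le> lam" "lam \<le> 1" using q ne unfolding lam by (auto simp: divide_le_eq_1)
    have "\<bar>s\<bar> / D \<le> lam" unfolding lam using q ne by (intro divide_left_mono) auto
    moreover have "(1 - lam) *\<^sub>R (x, y) + lam *\<^sub>R (xQ, yQ) \<in> K" using convexD[OF convex_K p Q, of "1 - lam" lam] l01 by simp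
    moreover have "(1 - lam) * x + lam * xQ = x - s"
    proof -
      have "(1 - lam) * x + lam * xQ = x - lam * (x - xQ)" by (simp add: algebra_simps)
      then show ?thesis using ne by (simp add: lam_def)
    qed
    moreover have "(1 - lam) * y + lam * yQ = y + lam * (yQ - y)" by (simp add: algebra_simps)
    ultimately show ?thesis using l01 by auto
  qed
  obtain lam where l: "0 \<le> lam" "(x - s, y + lam * (yT - y)) \<in> K" "\<bar>s\<bar> / D \<le> lam" using on[OF T s(1,3) h(1)] by blast
  obtain mu where m: "0 \<le> mu" "(x - s, y + mu * (yB - y)) \<in> K" "\<bar>s\<bar> / D \<le> mu" using on[OF B s(2,4) h(2)] by blast
  have "\<bar>s\<bar> / D * c \<le> lam * (yT - y)" using l h D by (intro mult_mono) auto
  moreover have "\<bar>s\<bar> / D * c \<le> mu * (y - yB)" using m h D by (intro mult_mono) auto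
  moreover have "\<bar>z\<bar> \<le> \<bar>s\<bar> / D * c" using z by (simp add: mult.commute)
  ultimately have "y + mu * (yB - y) \<le> y - z" "y - z \<le> y + lam * (yT - y)" by (auto simp: algebra_simps abs_le_iff)
  then show ?thesis by (rule vertical_between[OF m(2) l(2)])
qed

end

section \<open>The longitudinal profile\<close>

lemma deriv_eqI_open:
  fixes f g :: "real \<Rightarrow> real"
  assumes "open U" "x \<in> U" "\<And>y. y \<in> U \<Longrightarrow> f y = g y" "(g has_real_derivative d) (at x)"
  shows "deriv f x = d"
  by (rule DERIV_imp_deriv, rule has_field_derivative_transform_within_open[OF assms(4,1,2)]) (simp add: assms)

lemma smooth_bounded_Icc:
  fixes f :: "real \<Rightarrow> real"
  assumes "smooth f" shows "\<exists>B. \<forall>x\<in>{p..q}. \<bar>f x\<bar> \<le> B"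
proof -
  have "compact (f ` {p..q})"
    by (intro compact_continuous_image continuous_on_subset[OF smooth_continuous[OF assms]]) auto
  then obtain B where "\<forall>y\<in>f ` {p..q}. norm y \<le> B" using compact_imp_bounded bounded_iff by metis
  then show ?thesis by auto
qed

lemma smooth_step_affine: "smooth (\<lambda>x. step (a * x + b))"
  by (rule smooth_on_compose[OF smooth_step])
     (auto intro!: smooth_on_add smooth_on_mult smooth_on_const smooth_on_ident)

text \<open>For \<open>q < p\<close> this is a decreasing step.\<close>
definition ramp :: "real \<Rightarrow> real \<Rightarrow> real \<Rightarrow> real" where
  "ramp p q x = step ((x - p) / (q - p))"

lemma smooth_ramp: "smooth (ramp p q)"
proof -
  have "smooth (\<lambda>x. step (inverse (q - p) * x + (- p) * inverse (q - p)))" by (rule smooth_step_affine)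
  then show ?thesis by (simp add: ramp_def[abs_def] divide_inverse left_diff_distrib mult.commute)
qed

lemma ramp_bounds: "0 \<le> ramp p q x" "ramp p q x \<le> 1"
  by (simp_all add: ramp_def step_bounds)

lemma ramp_up:
  assumes "p < q" shows "x \<le> p \<Longrightarrow> ramp p q x = 0" "q \<le> x \<Longrightarrow> ramp p q x = 1" "x \<le> y \<Longrightarrow> ramp p q x \<le> ramp p q y"
  using assms by (auto simp: ramp_def divide_le_0_iff intro!: step_0 step_1 step_mono divide_right_mono)

lemma ramp_down:
  assumes "p < q" shows "x \<le> p \<Longrightarrow> ramp q p x = 1" "q \<le> x \<Longrightarrow> ramp q p x = 0" "x \<le> y \<Longrightarrow> ramp q p y \<le> ramp q p x"
proof -
  have e: "(x - q) / (p - q) = (q - x) / (q - p)" for x by (metis minus_diff_eq minus_divide_divide)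
  show "x \<le> p \<Longrightarrow> ramp q p x = 1" "q \<le> x \<Longrightarrow> ramp q p x = 0" "x \<le> y \<Longrightarrow> ramp q p y \<le> ramp q p x"
    using assms unfolding ramp_def e
    by (auto simp: divide_le_0_iff intro!: step_0 step_1 step_mono divide_right_mono)
qed

text \<open>\<open>lo\<close> and \<open>hi\<close> will be the smaller and the larger of the
  abscissae of the highest and the lowest point. On each side, from outside in:
  \<open>anchor\<close> is switched on between the breakpoints 1 and 2, the field changes from its
  far to its near form between 2 and 3, and \<open>anchor\<close> is switched off between 3 and
  4.\<close>

locale profile =
  fixes l1 l2 l3 l4 lo hi r4 r3 r2 r1 \<delta> :: real
  assumes ord: "l1 < l2" "l2 < l3" "l3 < l4" "l4 < lo" "lo \<le> hi" "hi < r4" "r4 < r3" "r3 < r2" "r2 < r1"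
    and \<delta>: "0 < \<delta>"
begin

text \<open>
  Near the obstacle \<open>W e x = x - e\<close>; far away \<open>W e = tail\<close>, bounded with derivative
  \<open>\<delta> \<bar>x - mid\<bar>\<^sup>-\<^sup>1\<^sup>-\<^sup>\<delta>\<close>, which is where the weight in the resolvent estimate comes from. The null
  Lagrangian with coefficient \<open>G\<close> makes the zero order term positive in both regimes:
  \<open>G = W'' / 2\<close> far away, and \<open>G\<close> linear with the small slope \<open>\<nu>\<close> near the obstacle. In the two
  transition regions this fails, and there \<open>anchor = 1\<close>.
\<close>
definition mid where "mid = (lo + hi) / 2"
text \<open>Small enough that \<nu> (x - mid)^2 \<le> 1/2 where G is linear; the mixed term 2 \<nu>
  |x - mid| is then dominated by the diagonal.\<close>

definition \<nu> where "\<nu> = 1 / (2 * (1 + (r1 - l1))\<^sup>2)"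
text \<open>The two powers keep \<open>tail\<close> at least r2 - l2 in modulus outside (l3, r3).
  This exceeds |x - e| in the transition regions, as \<open>W_deriv_lower\<close> requires.\<close>

definition top where "top = (r3 - mid) powr (- \<delta>) + (mid - l3) powr (- \<delta>) + (r2 - l2)"

definition \<zeta> where "\<zeta> x = ramp l2 l3 x * ramp r2 r3 x"
definition anchor where "anchor x = ramp l1 l2 x * ramp l4 l3 x + ramp r1 r2 x * ramp r4 r3 x"
definition tail where "tail x = sgn (x - mid) * (top - \<bar>x - mid\<bar> powr (- \<delta>))"
text \<open>Split off because it does not contain the centre e: in the vector field the centre
  varies with the point, and only a compactly supported part depends on it.\<close>

definition w where "w x = (1 - \<zeta> x) * tail x"
definition W where "W e x = \<zeta> x * (x - e) + w x"
definition G where "G x = \<zeta> x * (\<nu> * (x - mid)) + (1 - \<zeta> x) * (deriv (deriv w) x / 2)"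

lemma mid: "lo \<le> mid" "mid \<le> hi" "l4 < mid" "mid < r4" "l3 < mid" "mid < r3"
  using ord by (auto simp: mid_def)

lemma smooth_\<zeta>: "smooth \<zeta>"
  unfolding \<zeta>_def[abs_def] by (intro smooth_on_mult smooth_ramp)

lemma smooth_anchor: "smooth anchor"
  unfolding anchor_def[abs_def] by (intro smooth_on_add smooth_on_mult smooth_ramp)

lemma \<zeta>_bounds: "0 \<le> \<zeta> x" "\<zeta> x \<le> 1"
  using ramp_bounds[of l2 l3 x] ramp_bounds[of r2 r3 x] by (auto simp: \<zeta>_def mult_le_one)

lemma \<zeta>_values: "l3 \<le> x \<Longrightarrow> x \<le> r3 \<Longrightarrow> \<zeta> x = 1" "x \<le> l2 \<Longrightarrow> \<zeta> x = 0" "r2 \<le> x \<Longrightarrow> \<zeta> x = 0"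
  using ord by (auto simp: \<zeta>_def ramp_up ramp_down)

lemma anchor_bounds: "0 \<le> anchor x" "anchor x \<le> 1"
proof -
  show "0 \<le> anchor x" by (simp add: anchor_def ramp_bounds)
  show "anchor x \<le> 1"
  proof (cases "x \<le> l4")
    case True
    then have "anchor x = ramp l1 l2 x * ramp l4 l3 x" using ord by (simp add: anchor_def ramp_up)
    then show ?thesis using ramp_bounds by (simp add: mult_le_one)
  next
    case False
    then have "anchor x = ramp r1 r2 x * ramp r4 r3 x" using ord by (simp add: anchor_def ramp_down)
    then show ?thesis using ramp_bounds by (simp add: mult_le_one)
  qed
qed

lemma anchor_values:
  "l2 \<le> x \<Longrightarrow> x \<le> l3 \<Longrightarrow> anchor x = 1" "r3 \<le> x \<Longrightarrow> x \<le> r2 \<Longrightarrow> anchor x = 1"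
  "x \<le> l1 \<Longrightarrow> anchor x = 0" "r1 \<le> x \<Longrightarrow> anchor x = 0" "l4 \<le> x \<Longrightarrow> x \<le> r4 \<Longrightarrow> anchor x = 0"
  using ord by (auto simp: anchor_def ramp_up ramp_down)

lemma \<zeta>_deriv_sign: "mid \<le> x \<Longrightarrow> deriv \<zeta> x \<le> 0" "x \<le> mid \<Longrightarrow> 0 \<le> deriv \<zeta> x"
proof -
  have eqr: "\<zeta> y = ramp r2 r3 y" if "l3 < y" for y using that ord by (simp add: \<zeta>_def ramp_up)
  have eql: "\<zeta> y = ramp l2 l3 y" if "y < r3" for y using that ord by (simp add: \<zeta>_def ramp_down)
  note d = smooth_has_real_derivative[OF smooth_\<zeta>]
  {
    assume "mid \<le> x"
    then have "x \<in> interior {l3<..}" using mid by (simp add: interior_open)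
    moreover have "mono_on {l3<..} (\<lambda>y. - \<zeta> y)" using ord by (auto intro!: mono_onI ramp_down simp: eqr)
    ultimately have "0 \<le> - deriv \<zeta> x" by (intro mono_on_imp_deriv_nonneg[OF _ DERIV_minus[OF d]])
    then show "deriv \<zeta> x \<le> 0" by simp
  }
  {
    assume "x \<le> mid"
    then have "x \<in> interior {..<r3}" using mid by (simp add: interior_open)
    moreover have "mono_on {..<r3} \<zeta>" using ord by (auto intro!: mono_onI ramp_up simp: eql)
    ultimately show "0 \<le> deriv \<zeta> x" by (intro mono_on_imp_deriv_nonneg[OF _ d])
  }
qed

lemma \<zeta>_deriv_zero: "l3 < x \<Longrightarrow> x < r3 \<Longrightarrow> deriv \<zeta> x = 0" "x < l2 \<Longrightarrow> deriv \<zeta> x = 0" "r2 < x \<Longrightarrow> deriv \<zeta> x = 0"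
proof -
  show "deriv \<zeta> x = 0" if "l3 < x" "x < r3"
    by (rule deriv_eqI_open[of "{l3<..<r3}" _ _ "\<lambda>_. 1"]) (use that \<zeta>_values in auto)
  show "deriv \<zeta> x = 0" if "x < l2"
    by (rule deriv_eqI_open[of "{..<l2}" _ _ "\<lambda>_. 0"]) (use that \<zeta>_values in auto)
  show "deriv \<zeta> x = 0" if "r2 < x"
    by (rule deriv_eqI_open[of "{r2<..}" _ _ "\<lambda>_. 0"]) (use that \<zeta>_values in auto)
qed

lemma abs_powr_deriv:
  assumes "x \<noteq> mid"
  shows "((\<lambda>x. \<bar>x - mid\<bar> powr a) has_real_derivative a * sgn (x - mid) * \<bar>x - mid\<bar> powr (a - 1)) (at x)"
proof (cases "x > mid")
  case True
  have "((\<lambda>x. (x - mid) powr a) has_real_derivative a * sgn (x - mid) * \<bar>x - mid\<bar> powr (a - 1)) (at x)"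
    using True by (auto intro!: derivative_eq_intros simp: powr_diff field_simps)
  then show ?thesis
    by (rule has_field_derivative_transform_within_open[of _ _ _ "{mid<..}"]) (use True in auto)
next
  case False
  then have lt: "x < mid" using assms by simp
  have "((\<lambda>x. (mid - x) powr a) has_real_derivative a * sgn (x - mid) * \<bar>x - mid\<bar> powr (a - 1)) (at x)"
    using lt by (auto intro!: derivative_eq_intros simp: powr_diff field_simps)
  then show ?thesis
    by (rule has_field_derivative_transform_within_open[of _ _ _ "{..<mid}"]) (use lt in auto)
qed

lemma sgn_mult_deriv:
  assumes "x \<noteq> mid" "(f has_real_derivative d) (at x)"
  shows "((\<lambda>x. sgn (x - mid) * f x) has_real_derivative sgn (x - mid) * d) (at x)"
proof (cases "x > mid")
  case True
  then have "(f has_real_derivative sgn (x - mid) * d) (at x)" using assms(2) by simp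
  then show ?thesis
    by (rule has_field_derivative_transform_within_open[of _ _ _ "{mid<..}"]) (use True in auto)
next
  case False
  then have lt: "x < mid" using assms by simp
  then have "((\<lambda>x. - f x) has_real_derivative sgn (x - mid) * d) (at x)" using DERIV_minus[OF assms(2)] by simp
  then show ?thesis
    by (rule has_field_derivative_transform_within_open[of _ _ _ "{..<mid}"]) (use lt in auto)
qed

lemma tail_derivs:
  assumes "x \<noteq> mid"
  shows "(tail has_real_derivative \<delta> * \<bar>x - mid\<bar> powr (- \<delta> - 1)) (at x)"
    "((\<lambda>x. \<delta> * \<bar>x - mid\<bar> powr (- \<delta> - 1)) has_real_derivative - (\<delta> * (\<delta> + 1) * sgn (x - mid) * \<bar>x - mid\<bar> powr (- \<delta> - 2))) (at x)"
    "((\<lambda>x. - (\<delta> * (\<delta> + 1) * sgn (x - mid) * \<bar>x - mid\<bar> powr (- \<delta> - 2))) has_real_derivative \<delta> * (\<delta> + 1) * (\<delta> + 2) * \<bar>x - mid\<bar> powr (- \<delta> - 3)) (at x)"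
proof -
  have ss: "sgn (x - mid) * sgn (x - mid) = 1" using assms by (auto simp: sgn_if)
  have "((\<lambda>x. top - \<bar>x - mid\<bar> powr (- \<delta>)) has_real_derivative 0 - (- \<delta>) * sgn (x - mid) * \<bar>x - mid\<bar> powr (- \<delta> - 1)) (at x)"
    by (intro DERIV_diff DERIV_const abs_powr_deriv assms)
  from sgn_mult_deriv[OF assms this] show "(tail has_real_derivative \<delta> * \<bar>x - mid\<bar> powr (- \<delta> - 1)) (at x)"
    unfolding tail_def[abs_def] using ss by (simp add: mult.assoc mult.left_commute[of "sgn (x - mid)"])
  have d2: "((\<lambda>x. \<delta> * \<bar>x - mid\<bar> powr (- \<delta> - 1)) has_real_derivative \<delta> * ((- \<delta> - 1) * sgn (x - mid) * \<bar>x - mid\<bar> powr (- \<delta> - 1 - 1))) (at x)"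
    by (intro DERIV_cmult abs_powr_deriv assms)
  have e2: "- \<delta> - 1 - 1 = - \<delta> - 2" by simp
  show "((\<lambda>x. \<delta> * \<bar>x - mid\<bar> powr (- \<delta> - 1)) has_real_derivative - (\<delta> * (\<delta> + 1) * sgn (x - mid) * \<bar>x - mid\<bar> powr (- \<delta> - 2))) (at x)"
    by (rule DERIV_cong[OF d2[unfolded e2]]) (simp add: algebra_simps)
  have "((\<lambda>x. - (\<delta> * (\<delta> + 1)) * (sgn (x - mid) * \<bar>x - mid\<bar> powr (- \<delta> - 2))) has_real_derivative
      - (\<delta> * (\<delta> + 1)) * (sgn (x - mid) * ((- \<delta> - 2) * sgn (x - mid) * \<bar>x - mid\<bar> powr (- \<delta> - 2 - 1)))) (at x)"
    by (intro DERIV_cmult sgn_mult_deriv abs_powr_deriv assms)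
  moreover have "- \<delta> - 2 - 1 = - \<delta> - 3" by simp
  moreover have "- (\<delta> * (\<delta> + 1)) * (sgn (x - mid) * ((- \<delta> - 2) * sgn (x - mid) * \<bar>x - mid\<bar> powr (- \<delta> - 3)))
     = (sgn (x - mid) * sgn (x - mid)) * (\<delta> * (\<delta> + 1) * (\<delta> + 2) * \<bar>x - mid\<bar> powr (- \<delta> - 3))"
    by (simp add: algebra_simps)
  ultimately show "((\<lambda>x. - (\<delta> * (\<delta> + 1) * sgn (x - mid) * \<bar>x - mid\<bar> powr (- \<delta> - 2))) has_real_derivative \<delta> * (\<delta> + 1) * (\<delta> + 2) * \<bar>x - mid\<bar> powr (- \<delta> - 3)) (at x)"
    unfolding ss by (simp add: mult.assoc)
qed

text \<open>\<open>tail\<close> is singular at \<open>mid\<close>, but 1 - \<zeta> vanishes on (l3,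
  r3); this interval and the two half-lines cover the line.\<close>

lemma smooth_w: "smooth w"
proof -
  have p: "smooth_on {0<..} (\<lambda>x::real. x powr (- \<delta>))" by (rule smooth_on_powr)
  have 1: "smooth_on {mid<..} w"
  proof (rule smooth_on_cong)
    show "smooth_on {mid<..} (\<lambda>x. (1 - \<zeta> x) * (top - (x - mid) powr (- \<delta>)))"
      by (intro smooth_on_mult smooth_on_diff smooth_on_const smooth_on_subset[OF smooth_\<zeta>] smooth_on_compose[OF p] smooth_on_ident) auto
  qed (simp add: w_def tail_def)
  have 2: "smooth_on {..<mid} w"
  proof (rule smooth_on_cong)
    show "smooth_on {..<mid} (\<lambda>x. (1 - \<zeta> x) * (- (top - (mid - x) powr (- \<delta>))))"
      by (intro smooth_on_mult smooth_on_minus smooth_on_diff smooth_on_const smooth_on_subset[OF smooth_\<zeta>] smooth_on_compose[OF p] smooth_on_ident) auto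
  qed (simp add: w_def tail_def)
  have 3: "smooth_on {l3<..<r3} w"
    by (rule smooth_on_cong[OF smooth_on_const[of _ 0]]) (auto simp: w_def \<zeta>_values)
  have "{mid<..} \<union> {..<mid} \<union> {l3<..<r3} = (UNIV :: real set)" using mid by auto
  then show ?thesis using smooth_on_Un[OF smooth_on_Un[OF 1 2] 3] by simp
qed

lemma smooth_W: "smooth (W e)"
  unfolding W_def[abs_def] by (intro smooth_on_add smooth_on_mult smooth_\<zeta> smooth_w smooth_on_diff smooth_on_ident smooth_on_const) auto

lemma smooth_G: "smooth G"
  unfolding G_def[abs_def] by (intro smooth_on_add smooth_on_mult smooth_on_diff smooth_\<zeta> smooth_w smooth_on_ident smooth_on_const
      smooth_on_comp_linear[OF bounded_linear_divide] smooth_deriv) auto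

lemma W_deriv: "deriv (W e) x = \<zeta> x + deriv \<zeta> x * (x - e) + deriv w x"
proof (rule DERIV_imp_deriv)
  show "(W e has_real_derivative \<zeta> x + deriv \<zeta> x * (x - e) + deriv w x) (at x)"
    unfolding W_def[abs_def]
    by (auto intro!: derivative_eq_intros smooth_has_real_derivative[OF smooth_\<zeta>] smooth_has_real_derivative[OF smooth_w])
qed

lemma w_deriv: "x \<noteq> mid \<Longrightarrow> deriv w x = (1 - \<zeta> x) * (\<delta> * \<bar>x - mid\<bar> powr (- \<delta> - 1)) - deriv \<zeta> x * tail x"
proof (rule DERIV_imp_deriv)
  assume "x \<noteq> mid"
  then show "(w has_real_derivative (1 - \<zeta> x) * (\<delta> * \<bar>x - mid\<bar> powr (- \<delta> - 1)) - deriv \<zeta> x * tail x) (at x)"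
    unfolding w_def[abs_def]
    by (auto intro!: derivative_eq_intros smooth_has_real_derivative[OF smooth_\<zeta>] tail_derivs(1))
qed

lemma middle:
  assumes "l3 < x" "x < r3"
  shows "W e x = x - e" "deriv (W e) x = 1" "deriv (deriv (W e)) x = 0" "G x = \<nu> * (x - mid)" "deriv G x = \<nu>"
proof -
  have U: "open {l3<..<r3}" "x \<in> {l3<..<r3}" using assms by auto
  have W: "W e y = y - e" if "y \<in> {l3<..<r3}" for y using that by (simp add: W_def w_def \<zeta>_values)
  then show "W e x = x - e" using U by blast
  have d: "deriv (W e) y = 1" if "y \<in> {l3<..<r3}" for y
    by (rule deriv_eqI_open[OF U(1) that W]) (auto intro!: derivative_eq_intros)
  then show "deriv (W e) x = 1" using U by blast
  show "deriv (deriv (W e)) x = 0" by (rule deriv_eqI_open[OF U d]) auto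
  have G: "G y = \<nu> * (y - mid)" if "y \<in> {l3<..<r3}" for y using that by (simp add: G_def \<zeta>_values)
  then show "G x = \<nu> * (x - mid)" using U by blast
  show "deriv G x = \<nu>" by (rule deriv_eqI_open[OF U G]) (auto intro!: derivative_eq_intros)
qed

lemma outer:
  assumes "x < l2 \<or> r2 < x"
  shows "W e x = tail x" "deriv (W e) x = \<delta> * \<bar>x - mid\<bar> powr (- \<delta> - 1)"
    "deriv (deriv (W e)) x = - (\<delta> * (\<delta> + 1) * sgn (x - mid) * \<bar>x - mid\<bar> powr (- \<delta> - 2))"
    "G x = - (\<delta> * (\<delta> + 1) * sgn (x - mid) * \<bar>x - mid\<bar> powr (- \<delta> - 2)) / 2"
    "deriv G x = \<delta> * (\<delta> + 1) * (\<delta> + 2) * \<bar>x - mid\<bar> powr (- \<delta> - 3) / 2"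
proof -
  define U where "U = {..<l2} \<union> {r2<..}"
  have U: "open U" "x \<in> U" using assms by (auto simp: U_def)
  have ne: "y \<noteq> mid" if "y \<in> U" for y using that mid ord by (auto simp: U_def)
  have z: "\<zeta> y = 0" if "y \<in> U" for y using that by (auto simp: U_def \<zeta>_values)
  have W: "W e y = tail y" if "y \<in> U" for e y using that z by (simp add: W_def w_def)
  then show "W e x = tail x" using U by blast
  have d: "deriv (W e) y = \<delta> * \<bar>y - mid\<bar> powr (- \<delta> - 1)" if "y \<in> U" for e y
    by (rule deriv_eqI_open[OF U(1) that W tail_derivs(1)[OF ne[OF that]]])
  then show "deriv (W e) x = \<delta> * \<bar>x - mid\<bar> powr (- \<delta> - 1)" using U by blast
  show "deriv (deriv (W e)) x = - (\<delta> * (\<delta> + 1) * sgn (x - mid) * \<bar>x - mid\<bar> powr (- \<delta> - 2))"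
    by (rule deriv_eqI_open[OF U d tail_derivs(2)[OF ne[OF U(2)]]])
  have wt: "w y = tail y" if "y \<in> U" for y using that z by (simp add: w_def)
  have dw: "deriv w y = \<delta> * \<bar>y - mid\<bar> powr (- \<delta> - 1)" if "y \<in> U" for y
    by (rule deriv_eqI_open[OF U(1) that wt tail_derivs(1)[OF ne[OF that]]])
  have ddw: "deriv (deriv w) y = - (\<delta> * (\<delta> + 1) * sgn (y - mid) * \<bar>y - mid\<bar> powr (- \<delta> - 2))" if "y \<in> U" for y
    by (rule deriv_eqI_open[OF U(1) that dw tail_derivs(2)[OF ne[OF that]]])
  have G: "G y = - (\<delta> * (\<delta> + 1) * sgn (y - mid) * \<bar>y - mid\<bar> powr (- \<delta> - 2)) / 2" if "y \<in> U" for y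
    using that z ddw by (simp add: G_def)
  then show "G x = - (\<delta> * (\<delta> + 1) * sgn (x - mid) * \<bar>x - mid\<bar> powr (- \<delta> - 2)) / 2" using U by blast
  show "deriv G x = \<delta> * (\<delta> + 1) * (\<delta> + 2) * \<bar>x - mid\<bar> powr (- \<delta> - 3) / 2"
    by (rule deriv_eqI_open[OF U G DERIV_cdivide[OF tail_derivs(3)[OF ne[OF U(2)]]]])
qed

lemma tail_large:
  assumes "r3 \<le> x" shows "r2 - l2 \<le> tail x" "tail x \<le> top"
proof -
  have "(x - mid) powr (- \<delta>) \<le> (r3 - mid) powr (- \<delta>)" using assms mid \<delta> by (intro powr_mono2') auto
  moreover have "0 \<le> (mid - l3) powr (- \<delta>)" by simp
  moreover have "tail x = top - (x - mid) powr (- \<delta>)" using assms mid by (simp add: tail_def)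
  ultimately show "r2 - l2 \<le> tail x" unfolding top_def by linarith
  show "tail x \<le> top" using assms mid by (simp add: tail_def)
qed

lemma tail_small:
  assumes "x \<le> l3" shows "tail x \<le> - (r2 - l2)" "- top \<le> tail x"
proof -
  have "(mid - x) powr (- \<delta>) \<le> (mid - l3) powr (- \<delta>)" using assms mid \<delta> by (intro powr_mono2') auto
  moreover have "0 \<le> (r3 - mid) powr (- \<delta>)" by simp
  moreover have "tail x = - (top - (mid - x) powr (- \<delta>))" using assms mid by (simp add: tail_def)
  ultimately show "tail x \<le> - (r2 - l2)" unfolding top_def by linarith
  show "- top \<le> tail x" using assms mid by (simp add: tail_def)
qed

text \<open>Together with \<open>W_left\<close>, a lower bound for the horizontal speed at the sides
  of the obstacle, against which the vertical speed is weighed later.\<close>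

lemma W_right:
  assumes "r4 \<le> x" "lo \<le> e" "e \<le> hi" shows "r4 - hi \<le> W e x"
proof -
  have 1: "\<zeta> x * (r4 - hi) \<le> \<zeta> x * (x - e)" using assms \<zeta>_bounds by (intro mult_left_mono) auto
  have 2: "(1 - \<zeta> x) * (r4 - hi) \<le> (1 - \<zeta> x) * tail x"
  proof (cases "r3 \<le> x")
    case True
    then show ?thesis using tail_large[OF True] \<zeta>_bounds[of x] ord by (intro mult_left_mono) auto
  next
    case False
    then have "\<zeta> x = 1" using assms mid ord by (intro \<zeta>_values) auto
    then show ?thesis by simp
  qed
  show ?thesis using 1 2 by (simp add: W_def w_def algebra_simps)
qed

lemma W_left:
  assumes "x \<le> l4" "lo \<le> e" "e \<le> hi" shows "W e x \<le> - (lo - l4)"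
proof -
  have 1: "\<zeta> x * (x - e) \<le> \<zeta> x * (- (lo - l4))" using assms \<zeta>_bounds by (intro mult_left_mono) auto
  have 2: "(1 - \<zeta> x) * tail x \<le> (1 - \<zeta> x) * (- (lo - l4))"
  proof (cases "x \<le> l3")
    case True
    then show ?thesis using tail_small[OF True] \<zeta>_bounds[of x] ord by (intro mult_left_mono) auto
  next
    case False
    then have "\<zeta> x = 1" using assms mid ord by (intro \<zeta>_values) auto
    then show ?thesis by simp
  qed
  show ?thesis using 1 2 by (simp add: W_def w_def algebra_simps)
qed

text \<open>W' is an average of 1 and the derivative of \<open>tail\<close>, plus \<zeta>' ((x - e)
  - tail). The last term is nonnegative: on the right \<zeta> decreases and \<open>tail\<close> lies
  above x - e, on the left both are reversed.\<close>

lemma W_deriv_lower: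
  assumes e: "lo \<le> e" "e \<le> hi" and "x \<noteq> mid"
  shows "min 1 (\<delta> * \<bar>x - mid\<bar> powr (- \<delta> - 1)) \<le> deriv (W e) x"
proof -
  define T' where "T' = \<delta> * \<bar>x - mid\<bar> powr (- \<delta> - 1)"
  have eq: "deriv (W e) x = (\<zeta> x + (1 - \<zeta> x) * T') + deriv \<zeta> x * ((x - e) - tail x)"
    unfolding W_deriv w_deriv[OF assms(3)] T'_def by (simp add: algebra_simps)
  have "0 \<le> deriv \<zeta> x * ((x - e) - tail x)"
  proof -
    consider "l3 < x" "x < r3" | "x < l2" | "r2 < x" | "l2 \<le> x" "x \<le> l3" | "r3 \<le> x" "x \<le> r2" by linarith
    then show ?thesis
    proof cases
      case 4
      then have "tail x \<le> x - e" using tail_small(1)[of x] e ord by linarith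
      moreover have "0 \<le> deriv \<zeta> x" using \<zeta>_deriv_sign(2)[of x] 4 mid by simp
      ultimately show ?thesis by simp
    next
      case 5
      then have "x - e \<le> tail x" using tail_large(1)[of x] e ord by linarith
      moreover have "deriv \<zeta> x \<le> 0" using \<zeta>_deriv_sign(1)[of x] 5 mid by simp
      ultimately show ?thesis by (simp add: mult_nonpos_nonpos)
    qed (simp_all add: \<zeta>_deriv_zero)
  qed
  moreover have "min 1 T' \<le> \<zeta> x + (1 - \<zeta> x) * T'"
  proof -
    have "\<zeta> x * min 1 T' \<le> \<zeta> x * 1" "(1 - \<zeta> x) * min 1 T' \<le> (1 - \<zeta> x) * T'"
      using \<zeta>_bounds[of x] mult_left_mono[of "min 1 T'" 1 "\<zeta> x"] mult_left_mono[of "min 1 T'" T' "1 - \<zeta> x"] by auto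
    then show ?thesis by (simp add: algebra_simps)
  qed
  ultimately show ?thesis unfolding eq T'_def[symmetric] by linarith
qed

end

section \<open>The vector field\<close>

definition P1 :: "(real \<times> real \<Rightarrow> real) \<Rightarrow> real \<times> real \<Rightarrow> real" where
  "P1 h p = frechet_derivative h (at p) (1, 0)"

definition P2 :: "(real \<times> real \<Rightarrow> real) \<Rightarrow> real \<times> real \<Rightarrow> real" where
  "P2 h p = frechet_derivative h (at p) (0, 1)"

lemma P_derivative: "smooth h \<Longrightarrow> (h has_derivative (\<lambda>v. fst v * P1 h p + snd v * P2 h p)) (at p)"
proof -
  assume h: "smooth h"
  have lin: "linear (frechet_derivative h (at p))" using has_derivative_linear[OF smooth_has_derivative[OF h]] .
  have "frechet_derivative h (at p) v = fst v * P1 h p + snd v * P2 h p" for v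
  proof -
    have "frechet_derivative h (at p) v = frechet_derivative h (at p) (fst v *\<^sub>R (1, 0) + snd v *\<^sub>R (0, 1))" by simp
    then show ?thesis unfolding P1_def P2_def by (simp only: linear_add[OF lin] linear_scale[OF lin]) simp
  qed
  then show ?thesis by (intro has_derivative_eq_rhs[OF smooth_has_derivative[OF h]] ext)
qed

lemma P_eqI:
  assumes "(h has_derivative (\<lambda>v. fst v * a + snd v * b)) (at p)"
  shows "P1 h p = a" "P2 h p = b"
  using fun_cong[OF frechet_derivative_at[OF assms], of "(1, 0)"] fun_cong[OF frechet_derivative_at[OF assms], of "(0, 1)"]
  by (simp_all add: P1_def P2_def)

lemma smooth_P1: "smooth h \<Longrightarrow> smooth (P1 h)" unfolding P1_def[abs_def] by (rule smooth_on_frechet)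
lemma smooth_P2: "smooth h \<Longrightarrow> smooth (P2 h)" unfolding P2_def[abs_def] by (rule smooth_on_frechet)

text \<open>Second derivatives are bounded in order to make the first ones Lipschitz, as
  \<open>planar_field\<close> demands.\<close>

definition bounded_C2 :: "(real \<times> real \<Rightarrow> real) \<Rightarrow> real \<Rightarrow> bool" where
  "bounded_C2 h B \<longleftrightarrow> smooth h \<and> (\<forall>p. \<bar>h p\<bar> \<le> B \<and> \<bar>P1 h p\<bar> \<le> B \<and> \<bar>P2 h p\<bar> \<le> B \<and>
     \<bar>P1 (P1 h) p\<bar> \<le> B \<and> \<bar>P2 (P1 h) p\<bar> \<le> B \<and> \<bar>P1 (P2 h) p\<bar> \<le> B \<and> \<bar>P2 (P2 h) p\<bar> \<le> B)"

lemma bounded_C2_lipschitz: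
  assumes "bounded_C2 h B"
  shows "\<bar>P1 h p - P1 h q\<bar> \<le> 2 * B * norm (p - q)" "\<bar>P2 h p - P2 h q\<bar> \<le> 2 * B * norm (p - q)"
  using assms lipschitz_of_partials[OF P_derivative[OF smooth_P1], of h B p q] lipschitz_of_partials[OF P_derivative[OF smooth_P2], of h B p q]
  by (auto simp: bounded_C2_def)

lemma P_add: "smooth f \<Longrightarrow> smooth g \<Longrightarrow> P1 (\<lambda>p. f p + g p) = (\<lambda>p. P1 f p + P1 g p)"
    "smooth f \<Longrightarrow> smooth g \<Longrightarrow> P2 (\<lambda>p. f p + g p) = (\<lambda>p. P2 f p + P2 g p)"
proof -
  assume s: "smooth f" "smooth g"
  have "((\<lambda>p. f p + g p) has_derivative (\<lambda>v. fst v * (P1 f p + P1 g p) + snd v * (P2 f p + P2 g p))) (at p)" for p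
    using has_derivative_add[OF P_derivative[OF s(1)] P_derivative[OF s(2)], of p] by (simp add: algebra_simps)
  from P_eqI[OF this] show "P1 (\<lambda>p. f p + g p) = (\<lambda>p. P1 f p + P1 g p)" "P2 (\<lambda>p. f p + g p) = (\<lambda>p. P2 f p + P2 g p)" by auto
qed

lemma bounded_C2_add:
  assumes "bounded_C2 f A" "bounded_C2 g B" shows "bounded_C2 (\<lambda>p. f p + g p) (A + B)"
proof -
  have s: "smooth f" "smooth g" using assms by (auto simp: bounded_C2_def)
  note e = P_add[OF s] P_add[OF smooth_P1[OF s(1)] smooth_P1[OF s(2)]] P_add[OF smooth_P2[OF s(1)] smooth_P2[OF s(2)]]
  show ?thesis
    using assms unfolding bounded_C2_def e
    by (auto intro!: smooth_on_add order_trans[OF abs_triangle_ineq] add_mono)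
qed

lemma bounded_C2_mono: "bounded_C2 h A \<Longrightarrow> A \<le> B \<Longrightarrow> bounded_C2 h B"
  unfolding bounded_C2_def by (meson order_trans)

lemma bounded_C2_compact:
  assumes h: "smooth h" and C: "compact C" "\<And>p. p \<notin> C \<Longrightarrow> h p = 0"
  shows "\<exists>B. bounded_C2 h B"
proof -
  have sup: "frechet_derivative f (at p) v = 0" if "p \<notin> C" "\<And>q. q \<notin> C \<Longrightarrow> f q = 0" for f :: "real \<times> real \<Rightarrow> real" and p v
  proof -
    have "(f has_derivative (\<lambda>_. 0)) (at p)"
      by (rule has_derivative_transform_within_open[of "\<lambda>_. 0" _ _ _ "- C"])
         (use C that in \<open>auto intro: compact_imp_closed\<close>)
    then show ?thesis using frechet_derivative_at by metis
  qed
  have bd: "\<exists>B. \<forall>p. \<bar>f p\<bar> \<le> B" if "smooth f" "\<And>q. q \<notin> C \<Longrightarrow> f q = 0" for f :: "real \<times> real \<Rightarrow> real"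
  proof -
    have "cont_compact f" using that C smooth_continuous unfolding cont_compact_def by blast
    then show ?thesis using cont_compact_bounded[of f] by auto
  qed
  have z: "P1 f q = 0" "P2 f q = 0" if "q \<notin> C" "\<And>q. q \<notin> C \<Longrightarrow> f q = 0" for f q
    using sup[OF that] by (auto simp: P1_def P2_def)
  note s = smooth_P1[OF h] smooth_P2[OF h]
  obtain b1 where b1: "\<And>p. \<bar>h p\<bar> \<le> b1" using bd[OF h C(2)] by auto
  obtain b2 where b2: "\<And>p. \<bar>P1 h p\<bar> \<le> b2" using bd[OF s(1) z(1)[OF _ C(2)]] by auto
  obtain b3 where b3: "\<And>p. \<bar>P2 h p\<bar> \<le> b3" using bd[OF s(2) z(2)[OF _ C(2)]] by auto
  obtain b4 where b4: "\<And>p. \<bar>P1 (P1 h) p\<bar> \<le> b4" using bd[OF smooth_P1[OF s(1)] z(1)[OF _ z(1)[OF _ C(2)]]] by auto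
  obtain b5 where b5: "\<And>p. \<bar>P2 (P1 h) p\<bar> \<le> b5" using bd[OF smooth_P2[OF s(1)] z(2)[OF _ z(1)[OF _ C(2)]]] by auto
  obtain b6 where b6: "\<And>p. \<bar>P1 (P2 h) p\<bar> \<le> b6" using bd[OF smooth_P1[OF s(2)] z(1)[OF _ z(2)[OF _ C(2)]]] by auto
  obtain b7 where b7: "\<And>p. \<bar>P2 (P2 h) p\<bar> \<le> b7" using bd[OF smooth_P2[OF s(2)] z(2)[OF _ z(2)[OF _ C(2)]]] by auto
  have nn: "0 \<le> b1" "0 \<le> b2" "0 \<le> b3" "0 \<le> b4" "0 \<le> b5" "0 \<le> b6" "0 \<le> b7"
    using b1[of 0] b2[of 0] b3[of 0] b4[of 0] b5[of 0] b6[of 0] b7[of 0] by linarith+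
  have "bounded_C2 h (b1 + b2 + b3 + b4 + b5 + b6 + b7)"
    unfolding bounded_C2_def
  proof (intro conjI allI h)
    fix p
    note all = b1[of p] b2[of p] b3[of p] b4[of p] b5[of p] b6[of p] b7[of p] nn
    show "\<bar>h p\<bar> \<le> b1 + b2 + b3 + b4 + b5 + b6 + b7" using all by linarith
    show "\<bar>P1 h p\<bar> \<le> b1 + b2 + b3 + b4 + b5 + b6 + b7" using all by linarith
    show "\<bar>P2 h p\<bar> \<le> b1 + b2 + b3 + b4 + b5 + b6 + b7" using all by linarith
    show "\<bar>P1 (P1 h) p\<bar> \<le> b1 + b2 + b3 + b4 + b5 + b6 + b7" using all by linarith
    show "\<bar>P2 (P1 h) p\<bar> \<le> b1 + b2 + b3 + b4 + b5 + b6 + b7" using all by linarith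
    show "\<bar>P1 (P2 h) p\<bar> \<le> b1 + b2 + b3 + b4 + b5 + b6 + b7" using all by linarith
    show "\<bar>P2 (P2 h) p\<bar> \<le> b1 + b2 + b3 + b4 + b5 + b6 + b7" using all by linarith
  qed
  then show ?thesis by blast
qed

lemma smooth_comp_fst: "smooth f \<Longrightarrow> smooth (\<lambda>p::real \<times> real. f (fst p))" for f :: "real \<Rightarrow> real"
  by (rule smooth_on_compose[of UNIV]) (auto intro: smooth_on_linear bounded_linear_fst)

lemma smooth_comp_snd: "smooth f \<Longrightarrow> smooth (\<lambda>p::real \<times> real. f (snd p))" for f :: "real \<Rightarrow> real"
  by (rule smooth_on_compose[of UNIV]) (auto intro: smooth_on_linear bounded_linear_snd)

lemma P_comp_fst: "smooth f \<Longrightarrow> P1 (\<lambda>p. f (fst p)) = (\<lambda>p. deriv f (fst p))" "smooth f \<Longrightarrow> P2 (\<lambda>p. f (fst p)) = (\<lambda>p. 0)"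
proof -
  assume s: "smooth f"
  have "((\<lambda>p. f (fst p)) has_derivative (\<lambda>v. fst v * deriv f (fst p) + snd v * 0)) (at p)" for p :: "real \<times> real"
  proof -
    have "(f has_derivative (\<lambda>h. deriv f (fst p) * h)) (at (fst p))"
      using smooth_has_real_derivative[OF s] by (simp add: has_field_derivative_def)
    from has_derivative_compose[OF has_derivative_fst[OF has_derivative_ident] this]
    show ?thesis by (simp add: mult.commute)
  qed
  from P_eqI[OF this] show "P1 (\<lambda>p. f (fst p)) = (\<lambda>p. deriv f (fst p))" "P2 (\<lambda>p. f (fst p)) = (\<lambda>p. 0)" by auto
qed

lemma bounded_C2_fst:
  assumes s: "smooth f" and b: "\<And>x. \<bar>f x\<bar> \<le> B" "\<And>x. \<bar>deriv f x\<bar> \<le> B" "\<And>x. \<bar>deriv (deriv f) x\<bar> \<le> B"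
  shows "bounded_C2 (\<lambda>p. f (fst p)) B"
proof -
  have B: "0 \<le> B" using b(1)[of 0] by linarith
  have z: "P1 (\<lambda>p. 0) = (\<lambda>p. 0)" "P2 (\<lambda>p. 0) = (\<lambda>p. 0)" by (auto simp: P1_def P2_def fun_eq_iff frechet_derivative_const)
  show ?thesis unfolding bounded_C2_def P_comp_fst[OF s] P_comp_fst[OF smooth_deriv[OF s]] z
    using b B by (auto intro: smooth_comp_fst s)
qed

text \<open>\<open>lipschitz_of_partials\<close> loses a factor 2, hence 2 B \<le> L.\<close>

lemma planar_fieldI:
  assumes "bounded_C2 X1 B" "bounded_C2 X2 B" "1 \<le> L" "2 * B \<le> L"
  shows "planar_field X1 X2 (P1 X1) (P2 X1) (P1 X2) (P2 X2) L"
proof -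
  have B: "0 \<le> B" using assms(1) unfolding bounded_C2_def by (meson abs_ge_zero order_trans)
  have BL: "B \<le> L" using assms(4) B by linarith
  have lip: "u \<le> L * n" if "u \<le> 2 * B * n" "0 \<le> n" for u n
    using that mult_right_mono[OF assms(4), of n] by linarith
  note l1 = bounded_C2_lipschitz[OF assms(1)] and l2 = bounded_C2_lipschitz[OF assms(2)]
  have s: "smooth X1" "smooth X2" using assms by (auto simp: bounded_C2_def)
  have b: "\<bar>X1 p\<bar> \<le> L" "\<bar>P1 X1 p\<bar> \<le> L" "\<bar>P2 X1 p\<bar> \<le> L" "\<bar>X2 p\<bar> \<le> L" "\<bar>P1 X2 p\<bar> \<le> L" "\<bar>P2 X2 p\<bar> \<le> L" for p
    using assms(1,2) BL unfolding bounded_C2_def by (meson order_trans)+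
  show ?thesis
    by unfold_locales (intro s P_derivative assms(3) b lip l1 l2 norm_ge_zero)+
qed

context profile
begin

text \<open>Continuity on the compact interval [l2, r2], the explicit form of \<open>tail\<close>
  outside.\<close>

lemma w_bounded: "\<exists>B. (\<forall>x. \<bar>w x\<bar> \<le> B) \<and> (\<forall>x. \<bar>deriv w x\<bar> \<le> B) \<and> (\<forall>x. \<bar>deriv (deriv w) x\<bar> \<le> B)"
proof -
  define d where "d = min (mid - l2) (r2 - mid)"
  have d: "0 < d" using mid ord by (simp add: d_def)
  have far: "d \<le> \<bar>x - mid\<bar>" if "x < l2 \<or> r2 < x" for x using that by (auto simp: d_def)
  have w_eq: "w = (\<lambda>x. W 0 x - \<zeta> x * x)" by (auto simp: W_def fun_eq_iff)
  have dw: "deriv w x = deriv (W 0) x" "deriv (deriv w) x = deriv (deriv (W 0)) x" if x: "x < l2 \<or> r2 < x" for x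
  proof -
    define U where "U = {..<l2} \<union> {r2<..}"
    have U: "open U" "x \<in> U" using x by (auto simp: U_def)
    have eq: "w y = W 0 y" if "y \<in> U" for y using that by (auto simp: w_eq \<zeta>_values U_def)
    have d1: "deriv w y = deriv (W 0) y" if "y \<in> U" for y
      by (rule deriv_eqI_open[OF U(1) that eq smooth_has_real_derivative[OF smooth_W]])
    then show "deriv w x = deriv (W 0) x" using U by blast
    show "deriv (deriv w) x = deriv (deriv (W 0)) x"
      by (rule deriv_eqI_open[OF U d1 smooth_has_real_derivative[OF smooth_deriv[OF smooth_W]]])
  qed
  have global: "\<exists>B. \<forall>x. \<bar>f x\<bar> \<le> B" if s: "smooth f" and o: "\<And>x. x < l2 \<or> r2 < x \<Longrightarrow> \<bar>f x\<bar> \<le> b" for f :: "real \<Rightarrow> real" and b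
  proof -
    obtain B where B: "\<forall>x\<in>{l2..r2}. \<bar>f x\<bar> \<le> B" using smooth_bounded_Icc[OF s] by blast
    have "\<bar>f x\<bar> \<le> max B b" for x using B o[of x] by (cases "x \<in> {l2..r2}") (auto simp: le_max_iff_disj)
    then show ?thesis by blast
  qed
  have pw: "\<bar>x - mid\<bar> powr (- c) \<le> d powr (- c)" if "x < l2 \<or> r2 < x" "0 \<le> c" for x c
    using d far[OF that(1)] that(2) by (intro powr_mono2') auto
  have "\<exists>B. \<forall>x. \<bar>w x\<bar> \<le> B"
  proof (rule global[OF smooth_w])
    fix x assume x: "x < l2 \<or> r2 < x"
    then have "w x = tail x" by (auto simp: w_def \<zeta>_values)
    moreover have "0 \<le> r2 - l2" using ord by simp
    ultimately show "\<bar>w x\<bar> \<le> top" using x tail_large[of x] tail_small[of x] ord by auto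
  qed
  moreover have "\<exists>B. \<forall>x. \<bar>deriv w x\<bar> \<le> B"
  proof (rule global[OF smooth_deriv[OF smooth_w]])
    fix x assume x: "x < l2 \<or> r2 < x"
    show "\<bar>deriv w x\<bar> \<le> \<delta> * d powr (- (\<delta> + 1))"
      unfolding dw[OF x] outer[OF x] using pw[OF x, of "\<delta> + 1"] \<delta> by (simp add: abs_mult mult_left_mono)
  qed
  moreover have "\<exists>B. \<forall>x. \<bar>deriv (deriv w) x\<bar> \<le> B"
  proof (rule global[OF smooth_deriv[OF smooth_deriv[OF smooth_w]]])
    fix x assume x: "x < l2 \<or> r2 < x"
    have ne: "x \<noteq> mid" using x mid ord by auto
    have "\<bar>sgn (x - mid)\<bar> = 1" using ne by (simp add: sgn_if)
    then show "\<bar>deriv (deriv w) x\<bar> \<le> \<delta> * (\<delta> + 1) * d powr (- (\<delta> + 2))"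
      unfolding dw[OF x] outer[OF x] using pw[OF x, of "\<delta> + 2"] \<delta> by (simp add: abs_mult mult_left_mono)
  qed
  ultimately obtain b1 b2 b3 where "\<And>x. \<bar>w x\<bar> \<le> b1" "\<And>x. \<bar>deriv w x\<bar> \<le> b2" "\<And>x. \<bar>deriv (deriv w) x\<bar> \<le> b3" by auto
  then show ?thesis by (intro exI[of _ "max b1 (max b2 b3)"]) (simp add: le_max_iff_disj)
qed

end

section \<open>Coercivity\<close>

text \<open>The square is completed once in each variable, and the two resulting bounds are
  averaged.\<close>

lemma quadratic_lower:
  fixes A B C s r :: real
  assumes "0 < A" "0 < C"
  defines "d \<equiv> 4 * A * C - B\<^sup>2"
  shows "d / (8 * C) * s\<^sup>2 + d / (8 * A) * r\<^sup>2 \<le> A * s\<^sup>2 - B * (s * r) + C * r\<^sup>2"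
proof -
  have 1: "A * s\<^sup>2 - B * (s * r) + C * r\<^sup>2 = C * (r - B * s / (2 * C))\<^sup>2 + d / (4 * C) * s\<^sup>2"
    using assms(2) unfolding d_def by (simp add: power2_eq_square field_simps)
  have 2: "A * s\<^sup>2 - B * (s * r) + C * r\<^sup>2 = A * (s - B * r / (2 * A))\<^sup>2 + d / (4 * A) * r\<^sup>2"
    using assms(1) unfolding d_def by (simp add: power2_eq_square field_simps)
  have "d / (4 * C) * s\<^sup>2 \<le> A * s\<^sup>2 - B * (s * r) + C * r\<^sup>2" unfolding 1 using assms by simp
  moreover have "d / (4 * A) * r\<^sup>2 \<le> A * s\<^sup>2 - B * (s * r) + C * r\<^sup>2" unfolding 2 using assms by simp
  moreover have "d / (8 * C) * s\<^sup>2 = (d / (4 * C) * s\<^sup>2) / 2" "d / (8 * A) * r\<^sup>2 = (d / (4 * A) * r\<^sup>2) / 2" by simp_all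
  ultimately show ?thesis by linarith
qed

context profile
begin

definition \<rho>2 where "\<rho>2 x = (1 + \<bar>x\<bar>) powr (- (3 + \<delta>))"

lemma \<rho>2_bounds: "0 < \<rho>2 x" "\<rho>2 x \<le> 1"
proof -
  show "0 < \<rho>2 x" by (simp add: \<rho>2_def)
  have "\<rho>2 x \<le> (1 + \<bar>x\<bar>) powr 0" unfolding \<rho>2_def using \<delta> by (intro powr_mono) auto
  then show "\<rho>2 x \<le> 1" by (simp split: if_splits)
qed

text \<open>After division by W' = \<delta> P the form in s and R = r / \<xi> has the constant
  coefficients A, 2 (\<delta> + 1) and C = (\<delta> + 1)(\<delta> + 2)/2. With A = 2 the quantity 4
  A C - 4 (\<delta> + 1)^2 would be 4 (\<delta> + 1); giving up 1/(2 + \<delta>) in A halves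
  it.\<close>

lemma outer_coercive:
  assumes x: "x < l2 \<or> r2 < x" and s: "0 \<le> s" "0 \<le> r"
  shows "\<delta> / (8 * (\<delta> + 2)) * (1 + \<bar>mid\<bar>) powr (- (3 + \<delta>)) * (\<rho>2 x * s\<^sup>2 + \<rho>2 x * r\<^sup>2)
    \<le> (2 - 1 / (2 + \<delta>)) * deriv (W e) x * s\<^sup>2 - \<bar>deriv (deriv (W e)) x + 2 * G x\<bar> * (s * r) + deriv G x * r\<^sup>2"
proof -
  define \<xi> where "\<xi> = \<bar>x - mid\<bar>"
  define P where "P = \<xi> powr (- \<delta> - 1)"
  define R where "R = r / \<xi>"
  define A where "A = 2 - 1 / (2 + \<delta>)"
  define C where "C = (\<delta> + 1) * (\<delta> + 2) / 2"
  have \<xi>: "0 < \<xi>" using x mid ord by (auto simp: \<xi>_def)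
  have sg: "\<bar>sgn (x - mid)\<bar> = 1" using \<xi> by (auto simp: \<xi>_def sgn_if)
  have P0: "0 < P" using \<xi> by (simp add: P_def)
  have p2: "\<xi> powr (- \<delta> - 2) = P / \<xi>"
  proof -
    have "\<xi> powr (- \<delta> - 2) = \<xi> powr ((- \<delta> - 1) - 1)" by (simp add: algebra_simps)
    then show ?thesis using \<xi> by (simp only: powr_diff P_def) simp
  qed
  have p3: "\<xi> powr (- \<delta> - 3) = P / \<xi>\<^sup>2"
  proof -
    have "\<xi> powr (- \<delta> - 3) = \<xi> powr ((- \<delta> - 1) - 2)" by (simp add: algebra_simps)
    then show ?thesis using \<xi> by (simp only: powr_diff P_def) simp
  qed
  have A: "1 \<le> A" "A \<le> 2" "A * (\<delta> + 2) = 2 * \<delta> + 3" using \<delta> by (auto simp: A_def field_simps)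
  have C: "0 < C" using \<delta> by (simp add: C_def)
  have d: "4 * A * C - (2 * (\<delta> + 1))\<^sup>2 = 2 * (\<delta> + 1)"
  proof -
    have "4 * A * C = 2 * (\<delta> + 1) * (A * (\<delta> + 2))" by (simp add: C_def)
    then show ?thesis unfolding A(3) by (simp add: power2_eq_square algebra_simps)
  qed
  have mixed: "\<bar>deriv (deriv (W e)) x + 2 * G x\<bar> = \<delta> * (2 * (\<delta> + 1)) * (P / \<xi>)"
  proof -
    have "deriv (deriv (W e)) x + 2 * G x = - (sgn (x - mid) * (\<delta> * (2 * (\<delta> + 1)) * (P / \<xi>)))"
      unfolding outer[OF x] \<xi>_def[symmetric] p2 using \<xi> by (simp add: field_simps)
    then show ?thesis using \<delta> P0 \<xi> sg by (simp add: abs_mult)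
  qed
  have "(2 * (\<delta> + 1)) / (8 * C) * s\<^sup>2 + (2 * (\<delta> + 1)) / (8 * A) * R\<^sup>2 \<le> A * s\<^sup>2 - 2 * (\<delta> + 1) * (s * R) + C * R\<^sup>2"
    using quadratic_lower[of A C "2 * (\<delta> + 1)" s R] A C unfolding d by simp
  moreover have "1 / (8 * (\<delta> + 2)) \<le> (2 * (\<delta> + 1)) / (8 * C)"
  proof -
    have "(2 * (\<delta> + 1)) / (8 * C) = 2 * (\<delta> + 1) / (2 * (\<delta> + 1) * (2 * (\<delta> + 2)))"
      unfolding C_def by (rule arg_cong[where f = "\<lambda>v. 2 * (\<delta> + 1) / v"]) (simp add: algebra_simps)
    also have "\<dots> = 1 / (2 * (\<delta> + 2))" using \<delta> by (intro nonzero_divide_mult_cancel_left) simp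
    finally have e: "(2 * (\<delta> + 1)) / (8 * C) = 1 / (2 * (\<delta> + 2))" .
    show ?thesis unfolding e using \<delta> by (intro divide_left_mono) auto
  qed
  moreover have "1 / (8 * (\<delta> + 2)) \<le> (2 * (\<delta> + 1)) / (8 * A)"
  proof -
    have "1 / (8 * (\<delta> + 2)) \<le> 1 / 8" using \<delta> by (simp add: field_simps)
    also have "\<dots> \<le> (2 * (\<delta> + 1)) / (8 * A)" using A \<delta> by (simp add: field_simps)
    finally show ?thesis .
  qed
  ultimately have "1 / (8 * (\<delta> + 2)) * s\<^sup>2 + 1 / (8 * (\<delta> + 2)) * R\<^sup>2 \<le> A * s\<^sup>2 - 2 * (\<delta> + 1) * (s * R) + C * R\<^sup>2"
    by (meson add_mono mult_right_mono zero_le_power2 order_trans)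
  then have main: "(\<delta> * P) * (1 / (8 * (\<delta> + 2)) * s\<^sup>2 + 1 / (8 * (\<delta> + 2)) * R\<^sup>2)
      \<le> (\<delta> * P) * (A * s\<^sup>2 - 2 * (\<delta> + 1) * (s * R) + C * R\<^sup>2)"
    using \<delta> P0 by (intro mult_left_mono) auto
  have eq: "(\<delta> * P) * (A * s\<^sup>2 - 2 * (\<delta> + 1) * (s * R) + C * R\<^sup>2)
    = (2 - 1 / (2 + \<delta>)) * deriv (W e) x * s\<^sup>2 - \<bar>deriv (deriv (W e)) x + 2 * G x\<bar> * (s * r) + deriv G x * r\<^sup>2"
    unfolding mixed unfolding outer[OF x] \<xi>_def[symmetric] p3 P_def[symmetric] A_def[symmetric] R_def C_def
    by (simp add: power_divide algebra_simps add_divide_distrib)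
  \<comment> \<open>The profile is centred at \<open>mid\<close> and the weight at 0; this
    comparison, raised to negative powers, passes from one to the other.\<close>
  have le: "\<xi> \<le> (1 + \<bar>mid\<bar>) * (1 + \<bar>x\<bar>)"
  proof -
    have "\<xi> \<le> \<bar>x\<bar> + \<bar>mid\<bar>" unfolding \<xi>_def by simp
    also have "\<dots> \<le> (1 + \<bar>mid\<bar>) * (1 + \<bar>x\<bar>)" by (simp add: algebra_simps)
    finally show ?thesis .
  qed
  define m where "m = (1 + \<bar>mid\<bar>) powr (- (3 + \<delta>))"
  have pow: "(1 + \<bar>mid\<bar>) powr a * (1 + \<bar>x\<bar>) powr a \<le> \<xi> powr a" if "a \<le> 0" for a
    using powr_mono2'[OF that \<xi> le] by (simp add: powr_mult)
  have w3: "m * \<rho>2 x \<le> P / \<xi>\<^sup>2"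
    using pow[of "- (3 + \<delta>)"] \<delta> unfolding m_def \<rho>2_def p3[symmetric] by (simp add: algebra_simps)
  have w1: "m * \<rho>2 x \<le> P"
  proof -
    have "m \<le> (1 + \<bar>mid\<bar>) powr (- \<delta> - 1)" "\<rho>2 x \<le> (1 + \<bar>x\<bar>) powr (- \<delta> - 1)"
      unfolding m_def \<rho>2_def by (intro powr_mono; simp)+
    then have "m * \<rho>2 x \<le> (1 + \<bar>mid\<bar>) powr (- \<delta> - 1) * (1 + \<bar>x\<bar>) powr (- \<delta> - 1)"
      using \<rho>2_bounds[of x] by (intro mult_mono) auto
    also have "\<dots> \<le> P" unfolding P_def using \<delta> by (intro pow) simp
    finally show ?thesis .
  qed
  have "\<delta> / (8 * (\<delta> + 2)) * m * (\<rho>2 x * s\<^sup>2 + \<rho>2 x * r\<^sup>2) = \<delta> / (8 * (\<delta> + 2)) * ((m * \<rho>2 x) * s\<^sup>2 + (m * \<rho>2 x) * r\<^sup>2)"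
    by (simp add: algebra_simps)
  also have "\<dots> \<le> \<delta> / (8 * (\<delta> + 2)) * (P * s\<^sup>2 + P / \<xi>\<^sup>2 * r\<^sup>2)"
    using w1 w3 \<delta> by (intro mult_left_mono add_mono mult_right_mono) auto
  also have "\<dots> = (\<delta> * P) * (1 / (8 * (\<delta> + 2)) * s\<^sup>2 + 1 / (8 * (\<delta> + 2)) * R\<^sup>2)"
    by (simp add: R_def power_divide algebra_simps)
  finally show ?thesis using main unfolding eq m_def by linarith
qed

lemma \<nu>: "0 < \<nu>" "\<nu> * (r1 - l1)\<^sup>2 \<le> 1 / 2"
proof -
  have "0 < 1 + (r1 - l1)" using ord by simp
  then show "0 < \<nu>" by (simp add: \<nu>_def)
  have "(r1 - l1)\<^sup>2 \<le> (1 + (r1 - l1))\<^sup>2" using ord by (intro power_mono) auto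
  then show "\<nu> * (r1 - l1)\<^sup>2 \<le> 1 / 2" using \<open>0 < 1 + (r1 - l1)\<close> by (simp add: \<nu>_def field_simps)
qed

text \<open>Here W' = 1 and W'' = 0, so the mixed term comes from G alone and is controlled by the
  choice of \<nu>.\<close>

lemma middle_coercive:
  assumes x: "l3 < x" "x < r3" and s: "0 \<le> s" "0 \<le> r"
  shows "min (1 / 4) (\<nu> / 4) * (\<rho>2 x * s\<^sup>2 + \<rho>2 x * r\<^sup>2)
    \<le> (2 - 1 / (2 + \<delta>)) * deriv (W e) x * s\<^sup>2 - \<bar>deriv (deriv (W e)) x + 2 * G x\<bar> * (s * r) + deriv G x * r\<^sup>2"
proof -
  define A where "A = 2 - 1 / (2 + \<delta>)"
  define B where "B = 2 * \<nu> * \<bar>x - mid\<bar>"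
  have A: "3 / 2 \<le> A" "A \<le> 2" using \<delta> by (auto simp: A_def field_simps)
  have "\<bar>x - mid\<bar> \<le> r1 - l1" using x mid ord by (auto simp: abs_le_iff)
  then have "\<bar>x - mid\<bar>\<^sup>2 \<le> (r1 - l1)\<^sup>2" by (intro power_mono) auto
  then have "\<nu> * \<bar>x - mid\<bar>\<^sup>2 \<le> 1 / 2" using \<nu> mult_left_mono[of "\<bar>x - mid\<bar>\<^sup>2" "(r1 - l1)\<^sup>2" \<nu>] by linarith
  then have "4 * \<nu> * (\<nu> * \<bar>x - mid\<bar>\<^sup>2) \<le> 4 * \<nu> * (1 / 2)" using \<nu> by (intro mult_left_mono) auto
  moreover have "B\<^sup>2 = 4 * \<nu> * (\<nu> * \<bar>x - mid\<bar>\<^sup>2)" by (simp add: B_def power2_eq_square)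
  moreover have "4 * (3 / 2) * \<nu> \<le> 4 * A * \<nu>" using A \<nu> by (intro mult_right_mono) auto
  ultimately have d: "4 * \<nu> \<le> 4 * A * \<nu> - B\<^sup>2" by linarith
  have "(4 * A * \<nu> - B\<^sup>2) / (8 * \<nu>) * s\<^sup>2 + (4 * A * \<nu> - B\<^sup>2) / (8 * A) * r\<^sup>2 \<le> A * s\<^sup>2 - B * (s * r) + \<nu> * r\<^sup>2"
    using quadratic_lower[of A \<nu> B s r] A \<nu> by simp
  moreover have "1 / 4 \<le> (4 * A * \<nu> - B\<^sup>2) / (8 * \<nu>)" using d \<nu> by (simp add: field_simps)
  moreover have "\<nu> / 4 \<le> (4 * A * \<nu> - B\<^sup>2) / (8 * A)"
  proof -
    have "\<nu> * (8 * A) \<le> \<nu> * 16" using A \<nu> by (intro mult_left_mono) auto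
    then show ?thesis using d A by (simp add: field_simps)
  qed
  ultimately have le: "1 / 4 * s\<^sup>2 + \<nu> / 4 * r\<^sup>2 \<le> A * s\<^sup>2 - B * (s * r) + \<nu> * r\<^sup>2"
    by (meson add_mono mult_right_mono zero_le_power2 order_trans)
  have "min (1 / 4) (\<nu> / 4) * (\<rho>2 x * s\<^sup>2) \<le> 1 / 4 * s\<^sup>2" "min (1 / 4) (\<nu> / 4) * (\<rho>2 x * r\<^sup>2) \<le> \<nu> / 4 * r\<^sup>2"
    using \<rho>2_bounds[of x] \<nu> by (intro mult_mono mult_left_le_one_le; simp)+
  moreover have "\<bar>deriv (deriv (W e)) x + 2 * G x\<bar> = B" using \<nu> by (simp add: middle[OF x] B_def abs_mult)
  ultimately show ?thesis using le unfolding A_def[symmetric] middle(2,5)[OF x]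
    by (simp add: distrib_left)
qed

text \<open>In the transition regions only W' \<ge> \<beta> is used besides bounds; a large zero
  order coefficient H wins by completing the square. H will be \<tau> E.\<close>

lemma anchor_coercive:
  assumes b: "0 < \<beta>" "\<beta> \<le> deriv (W e) x" and C: "\<bar>deriv (deriv (W e)) x + 2 * G x\<bar> \<le> C" "\<bar>deriv G x\<bar> \<le> C"
    and H: "C + C\<^sup>2 / (4 * \<beta>) + 1 \<le> H" and s: "0 \<le> s" "0 \<le> r"
  shows "min (\<beta> / 2) 1 * (\<rho>2 x * s\<^sup>2 + \<rho>2 x * r\<^sup>2)
    \<le> (2 - 1 / (2 + \<delta>)) * deriv (W e) x * s\<^sup>2 - \<bar>deriv (deriv (W e)) x + 2 * G x\<bar> * (s * r) + (deriv G x + H) * r\<^sup>2"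
proof -
  have "3 / 2 * \<beta> \<le> (2 - 1 / (2 + \<delta>)) * deriv (W e) x"
    using b \<delta> by (intro mult_mono) (auto simp: field_simps)
  then have 1: "3 / 2 * \<beta> * s\<^sup>2 \<le> (2 - 1 / (2 + \<delta>)) * deriv (W e) x * s\<^sup>2" by (intro mult_right_mono) auto
  have 2: "\<bar>deriv (deriv (W e)) x + 2 * G x\<bar> * (s * r) \<le> C * (s * r)" using C s by (intro mult_right_mono) auto
  have "\<beta> * (s - C * r / (2 * \<beta>))\<^sup>2 = \<beta> * s\<^sup>2 - C * (s * r) + C\<^sup>2 / (4 * \<beta>) * r\<^sup>2"
    using b by (simp add: power2_eq_square field_simps)
  moreover have "0 \<le> \<beta> * (s - C * r / (2 * \<beta>))\<^sup>2" using b by simp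
  ultimately have 3: "C * (s * r) \<le> \<beta> * s\<^sup>2 + C\<^sup>2 / (4 * \<beta>) * r\<^sup>2" by linarith
  have "C\<^sup>2 / (4 * \<beta>) + 1 \<le> deriv G x + H" using C(2) H by linarith
  then have 4: "(C\<^sup>2 / (4 * \<beta>) + 1) * r\<^sup>2 \<le> (deriv G x + H) * r\<^sup>2" by (intro mult_right_mono) auto
  have 5: "min (\<beta> / 2) 1 * (\<rho>2 x * s\<^sup>2) \<le> \<beta> / 2 * s\<^sup>2" "min (\<beta> / 2) 1 * (\<rho>2 x * r\<^sup>2) \<le> 1 * r\<^sup>2"
    using \<rho>2_bounds[of x] b by (intro mult_mono mult_left_le_one_le; simp)+
  show ?thesis using 1 2 3 4 5 by (simp add: algebra_simps)
qed

lemma anchor_deriv_bounded: "\<exists>B. \<forall>x. \<bar>deriv anchor x\<bar> \<le> B"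
proof -
  have z: "deriv anchor x = 0" if "x < l1 \<or> r1 < x" for x
    by (rule deriv_eqI_open[of "{..<l1} \<union> {r1<..}" _ _ "\<lambda>_. 0"]) (use that anchor_values in auto)
  obtain B where B: "\<forall>x\<in>{l1..r1}. \<bar>deriv anchor x\<bar> \<le> B"
    using smooth_bounded_Icc[OF smooth_deriv[OF smooth_anchor]] by blast
  have "\<bar>deriv anchor x\<bar> \<le> max B 0" for x using B z[of x] by (cases "x \<in> {l1..r1}") (auto simp: le_max_iff_disj)
  then show ?thesis by blast
qed

lemma transition_bounded: "\<exists>C. \<forall>x\<in>{l1..r1}. \<bar>deriv (deriv (W e)) x + 2 * G x\<bar> \<le> C \<and> \<bar>deriv G x\<bar> \<le> C"
proof -
  have "smooth (\<lambda>x. deriv (deriv (W e)) x + 2 * G x)"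
    by (intro smooth_on_add smooth_on_mult smooth_on_const smooth_deriv smooth_W smooth_G) auto
  from smooth_bounded_Icc[OF this] smooth_bounded_Icc[OF smooth_deriv[OF smooth_G]] obtain B1 B2
    where "\<forall>x\<in>{l1..r1}. \<bar>deriv (deriv (W e)) x + 2 * G x\<bar> \<le> B1" "\<forall>x\<in>{l1..r1}. \<bar>deriv G x\<bar> \<le> B2" by blast
  then show ?thesis by (intro exI[of _ "max B1 B2"]) (simp add: le_max_iff_disj)
qed

end

context profile
begin

lemma W_deriv_uniform:
  obtains \<beta> where "0 < \<beta>" "\<And>x e. l1 \<le> x \<Longrightarrow> x \<le> r1 \<Longrightarrow> lo \<le> e \<Longrightarrow> e \<le> hi \<Longrightarrow> \<beta> \<le> deriv (W e) x"
proof
  have r: "0 < r1 - l1" using ord by simp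
  show "0 < min 1 (\<delta> * (r1 - l1) powr (- \<delta> - 1))" using \<delta> r by simp
  fix x e assume x: "l1 \<le> x" "x \<le> r1" "lo \<le> e" "e \<le> hi"
  show "min 1 (\<delta> * (r1 - l1) powr (- \<delta> - 1)) \<le> deriv (W e) x"
  proof (cases "x = mid")
    case True
    then show ?thesis using middle(2)[of x e] mid by simp
  next
    case False
    have "\<bar>x - mid\<bar> \<le> r1 - l1" using x mid ord by (auto simp: abs_le_iff)
    then have "(r1 - l1) powr (- \<delta> - 1) \<le> \<bar>x - mid\<bar> powr (- \<delta> - 1)" using False \<delta> by (intro powr_mono2') auto
    then have "\<delta> * (r1 - l1) powr (- \<delta> - 1) \<le> \<delta> * \<bar>x - mid\<bar> powr (- \<delta> - 1)" using \<delta> by (intro mult_left_mono) auto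
    then show ?thesis using W_deriv_lower[OF x(3,4) False] by linarith
  qed
qed

text \<open>Origin of the energy threshold: \<tau> E has to beat the constant \<open>H\<close> that
  the transition regions require. The constant c is the smallest of those from the three
  regions.\<close>

lemma line_coercive:
  assumes e: "lo \<le> eT" "eT \<le> hi" "lo \<le> eB" "eB \<le> hi" and \<tau>: "0 < \<tau>"
  obtains c E0 where "0 < c" "0 < E0" "\<And>E e x s r. E0 \<le> E \<Longrightarrow> e \<in> {eT, eB} \<Longrightarrow> 0 \<le> s \<Longrightarrow> 0 \<le> r \<Longrightarrow>
    c * (\<rho>2 x * s\<^sup>2 + \<rho>2 x * r\<^sup>2) \<le> (2 - 1 / (2 + \<delta>)) * deriv (W e) x * s\<^sup>2
      - \<bar>deriv (deriv (W e)) x + 2 * G x\<bar> * (s * r) + (deriv G x + \<tau> * (anchor x)\<^sup>2 * E) * r\<^sup>2"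
proof -
  obtain \<beta> where \<beta>: "0 < \<beta>" "\<And>x e. l1 \<le> x \<Longrightarrow> x \<le> r1 \<Longrightarrow> lo \<le> e \<Longrightarrow> e \<le> hi \<Longrightarrow> \<beta> \<le> deriv (W e) x"
    using W_deriv_uniform by blast
  obtain CT where CT: "\<forall>x\<in>{l1..r1}. \<bar>deriv (deriv (W eT)) x + 2 * G x\<bar> \<le> CT \<and> \<bar>deriv G x\<bar> \<le> CT"
    using transition_bounded by blast
  obtain CB where CB: "\<forall>x\<in>{l1..r1}. \<bar>deriv (deriv (W eB)) x + 2 * G x\<bar> \<le> CB \<and> \<bar>deriv G x\<bar> \<le> CB"
    using transition_bounded by blast
  define C where "C = max CT CB"
  define H where "H = C + C\<^sup>2 / (4 * \<beta>) + 1"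
  define co where "co = \<delta> / (8 * (\<delta> + 2)) * (1 + \<bar>mid\<bar>) powr (- (3 + \<delta>))"
  define c where "c = min co (min (min (1 / 4) (\<nu> / 4)) (min (\<beta> / 2) 1))"
  have co: "0 < co" using \<delta> by (simp add: co_def)
  have c: "0 < c" "c \<le> co" "c \<le> min (1 / 4) (\<nu> / 4)" "c \<le> min (\<beta> / 2) 1"
    using co \<nu> \<beta> by (auto simp: c_def)
  show ?thesis
  proof (rule that[of c "max 1 (H / \<tau>)"])
    fix E e x s r :: real
    assume E: "max 1 (H / \<tau>) \<le> E" and e': "e \<in> {eT, eB}" and s: "0 \<le> s" "0 \<le> r"
    have eb: "lo \<le> e" "e \<le> hi" using e e' by auto
    have 0: "0 \<le> \<rho>2 x * s\<^sup>2 + \<rho>2 x * r\<^sup>2" using \<rho>2_bounds(1)[of x] by simp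
    have E0: "0 \<le> \<tau> * (anchor x)\<^sup>2 * E * r\<^sup>2" using \<tau> E by simp
    consider (o) "x < l2 \<or> r2 < x" | (m) "l3 < x" "x < r3" | (t) "l2 \<le> x" "x \<le> r2" "x \<le> l3 \<or> r3 \<le> x" by linarith
    then show "c * (\<rho>2 x * s\<^sup>2 + \<rho>2 x * r\<^sup>2) \<le> (2 - 1 / (2 + \<delta>)) * deriv (W e) x * s\<^sup>2
      - \<bar>deriv (deriv (W e)) x + 2 * G x\<bar> * (s * r) + (deriv G x + \<tau> * (anchor x)\<^sup>2 * E) * r\<^sup>2"
    proof cases
      case o
      show ?thesis using mult_right_mono[OF c(2) 0] outer_coercive[OF o s, of e] E0
        unfolding co_def[symmetric] distrib_right by linarith
    next
      case m
      show ?thesis using mult_right_mono[OF c(3) 0] middle_coercive[OF m s, of e] E0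
        unfolding distrib_right by linarith
    next
      case t
      have a: "anchor x = 1" using t anchor_values by auto
      have x: "l1 \<le> x" "x \<le> r1" using t ord by auto
      have CC: "\<bar>deriv (deriv (W e)) x + 2 * G x\<bar> \<le> C" "\<bar>deriv G x\<bar> \<le> C"
        using bspec[OF CT, of x] bspec[OF CB, of x] x e' by (auto simp: C_def le_max_iff_disj)
      have "H \<le> \<tau> * E" using E \<tau> by (simp add: divide_le_eq mult.commute)
      then have "C + C\<^sup>2 / (4 * \<beta>) + 1 \<le> \<tau> * E" by (simp add: H_def)
      from anchor_coercive[OF \<beta>(1) \<beta>(2)[OF x eb] CC this s]
      show ?thesis using mult_right_mono[OF c(4) 0] unfolding a by (simp only: power_one mult_1_right)
    qed
  qed (use c in auto)
qed

end

text \<open>Besides the anchor, Y contributes - \<tau> h^2 |a|^2 and a mixed term containing 2 h h'.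
  As the cut-off enters squared, the mixed term keeps a factor h next to |b|, so half of \<tau> h^2
  |b|^2 and the reserve k \<beta> |a|^2 absorb it.\<close>

lemma anchored_form_lower:
  fixes a b w :: complex
  assumes h: "0 \<le> h" "h \<le> 1" and M: "\<bar>h'\<bar> \<le> M" and \<sigma>: "\<bar>\<sigma>\<bar> \<le> 2" and \<tau>: "0 < \<tau>"
    and \<beta>: "h \<noteq> 0 \<Longrightarrow> \<tau> * (1 + 32 * M\<^sup>2) \<le> k * \<beta>"
    and line: "c1 * (R * (cmod a)\<^sup>2 + R * (cmod w)\<^sup>2) \<le> (2 - k) * \<beta> * (cmod a)\<^sup>2 - \<bar>B\<bar> * (cmod a * cmod w) + (g + \<tau> * h\<^sup>2 * E) * (cmod w)\<^sup>2"
    and k: "0 \<le> k * \<beta>"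
  shows "c1 * (R * (cmod a)\<^sup>2 + R * (cmod w)\<^sup>2) + \<tau> / 2 * h\<^sup>2 * (cmod b)\<^sup>2
    \<le> 2 * \<beta> * (cmod a)\<^sup>2 + \<tau> * h\<^sup>2 * (cmod b)\<^sup>2 - \<tau> * h\<^sup>2 * (cmod a)\<^sup>2 + 2 * (\<tau> * (2 * h * h' * \<sigma>)) * Re (a * cnj b)
      + B * Re (a * cnj w) + (g + \<tau> * h\<^sup>2 * E) * (cmod w)\<^sup>2"
proof -
  define s t r where "s = cmod a" and "t = cmod b" and "r = cmod w"
  have n: "0 \<le> s" "0 \<le> t" "0 \<le> r" by (auto simp: s_def t_def r_def)
  have "\<bar>Re (a * cnj b)\<bar> \<le> s * t" "\<bar>Re (a * cnj w)\<bar> \<le> s * r"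
    using abs_Re_le_cmod[of "a * cnj b"] abs_Re_le_cmod[of "a * cnj w"] by (auto simp: s_def t_def r_def norm_mult)
  then have m: "\<bar>2 * (\<tau> * (2 * h * h' * \<sigma>)) * Re (a * cnj b)\<bar> \<le> \<tau> * (8 * M * s * (h * t))" "\<bar>B * Re (a * cnj w)\<bar> \<le> \<bar>B\<bar> * (s * r)"
  proof -
    have "\<bar>h'\<bar> * \<bar>\<sigma>\<bar> * \<bar>Re (a * cnj b)\<bar> \<le> M * 2 * (s * t)"
      using M \<sigma> \<open>\<bar>Re (a * cnj b)\<bar> \<le> s * t\<close> by (intro mult_mono) auto
    then have "4 * \<tau> * h * (\<bar>h'\<bar> * \<bar>\<sigma>\<bar> * \<bar>Re (a * cnj b)\<bar>) \<le> 4 * \<tau> * h * (M * 2 * (s * t))"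
      using \<tau> h by (intro mult_left_mono) auto
    moreover have "\<bar>2 * (\<tau> * (2 * h * h' * \<sigma>)) * Re (a * cnj b)\<bar> = 4 * \<tau> * h * (\<bar>h'\<bar> * \<bar>\<sigma>\<bar> * \<bar>Re (a * cnj b)\<bar>)"
      unfolding abs_mult using \<tau> h by simp
    moreover have "4 * \<tau> * h * (M * 2 * (s * t)) = \<tau> * (8 * M * s * (h * t))" by simp
    ultimately show "\<bar>2 * (\<tau> * (2 * h * h' * \<sigma>)) * Re (a * cnj b)\<bar> \<le> \<tau> * (8 * M * s * (h * t))"
      by linarith
    show "\<bar>B * Re (a * cnj w)\<bar> \<le> \<bar>B\<bar> * (s * r)"
      using \<open>\<bar>Re (a * cnj w)\<bar> \<le> s * r\<close> by (simp add: abs_mult mult_left_mono)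
  qed
  have main: "\<tau> * (8 * M * s * (h * t)) + \<tau> * h\<^sup>2 * s\<^sup>2 \<le> k * \<beta> * s\<^sup>2 + \<tau> / 2 * h\<^sup>2 * t\<^sup>2"
  proof (cases "h = 0")
    case True then show ?thesis using k by simp
  next
    case False
    have "0 \<le> \<tau> / 2 * (h * t - 8 * M * s)\<^sup>2" using \<tau> by simp
    also have "\<tau> / 2 * (h * t - 8 * M * s)\<^sup>2 = \<tau> / 2 * h\<^sup>2 * t\<^sup>2 - \<tau> * (8 * M * s * (h * t)) + 32 * \<tau> * M\<^sup>2 * s\<^sup>2"
      by (simp add: power2_eq_square algebra_simps)
    finally have 1: "\<tau> * (8 * M * s * (h * t)) \<le> \<tau> / 2 * h\<^sup>2 * t\<^sup>2 + 32 * \<tau> * M\<^sup>2 * s\<^sup>2" by linarith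
    have "\<tau> * h\<^sup>2 * s\<^sup>2 \<le> \<tau> * 1 * s\<^sup>2" using \<tau> h by (intro mult_left_mono mult_right_mono) (auto simp: power_le_one)
    moreover have "\<tau> * (1 + 32 * M\<^sup>2) * s\<^sup>2 \<le> k * \<beta> * s\<^sup>2" using \<beta>[OF False] by (intro mult_right_mono) auto
    ultimately show ?thesis using 1 by (simp add: algebra_simps)
  qed
  show ?thesis
    using line m main unfolding s_def[symmetric] t_def[symmetric] r_def[symmetric]
    by (simp add: algebra_simps abs_le_iff)
qed

lemma P_transfer:
  assumes "open U" "p \<in> U" "\<And>q. q \<in> U \<Longrightarrow> f q = g q" "(g has_derivative (\<lambda>v. fst v * a + snd v * b)) (at p)"
  shows "P1 f p = a" "P2 f p = b"
  by (rule P_eqI[OF has_derivative_transform_within_open[OF assms(4,1,2)]]; simp add: assms(3))+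

text \<open>y = sl x + ic is the chord between the leftmost and the rightmost point; over [l0, r0]
  the layer of half-width 2 \<eta> around it lies in the obstacle. \<open>c0\<close> bounds from
  below the vertical distance of the sides from the extremal heights, \<open>D\<close> from above
  the horizontal distance from \<open>xT\<close> and \<open>xB\<close>. The last condition on \<tau>
  keeps the vertical motion inside the triangle of \<open>triangle_step\<close>.\<close>

locale waveguide_setup = obstacle Ob + profile l1 l2 l3 l4 lo hi r4 r3 r2 r1 \<delta>
  for Ob l1 l2 l3 l4 lo hi r4 r3 r2 r1 \<delta> +
  fixes l0 r0 xT yT xB yB sl ic \<eta> c0 D \<tau> :: real
  assumes PT: "(xT, yT) \<in> K" and PB: "(xB, yB) \<in> K"
    and heights: "\<And>p. p \<in> K \<Longrightarrow> yB \<le> snd p \<and> snd p \<le> yT"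
    and xTB: "lo \<le> xT" "xT \<le> hi" "lo \<le> xB" "xB \<le> hi"
    and ends: "l0 < l1" "r1 < r0"
    and \<eta>: "0 < \<eta>" and chord: "\<And>x s. l0 \<le> x \<Longrightarrow> x \<le> r0 \<Longrightarrow> \<bar>s\<bar> \<le> 2 * \<eta> \<Longrightarrow> (x, sl * x + ic + s) \<in> Ob"
    and c0: "0 < c0" "\<And>p. p \<in> K \<Longrightarrow> fst p \<le> l4 \<or> r4 \<le> fst p \<Longrightarrow> c0 \<le> yT - snd p \<and> c0 \<le> snd p - yB"
    and D: "0 < D" "\<And>p. p \<in> K \<Longrightarrow> \<bar>fst p - xT\<bar> \<le> D \<and> \<bar>fst p - xB\<bar> \<le> D"
    and \<tau>: "0 < \<tau>" "\<tau> \<le> 1" "2 * \<tau> \<le> c0 / D * min (r4 - hi) (lo - l4)"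
begin

text \<open>The line through the leftmost and the rightmost point of the obstacle.\<close>
definition ell where "ell x = sl * x + ic"

text \<open>Over \<open>[l0, r0]\<close> the transition takes place inside the obstacle.\<close>
definition \<theta> where "\<theta> p = step (((snd p - ell (fst p)) / \<eta> + 1) / 2)"

text \<open>Equal to 1 in the waveguide; it confines the parts with a varying centre or with y as a
  factor to a bounded set.\<close>

definition kcut where "kcut y = ramp (-2) (-1) y * ramp 2 1 y"
definition center where "center p = xB + \<theta> p * (xT - xB)"
definition X1 where "X1 p = w (fst p) + kcut (snd p) * (\<zeta> (fst p) * (fst p - center p))"
text \<open>The factor with \<theta> is y - 1 above and y + 1 below the chord. The square of
  \<open>anchor\<close> leaves one factor \<open>anchor\<close> in the derivative, which
  \<open>anchored_form_lower\<close> exploits.\<close>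

definition X2 where "X2 p = \<tau> * (kcut (snd p) * ((anchor (fst p))\<^sup>2 * (snd p + 1 - 2 * \<theta> p)))"

lemma \<theta>_values: "\<eta> \<le> snd p - ell (fst p) \<Longrightarrow> \<theta> p = 1" "snd p - ell (fst p) \<le> - \<eta> \<Longrightarrow> \<theta> p = 0"
  using \<eta> by (auto simp: \<theta>_def field_simps intro!: step_0 step_1)

lemma \<theta>_bounds: "0 \<le> \<theta> p" "\<theta> p \<le> 1"
  by (simp_all add: \<theta>_def step_bounds)

lemma kcut_1: "\<bar>y\<bar> \<le> 1 \<Longrightarrow> kcut y = 1" by (auto simp: kcut_def ramp_up ramp_down)
lemma kcut_0: "2 \<le> \<bar>y\<bar> \<Longrightarrow> kcut y = 0" by (auto simp: kcut_def ramp_up ramp_down abs_real_def split: if_splits)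
lemma kcut_bounds: "0 \<le> kcut y" "kcut y \<le> 1" by (auto simp: kcut_def ramp_bounds mult_le_one)

lemma center_between: "lo \<le> center p" "center p \<le> hi"
proof -
  have "center p = (1 - \<theta> p) * xB + \<theta> p * xT" by (simp add: center_def algebra_simps)
  moreover have "(1 - \<theta> p) * lo + \<theta> p * lo \<le> (1 - \<theta> p) * xB + \<theta> p * xT" "(1 - \<theta> p) * xB + \<theta> p * xT \<le> (1 - \<theta> p) * hi + \<theta> p * hi"
    using \<theta>_bounds[of p] xTB by (intro add_mono mult_left_mono; simp)+
  ultimately show "lo \<le> center p" "center p \<le> hi" by (auto simp: algebra_simps)
qed

lemma smooth_\<theta>: "smooth \<theta>"
proof -
  have "smooth (\<lambda>p::real \<times> real. (inverse (2 * \<eta>)) * (snd p - (sl * fst p + ic)) + 1 / 2)"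
    by (intro smooth_on_add smooth_on_diff smooth_on_mult smooth_on_const smooth_on_linear bounded_linear_fst bounded_linear_snd) auto
  from smooth_on_compose[OF smooth_step this]
  have "smooth (\<lambda>p. step ((inverse (2 * \<eta>)) * (snd p - ell (fst p)) + 1 / 2))" by (simp add: ell_def)
  moreover have "(inverse (2 * \<eta>)) * v + 1 / 2 = (v / \<eta> + 1) / 2" for v using \<eta> by (simp add: field_simps)
  ultimately show ?thesis by (simp only: \<theta>_def[abs_def])
qed

lemma smooth_kcut: "smooth kcut"
  unfolding kcut_def[abs_def] by (intro smooth_on_mult smooth_ramp)

text \<open>Only \<open>w\<close> extends to infinity; all other parts vanish outside one fixed
  box.\<close>

lemma X_bounded: "\<exists>B. bounded_C2 X1 B \<and> bounded_C2 X2 B"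
proof -
  define C where "C = cbox (l1, -2) (r1, 2 :: real)"
  have C: "compact C" by (simp add: C_def)
  have out: "kcut (snd p) * (\<zeta> (fst p) * z) = 0" "kcut (snd p) * ((anchor (fst p))\<^sup>2 * z) = 0" if "p \<notin> C" for p z
  proof -
    have "fst p < l1 \<or> r1 < fst p \<or> 2 \<le> \<bar>snd p\<bar>" using that by (cases p) (auto simp: C_def)
    then show "kcut (snd p) * (\<zeta> (fst p) * z) = 0" "kcut (snd p) * ((anchor (fst p))\<^sup>2 * z) = 0"
      using ord by (auto simp: kcut_0 \<zeta>_values anchor_values)
  qed
  note lin = smooth_on_linear[OF open_UNIV bounded_linear_fst] smooth_on_linear[OF open_UNIV bounded_linear_snd]
  have sc: "smooth center" unfolding center_def[abs_def]
    by (intro smooth_on_add smooth_on_mult smooth_on_const smooth_\<theta>) auto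
  have "smooth (\<lambda>p. kcut (snd p) * (\<zeta> (fst p) * (fst p - center p)))"
    by (intro smooth_on_mult smooth_on_diff sc lin smooth_comp_fst smooth_comp_snd smooth_kcut smooth_\<zeta>)
  then obtain B1 where B1: "bounded_C2 (\<lambda>p. kcut (snd p) * (\<zeta> (fst p) * (fst p - center p))) B1"
    using bounded_C2_compact[OF _ C] out by blast
  have "smooth (\<lambda>p. \<tau> * (kcut (snd p) * ((anchor (fst p))\<^sup>2 * (snd p + 1 - 2 * \<theta> p))))" unfolding power2_eq_square
    by (intro smooth_on_mult smooth_on_diff smooth_on_add smooth_on_const lin smooth_comp_fst smooth_comp_snd smooth_kcut smooth_anchor smooth_\<theta> open_UNIV)
  then obtain B2 where B2: "bounded_C2 X2 B2"
    using bounded_C2_compact[OF _ C, of X2] out unfolding X2_def[abs_def] by force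
  obtain B3 where B3: "\<And>x. \<bar>w x\<bar> \<le> B3" "\<And>x. \<bar>deriv w x\<bar> \<le> B3" "\<And>x. \<bar>deriv (deriv w) x\<bar> \<le> B3"
    using w_bounded by blast
  have "bounded_C2 X1 (B3 + B1)" unfolding X1_def[abs_def]
    by (rule bounded_C2_add[OF bounded_C2_fst[OF smooth_w B3] B1])
  then show ?thesis using bounded_C2_mono[of X1 "B3 + B1" "max (B3 + B1) B2"] bounded_C2_mono[OF B2, of "max (B3 + B1) B2"] by auto
qed

lemma mem_waveguide: "p \<in> waveguide Ob \<longleftrightarrow> \<bar>snd p\<bar> < 1 \<and> p \<notin> K"
  by (cases p) (auto simp: waveguide_def)

lemma off_chord:
  assumes "p \<notin> Ob" "l0 \<le> fst p" "fst p \<le> r0" shows "2 * \<eta> < \<bar>snd p - ell (fst p)\<bar>"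
  using chord[OF assms(2,3), of "snd p - ell (fst p)"] assms(1)
  by (intro not_le_imp_less notI) (auto simp: ell_def)

text \<open>The transition of \<theta> is invisible in the waveguide: near each point \<theta> is
  constant, or the terms containing it vanish.\<close>

lemma local_form:
  assumes p: "p \<in> waveguide Ob"
  obtains U e \<sigma> where "open U" "p \<in> U" "e \<in> {xT, xB}" "\<bar>\<sigma>\<bar> = 1"
    "\<And>q. q \<in> U \<Longrightarrow> X1 q = W e (fst q)" "\<And>q. q \<in> U \<Longrightarrow> X2 q = \<tau> * ((anchor (fst q))\<^sup>2 * (snd q - \<sigma>))"
proof -
  have y: "\<bar>snd p\<bar> < 1" "p \<notin> Ob" using p Ob_K by (auto simp: mem_waveguide)
  define S where "S = {q :: real \<times> real. \<bar>snd q\<bar> < 1}"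
  have S: "open S" unfolding S_def by (intro open_Collect_less continuous_intros)
  consider (a) "l0 \<le> fst p" "fst p \<le> r0" "2 * \<eta> < snd p - ell (fst p)" | (b) "l0 \<le> fst p" "fst p \<le> r0" "2 * \<eta> < ell (fst p) - snd p"
    | (c) "fst p < l0 \<or> r0 < fst p" using off_chord[OF y(2)] by linarith
  then show ?thesis
  proof cases
    case a
    show ?thesis
    proof (rule that[of "S \<inter> {q. \<eta> < snd q - ell (fst q)}" xT 1])
      show "open (S \<inter> {q. \<eta> < snd q - ell (fst q)})" unfolding ell_def
        by (intro open_Int S open_Collect_less continuous_intros)
    qed (use a y \<eta> in \<open>auto simp: S_def X1_def X2_def W_def center_def kcut_1 \<theta>_values\<close>)
  next
    case b
    show ?thesis
    proof (rule that[of "S \<inter> {q. \<eta> < ell (fst q) - snd q}" xB "-1"])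
      show "open (S \<inter> {q. \<eta> < ell (fst q) - snd q})" unfolding ell_def
        by (intro open_Int S open_Collect_less continuous_intros)
    qed (use b y \<eta> in \<open>auto simp: S_def X1_def X2_def W_def center_def kcut_1 \<theta>_values\<close>)
  next
    case c
    show ?thesis
    proof (rule that[of "{q. fst q < l1} \<union> {q. r1 < fst q}" xT 1])
      show "open ({q. fst q < l1} \<union> {q::real \<times> real. r1 < fst q})"
        by (intro open_Un open_Collect_less continuous_intros)
    qed (use c ends ord in \<open>auto simp: X1_def X2_def W_def \<zeta>_values anchor_values\<close>)
  qed
qed

lemma partials:
  assumes p: "p \<in> waveguide Ob"
  obtains e \<sigma> where "e \<in> {xT, xB}" "\<bar>\<sigma>\<bar> = 1" "P1 X1 p = deriv (W e) (fst p)" "P2 X1 p = 0"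
    "P1 (P1 X1) p = deriv (deriv (W e)) (fst p)" "P2 (P1 X1) p = 0"
    "X2 p = \<tau> * ((anchor (fst p))\<^sup>2 * (snd p - \<sigma>))"
    "P1 X2 p = \<tau> * (2 * anchor (fst p) * deriv anchor (fst p) * (snd p - \<sigma>))" "P2 X2 p = \<tau> * (anchor (fst p))\<^sup>2"
proof -
  obtain U e \<sigma> where U: "open U" "p \<in> U" and e: "e \<in> {xT, xB}" "\<bar>\<sigma>\<bar> = 1"
    and X: "\<And>q. q \<in> U \<Longrightarrow> X1 q = W e (fst q)" "\<And>q. q \<in> U \<Longrightarrow> X2 q = \<tau> * ((anchor (fst q))\<^sup>2 * (snd q - \<sigma>))"
    using local_form[OF p] by metis
  have df: "((\<lambda>q. f (fst q)) has_derivative (\<lambda>v. fst v * deriv f (fst q) + snd v * 0)) (at q)" if "smooth f" for f and q :: "real \<times> real"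
    using P_derivative[OF smooth_comp_fst[OF that], of q] unfolding P_comp_fst[OF that] .
  have 1: "P1 X1 q = deriv (W e) (fst q)" "P2 X1 q = 0" if "q \<in> U" for q
    using P_transfer[OF U(1) that X(1) df[OF smooth_W]] by auto
  have 2: "P1 (P1 X1) p = deriv (deriv (W e)) (fst p)" "P2 (P1 X1) p = 0"
    using P_transfer[OF U 1(1) df[OF smooth_deriv[OF smooth_W]]] by auto
  have "((\<lambda>q. \<tau> * ((anchor (fst q))\<^sup>2 * (snd q - \<sigma>))) has_derivative
      (\<lambda>v. fst v * (\<tau> * (2 * anchor (fst p) * deriv anchor (fst p) * (snd p - \<sigma>))) + snd v * (\<tau> * (anchor (fst p))\<^sup>2))) (at p)"
    by (auto intro!: derivative_eq_intros df[OF smooth_anchor] simp: algebra_simps)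
  from P_transfer[OF U X(2) this] 1[OF U(2)] 2 X(2)[OF U(2)] e show ?thesis by (intro that) auto
qed

text \<open>The multiplier is \<open>P1 X1\<close>, that is W', so the divergence term keeps only
  the contribution of \<open>X2\<close>. In c, the divisor 2 L^2 pays for the component of X . grad
  u along x and 1/16 for the one along y, for which \<tau>/2 h^2 |b|^2 is at hand.\<close>

lemma coercive:
  assumes p: "p \<in> waveguide Ob" and L: "1 \<le> L" "\<And>q. \<bar>X1 q\<bar> \<le> L" and M: "\<And>x. \<bar>deriv anchor x\<bar> \<le> M"
    and \<beta>: "\<And>x e. l1 \<le> x \<Longrightarrow> x \<le> r1 \<Longrightarrow> lo \<le> e \<Longrightarrow> e \<le> hi \<Longrightarrow> \<tau> * (1 + 32 * M\<^sup>2) \<le> 1 / (2 + \<delta>) * deriv (W e) x"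
    and c1: "0 < c1" and line: "\<And>e x s r. e \<in> {xT, xB} \<Longrightarrow> 0 \<le> s \<Longrightarrow> 0 \<le> r \<Longrightarrow>
    c1 * (\<rho>2 x * s\<^sup>2 + \<rho>2 x * r\<^sup>2) \<le> (2 - 1 / (2 + \<delta>)) * deriv (W e) x * s\<^sup>2
      - \<bar>deriv (deriv (W e)) x + 2 * G x\<bar> * (s * r) + (deriv G x + \<tau> * (anchor x)\<^sup>2 * E) * r\<^sup>2"
    and c: "0 < c" "c \<le> c1 / (2 * L\<^sup>2)" "c \<le> 1 / 16" and R: "R\<^sup>2 = \<rho>2 (fst p)"
  shows "c * (R\<^sup>2 * (cmod z)\<^sup>2 + R\<^sup>2 * (cmod (of_real (X1 p) * a + of_real (X2 p) * b))\<^sup>2)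
       \<le> 2 * (P1 X1 p * (cmod a)\<^sup>2 + P2 X2 p * (cmod b)\<^sup>2 + (P2 X1 p + P1 X2 p) * Re (a * cnj b))
          - (P1 X1 p + P2 X2 p) * ((cmod a)\<^sup>2 + (cmod b)\<^sup>2 - E * (cmod z)\<^sup>2)
          + (P1 X1 p * ((cmod a)\<^sup>2 + (cmod b)\<^sup>2 - E * (cmod z)\<^sup>2) + P1 (P1 X1) p * Re (a * cnj z) + P2 (P1 X1) p * Re (b * cnj z))
          + (deriv G (fst p) * (cmod z)\<^sup>2 + 2 * G (fst p) * Re (a * cnj z))"
proof -
  obtain e \<sigma> where e: "e \<in> {xT, xB}" "\<bar>\<sigma>\<bar> = 1" and pd: "P1 X1 p = deriv (W e) (fst p)" "P2 X1 p = 0"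
    "P1 (P1 X1) p = deriv (deriv (W e)) (fst p)" "P2 (P1 X1) p = 0"
    "P1 X2 p = \<tau> * (2 * anchor (fst p) * deriv anchor (fst p) * (snd p - \<sigma>))" "P2 X2 p = \<tau> * (anchor (fst p))\<^sup>2"
    and X2: "X2 p = \<tau> * ((anchor (fst p))\<^sup>2 * (snd p - \<sigma>))"
    using partials[OF p] by metis
  define h where "h = anchor (fst p)"
  define r2 where "r2 = \<rho>2 (fst p)"
  have eb: "lo \<le> e" "e \<le> hi" using e xTB by auto
  have \<sigma>: "\<bar>snd p - \<sigma>\<bar> \<le> 2" using p e(2) by (auto simp: mem_waveguide)
  have h: "0 \<le> h" "h \<le> 1" by (auto simp: h_def anchor_bounds)
  have h2: "0 \<le> h\<^sup>2" "h\<^sup>2 \<le> 1" using h by (auto simp: power_le_one)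
  have b0: "0 \<le> 1 / (2 + \<delta>) * deriv (W e) (fst p)"
  proof (cases "fst p = mid")
    case True then show ?thesis using middle(2)[of mid e] mid \<delta> by simp
  next
    case False
    have "0 \<le> min 1 (\<delta> * \<bar>fst p - mid\<bar> powr (- \<delta> - 1))" using \<delta> by simp
    also note W_deriv_lower[OF eb False]
    finally show ?thesis using \<delta> by simp
  qed
  have low: "c1 * (r2 * (cmod a)\<^sup>2 + r2 * (cmod z)\<^sup>2) + \<tau> / 2 * h\<^sup>2 * (cmod b)\<^sup>2
    \<le> 2 * deriv (W e) (fst p) * (cmod a)\<^sup>2 + \<tau> * h\<^sup>2 * (cmod b)\<^sup>2 - \<tau> * h\<^sup>2 * (cmod a)\<^sup>2
      + 2 * (\<tau> * (2 * h * deriv anchor (fst p) * (snd p - \<sigma>))) * Re (a * cnj b)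
      + (deriv (deriv (W e)) (fst p) + 2 * G (fst p)) * Re (a * cnj z) + (deriv G (fst p) + \<tau> * h\<^sup>2 * E) * (cmod z)\<^sup>2"
  proof (rule anchored_form_lower[OF h M \<sigma> \<tau>(1) _ _ b0])
    show "\<tau> * (1 + 32 * M\<^sup>2) \<le> 1 / (2 + \<delta>) * deriv (W e) (fst p)" if "h \<noteq> 0"
    proof (rule \<beta>[OF _ _ eb])
      show "l1 \<le> fst p" "fst p \<le> r1" using that anchor_values(3,4)[of "fst p"] by (force simp: h_def)+
    qed
  qed (use line[OF e(1), of "cmod a" "cmod z" "fst p"] in \<open>auto simp: r2_def h_def\<close>)
  have r2: "0 \<le> r2" "r2 \<le> 1" using \<rho>2_bounds[of "fst p"] by (auto simp: r2_def)
  have "cmod (of_real (X1 p) * a + of_real (X2 p) * b) \<le> \<bar>X1 p\<bar> * cmod a + \<bar>X2 p\<bar> * cmod b"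
    using norm_triangle_ineq[of "of_real (X1 p) * a" "of_real (X2 p) * b"] by (simp add: norm_mult)
  then have "(cmod (of_real (X1 p) * a + of_real (X2 p) * b))\<^sup>2 \<le> (\<bar>X1 p\<bar> * cmod a + \<bar>X2 p\<bar> * cmod b)\<^sup>2"
    by (intro power_mono) auto
  also have "\<dots> \<le> 2 * (\<bar>X1 p\<bar> * cmod a)\<^sup>2 + 2 * (\<bar>X2 p\<bar> * cmod b)\<^sup>2"
    using zero_le_power2[of "\<bar>X1 p\<bar> * cmod a - \<bar>X2 p\<bar> * cmod b"] unfolding power2_sum power2_diff by linarith
  also have "\<dots> \<le> 2 * (L\<^sup>2 * (cmod a)\<^sup>2) + 2 * (4 * \<tau> * h\<^sup>2 * (cmod b)\<^sup>2)"
  proof -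
    have 1: "\<bar>X1 p\<bar>\<^sup>2 \<le> L\<^sup>2" using L by (intro power_mono) auto
    have "\<bar>X2 p\<bar> \<le> \<tau> * h\<^sup>2 * 2" unfolding X2 using \<sigma> \<tau> h2 by (simp add: abs_mult h_def mult_left_mono)
    then have "\<bar>X2 p\<bar>\<^sup>2 \<le> (\<tau> * h\<^sup>2 * 2)\<^sup>2" by (intro power_mono) auto
    also have "\<dots> = 4 * (\<tau> * h\<^sup>2) * (\<tau> * h\<^sup>2)" by (simp add: power2_eq_square)
    also have "\<dots> \<le> 4 * (\<tau> * h\<^sup>2) * 1" using \<tau> h2 by (intro mult_left_mono) (auto simp: mult_le_one)
    finally have 2: "\<bar>X2 p\<bar>\<^sup>2 \<le> 4 * \<tau> * h\<^sup>2" by simp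
    show ?thesis unfolding power_mult_distrib
      by (intro add_mono mult_left_mono mult_right_mono 1 2) auto
  qed
  finally have Xn: "(cmod (of_real (X1 p) * a + of_real (X2 p) * b))\<^sup>2 \<le> 2 * (L\<^sup>2 * (cmod a)\<^sup>2) + 2 * (4 * \<tau> * h\<^sup>2 * (cmod b)\<^sup>2)" .
  have L2: "1 \<le> L\<^sup>2" using L by simp
  have cL: "c * (2 * L\<^sup>2) \<le> c1"
    by (rule pos_le_divide_eq[THEN iffD1, OF _ c(2)]) (use L in simp)
  have c_le: "c \<le> c1"
  proof -
    have "c * 1 \<le> c * (2 * L\<^sup>2)" using c L2 by (intro mult_left_mono) auto
    then show ?thesis using cL by linarith
  qed
  have "c * (r2 * (cmod z)\<^sup>2 + r2 * (cmod (of_real (X1 p) * a + of_real (X2 p) * b))\<^sup>2)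
    \<le> c * (r2 * (cmod z)\<^sup>2 + r2 * (2 * (L\<^sup>2 * (cmod a)\<^sup>2) + 2 * (4 * \<tau> * h\<^sup>2 * (cmod b)\<^sup>2)))"
    using c r2 Xn by (intro mult_left_mono add_left_mono) auto
  also have "\<dots> = c * (r2 * (cmod z)\<^sup>2) + (c * (2 * L\<^sup>2)) * (r2 * (cmod a)\<^sup>2) + r2 * (c * 8 * (\<tau> * h\<^sup>2 * (cmod b)\<^sup>2))"
    by (simp add: algebra_simps)
  also have "\<dots> \<le> c1 * (r2 * (cmod z)\<^sup>2) + c1 * (r2 * (cmod a)\<^sup>2) + 1 * (1 / 2 * (\<tau> * h\<^sup>2 * (cmod b)\<^sup>2))"
    using c c_le cL r2 \<tau> h2 by (intro add_mono mult_right_mono mult_mono) auto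
  finally have "c * (r2 * (cmod z)\<^sup>2 + r2 * (cmod (of_real (X1 p) * a + of_real (X2 p) * b))\<^sup>2)
    \<le> c1 * (r2 * (cmod a)\<^sup>2 + r2 * (cmod z)\<^sup>2) + \<tau> / 2 * h\<^sup>2 * (cmod b)\<^sup>2" by (simp add: algebra_simps)
  from order_trans[OF this low] show ?thesis
    unfolding R r2_def[symmetric] pd h_def[symmetric] by (simp add: algebra_simps)
qed

end

section \<open>The flow maps the obstacle into itself\<close>

context waveguide_setup
begin

lemma K_strip: "p \<in> K \<Longrightarrow> \<bar>snd p\<bar> < 1"
  using subsetD[OF strip, of p] by (cases p) auto

lemma X1_obstacle: "p \<in> K \<Longrightarrow> X1 p = W (center p) (fst p)"
  using K_strip[of p] by (simp add: X1_def W_def kcut_1)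

lemma X2_obstacle: "p \<in> K \<Longrightarrow> \<bar>X2 p\<bar> \<le> 2 * \<tau>"
proof -
  assume p: "p \<in> K"
  have "\<bar>snd p + 1 - 2 * \<theta> p\<bar> \<le> 2" using K_strip[OF p] \<theta>_bounds[of p] by (auto simp: abs_le_iff)
  then have "(anchor (fst p))\<^sup>2 * \<bar>snd p + 1 - 2 * \<theta> p\<bar> \<le> 1 * 2"
    using anchor_bounds[of "fst p"] by (intro mult_mono) (auto simp: power_le_one)
  then show ?thesis using \<tau> K_strip[OF p] by (simp add: X2_def abs_mult kcut_1)
qed

text \<open>Here the anchor may act. The shift moves towards both \<open>xT\<close> and
  \<open>xB\<close> with horizontal speed at least \<omega>, and its slope is at most c0 / D, so it
  stays in the triangle.\<close>

lemma side_step: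
  assumes p: "p \<in> K" "fst p \<le> l4 \<or> r4 \<le> fst p" and t: "0 \<le> t" "t * L \<le> min (r4 - hi) (lo - l4)" and L: "\<bar>X1 p\<bar> \<le> L"
  shows "(fst p - t * X1 p, snd p - t * X2 p) \<in> K"
proof (cases "t = 0")
  case True then show ?thesis using p by simp
next
  case False
  define \<omega> where "\<omega> = min (r4 - hi) (lo - l4)"
  have \<omega>: "0 < \<omega>" using ord by (simp add: \<omega>_def)
  have t0: "0 < t" using t False by simp
  have tX: "\<bar>t * X1 p\<bar> \<le> \<omega>"
  proof -
    have "t * \<bar>X1 p\<bar> \<le> t * L" using t L by (intro mult_left_mono) auto
    then show ?thesis using t by (simp add: abs_mult \<omega>_def)
  qed
  have X: "\<omega> \<le> \<bar>X1 p\<bar>" "(r4 \<le> fst p \<and> 0 < X1 p) \<or> (fst p \<le> l4 \<and> X1 p < 0)"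
    using p(2) W_right[of "fst p" "center p"] W_left[of "fst p" "center p"] center_between[of p] ord
    unfolding X1_obstacle[OF p(1)] \<omega>_def by linarith+
  have far: "\<omega> \<le> \<bar>fst p - x\<bar>" "0 < (fst p - x) * (t * X1 p)" if x: "lo \<le> x" "x \<le> hi" for x
  proof -
    show "\<omega> \<le> \<bar>fst p - x\<bar>" using p(2) x by (auto simp: \<omega>_def)
    have "0 < (fst p - x) * X1 p" using X(2) x ord by (auto intro: mult_pos_pos mult_neg_neg)
    then have "0 < t * ((fst p - x) * X1 p)" using t0 by simp
    then show "0 < (fst p - x) * (t * X1 p)" by (simp only: mult.left_commute)
  qed
  have z: "\<bar>t * X2 p\<bar> \<le> c0 / D * \<bar>t * X1 p\<bar>"
  proof -
    have "\<bar>X2 p\<bar> \<le> c0 / D * \<omega>" using X2_obstacle[OF p(1)] \<tau>(3) by (simp only: \<omega>_def)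
    also have "\<dots> \<le> c0 / D * \<bar>X1 p\<bar>" using X(1) c0(1) D(1) by (intro mult_left_mono) auto
    finally have "t * \<bar>X2 p\<bar> \<le> t * (c0 / D * \<bar>X1 p\<bar>)" using t by (intro mult_left_mono) auto
    then show ?thesis using t by (simp add: abs_mult mult.left_commute)
  qed
  show ?thesis
  proof (rule triangle_step[OF _ PT PB])
    show "(fst p, snd p) \<in> K" using p by simp
    show "\<bar>t * X1 p\<bar> \<le> \<bar>fst p - xT\<bar>" "\<bar>t * X1 p\<bar> \<le> \<bar>fst p - xB\<bar>"
      using tX far(1)[of xT] far(1)[of xB] xTB by linarith+
    show "0 < (fst p - xT) * (t * X1 p)" "0 < (fst p - xB) * (t * X1 p)" using far(2) xTB by blast+
    show "\<bar>t * X2 p\<bar> \<le> c0 / D * \<bar>t * X1 p\<bar>" by (rule z)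
  qed (use D(2)[OF p(1)] c0(1) c0(2)[OF p] in auto)
qed

text \<open>The motion is horizontal. Above the layer it goes towards \<open>xT\<close>, and the
  point reached is between the chord and the segment from p to the top, hence in K by convexity;
  below the layer the same holds with the bottom. In the layer where \<theta> varies the point stays
  within 2 \<eta> of the chord.\<close>

lemma middle_step:
  assumes p: "p \<in> K" "l4 < fst p" "fst p < r4" and t: "0 \<le> t" "t \<le> 1" "t * (\<bar>sl\<bar> * (r4 - l4)) \<le> \<eta>"
  shows "(fst p - t * X1 p, snd p - t * X2 p) \<in> K"
proof -
  define x y where "x = fst p" and "y = snd p"
  have X: "X1 p = x - center p" "X2 p = 0"
    using p ord K_strip[OF p(1)] by (auto simp: X1_def X2_def w_def x_def kcut_1 \<zeta>_values anchor_values)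
  define x' where "x' = x - t * (x - center p)"
  have x'_eq: "x' = (1 - t) * x + t * center p" by (simp add: x'_def algebra_simps)
  have cen: "l4 < center p" "center p < r4" using center_between[of p] ord by linarith+
  have "(1 - t) * l4 + t * l4 \<le> x'" "x' \<le> (1 - t) * r4 + t * r4" unfolding x'_eq
    using t cen p by (intro add_mono mult_left_mono; simp add: x_def)+
  then have x': "l4 \<le> x'" "x' \<le> r4" by (auto simp: algebra_simps)
  then have dom: "l0 \<le> x'" "x' \<le> r0" using ends ord by auto
  have near: "\<bar>ell x' - ell x\<bar> \<le> \<eta>"
  proof -
    have "ell x' - ell x = - (t * (sl * (x - center p)))" by (simp add: ell_def x'_def algebra_simps)
    then have "\<bar>ell x' - ell x\<bar> = t * (\<bar>sl\<bar> * \<bar>x - center p\<bar>)" using t by (simp add: abs_mult)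
    also have "\<dots> \<le> t * (\<bar>sl\<bar> * (r4 - l4))" using t cen p by (intro mult_left_mono) (auto simp: x_def abs_le_iff)
    finally show ?thesis using t by linarith
  qed
  have chord': "(x', ell x' + s) \<in> K" if "\<bar>s\<bar> \<le> 2 * \<eta>" for s
    using chord[OF dom that] Ob_K by (auto simp: ell_def)
  have "(x', y) \<in> K"
  proof -
    consider (a) "\<eta> \<le> y - ell x" | (b) "y - ell x \<le> - \<eta>" | (c) "\<bar>y - ell x\<bar> < \<eta>" by linarith
    then show ?thesis
    proof cases
      case a
      then have "center p = xT" by (simp add: center_def \<theta>_values x_def y_def)
      then have eq: "(1 - t) *\<^sub>R p + t *\<^sub>R (xT, yT) = (x', y + t * (yT - y))"
        by (simp add: prod_eq_iff x'_eq x_def y_def algebra_simps)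
      have "(x', y + t * (yT - y)) \<in> K" unfolding eq[symmetric] using convexD[OF convex_K p(1) PT] t by simp
      moreover have "(x', ell x' + 0) \<in> K" using \<eta> by (intro chord') simp
      moreover have "0 \<le> t * (yT - y)" using heights[OF p(1)] t by (simp add: y_def)
      ultimately show ?thesis using a near vertical_between[of x' "ell x'" "y + t * (yT - y)" y] by auto
    next
      case b
      then have "center p = xB" by (simp add: center_def \<theta>_values x_def y_def)
      then have eq: "(1 - t) *\<^sub>R p + t *\<^sub>R (xB, yB) = (x', y - t * (y - yB))"
        by (simp add: prod_eq_iff x'_eq x_def y_def algebra_simps)
      have "(x', y - t * (y - yB)) \<in> K" unfolding eq[symmetric] using convexD[OF convex_K p(1) PB] t by simp
      moreover have "(x', ell x' + 0) \<in> K" using \<eta> by (intro chord') simp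
      moreover have "0 \<le> t * (y - yB)" using heights[OF p(1)] t by (simp add: y_def)
      ultimately show ?thesis using b near vertical_between[of x' "y - t * (y - yB)" "ell x'" y] by auto
    next
      case c
      then show ?thesis using near chord'[of "y - ell x'"] by simp
    qed
  qed
  then show ?thesis by (simp add: X x'_def x_def y_def)
qed

text \<open>On the wall that faces the obstacle the vertical component vanishes; beyond it the shift
  contracts towards the wall and, as q \<le> 1, does not cross it.\<close>

lemma wall_step:
  assumes p: "1 \<le> \<bar>snd p\<bar>" and t: "0 \<le> t" "t \<le> 1" shows "1 \<le> \<bar>snd p - t * X2 p\<bar>"
proof (cases "anchor (fst p) = 0")
  case True then show ?thesis using p by (simp add: X2_def)
next
  case False
  have "l1 \<le> fst p" "fst p \<le> r1" using False anchor_values(3,4)[of "fst p"] by force+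
  then have x: "l0 \<le> fst p" "fst p \<le> r0" using ends by auto
  \<comment> \<open>The layer around the chord is inside the obstacle and so strictly between the
    walls; hence \<theta> is constant at and beyond each wall.\<close>
  have "(fst p, ell (fst p) + 2 * \<eta>) \<in> K" "(fst p, ell (fst p) + - (2 * \<eta>)) \<in> K"
    using chord[OF x, of "2 * \<eta>"] chord[OF x, of "- (2 * \<eta>)"] \<eta> Ob_K unfolding ell_def by auto
  from this[THEN K_strip] have th: "1 \<le> snd p \<Longrightarrow> \<theta> p = 1" "snd p \<le> -1 \<Longrightarrow> \<theta> p = 0"
    using \<eta> by (auto intro!: \<theta>_values)
  define q where "q = t * (\<tau> * (kcut (snd p) * (anchor (fst p))\<^sup>2))"
  have q: "0 \<le> q" "q \<le> 1"
    using t \<tau> kcut_bounds[of "snd p"] anchor_bounds[of "fst p"] unfolding q_def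
    by (auto intro!: mult_le_one mult_nonneg_nonneg simp: power_le_one)
  have eq: "t * X2 p = q * (snd p + 1 - 2 * \<theta> p)" by (simp add: q_def X2_def)
  show ?thesis
  proof (cases "1 \<le> snd p")
    case True
    have "q * (snd p - 1) \<le> 1 * (snd p - 1)" using q True by (intro mult_right_mono) auto
    then show ?thesis unfolding eq th(1)[OF True] by simp
  next
    case False
    then have neg: "snd p \<le> -1" using p by linarith
    have "1 * (snd p + 1) \<le> q * (snd p + 1)" using q neg by (intro mult_right_mono_neg) auto
    then show ?thesis unfolding eq th(2)[OF neg] by simp
  qed
qed

lemma shift_outside:
  assumes p: "p \<notin> waveguide Ob" and L: "\<bar>X1 p\<bar> \<le> L"
    and t: "0 \<le> t" "t \<le> 1" "t * L \<le> min (r4 - hi) (lo - l4)" "t * (\<bar>sl\<bar> * (r4 - l4)) \<le> \<eta>"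
  shows "(fst p - t * X1 p, snd p - t * X2 p) \<notin> waveguide Ob"
proof (cases "p \<in> K")
  case True
  then have "(fst p - t * X1 p, snd p - t * X2 p) \<in> K"
    using side_step[OF True _ t(1,3) L] middle_step[OF True _ _ t(1,2,4)] by (cases "fst p \<le> l4 \<or> r4 \<le> fst p") auto
  then show ?thesis by (simp add: mem_waveguide)
next
  case False
  then have "1 \<le> \<bar>snd p\<bar>" using p by (auto simp: mem_waveguide)
  from wall_step[OF this t(1,2)] show ?thesis by (simp add: mem_waveguide)
qed

end

section \<open>The weighted resolvent estimate\<close>

definition weight :: "real \<Rightarrow> real \<times> real \<Rightarrow> real" where
  "weight \<delta> p = (1 + \<bar>fst p\<bar>) powr (- ((3 + \<delta>) / 2))"

lemma weight_bounds: "0 \<le> \<delta> \<Longrightarrow> 0 \<le> weight \<delta> p" "0 \<le> \<delta> \<Longrightarrow> weight \<delta> p \<le> 1"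
proof -
  assume \<delta>: "0 \<le> \<delta>"
  show "0 \<le> weight \<delta> p" by (simp add: weight_def)
  have "weight \<delta> p \<le> (1 + \<bar>fst p\<bar>) powr 0" unfolding weight_def using \<delta> by (intro powr_mono) auto
  then show "weight \<delta> p \<le> 1" by (simp split: if_splits)
qed

lemma continuous_weight: "continuous_on UNIV (weight \<delta>)"
  unfolding weight_def[abs_def] by (intro continuous_intros) auto

lemma weight_lipschitz:
  assumes \<delta>: "0 \<le> \<delta>" shows "\<bar>weight \<delta> p - weight \<delta> q\<bar> \<le> (3 + \<delta>) / 2 * norm (p - q)"
proof -
  define s where "s = (3 + \<delta>) / 2"
  have s: "0 \<le> s" using \<delta> by (simp add: s_def)
  have "norm ((1 + \<bar>fst p\<bar>) powr (- s) - (1 + \<bar>fst q\<bar>) powr (- s)) \<le> s * norm (\<bar>fst p\<bar> - \<bar>fst q\<bar>)"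
  proof (rule field_differentiable_bound[of "{0..}" _ "\<lambda>v. - s * (1 + v) powr (- s - 1)"])
    fix v :: real assume v: "v \<in> {0..}"
    show "((\<lambda>v. (1 + v) powr (- s)) has_real_derivative - s * (1 + v) powr (- s - 1)) (at v within {0..})"
      using v by (auto intro!: derivative_eq_intros simp: powr_diff field_simps)
    have "(1 + v) powr (- s - 1) \<le> (1 + v) powr 0" using v s by (intro powr_mono) auto
    also have "(1 + v) powr 0 = 1" using v by simp
    finally show "norm (- s * (1 + v) powr (- s - 1)) \<le> s" using s v by (simp add: abs_mult mult_left_le)
  qed auto
  also have "\<dots> \<le> s * norm (p - q)"
  proof (rule mult_left_mono[OF _ s])
    have "\<bar>\<bar>fst p\<bar> - \<bar>fst q\<bar>\<bar> \<le> \<bar>fst (p - q)\<bar>" by simp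
    also have "\<dots> \<le> norm (p - q)" using norm_fst_le[of "fst (p - q)" "snd (p - q)"] by (simp only: prod.collapse real_norm_def)
    finally show "norm (\<bar>fst p\<bar> - \<bar>fst q\<bar>) \<le> norm (p - q)" by simp
  qed
  finally show ?thesis by (simp add: weight_def s_def)
qed

lemma open_waveguide: "open (waveguide Ob)"
  unfolding waveguide_def by (intro open_Diff open_Times) auto

context waveguide_setup
begin

lemma weighted_resolvent_bound:
  assumes M: "\<And>x. \<bar>deriv anchor x\<bar> \<le> M"
    and \<beta>: "\<And>x e. l1 \<le> x \<Longrightarrow> x \<le> r1 \<Longrightarrow> lo \<le> e \<Longrightarrow> e \<le> hi \<Longrightarrow> \<tau> * (1 + 32 * M\<^sup>2) \<le> 1 / (2 + \<delta>) * deriv (W e) x"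
  shows "\<exists>E0>0. \<exists>C>0. \<forall>E\<ge>E0. \<forall>\<epsilon>\<in>{0<..1}. \<forall>f u. f \<in> L2 (lebesgue_on (waveguide Ob)) \<longrightarrow>
    (u, \<lambda>x. of_real (weight \<delta> x) * f x + Complex E \<epsilon> * u x) \<in> neg_dirichlet_laplacian (waveguide Ob) \<longrightarrow>
    L2_norm (lebesgue_on (waveguide Ob)) (\<lambda>x. of_real (weight \<delta> x) * u x) \<le> C * sqrt E * L2_norm (lebesgue_on (waveguide Ob)) f"
proof -
  obtain B where B: "bounded_C2 X1 B" "bounded_C2 X2 B" using X_bounded by blast
  \<comment> \<open>Also at least the Lipschitz constant of the weight, because
    \<open>rellich_limit\<close> uses one constant for the field and the weight.\<close>
  define L where "L = max 1 (max (2 * B) ((3 + \<delta>) / 2))"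
  have L: "1 \<le> L" "2 * B \<le> L" "(3 + \<delta>) / 2 \<le> L" unfolding L_def by linarith+
  interpret fld: planar_field X1 X2 "P1 X1" "P2 X1" "P1 X2" "P2 X2" L
    by (rule planar_fieldI[OF B L(1,2)])
  interpret dom: planar_domain "waveguide Ob" by unfold_locales (rule open_waveguide)
  define \<omega> where "\<omega> = min (r4 - hi) (lo - l4)"
  \<comment> \<open>The summand 1 covers a horizontal chord, sl = 0.\<close>
  define k where "k = \<bar>sl\<bar> * (r4 - l4) + 1"
  have k: "0 < k" using ord by (auto simp: k_def intro!: add_nonneg_pos)
  have \<omega>: "0 < \<omega>" using ord by (simp add: \<omega>_def)
  \<comment> \<open>\<omega> / L limits the horizontal step at the sides, \<eta> / k the change of
    height of the chord along a step.\<close>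
  define t1 where "t1 = min (min 1 fld.t0) (min (\<omega> / L) (\<eta> / k))"
  have "0 < t1" using \<omega> k \<eta> L by (auto simp: t1_def fld.t0_def)
  moreover have "t1 \<le> 1" "t1 \<le> fld.t0" "t1 \<le> \<omega> / L" "t1 \<le> \<eta> / k" unfolding t1_def by linarith+
  ultimately have t1: "0 < t1" "t1 \<le> 1" "t1 \<le> fld.t0" "t1 \<le> \<omega> / L" "t1 \<le> \<eta> / k" by auto
  interpret out: outgoing_field "waveguide Ob" X1 X2 "P1 X1" "P2 X1" "P1 X2" "P2 X2" L t1
  proof unfold_locales
    show "0 < t1" "t1 \<le> fld.t0" by (rule t1)+
    fix t :: real and p :: "real \<times> real" assume t: "0 \<le> t" "t \<le> t1" and p: "p \<notin> waveguide Ob"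
    have "t \<le> \<omega> / L" "t \<le> \<eta> / k" using t t1 by linarith+
    then have "t * L \<le> \<omega>" "t * k \<le> \<eta>" using L k by (simp_all add: pos_le_divide_eq)
    moreover note this(2)
    then have "t * (\<bar>sl\<bar> * (r4 - l4)) \<le> \<eta>" using t by (simp add: k_def distrib_left)
    ultimately show "fld.shift t p \<notin> waveguide Ob"
      using shift_outside[OF p fld.bX(1) t(1)] t t1 by (simp add: fld.shift_def \<omega>_def)
  qed
  obtain c1 E0 where c1: "0 < c1" and line: "\<And>E e x s r. E0 \<le> E \<Longrightarrow> e \<in> {xT, xB} \<Longrightarrow> 0 \<le> s \<Longrightarrow> 0 \<le> r \<Longrightarrow>
    c1 * (\<rho>2 x * s\<^sup>2 + \<rho>2 x * r\<^sup>2) \<le> (2 - 1 / (2 + \<delta>)) * deriv (W e) x * s\<^sup>2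
      - \<bar>deriv (deriv (W e)) x + 2 * G x\<bar> * (s * r) + (deriv G x + \<tau> * (anchor x)\<^sup>2 * E) * r\<^sup>2"
    using line_coercive[OF xTB \<tau>(1)] by metis
  define c where "c = min (c1 / (2 * L\<^sup>2)) (1 / 16)"
  have c: "0 < c" "c \<le> c1 / (2 * L\<^sup>2)" "c \<le> 1 / 16" using c1 L by (auto simp: c_def)
  have B0: "0 \<le> B" using B(1) unfolding bounded_C2_def by (meson abs_ge_zero order_trans)
  have s1: "smooth X1" using B by (simp add: bounded_C2_def)
  have weight2: "(weight \<delta> p)\<^sup>2 = \<rho>2 (fst p)" for p
  proof -
    have e: "- (3 + \<delta>) = - ((3 + \<delta>) / 2) + - ((3 + \<delta>) / 2)" by (simp only: field_sum_of_halves flip: minus_add_distrib)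
    show ?thesis unfolding weight_def \<rho>2_def e powr_add power2_eq_square ..
  qed
  show ?thesis
  proof (intro exI conjI allI ballI impI)
    show "0 < max 1 E0" "0 < (1 + 4 * L + B) / c" using L B0 c by auto
    fix E \<epsilon> :: real and f u :: "real \<times> real \<Rightarrow> complex"
    assume E: "max 1 E0 \<le> E" and \<epsilon>: "\<epsilon> \<in> {0<..1}" and f: "f \<in> L2 (lebesgue_on (waveguide Ob))"
      and mem: "(u, \<lambda>x. of_real (weight \<delta> x) * f x + Complex E \<epsilon> * u x) \<in> neg_dirichlet_laplacian (waveguide Ob)"
    show "L2_norm (lebesgue_on (waveguide Ob)) (\<lambda>x. of_real (weight \<delta> x) * u x)
      \<le> (1 + 4 * L + B) / c * sqrt E * L2_norm (lebesgue_on (waveguide Ob)) f"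
    proof (rule out.coercive_resolvent_bound)
      show "(u, \<lambda>x. of_real (weight \<delta> x) * f x + Complex E \<epsilon> * u x) \<in> dom.A"
        using mem by (simp only: dom.laplacian_graph)
      show "smooth (P1 X1)" by (rule smooth_P1[OF s1])
      show "(P1 X1 has_derivative (\<lambda>v. fst v * P1 (P1 X1) p + snd v * P2 (P1 X1) p)) (at p)" for p
        by (rule P_derivative[OF smooth_P1[OF s1]])
      show "\<bar>P1 X1 p\<bar> \<le> B" "\<bar>P1 (P1 X1) p\<bar> \<le> B" "\<bar>P2 (P1 X1) p\<bar> \<le> B" for p using B(1) unfolding bounded_C2_def by blast+
      show "continuous_on UNIV (P1 (P1 X1))" "continuous_on UNIV (P2 (P1 X1))"
        using s1 by (intro smooth_continuous smooth_P1 smooth_P2; simp)+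
      show "smooth (\<lambda>p::real \<times> real. G (fst p))" by (rule smooth_comp_fst[OF smooth_G])
      show "((\<lambda>p. G (fst p)) has_derivative (\<lambda>v. fst v * deriv G (fst p) + snd v * 0)) (at p)" for p :: "real \<times> real"
        using P_derivative[OF smooth_comp_fst[OF smooth_G], of p] unfolding P_comp_fst[OF smooth_G] .
      show "continuous_on UNIV (\<lambda>p::real \<times> real. deriv G (fst p))"
        by (rule smooth_continuous[OF smooth_comp_fst[OF smooth_deriv[OF smooth_G]]])
      show "0 \<le> weight \<delta> p" "weight \<delta> p \<le> 1" for p using weight_bounds \<delta> by auto
      show "\<bar>weight \<delta> p - weight \<delta> q\<bar> \<le> L * norm (p - q)" for p q
        using weight_lipschitz[of \<delta> p q] \<delta> mult_right_mono[OF L(3), of "norm (p - q)"] by simp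
      show "c * ((weight \<delta> p)\<^sup>2 * (cmod z)\<^sup>2 + (weight \<delta> p)\<^sup>2 * (cmod (of_real (X1 p) * a + of_real (X2 p) * b))\<^sup>2)
       \<le> 2 * (P1 X1 p * (cmod a)\<^sup>2 + P2 X2 p * (cmod b)\<^sup>2 + (P2 X1 p + P1 X2 p) * Re (a * cnj b))
          - (P1 X1 p + P2 X2 p) * ((cmod a)\<^sup>2 + (cmod b)\<^sup>2 - E * (cmod z)\<^sup>2)
          + (P1 X1 p * ((cmod a)\<^sup>2 + (cmod b)\<^sup>2 - E * (cmod z)\<^sup>2) + P1 (P1 X1) p * Re (a * cnj z) + P2 (P1 X1) p * Re (b * cnj z))
          + (deriv G (fst p) * (cmod z)\<^sup>2 + 2 * G (fst p) * Re (a * cnj z))"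
        if p: "p \<in> waveguide Ob" for p a b z
        by (rule coercive[OF p L(1) fld.bX(1) M \<beta> c1 line c weight2]) (use E in auto)
    qed (use c E \<epsilon> f in auto)
  qed
qed

end

text \<open>Supplies the data of \<open>waveguide_setup\<close>: the intervals [xl, lo] and [hi, xr]
  are cut into six equal parts, the thickness and \<open>c0\<close> come from compactness, and
  \<tau> is fixed last, being small relative to the rest.\<close>

lemma (in obstacle) weighted_resolvent_estimate:
  assumes \<delta>: "0 < \<delta>"
  shows "\<exists>E0>0. \<exists>C>0. \<forall>E\<ge>E0. \<forall>\<epsilon>\<in>{0<..1}. \<forall>f u. f \<in> L2 (lebesgue_on (waveguide Ob)) \<longrightarrow>
    (u, \<lambda>x. of_real (weight \<delta> x) * f x + Complex E \<epsilon> * u x) \<in> neg_dirichlet_laplacian (waveguide Ob) \<longrightarrow>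
    L2_norm (lebesgue_on (waveguide Ob)) (\<lambda>x. of_real (weight \<delta> x) * u x) \<le> C * sqrt E * L2_norm (lebesgue_on (waveguide Ob)) f"
proof (rule extremal_points)
  fix xT yT xB yB xl yl xr yr
  assume T: "(xT, yT) \<in> K" "\<And>p. p \<in> K \<Longrightarrow> snd p \<le> yT" "\<And>p. p \<in> K \<Longrightarrow> snd p = yT \<Longrightarrow> fst p = xT"
    and B: "(xB, yB) \<in> K" "\<And>p. p \<in> K \<Longrightarrow> yB \<le> snd p" "\<And>p. p \<in> K \<Longrightarrow> snd p = yB \<Longrightarrow> fst p = xB"
    and lr: "(xl, yl) \<in> K" "(xr, yr) \<in> K" "\<And>p. p \<in> K \<Longrightarrow> xl \<le> fst p" "\<And>p. p \<in> K \<Longrightarrow> fst p \<le> xr"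
    and lt: "xl < xT" "xT < xr" "xl < xB" "xB < xr"
  define lo hi where "lo = min xT xB" and "hi = max xT xB"
  define a b where "a = (lo - xl) / 6" and "b = (xr - hi) / 6"
  have "xl < lo" "hi < xr" "lo \<le> hi" using lt by (auto simp: lo_def hi_def)
  then have ab: "0 < a" "0 < b" "lo = xl + 6 * a" "xr = hi + 6 * b" "lo \<le> hi" by (auto simp: a_def b_def field_simps)
  define l0 l1 l2 l3 l4 where "l0 = xl + a" and "l1 = xl + 2 * a" and "l2 = xl + 3 * a" and "l3 = xl + 4 * a" and "l4 = xl + 5 * a"
  define r0 r1 r2 r3 r4 where "r0 = hi + 5 * b" and "r1 = hi + 4 * b" and "r2 = hi + 3 * b" and "r3 = hi + 2 * b" and "r4 = hi + b"
  note defs = l0_def l1_def l2_def l3_def l4_def r0_def r1_def r2_def r3_def r4_def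
  interpret pr: profile l1 l2 l3 l4 lo hi r4 r3 r2 r1 \<delta>
    by unfold_locales (use ab \<delta> in \<open>auto simp: defs\<close>)
  define sl where "sl = (yr - yl) / (xr - xl)"
  define ic where "ic = yl - sl * xl"
  have X: "0 < xr - xl" using lt by linarith
  have on_chord: "(x, sl * x + ic) \<in> Ob" if x: "l0 \<le> x" "x \<le> r0" for x
  proof -
    define u where "u = (x - xl) / (xr - xl)"
    have u: "0 < u" "u < 1" using x ab X by (auto simp: u_def defs)
    have ux: "u * (xr - xl) = x - xl" using X by (simp add: u_def)
    have "sl * (x - xl) = u * (yr - yl)" by (simp add: sl_def u_def)
    then have "(x, sl * x + ic) = (1 - u) *\<^sub>R (xl, yl) + u *\<^sub>R (xr, yr)"
      using ux by (simp add: ic_def algebra_simps)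
    then have "(x, sl * x + ic) \<in> open_segment (xl, yl) (xr, yr)"
      unfolding in_segment using u X by auto
    then show ?thesis using open_segment_Ob[OF lr(1,2)] X by auto
  qed
  have "compact ((\<lambda>x. (x, sl * x + ic)) ` {l0..r0})"
    by (intro compact_continuous_image continuous_intros) auto
  moreover have "(\<lambda>x. (x, sl * x + ic)) ` {l0..r0} \<subseteq> Ob" using on_chord by auto
  ultimately obtain d where d: "0 < d" "(\<Union>p\<in>(\<lambda>x. (x, sl * x + ic)) ` {l0..r0}. ball p d) \<subseteq> Ob"
    using compact_subset_open_imp_ball_epsilon_subset[OF _ op] by blast
  have chord: "(x, sl * x + ic + s) \<in> Ob" if "l0 \<le> x" "x \<le> r0" "\<bar>s\<bar> \<le> 2 * (d / 4)" for x s
  proof -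
    have "(x, sl * x + ic + s) \<in> ball (x, sl * x + ic) d" using that d by (simp add: dist_Pair_Pair dist_real_def)
    moreover have "ball (x, sl * x + ic) d \<subseteq> Ob" using that(1,2) by (intro order_trans[OF UN_upper d(2)]) auto
    ultimately show ?thesis by blast
  qed
  have "\<exists>c0>0. \<forall>p\<in>K. fst p \<le> l4 \<or> r4 \<le> fst p \<longrightarrow> c0 \<le> yT - snd p \<and> c0 \<le> snd p - yB"
  proof -
    define S where "S = K \<inter> ({p. fst p \<le> l4} \<union> {p. r4 \<le> fst p})"
    have S: "compact S" unfolding S_def
      by (intro compact_Int_closed compact_K closed_Un closed_Collect_le continuous_intros)
    \<comment> \<open>At the sides the extremal heights are not attained: the unique points that
      attain them have abscissae in [lo, hi].\<close>
    have pos: "0 < min (yT - snd p) (snd p - yB)" if p: "p \<in> S" for p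
    proof -
      have pK: "p \<in> K" and px: "fst p < lo \<or> hi < fst p" using p ab by (auto simp: S_def defs)
      have "snd p \<noteq> yT" "snd p \<noteq> yB" using T(3)[OF pK] B(3)[OF pK] px by (auto simp: lo_def hi_def)
      then show ?thesis using T(2)[OF pK] B(2)[OF pK] by simp
    qed
    show ?thesis
    proof (cases "S = {}")
      case True
      then show ?thesis by (intro exI[of _ 1]) (auto simp: S_def)
    next
      case False
      have "continuous_on S (\<lambda>p. min (yT - snd p) (snd p - yB))" by (intro continuous_intros)
      from continuous_attains_inf[OF S False this] obtain q where
        q: "q \<in> S" "\<And>p. p \<in> S \<Longrightarrow> min (yT - snd q) (snd q - yB) \<le> min (yT - snd p) (snd p - yB)" by blast
      show ?thesis
      proof (intro exI[of _ "min (yT - snd q) (snd q - yB)"] conjI ballI impI)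
        show "0 < min (yT - snd q) (snd q - yB)" by (rule pos[OF q(1)])
        fix p assume "p \<in> K" "fst p \<le> l4 \<or> r4 \<le> fst p"
        then have "p \<in> S" by (auto simp: S_def)
        from q(2)[OF this] show "min (yT - snd q) (snd q - yB) \<le> yT - snd p" "min (yT - snd q) (snd q - yB) \<le> snd p - yB"
          by linarith+
      qed
    qed
  qed
  then obtain c0 where c0: "0 < c0" "\<And>p. p \<in> K \<Longrightarrow> fst p \<le> l4 \<or> r4 \<le> fst p \<Longrightarrow> c0 \<le> yT - snd p \<and> c0 \<le> snd p - yB" by blast
  obtain \<beta> where \<beta>: "0 < \<beta>" "\<And>x e. l1 \<le> x \<Longrightarrow> x \<le> r1 \<Longrightarrow> lo \<le> e \<Longrightarrow> e \<le> hi \<Longrightarrow> \<beta> \<le> deriv (pr.W e) x"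
    using pr.W_deriv_uniform by blast
  obtain M where M: "\<And>x. \<bar>deriv pr.anchor x\<bar> \<le> M" using pr.anchor_deriv_bounded by blast
  have M1: "0 < 1 + 32 * M\<^sup>2" by (intro add_pos_nonneg) auto
  define \<omega> where "\<omega> = c0 / (xr - xl) * min (r4 - hi) (lo - l4)"
  have \<omega>: "0 < \<omega>" using c0 X ab by (simp add: \<omega>_def defs)
  define k where "k = 1 / (2 + \<delta>) * \<beta>"
  have k: "0 < k" using \<beta> \<delta> by (simp add: k_def)
  \<comment> \<open>The bound \<omega> / 2 keeps the shifted obstacle inside itself; the other lets
    W'/(2 + \<delta>) pay for the anchor.\<close>
  define \<tau> where "\<tau> = min 1 (min (\<omega> / 2) (k / (1 + 32 * M\<^sup>2)))"
  have \<tau>0: "0 < \<tau>" using \<omega> k M1 by (simp add: \<tau>_def)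
  have \<tau>: "\<tau> \<le> 1" "\<tau> \<le> \<omega> / 2" "\<tau> \<le> k / (1 + 32 * M\<^sup>2)" unfolding \<tau>_def by linarith+
  interpret wg: waveguide_setup Ob l1 l2 l3 l4 lo hi r4 r3 r2 r1 \<delta> l0 r0 xT yT xB yB sl ic "d / 4" c0 "xr - xl" \<tau>
  proof unfold_locales
    show "(xT, yT) \<in> K" "(xB, yB) \<in> K" by (rule T B)+
    show "yB \<le> snd p \<and> snd p \<le> yT" if "p \<in> K" for p using T(2) B(2) that by blast
    show "lo \<le> xT" "xT \<le> hi" "lo \<le> xB" "xB \<le> hi" by (auto simp: lo_def hi_def)
    show "l0 < l1" "r1 < r0" using ab by (auto simp: defs)
    show "0 < d / 4" "0 < xr - xl" "0 < c0" "0 < \<tau>" "\<tau> \<le> 1" using d X c0 \<tau>0 \<tau> by auto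
    show "(x, sl * x + ic + s) \<in> Ob" if "l0 \<le> x" "x \<le> r0" "\<bar>s\<bar> \<le> 2 * (d / 4)" for x s by (rule chord[OF that])
    show "c0 \<le> yT - snd p \<and> c0 \<le> snd p - yB" if "p \<in> K" "fst p \<le> l4 \<or> r4 \<le> fst p" for p by (rule c0(2)[OF that])
    show "\<bar>fst p - xT\<bar> \<le> xr - xl \<and> \<bar>fst p - xB\<bar> \<le> xr - xl" if "p \<in> K" for p
      using lr(3,4)[OF that] lt by (auto simp: abs_le_iff)
    show "2 * \<tau> \<le> c0 / (xr - xl) * min (r4 - hi) (lo - l4)" using \<tau>(2) unfolding \<omega>_def[symmetric] by simp
  qed
  show ?thesis
  proof (rule wg.weighted_resolvent_bound[OF M])
    fix x e assume xe: "l1 \<le> x" "x \<le> r1" "lo \<le> e" "e \<le> hi"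
    have "\<tau> * (1 + 32 * M\<^sup>2) \<le> k" by (rule pos_le_divide_eq[THEN iffD1, OF M1 \<tau>(3)])
    also have "\<dots> \<le> 1 / (2 + \<delta>) * deriv (pr.W e) x" unfolding k_def using \<beta>(2)[OF xe] \<delta> by (intro mult_left_mono) auto
    finally show "\<tau> * (1 + 32 * M\<^sup>2) \<le> 1 / (2 + \<delta>) * deriv (pr.W e) x" .
  qed
qed

theorem theorem4:
  fixes Ob :: "(real \<times> real) set" and \<delta> :: real
  assumes "Ob \<noteq> {}" and "open Ob" and "bounded Ob" and "strictly_convex Ob"
    and "C11_boundary Ob"
    and "closure Ob \<subseteq> UNIV \<times> {-1<..<1}"
    and "\<delta> > 0"
  defines "M \<equiv> lebesgue_on (waveguide Ob)"
    and "A \<equiv> neg_dirichlet_laplacian (waveguide Ob)"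
  shows "\<exists>E\<^sub>0>0. \<exists>C>0. \<forall>E\<ge>E\<^sub>0. \<forall>\<epsilon>\<in>{0<..1}.
           Complex E \<epsilon> \<in> resolvent_set M A \<and>
           L2_opnorm M (weight_mult (- ((3 + \<delta>) / 2)) \<circ> resolvent M A (Complex E \<epsilon>)
                          \<circ> weight_mult (- ((3 + \<delta>) / 2)))
             \<le> ereal (C * sqrt E)"
proof -
  interpret obstacle Ob by unfold_locales (use assms in auto)
  interpret dom: planar_domain "waveguide Ob" by unfold_locales (rule open_waveguide)
  note graph = dom.laplacian_graph[folded A_def]
  obtain E0 C where E0: "0 < E0" and C: "0 < C" and bound: "\<And>E \<epsilon> f u. E0 \<le> E \<Longrightarrow> \<epsilon> \<in> {0<..1} \<Longrightarrow> f \<in> L2 M \<Longrightarrow>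
    (u, \<lambda>x. of_real (weight \<delta> x) * f x + Complex E \<epsilon> * u x) \<in> A \<Longrightarrow>
    L2_norm M (\<lambda>x. of_real (weight \<delta> x) * u x) \<le> C * sqrt E * L2_norm M f"
    using weighted_resolvent_estimate[OF \<open>\<delta> > 0\<close>] unfolding M_def A_def by blast
  have wm: "weight_mult (- ((3 + \<delta>) / 2)) f = (\<lambda>p. of_real (weight \<delta> p) * f p)" for f
    by (auto simp: weight_mult_def weight_def)
  have weight_L2: "(\<lambda>p. of_real (weight \<delta> p) * f p) \<in> L2 M" if "f \<in> L2 M" for f
  proof (rule L2_bounded_mult[OF that])
    show "(\<lambda>p. complex_of_real (weight \<delta> p)) \<in> borel_measurable M" unfolding M_def
      by (intro borel_imp_lebesgue_on borel_measurable_continuous_onI continuous_intros continuous_weight)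
    show "cmod (complex_of_real (weight \<delta> p)) \<le> 1" for p using weight_bounds[of \<delta> p] assms by simp
  qed
  show ?thesis
  proof (rule exI[of _ E0], rule conjI[OF E0], rule exI[of _ C], rule conjI[OF C], intro allI ballI impI conjI)
    fix E \<epsilon> :: real assume E: "E0 \<le> E" and \<epsilon>: "\<epsilon> \<in> {0<..1}"
    have im: "0 < Im (Complex E \<epsilon>)" using \<epsilon> by simp
    show "Complex E \<epsilon> \<in> resolvent_set M A"
      using dom.upper_half_plane_resolvent[OF im] unfolding graph M_def .
    show "L2_opnorm M (weight_mult (- ((3 + \<delta>) / 2)) \<circ> resolvent M A (Complex E \<epsilon>) \<circ> weight_mult (- ((3 + \<delta>) / 2)))
      \<le> ereal (C * sqrt E)"
      unfolding L2_opnorm_def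
    proof (rule SUP_least)
      fix f assume "f \<in> {f \<in> L2 M. L2_norm M f \<le> 1}"
      then have f: "f \<in> L2 M" "L2_norm M f \<le> 1" by auto
      define F where "F = (\<lambda>p. of_real (weight \<delta> p) * f p)"
      define u where "u = resolvent M A (Complex E \<epsilon>) F"
      have F: "F \<in> L2 M" unfolding F_def by (rule weight_L2[OF f(1)])
      \<comment> \<open>Existence justifies the choice made by \<open>resolvent\<close>. The bound
        holds for every solution, so the one chosen does not matter.\<close>
      have "\<exists>u. u \<in> L2 M \<and> (u, \<lambda>x. F x + Complex E \<epsilon> * u x) \<in> A"
        using dom.resolvent_exists[OF im, of F] F unfolding graph M_def by blast
      from someI_ex[OF this] have u: "u \<in> L2 M" "(u, \<lambda>x. F x + Complex E \<epsilon> * u x) \<in> A"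
        unfolding u_def resolvent_def by blast+
      have T: "(weight_mult (- ((3 + \<delta>) / 2)) \<circ> resolvent M A (Complex E \<epsilon>) \<circ> weight_mult (- ((3 + \<delta>) / 2))) f
        = (\<lambda>p. of_real (weight \<delta> p) * u p)"
        unfolding comp_def wm u_def F_def ..
      have "L2_norm M (\<lambda>x. of_real (weight \<delta> x) * u x) \<le> C * sqrt E * L2_norm M f"
        by (rule bound[OF E \<epsilon> f(1)]) (use u(2) in \<open>simp add: F_def\<close>)
      also have "\<dots> \<le> C * sqrt E * 1" using C E E0 f(2) by (intro mult_left_mono) auto
      finally show "(if (weight_mult (- ((3 + \<delta>) / 2)) \<circ> resolvent M A (Complex E \<epsilon>) \<circ> weight_mult (- ((3 + \<delta>) / 2))) f \<in> L2 M
        then ereal (L2_norm M ((weight_mult (- ((3 + \<delta>) / 2)) \<circ> resolvent M A (Complex E \<epsilon>) \<circ> weight_mult (- ((3 + \<delta>) / 2))) f)) else \<infinity>)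
        \<le> ereal (C * sqrt E)"
        \<comment> \<open>\<open>L2_opnorm\<close> assigns infinity to outputs outside L^2, hence
          the membership.\<close>
        unfolding T using weight_L2[OF u(1)] by simp
    qed
  qed
qed

end
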